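(* Let $0\le a<b\le\infty$, let $0<r\le 1$ and $0<p,q<\infty$, and let $u,v,w$ be weights on $(a,b)$ such that $0<\int_x^b w<\infty$ for all $x\in(a,b)$. Consider the inequality $$\bigg(\int_a^b \bigg(\int_a^t f(s)^r v(s)\, ds \bigg)^{\frac{q}{r}} u(t)\, dt \bigg)^{\frac{1}{q}} \leq C \bigg(\int_a^b \bigg(\int_a^t f(s)\, ds \bigg)^{p} w(t)\, dt\bigg)^{\frac{1}{p}}. \qquad ( * )$$ Define the following quantities (each is used only in the parameter ranges indicated below): $$C_1 := \operatorname*{ess\,sup}_{x\in (a,b)} \bigg(\int_x^b w\bigg)^{-\frac{1}{p}} \operatorname*{ess\,sup}_{t\in (x,b)} \bigg( \int_t^b u \bigg)^{\frac{1}{q}} V_r(x,t),$$ $$C_2 := \sup_{x\in (a,b)} \bigg(\int_x^b w\bigg)^{-\frac{1}{p}} \bigg( \int_x^b \bigg( \int_t^b u \bigg)^{\frac{q}{1-q}} u(t)\, V_r(x,t)^{\frac{q}{1-q}}\, dt \bigg)^{\frac{1-q}{q}},$$ $$C_3 := \sup_{x \in (a,b)} \bigg(\int_{x}^b u\bigg)^{\frac{1}{q}} \bigg(\int_a^{x} \bigg(\int_t^b w \bigg)^{-\frac{p}{p-r}} w(t)\, V_r(t,x)^{\frac{pr}{p-r}}\, dt \bigg)^{\frac{p-r}{pr}},$$ $$C_4 := \bigg(\int_a^{b} \bigg(\int_x^b u\bigg)^{\frac{q}{p-q}} u(x) \operatorname*{ess\,sup}_{t\in (a, x)} \bigg[\bigg(\int_t^b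 w \bigg)^{-\frac{q}{p-q}} V_r(t,x)^{\frac{pq}{p-q}}\bigg] dx \bigg)^{\frac{p-q}{pq}},$$ $$C_5 := \bigg(\int_a^b w(x) \sup_{y\in (a,x)} \bigg[\bigg(\int_y^b w\bigg)^{-\frac{p}{p-q}} \bigg( \int_{y}^x \bigg( \int_t^x u \bigg)^{\frac{q}{1-q}} u(t)\, V_r(y,t)^{\frac{q}{1-q}}\, dt \bigg)^{\frac{p(1-q)}{p-q}}\bigg] dx \bigg)^{\frac{p-q}{pq}},$$ $$C_6 := \Bigg(\int_a^{b} w(x) \operatorname*{ess\,sup}_{y\in(a, x)} \Bigg[\bigg(\int_y^{b} w\bigg)^{-1} \bigg(\int_y^{x} \bigg(\int_t^b u\bigg)^{\frac{q}{p-q}} u(t)\,dt\bigg) \bigg(\int_a^y \bigg(\int_t^b w \bigg)^{-\frac{p}{p-r}} w(t)\,V_r(t,y)^{\frac{pr}{p-r}}\,dt\bigg)^{\frac{(p-r)q}{(p-q)r}}\Bigg] dx \Bigg)^{\frac{p-q}{pq}},$$ $$C_7 := \Bigg(\int_a^{b} w(x) \operatorname*{ess\,sup}_{y\in(a,x)} \Bigg[\bigg(\int_y^b w\bigg)^{-\frac{p}{p-q}} \operatorname*{ess\,sup}_{t\in(y,x)} \bigg( \int_t^{x} u \bigg)^{\frac{p}{p-q}} V_r(y,t)^{\frac{pq}{p-q}}\Bigg] dx \Bigg)^{\frac{p-q}{pq}}.$$ Then there is a constant $C\in(0,\infty)$ such that $( * )$ holds for all $f\in\mathcal M^+(a,b)$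 if and only if one of the following holds: (i) $p \leq r \leq 1 \leq q$ and $C_1<\infty$; moreover, in this case the best constant $C$ in $( * )$ satisfies $C\approx C_1$; (ii) $p\leq q<1$, $p\leq r\leq 1$ and $C_2<\infty$; moreover, in this case the best constant satisfies $C\approx C_2$; (iii) $r<p\leq q$, $r\leq 1\leq q$ and $\max\{C_1,C_3\}<\infty$; moreover, in this case the best constant satisfies $C\approx C_1+C_3$; (iv) $r<p\leq q<1$ and $\max\{C_2,C_3\}<\infty$; moreover, in this case the best constant satisfies $C\approx C_2+C_3$; (v) $q<p\leq r\leq 1$ and $\max\{C_4,C_5\}<\infty$; moreover, in this case the best constant satisfies $C\approx C_4+C_5$; (vi) $q<p$, $q<1$, $r<p$, $r\leq 1$ and $\max\{C_1,C_5,C_6\}<\infty$; moreover, in this case the best constant satisfies $C\approx C_1+C_5+C_6$; (vii) $r\leq 1\leq q<p$ and $\max\{C_1,C_6,C_7\}<\infty$; moreover, in this case the best constant satisfies $C\approx C_1+C_6+C_7$.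
   Context: $\mathcal M^+(a,b)$ denotes the set of all non-negative (Lebesgue) measurable functions on $(a,b)$. A weight on $(a,b)$ is a measurable function that is positive and finite a.e. on $(a,b)$. In integrals such as $\int_x^b w$ the integration variable and differential are omitted: $\int_x^b w=\int_x^b w(s)\,ds$. For $a\le \alpha<\beta\le b$ and the weight $v$, set $$V_r(\alpha,\beta)=\begin{cases}\Big(\int_\alpha^\beta v(s)^{\frac{1}{1-r}}\,ds\Big)^{\frac{1-r}{r}} & \text{if } 0<r<1,\\[4pt] \operatorname*{ess\,sup}_{s\in(\alpha,\beta)} v(s) & \text{if } r=1.\end{cases}$$ The best constant in $( * )$ is the smallest $C$ for which $( * )$ holds for all $f\in\mathcal M^+(a,b)$. The notation $A\approx B$ means that $A\le\lambda B$ and $B\le\lambda' A$ with positive constants $\lambda,\lambda'$ depending only on inessential parameters (here: on the exponents $p,q,r$, and not on $u,v,w$ or $f$). Conventions: $1/(\pm\infty)=0$, $0/0=0$, $0\cdot(\pm\infty)=0$. *)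

theory Defs
  imports "HOL-Analysis.Analysis" "HOL-Probability.Essential_Supremum"
begin

(* Weights, integrals and all derived quantities take values in [0,\<infinity>].  The type ennreal has
   0 * \<infinity> = 0 and inverse \<infinity> = 0, but no real powers; they are given here by their usual limiting
   values at 0 and \<infinity>. *)
definition ennreal_powr :: "ennreal \<Rightarrow> real \<Rightarrow> ennreal"  (infixr \<open>powe\<close> 80) where
  "x powe s =
     (if s = 0 then 1
      else if x = 0 then (if s > 0 then 0 else \<infinity>)
      else if x = \<infinity> then (if s > 0 then \<infinity> else 0)
      else ennreal (enn2real x powr s))"

(* Endpoints are extended reals, since b = \<infinity> is allowed; integration and essential suprema are
   with respect to Lebesgue measure on the open interval (\<alpha>,\<beta>) of reals. *)
abbreviation integ :: "ereal \<Rightarrow> ereal \<Rightarrow> (real \<Rightarrow> ennreal) \<Rightarrow> ennreal" where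
  "integ \<alpha> \<beta> g \<equiv> \<integral>\<^sup>+ s. g s \<partial>(lebesgue_on (einterval \<alpha> \<beta>))"

abbreviation ess_sup :: "ereal \<Rightarrow> ereal \<Rightarrow> (real \<Rightarrow> ennreal) \<Rightarrow> ennreal" where
  "ess_sup \<alpha> \<beta> g \<equiv> esssup (lebesgue_on (einterval \<alpha> \<beta>)) g"

definition Mplus :: "ereal \<Rightarrow> ereal \<Rightarrow> (real \<Rightarrow> ennreal) set" where
  "Mplus a b = borel_measurable (lebesgue_on (einterval a b))"

definition weight :: "ereal \<Rightarrow> ereal \<Rightarrow> (real \<Rightarrow> ennreal) \<Rightarrow> bool" where
  "weight a b u \<longleftrightarrow> u \<in> borel_measurable (lebesgue_on (einterval a b)) \<and>
     (AE x in lebesgue_on (einterval a b). 0 < u x \<and> u x < \<infinity>)"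

(* Only used for 0 < r \<le> 1. *)
definition V :: "real \<Rightarrow> (real \<Rightarrow> ennreal) \<Rightarrow> ereal \<Rightarrow> ereal \<Rightarrow> ennreal" where
  "V r v \<alpha> \<beta> =
     (if r < 1 then (integ \<alpha> \<beta> (\<lambda>s. v s powe (1 / (1 - r)))) powe ((1 - r) / r)
      else ess_sup \<alpha> \<beta> v)"

definition ineq_holds ::
  "ereal \<Rightarrow> ereal \<Rightarrow> real \<Rightarrow> real \<Rightarrow> real \<Rightarrow> (real \<Rightarrow> ennreal) \<Rightarrow> (real \<Rightarrow> ennreal) \<Rightarrow> (real \<Rightarrow> ennreal)
    \<Rightarrow> real \<Rightarrow> bool" where
  "ineq_holds a b p q r u v w C \<longleftrightarrow>
     (\<forall>f \<in> Mplus a b.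
        (integ a b (\<lambda>t. (integ a (ereal t) (\<lambda>s. f s powe r * v s)) powe (q / r) * u t)) powe (1 / q)
        \<le> ennreal C *
          (integ a b (\<lambda>t. (integ a (ereal t) f) powe p * w t)) powe (1 / p))"

definition best_const ::
  "ereal \<Rightarrow> ereal \<Rightarrow> real \<Rightarrow> real \<Rightarrow> real \<Rightarrow> (real \<Rightarrow> ennreal) \<Rightarrow> (real \<Rightarrow> ennreal) \<Rightarrow> (real \<Rightarrow> ennreal)
    \<Rightarrow> real \<Rightarrow> bool" where
  "best_const a b p q r u v w C \<longleftrightarrow>
     0 < C \<and> ineq_holds a b p q r u v w C \<and>
     (\<forall>C'>0. ineq_holds a b p q r u v w C' \<longrightarrow> C \<le> C')"

(* The best constant exists and is equivalent to K, with equivalence constants lam and lam'. *)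
definition best_const_equiv ::
  "ereal \<Rightarrow> ereal \<Rightarrow> real \<Rightarrow> real \<Rightarrow> real \<Rightarrow> (real \<Rightarrow> ennreal) \<Rightarrow> (real \<Rightarrow> ennreal) \<Rightarrow> (real \<Rightarrow> ennreal)
    \<Rightarrow> real \<Rightarrow> real \<Rightarrow> ennreal \<Rightarrow> bool" where
  "best_const_equiv a b p q r u v w lam lam' K \<longleftrightarrow>
     (\<exists>C. best_const a b p q r u v w C \<and>
        ennreal C \<le> ennreal lam * K \<and> K \<le> ennreal lam' * ennreal C)"

(* The quantities C1, ..., C7 are meaningful only in the exponent ranges in which they are used:
   q < 1 for C2 and C5, r < p for C3 and C6, q < p for C4, C5, C6 and C7.  There the denominators
   below are positive, and the only quantity raised to a negative power is the integral of w over
   (x,b), which is positive and finite. *)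
definition C1 ::
  "ereal \<Rightarrow> ereal \<Rightarrow> real \<Rightarrow> real \<Rightarrow> real \<Rightarrow> (real \<Rightarrow> ennreal) \<Rightarrow> (real \<Rightarrow> ennreal) \<Rightarrow> (real \<Rightarrow> ennreal)
    \<Rightarrow> ennreal" where
  "C1 a b p q r u v w =
     ess_sup a b (\<lambda>x. (integ (ereal x) b w) powe (- (1 / p)) *
       ess_sup (ereal x) b (\<lambda>t. (integ (ereal t) b u) powe (1 / q) * V r v (ereal x) (ereal t)))"

definition C2 ::
  "ereal \<Rightarrow> ereal \<Rightarrow> real \<Rightarrow> real \<Rightarrow> real \<Rightarrow> (real \<Rightarrow> ennreal) \<Rightarrow> (real \<Rightarrow> ennreal) \<Rightarrow> (real \<Rightarrow> ennreal)
    \<Rightarrow> ennreal" where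
  "C2 a b p q r u v w =
     (SUP x \<in> einterval a b. (integ (ereal x) b w) powe (- (1 / p)) *
       (integ (ereal x) b (\<lambda>t. (integ (ereal t) b u) powe (q / (1 - q)) * u t *
          V r v (ereal x) (ereal t) powe (q / (1 - q)))) powe ((1 - q) / q))"

definition C3 ::
  "ereal \<Rightarrow> ereal \<Rightarrow> real \<Rightarrow> real \<Rightarrow> real \<Rightarrow> (real \<Rightarrow> ennreal) \<Rightarrow> (real \<Rightarrow> ennreal) \<Rightarrow> (real \<Rightarrow> ennreal)
    \<Rightarrow> ennreal" where
  "C3 a b p q r u v w =
     (SUP x \<in> einterval a b. (integ (ereal x) b u) powe (1 / q) *
       (integ a (ereal x) (\<lambda>t. (integ (ereal t) b w) powe (- (p / (p - r))) * w t *
          V r v (ereal t) (ereal x) powe (p * r / (p - r)))) powe ((p - r) / (p * r)))"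

definition C4 ::
  "ereal \<Rightarrow> ereal \<Rightarrow> real \<Rightarrow> real \<Rightarrow> real \<Rightarrow> (real \<Rightarrow> ennreal) \<Rightarrow> (real \<Rightarrow> ennreal) \<Rightarrow> (real \<Rightarrow> ennreal)
    \<Rightarrow> ennreal" where
  "C4 a b p q r u v w =
     (integ a b (\<lambda>x. (integ (ereal x) b u) powe (q / (p - q)) * u x *
       ess_sup a (ereal x) (\<lambda>t. (integ (ereal t) b w) powe (- (q / (p - q))) *
          V r v (ereal t) (ereal x) powe (p * q / (p - q))))) powe ((p - q) / (p * q))"

definition C5 ::
  "ereal \<Rightarrow> ereal \<Rightarrow> real \<Rightarrow> real \<Rightarrow> real \<Rightarrow> (real \<Rightarrow> ennreal) \<Rightarrow> (real \<Rightarrow> ennreal) \<Rightarrow> (real \<Rightarrow> ennreal)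
    \<Rightarrow> ennreal" where
  "C5 a b p q r u v w =
     (integ a b (\<lambda>x. w x *
       (SUP y \<in> einterval a (ereal x). (integ (ereal y) b w) powe (- (p / (p - q))) *
          (integ (ereal y) (ereal x) (\<lambda>t. (integ (ereal t) (ereal x) u) powe (q / (1 - q)) * u t *
             V r v (ereal y) (ereal t) powe (q / (1 - q)))) powe (p * (1 - q) / (p - q)))))
     powe ((p - q) / (p * q))"

definition C6 ::
  "ereal \<Rightarrow> ereal \<Rightarrow> real \<Rightarrow> real \<Rightarrow> real \<Rightarrow> (real \<Rightarrow> ennreal) \<Rightarrow> (real \<Rightarrow> ennreal) \<Rightarrow> (real \<Rightarrow> ennreal)
    \<Rightarrow> ennreal" where
  "C6 a b p q r u v w =
     (integ a b (\<lambda>x. w x *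
       ess_sup a (ereal x) (\<lambda>y. (integ (ereal y) b w) powe (- 1) *
          integ (ereal y) (ereal x) (\<lambda>t. (integ (ereal t) b u) powe (q / (p - q)) * u t) *
          (integ a (ereal y) (\<lambda>t. (integ (ereal t) b w) powe (- (p / (p - r))) * w t *
             V r v (ereal t) (ereal y) powe (p * r / (p - r)))) powe ((p - r) * q / ((p - q) * r)))))
     powe ((p - q) / (p * q))"

definition C7 ::
  "ereal \<Rightarrow> ereal \<Rightarrow> real \<Rightarrow> real \<Rightarrow> real \<Rightarrow> (real \<Rightarrow> ennreal) \<Rightarrow> (real \<Rightarrow> ennreal) \<Rightarrow> (real \<Rightarrow> ennreal)
    \<Rightarrow> ennreal" where
  "C7 a b p q r u v w =
     (integ a b (\<lambda>x. w x *
       ess_sup a (ereal x) (\<lambda>y. (integ (ereal y) b w) powe (- (p / (p - q))) *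
          ess_sup (ereal y) (ereal x) (\<lambda>t. (integ (ereal t) (ereal x) u) powe (p / (p - q)) *
             V r v (ereal y) (ereal t) powe (p * q / (p - q))))))
     powe ((p - q) / (p * q))"

end

theory Submission
  imports Defs
begin

text \<open>
  Write \<open>W(x) = \<integral>\<^bsub>x\<^esub>\<^bsup>b\<^esup> w\<close> and \<open>F(t) = \<integral>\<^bsub>a\<^esub>\<^bsup>t\<^esup> f\<close>. Cut the interval into the bands on which \<open>W\<close> is comparable to
  \<open>2\<^sup>-\<^sup>k\<close>. By the discrete Hardy inequality \<open>\<integral> F\<^sup>p w\<close> is comparable to \<open>\<Sum>\<^sub>k 2\<^sup>-\<^sup>k m\<^sub>k\<^sup>p\<close>, where \<open>m\<^sub>k\<close> is the mass of \<open>f\<close>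
  on the \<open>k\<close>-th band. On the left-hand side \<open>\<integral>\<^bsub>a\<^esub>\<^bsup>t\<^esup> f\<^sup>r v\<close> is split into the part on the band of \<open>t\<close> and the
  part on the earlier bands. The first part is governed by the best constant \<open>K\<close> of the inequality with
  \<open>(\<integral> f)\<^sup>q\<close> on the right, localised to one band; this \<open>K\<close> is computed from the tail of \<open>u\<close> and
  \<open>V\<^sub>r\<close> and yields \<open>C1\<close>, \<open>C2\<close>, \<open>C5\<close>, \<open>C7\<close>. In the second part \<open>f\<^sup>r v\<close> contributes at most \<open>V\<^sub>r\<^sup>r m\<^sub>k\<^sup>r\<close> on
  each band, and Hoelder's inequality in \<open>k\<close> (\<open>r < p\<close>) or \<open>\<ell>\<^sup>p \<subseteq> \<ell>\<^sup>r\<close> (\<open>p \<le> r\<close>) yields \<open>C3\<close>, \<open>C4\<close>, \<open>C6\<close>.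
  Conversely, each of these quantities is bounded by testing the inequality with sums \<open>\<Sum>\<^sub>k z\<^sub>k f\<^sub>k\<close> of almost
  extremal functions \<open>f\<^sub>k\<close> of the bands and using the duality of the spaces \<open>\<ell>\<^sup>p\<close>.
\<close>

section \<open>Powers and sums over the integers\<close>

text \<open>The weights may make any quantity 0 or infinite, so degenerate cases are split off
  before each division; the equivalence constants may depend on p, q, r only, so each estimate
  carries an explicit one. Both parts of the left-hand side are instances of one Hardy inequality
  between measures: \<open>\<nu>\<close> stands for f^r v, \<open>E\<close> for the right-hand side,
  and the outer variable enters only through the ray \<open>{..<\<rho> t}\<close>. Integration by
  parts is replaced by halving masses on dyadic level sets. Continuity of W shows that after a
  nonempty band the next one is nonempty and carries a fixed share of w. The obstacle is the left
  end: W may be bounded there, and the integrals in \<open>C3\<close> and \<open>C6\<close> see a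
  band only through the band before it, so the first two bands escape them. \<open>C1\<close> or
  \<open>C2\<close> handles these; in (vi) and (vii) this is what \<open>C1\<close> is for. In
  \<open>C6\<close> the supremum runs over points inside bands, whereas test functions see whole
  bands; the band function is moved until chosen points become band ends, and \<open>band\<close>
  allows the factor 4 to leave room for this.\<close>

abbreviation ind :: "'a set \<Rightarrow> 'a \<Rightarrow> ennreal" where "ind \<equiv> indicator"

abbreviation cut :: "'a set \<Rightarrow> ('a \<Rightarrow> ennreal) \<Rightarrow> 'a \<Rightarrow> ennreal" where
  "cut A g \<equiv> \<lambda>s. g s * ind A s"

abbreviation pw :: "('a \<Rightarrow> ennreal) \<Rightarrow> real \<Rightarrow> ('a \<Rightarrow> ennreal) \<Rightarrow> 'a \<Rightarrow> ennreal" where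
  "pw f r v \<equiv> \<lambda>s. f s powe r * v s"

lemma powe_zero_right [simp]: "x powe 0 = 1" by (simp add: ennreal_powr_def)

lemma powe_zero_left [simp]: "s > 0 \<Longrightarrow> 0 powe s = 0" by (simp add: ennreal_powr_def)

lemma powe_top_left [simp]: "s > 0 \<Longrightarrow> \<infinity> powe s = \<infinity>" "s > 0 \<Longrightarrow> top powe s = top"
  by (simp_all add: ennreal_powr_def)

lemma powe_ennreal_pos: "x > 0 \<Longrightarrow> ennreal x powe s = ennreal (x powr s)" by (simp add: ennreal_powr_def)

lemma powe_ennreal: "s > 0 \<Longrightarrow> x \<ge> 0 \<Longrightarrow> ennreal x powe s = ennreal (x powr s)"
  by (cases "x = 0") (simp_all add: ennreal_powr_def)

lemma one_powe [simp]: "1 powe s = 1" using powe_ennreal_pos[of 1 s] by simp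

lemma powe_one_right [simp]: "x powe 1 = x" by (cases x) (auto simp: ennreal_powr_def top_unique)

lemma powe_mono:
  assumes "x \<le> y" "0 \<le> s" shows "x powe s \<le> y powe s"
proof (cases "s = 0")
  case False
  with assms have s: "s > 0" by simp
  show ?thesis
  proof (cases y)
    case (real b)
    then obtain a where a: "x = ennreal a" "0 \<le> a" using assms(1) by (cases x) (auto simp: top_unique)
    with real assms have "a \<le> b" by simp
    with a real s show ?thesis by (simp add: powe_ennreal powr_mono2 ennreal_leI)
  qed (use s in simp)
qed simp

text \<open>For positive exponents \<open>powe\<close> respects the convention 0 * top = 0. For x =
  0, y = top and a negative exponent the two sides would be top and 0, so negative powers get
  separate lemmas.\<close>

lemma powe_mult:
  assumes "0 < s" shows "(x * y) powe s = x powe s * y powe s"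
proof -
  consider "x = 0" | "y = 0" | "x = top" "y \<noteq> 0" | "y = top" "x \<noteq> 0"
    | a b where "x = ennreal a" "y = ennreal b" "0 \<le> a" "0 \<le> b" by (cases x; cases y) auto
  then show ?thesis
  proof cases
    case 3
    then have "y powe s \<noteq> 0" using assms by (cases y) (auto simp: powe_ennreal)
    with 3 assms show ?thesis by (simp add: ennreal_top_mult)
  next
    case 4
    then have "x powe s \<noteq> 0" using assms by (cases x) (auto simp: powe_ennreal)
    with 4 assms show ?thesis by (simp add: ennreal_mult_top)
  next
    case 5
    then show ?thesis
      using assms by (simp add: powe_ennreal flip: ennreal_mult) (simp add: powe_ennreal powr_mult)
  qed (use assms in simp_all)
qed

lemma powe_powe:
  assumes "0 < s" "0 < t" shows "(x powe s) powe t = x powe (s * t)"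
  using assms by (cases x) (auto simp: powe_ennreal powr_powr)

lemma powe_add:
  assumes "0 < s" "0 < t" shows "x powe (s + t) = x powe s * x powe t"
  using assms by (cases x) (auto simp: powe_ennreal powr_add ennreal_mult)

lemma powe_le_iff:
  assumes "0 < s" shows "x powe s \<le> y powe s \<longleftrightarrow> x \<le> y"
proof
  assume "x powe s \<le> y powe s"
  then have "(x powe s) powe (1 / s) \<le> (y powe s) powe (1 / s)" using assms by (simp add: powe_mono)
  moreover have "(z powe s) powe (1 / s) = z" for z using assms by (simp add: powe_powe)
  ultimately show "x \<le> y" by simp
qed (use assms in \<open>simp add: powe_mono\<close>)

lemma powe_eq_iff: "0 < s \<Longrightarrow> x powe s = y powe s \<longleftrightarrow> x = y" by (metis powe_le_iff antisym order_refl)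

lemma powe_eq_0_iff: "0 < s \<Longrightarrow> x powe s = 0 \<longleftrightarrow> x = 0" using powe_eq_iff[of s x 0] by simp

lemma powe_eq_top_iff: "0 < s \<Longrightarrow> x powe s = top \<longleftrightarrow> x = top" using powe_eq_iff[of s x top] by simp

lemma powe_less_top_iff: "0 < s \<Longrightarrow> x powe s < top \<longleftrightarrow> x < top"
  by (simp add: less_top[symmetric] powe_eq_top_iff)

lemma powe_le_move: "0 < s \<Longrightarrow> x powe s \<le> y \<longleftrightarrow> x \<le> y powe (1 / s)"
  using powe_le_iff[of s x "y powe (1 / s)"] by (simp add: powe_powe)

lemma powe_SUP:
  assumes "0 < s" "I \<noteq> {}"
  shows "(SUP i\<in>I. f i) powe s = (SUP i\<in>I. f i powe s)"
proof (rule antisym)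
  have "(SUP i\<in>I. f i) \<le> (SUP i\<in>I. f i powe s) powe (1 / s)"
  proof (rule SUP_least)
    fix i assume "i \<in> I"
    then show "f i \<le> (SUP i\<in>I. f i powe s) powe (1 / s)"
      using assms by (subst powe_le_move[symmetric]) (auto intro: SUP_upper)
  qed
  then show "(SUP i\<in>I. f i) powe s \<le> (SUP i\<in>I. f i powe s)" using assms by (simp add: powe_le_move)
qed (use assms in \<open>auto intro!: SUP_least powe_mono SUP_upper\<close>)

lemma powe_measurable [measurable]:
  assumes [measurable]: "f \<in> borel_measurable M"
  shows "(\<lambda>x. f x powe s) \<in> borel_measurable M" unfolding ennreal_powr_def by measurable

text \<open>Quasi-triangle inequality from x + y <= 2 max(x, y); it serves for concave and convex
  powers alike, at the price of 2^s.\<close>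

lemma powe_add_le:
  assumes "0 < s" shows "(x + y) powe s \<le> ennreal (2 powr s) * (x powe s + y powe s)"
proof -
  have "x + y \<le> ennreal 2 * max x y"
    by (metis add_mono max.cobounded1 max.cobounded2 ennreal_numeral mult_2)
  then have "(x + y) powe s \<le> (ennreal 2 * max x y) powe s" using assms by (intro powe_mono) auto
  also have "... = ennreal (2 powr s) * max x y powe s"
    using assms by (simp add: powe_mult powe_ennreal flip: ennreal_numeral)
  also have "max x y powe s \<le> x powe s + y powe s"
    by (cases "x \<le> y") (auto simp: max_def add_increasing add_increasing2)
  finally show ?thesis by (simp add: mult_left_mono)
qed

lemma powe_neg_mult:
  assumes "0 < s" "x \<noteq> 0" "x \<noteq> top"
  shows "x powe (- s) * x powe s = 1" "x powe s * x powe (- s) = 1"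
  using assms by (cases x; simp add: powe_ennreal_pos flip: ennreal_mult powr_add; fail)+

lemma powe_neg_powe:
  assumes "0 < t" shows "(x powe (- s)) powe t = x powe (- (s * t))"
proof (cases "s = 0")
  case False
  then have "s * t > 0 \<longleftrightarrow> s > 0" "s * t < 0 \<longleftrightarrow> s < 0"
    using assms by (auto simp: zero_less_mult_iff mult_less_0_iff)
  then show ?thesis using assms False by (cases x; cases "x = 0") (auto simp: ennreal_powr_def powr_powr)
qed simp

lemma powe_neg_antimono:
  assumes "x \<le> y" "0 \<le> s" "0 < x" shows "y powe (- s) \<le> x powe (- s)"
proof (cases "s = 0")
  case False
  show ?thesis
  proof (cases y)
    case (real b)
    then obtain a where a: "x = ennreal a" "0 \<le> a" using assms(1) by (cases x) (auto simp: top_unique)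
    with real assms have ab: "a \<le> b" "0 < a" "0 < b" by auto
    with a real assms False show ?thesis by (simp add: powe_ennreal_pos powr_mono2' ennreal_leI)
  next
    case top
    with assms False show ?thesis by (simp add: ennreal_powr_def)
  qed
qed simp

section \<open>Powers of two and dyadic rounding\<close>

definition dyad :: "real \<Rightarrow> ennreal" where "dyad x = ennreal (2 powr x)"

lemma dyad_0 [simp]: "dyad 0 = 1" by (simp add: dyad_def)
lemma dyad_1: "dyad 1 = 2" by (simp add: dyad_def)
lemma dyad_add: "dyad (x + y) = dyad x * dyad y" by (simp add: dyad_def powr_add ennreal_mult)
lemma dyad_pos [simp]: "0 < dyad x" "dyad x \<noteq> 0" by (simp_all add: dyad_def less_top)
lemma dyad_finite [simp]: "dyad x < top" "dyad x \<noteq> top" "top \<noteq> dyad x" by (simp_all add: dyad_def)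
lemma dyad_powe: "dyad x powe s = dyad (x * s)" by (simp add: dyad_def powe_ennreal_pos powr_powr)
lemma dyad_mono: "x \<le> y \<Longrightarrow> dyad x \<le> dyad y" by (simp add: dyad_def ennreal_leI)
lemma dyad_le_iff [simp]: "dyad x \<le> dyad y \<longleftrightarrow> x \<le> y" by (simp add: dyad_def)
lemma dyad_less_iff [simp]: "dyad x < dyad y \<longleftrightarrow> x < y" by (simp add: dyad_def ennreal_less_iff)
lemma dyad_minus: "dyad (- x) * dyad x = 1" "dyad x * dyad (- x) = 1"
  by (simp_all add: dyad_add[symmetric])

lemma dyad_double: "dyad x + dyad x = dyad (x + 1)" by (simp add: dyad_add dyad_1 mult_2_right)

lemma dyad_floor:
  assumes "x \<noteq> 0" "x \<noteq> top"
  obtains i :: int where "dyad (real_of_int i) \<le> x" "x < dyad (real_of_int i + 1)"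
proof -
  obtain a where a: "x = ennreal a" "a > 0" using assms by (cases x) (auto simp: less_le)
  let ?i = "\<lfloor>log 2 a\<rfloor>"
  have "2 powr ?i \<le> 2 powr (log 2 a)" "2 powr (log 2 a) < 2 powr (?i + 1)"
    by (intro powr_mono) (auto simp: of_int_floor_le)
  then show thesis using that[of ?i] a by (simp add: dyad_def ennreal_less_iff)
qed

lemma dyad_cancel: "dyad x * y \<le> z \<longleftrightarrow> y \<le> dyad (- x) * z"
proof
  assume "dyad x * y \<le> z"
  then have "dyad (- x) * (dyad x * y) \<le> dyad (- x) * z" by (rule mult_left_mono) simp
  then show "y \<le> dyad (- x) * z" by (simp add: mult.assoc[symmetric] dyad_minus)
next
  assume "y \<le> dyad (- x) * z"
  then have "dyad x * y \<le> dyad x * (dyad (- x) * z)" by (rule mult_left_mono) simp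
  then show "dyad x * y \<le> z" by (simp add: mult.assoc[symmetric] dyad_minus)
qed

lemma powe_neg_dyad_le: "dyad x \<le> y \<Longrightarrow> 0 \<le> c \<Longrightarrow> y powe (- c) \<le> dyad (- (x * c))"
  using powe_neg_antimono[of "dyad x" y c] by (simp add: dyad_powe)

lemma powe_neg_dyad_ge: "y \<le> dyad x \<Longrightarrow> 0 < y \<Longrightarrow> 0 \<le> c \<Longrightarrow> dyad (- (x * c)) \<le> y powe (- c)"
  using powe_neg_antimono[of y "dyad x" c] by (simp add: dyad_powe)

text \<open>Sums over the integers are integrals over \<open>count_space UNIV\<close>, so that monotone convergence
  and Tonelli's theorem apply to them.\<close>

abbreviation zsum :: "(int \<Rightarrow> ennreal) \<Rightarrow> ennreal" where
  "zsum f \<equiv> \<integral>\<^sup>+ k. f k \<partial>count_space UNIV"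

lemma sum_le_zsum: "finite J \<Longrightarrow> (\<Sum>k\<in>J. f k) \<le> zsum f"
proof -
  assume J: "finite J"
  have "(\<Sum>k\<in>J. f k) = (\<integral>\<^sup>+ k. f k * ind J k \<partial>count_space UNIV)"
    using J by (subst nn_integral_count_space'[of J]) (auto intro!: sum.cong)
  also have "... \<le> zsum f" by (intro nn_integral_mono) (auto simp: indicator_def)
  finally show ?thesis .
qed

lemma term_le_zsum: "f k \<le> zsum f" using sum_le_zsum[of "{k}" f] by simp

lemma zsum_least:
  assumes "\<And>J. finite J \<Longrightarrow> (\<Sum>k\<in>J. f k) \<le> c"
  shows "zsum f \<le> c"
proof -
  let ?J = "\<lambda>n::nat. {- int n..int n}"
  have "zsum f = (\<integral>\<^sup>+ k. (SUP n. f k * ind (?J n) k) \<partial>count_space UNIV)"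
  proof (intro nn_integral_cong antisym)
    fix k :: int
    have "f k * ind (?J (nat \<bar>k\<bar>)) k \<le> (SUP n. f k * ind (?J n) k)" by (rule SUP_upper) simp
    moreover have "ind (?J (nat \<bar>k\<bar>)) k = (1 :: ennreal)" by (auto simp: indicator_def)
    ultimately show "f k \<le> (SUP n. f k * ind (?J n) k)" by (simp only: mult_1_right)
  qed (auto intro!: SUP_least simp: indicator_def)
  also have "... = (SUP n. \<integral>\<^sup>+ k. f k * ind (?J n) k \<partial>count_space UNIV)"
    by (rule nn_integral_monotone_convergence_SUP)
       (auto intro!: incseq_SucI le_funI simp: indicator_def)
  also have "... \<le> c"
  proof (rule SUP_least)
    fix n :: nat
    have "(\<integral>\<^sup>+ k. f k * ind (?J n) k \<partial>count_space UNIV) = (\<Sum>k\<in>?J n. f k)"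
      by (subst nn_integral_count_space'[of "?J n"]) (auto intro!: sum.cong)
    then show "(\<integral>\<^sup>+ k. f k * ind (?J n) k \<partial>count_space UNIV) \<le> c" using assms[of "?J n"] by simp
  qed
  finally show ?thesis .
qed

lemma zsum_swap:
  assumes "\<And>k. f k \<in> borel_measurable M"
  shows "(\<integral>\<^sup>+ x. zsum (\<lambda>k. f k x) \<partial>M) = zsum (\<lambda>k. \<integral>\<^sup>+ x. f k x \<partial>M)"
  using nn_integral_count_space_nn_integral[of UNIV f M] assms by simp

lemma zsum_measurable [measurable]:
  assumes [measurable]: "\<And>k. f k \<in> borel_measurable M"
  shows "(\<lambda>x. zsum (\<lambda>k. f k x)) \<in> borel_measurable M"
proof -
  have "zsum g = (\<Sum>n. g (int_decode n))" for g
    using nn_integral_bij_count_space[OF bij_int_decode, of g] by (simp add: nn_integral_count_space_nat)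
  then show ?thesis by simp
qed

lemma zsum_zsum_swap: "zsum (\<lambda>j. zsum (\<lambda>k. f k j)) = zsum (\<lambda>k. zsum (\<lambda>j. f k j))"
  by (rule zsum_swap) simp

lemma zsum_cmult: "zsum (\<lambda>k. c * f k) = c * zsum f" "zsum (\<lambda>k. f k * c) = zsum f * c"
  by (simp_all add: nn_integral_cmult nn_integral_multc)

lemma zsum_single: "zsum (cut {j} f) = f j"
  by (subst nn_integral_count_space'[of "{j}"]) (auto simp: indicator_def)

lemma zsum_single': "zsum (\<lambda>k. f k * ind {k} j) = f j"
  using zsum_single[of f j] by (simp add: indicator_def eq_commute)

lemma zsum_mono: "(\<And>k. f k \<le> g k) \<Longrightarrow> zsum f \<le> zsum g" by (rule nn_integral_mono) simp

lemma nn_integral_levels: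
  assumes [measurable]: "g \<in> borel_measurable M" "h \<in> M \<rightarrow>\<^sub>M count_space UNIV"
  shows "(\<integral>\<^sup>+ x. g x \<partial>M) = zsum (\<lambda>k. \<integral>\<^sup>+ x. g x * ind {k} (h x) \<partial>M)"
proof -
  have [measurable]: "(\<lambda>x. ind {k} (h x) :: ennreal) \<in> borel_measurable M" for k
    by (rule measurable_compose[OF assms(2)]) simp
  have "(\<integral>\<^sup>+ x. g x \<partial>M) = (\<integral>\<^sup>+ x. zsum (\<lambda>k. g x * ind {k} (h x)) \<partial>M)"
    by (simp add: zsum_single'[where f = "\<lambda>_. g _"])
  also have "... = zsum (\<lambda>k. \<integral>\<^sup>+ x. g x * ind {k} (h x) \<partial>M)" by (rule zsum_swap) measurable
  finally show ?thesis .
qed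

text \<open>Each factor \<open>f k powe (s - 1)\<close> is at most the same power of the whole sum.
  This is the embedding of l^1 into l^s, also for divergent sums.\<close>

lemma zsum_powe_ge:
  assumes "1 \<le> s" shows "zsum (\<lambda>k. f k powe s) \<le> (zsum f) powe s"
proof (cases "s = 1")
  case False
  with assms have s: "0 < s - 1" by simp
  have powe: "x powe s = x * x powe (s - 1)" for x using powe_add[of 1 "s - 1" x] s by simp
  have "zsum (\<lambda>k. f k powe s) \<le> zsum (\<lambda>k. f k * (zsum f) powe (s - 1))"
    unfolding powe using s by (intro zsum_mono mult_left_mono powe_mono term_le_zsum) auto
  then show ?thesis by (simp add: zsum_cmult powe)
qed simp

lemma zsum_powe_le:
  assumes "0 < s" "s \<le> 1" shows "(zsum f) powe s \<le> zsum (\<lambda>k. f k powe s)"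
proof -
  have "zsum (\<lambda>k. (f k powe s) powe (1 / s)) \<le> (zsum (\<lambda>k. f k powe s)) powe (1 / s)"
    using assms by (intro zsum_powe_ge) (simp add: field_simps)
  then show ?thesis using assms by (simp add: powe_powe powe_le_move)
qed

text \<open>Index sets of any type are allowed here, so \<open>zsum_powe_le\<close> is used only for
  two terms, placed at the integers 0 and 1; induction does the rest.\<close>

lemma sum_powe_le:
  assumes "0 < s" "s \<le> 1" "finite J" shows "(\<Sum>k\<in>J. f k) powe s \<le> (\<Sum>k\<in>J. f k powe s)" using assms(3)
proof (induction J)
  case (insert k J)
  have *: "(x + y) powe s \<le> x powe s + y powe s" for x y
  proof -
    have "zsum (\<lambda>k. x * ind {0} k + y * ind {1} k) = x + y" by (simp add: nn_integral_add zsum_single)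
    moreover have "zsum (\<lambda>k. (x * ind {0} k + y * ind {1} k) powe s) =
        zsum (\<lambda>k. x powe s * ind {0} k + y powe s * ind {1} k)"
      using assms(1) by (intro nn_integral_cong) (auto simp: indicator_def)
    moreover have "... = x powe s + y powe s" by (simp add: nn_integral_add zsum_single)
    ultimately show ?thesis
      using zsum_powe_le[OF assms(1,2), of "\<lambda>k. x * ind {0} k + y * ind {1} k"] by simp
  qed
  show ?case using *[of "f k" "\<Sum>k\<in>J. f k"] insert by (simp add: add_left_mono order_trans)
qed (use assms in simp)

lemma young_powe:
  assumes "0 < l" "l < 1"
  shows "x powe l * y powe (1 - l) \<le> ennreal l * x + ennreal (1 - l) * y"
proof -
  consider "x = 0" | "y = 0" | "x = top" | "y = top"
    | a b where "x = ennreal a" "y = ennreal b" "0 < a" "0 < b"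
    by (cases x; cases y) (auto simp: less_le)
  then show ?thesis
  proof cases
    case 5
    have "a powr l * b powr (1 - l) \<le> l * a + (1 - l) * b"
      using assms 5 by (intro Youngs_inequality_0) auto
    then show ?thesis using assms 5
      by (simp add: powe_ennreal_pos ennreal_leI flip: ennreal_mult ennreal_plus)
  qed (use assms in \<open>auto simp: ennreal_mult_top\<close>)
qed

text \<open>Hoelder with exponents 1/l and 1/(1 - l), phrased in powers of integrals.
  \<open>young_powe\<close> is applied to f and g divided by their integrals; the weights l and 1 -
  l then add up to 1. Zero and infinite integrals are removed first, because of this
  division.\<close>

lemma hoelder_powe:
  assumes l: "0 < l" "l < 1" and [measurable]: "f \<in> borel_measurable M" "g \<in> borel_measurable M"
  shows "(\<integral>\<^sup>+ x. f x powe l * g x powe (1 - l) \<partial>M)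
           \<le> (\<integral>\<^sup>+ x. f x \<partial>M) powe l * (\<integral>\<^sup>+ x. g x \<partial>M) powe (1 - l)"
proof -
  let ?F = "\<integral>\<^sup>+ x. f x \<partial>M" and ?G = "\<integral>\<^sup>+ x. g x \<partial>M"
  consider "?F = 0" | "?G = 0" | "?F \<noteq> 0" "?G \<noteq> 0" "?F = top \<or> ?G = top"
    | "?F \<noteq> 0" "?G \<noteq> 0" "?F \<noteq> top" "?G \<noteq> top" by blast
  then show ?thesis
  proof cases
    case 1
    then have "AE x in M. f x = 0" by (simp add: nn_integral_0_iff_AE)
    then have "AE x in M. f x powe l * g x powe (1 - l) = 0" by eventually_elim (use l in simp)
    then have "(\<integral>\<^sup>+ x. f x powe l * g x powe (1 - l) \<partial>M) = 0" by (subst nn_integral_0_iff_AE) auto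
    then show ?thesis by simp
  next
    case 2
    then have "AE x in M. g x = 0" by (simp add: nn_integral_0_iff_AE)
    then have "AE x in M. f x powe l * g x powe (1 - l) = 0" by eventually_elim (use l in simp)
    then have "(\<integral>\<^sup>+ x. f x powe l * g x powe (1 - l) \<partial>M) = 0" by (subst nn_integral_0_iff_AE) auto
    then show ?thesis by simp
  next
    case 3
    then have "?F powe l * ?G powe (1 - l) = top"
      using l by (auto simp: ennreal_mult_eq_top_iff powe_eq_top_iff powe_eq_0_iff)
    then show ?thesis by simp
  next
    case 4
    let ?D = "?F powe l * ?G powe (1 - l)"
    have *: "f x powe l * g x powe (1 - l) \<le> ?D * (ennreal l * (f x / ?F) + ennreal (1 - l) * (g x / ?G))" for x
    proof -
      have "f x = ?F * (f x / ?F)" "g x = ?G * (g x / ?G)"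
        using 4 by (simp_all add: ennreal_times_divide ennreal_mult_divide_eq mult.commute)
      then have "f x powe l * g x powe (1 - l) =
          (?F * (f x / ?F)) powe l * (?G * (g x / ?G)) powe (1 - l)" by simp
      also have "... = ?D * ((f x / ?F) powe l * (g x / ?G) powe (1 - l))"
        using l by (simp add: powe_mult mult_ac)
      also have "... \<le> ?D * (ennreal l * (f x / ?F) + ennreal (1 - l) * (g x / ?G))"
        using l by (intro mult_left_mono young_powe) auto
      finally show ?thesis .
    qed
    have "(\<integral>\<^sup>+ x. f x powe l * g x powe (1 - l) \<partial>M) \<le>
        (\<integral>\<^sup>+ x. ?D * (ennreal l * (f x / ?F) + ennreal (1 - l) * (g x / ?G)) \<partial>M)"
      by (intro nn_integral_mono *)
    also have "... = ?D * (ennreal l * (?F / ?F) + ennreal (1 - l) * (?G / ?G))"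
      by (simp add: nn_integral_cmult nn_integral_add nn_integral_divide)
    also have "... = ?D" using 4 l by (simp add: ennreal_divide_self less_top flip: ennreal_plus)
    finally show ?thesis .
  qed
qed

lemma le_double: "(x :: ennreal) \<le> 2 * x" by (simp add: mult_2)

section \<open>Geometric series and weighted discrete Hardy inequalities\<close>

definition geo :: "real \<Rightarrow> ennreal" where
  "geo x = zsum (\<lambda>j. dyad (- (x * of_int j)) * ind {0..} j)"

lemma geo_finite:
  assumes "0 < x" shows "geo x < top"
proof -
  let ?z = "(1/2) powr x"
  have z: "0 \<le> ?z" "?z < 1" using assms powr_less_mono2[of x "1/2" 1] by simp_all
  have "geo x \<le> ennreal (1 / (1 - ?z))" unfolding geo_def
  proof (rule zsum_least)
    fix J :: "int set" assume J: "finite J"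
    let ?N = "nat ` (J \<inter> {0..})"
    have "(\<Sum>j\<in>J. dyad (- (x * of_int j)) * ind {0..} j) =
        (\<Sum>j\<in>J \<inter> {0..}. dyad (- (x * of_int j)))"
      using J by (intro sum.mono_neutral_cong_right) (auto simp: indicator_def)
    also have "... = (\<Sum>n\<in>?N. dyad (- (x * of_nat n)))" by (subst sum.reindex) (auto simp: inj_on_def)
    also have "... = (\<Sum>n\<in>?N. ennreal (?z ^ n))" by (intro sum.cong refl)
         (simp add: dyad_def powr_power powr_minus powr_powr powr_divide inverse_eq_divide
            mult.commute flip: powr_realpow)
    also have "... = ennreal (\<Sum>n\<in>?N. ?z ^ n)" by (rule sum_ennreal) simp
    also have "... \<le> ennreal (\<Sum>n. ?z ^ n)"
      using z J by (intro ennreal_leI sum_le_suminf summable_geometric) auto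
    also have "(\<Sum>n. ?z ^ n) = 1 / (1 - ?z)" using z by (intro suminf_geometric) auto
    finally show "(\<Sum>j\<in>J. dyad (- (x * of_int j)) * ind {0..} j) \<le> ennreal (1 / (1 - ?z))" .
  qed
  then show ?thesis by (simp add: order_le_less_trans)
qed

lemma zsum_reindex:
  assumes "bij h" shows "zsum (\<lambda>k. f (h k)) = zsum f"
  using nn_integral_bij_count_space[of h UNIV UNIV f] assms by (simp add: bij_betw_def bij_def)

lemma zsum_uminus: "zsum (\<lambda>k. f (- k)) = zsum f" by (rule zsum_reindex) (rule bij_uminus)

lemma zsum_diff: "zsum (\<lambda>k. f (j - k)) = zsum f" by (rule zsum_reindex[of "\<lambda>k. j - k"])
     (auto intro!: bijI injI surjI[of _ "\<lambda>k. j - k"])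

lemma zsum_shift: "zsum (\<lambda>k. f (k + j)) = zsum f" by (rule zsum_reindex[of "\<lambda>k. k + j"])
     (auto intro!: bijI injI surjI[of _ "\<lambda>k. k - j"])

lemma zsum_geo: "zsum (\<lambda>j. dyad (- (x * of_int (k - j))) * ind {..k} j) = geo x" unfolding geo_def
  by (subst zsum_diff[of _ k, symmetric]) (auto intro!: nn_integral_cong simp: indicator_def)

lemma zsum_geo': "zsum (\<lambda>k. dyad (- (x * of_int (k - j))) * ind {..k} j) = geo x" unfolding geo_def
  by (subst zsum_shift[of _ "- j", symmetric]) (auto intro!: nn_integral_cong simp: indicator_def)

text \<open>A weak-type argument that treats every p > 0 at once: with T the sum on the right, a j
  <= T^(1/p) 2^(-(d/p)(k - j)) for each j, and these bounds form a geometric series.\<close>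

lemma zsum_below_powe:
  assumes "0 < p" "0 < d"
  shows "(zsum (cut {..k} a)) powe p
    \<le> geo (d / p) powe p * zsum (\<lambda>j. dyad (d * of_int (k - j)) * (a j powe p) * ind {..k} j)"
proof -
  let ?T = "zsum (\<lambda>j. dyad (d * of_int (k - j)) * (a j powe p) * ind {..k} j)"
  have "a j \<le> ?T powe (1 / p) * dyad (- (d / p * of_int (k - j)))" if "j \<le> k" for j
  proof -
    have "dyad (d * of_int (k - j)) * (a j powe p) \<le> ?T"
      using term_le_zsum[of "\<lambda>j. dyad (d * of_int (k - j)) * (a j powe p) * ind {..k} j" j] that by simp
    then have "a j powe p \<le> dyad (- (d * of_int (k - j))) * ?T" by (simp add: dyad_cancel)
    then have "a j \<le> (dyad (- (d * of_int (k - j))) * ?T) powe (1 / p)"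
      using assms by (simp add: powe_le_move)
    then show ?thesis using assms by (simp add: powe_mult dyad_powe mult.commute)
  qed
  then have "zsum (cut {..k} a)
      \<le> zsum (\<lambda>j. ?T powe (1 / p) * (dyad (- (d / p * of_int (k - j))) * ind {..k} j))"
    by (intro zsum_mono) (auto simp: indicator_def)
  also have "... = ?T powe (1 / p) * geo (d / p)" by (simp only: zsum_cmult zsum_geo)
  finally have "(zsum (cut {..k} a)) powe p \<le> (?T powe (1 / p) * geo (d / p)) powe p"
    using assms by (simp add: powe_mono)
  then show ?thesis using assms by (simp add: powe_mult powe_powe mult.commute)
qed

definition c_hardy :: "real \<Rightarrow> real \<Rightarrow> ennreal" where
  "c_hardy p d = geo (d / 2 / p) powe p * geo (d / 2)"

lemma c_hardy_finite: "0 < p \<Longrightarrow> 0 < d \<Longrightarrow> c_hardy p d < top"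
  using geo_finite[of "d / 2 / p"] geo_finite[of "d / 2"]
  by (simp add: c_hardy_def ennreal_mult_less_top powe_less_top_iff)

lemma geo_pos: "geo x \<noteq> 0"
  using term_le_zsum[of "\<lambda>j. dyad (- (x * of_int j)) * ind {0..} j" 0] by (auto simp: geo_def)

lemma c_hardy_pos: "0 < p \<Longrightarrow> c_hardy p d \<noteq> 0" by (simp add: c_hardy_def geo_pos powe_eq_0_iff)

text \<open>Taking d/2 in \<open>zsum_below_powe\<close> leaves the factor 2^(-dj) 2^(-(d/2)(k -
  j)), which after exchanging the sums is again a geometric series, now in k. The two factors of
  \<open>c_hardy\<close> come from these two series.\<close>

lemma geometric_hardy:
  assumes "0 < p" "0 < d"
  shows "zsum (\<lambda>k. dyad (- (d * of_int k)) * (zsum (cut {..k} a)) powe p)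
    \<le> c_hardy p d * zsum (\<lambda>k. dyad (- (d * of_int k)) * a k powe p)"
proof -
  let ?c = "geo (d / 2 / p) powe p"
  have "zsum (\<lambda>k. dyad (- (d * of_int k)) * (zsum (cut {..k} a)) powe p)
     \<le> zsum (\<lambda>k. dyad (- (d * of_int k)) *
        (?c * zsum (\<lambda>j. dyad (d / 2 * of_int (k - j)) * (a j powe p) * ind {..k} j)))"
    using assms by (intro zsum_mono mult_left_mono zsum_below_powe) auto
  also have "... = zsum (\<lambda>k. zsum (\<lambda>j. ?c * (dyad (- (d * of_int j)) * a j powe p) *
        (dyad (- (d / 2 * of_int (k - j))) * ind {..k} j)))"
  proof (intro nn_integral_cong)
    fix k :: int
    have eq: "dyad (- (d * of_int k)) * dyad (d / 2 * of_int (k - j)) =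
        dyad (- (d * of_int j)) * dyad (- (d / 2 * of_int (k - j)))" for j
      by (simp add: dyad_add[symmetric] field_simps)
    have "dyad (- (d * of_int k)) * (?c * (dyad (d / 2 * of_int (k - j)) * (a j powe p) * i)) =
       ?c * (dyad (- (d * of_int j)) * a j powe p) * (dyad (- (d / 2 * of_int (k - j))) * i)" for j i
    proof -
      have "dyad (- (d * of_int k)) * (?c * (dyad (d / 2 * of_int (k - j)) * (a j powe p) * i)) =
          (dyad (- (d * of_int k)) * dyad (d / 2 * of_int (k - j))) * (?c * (a j powe p) * i)"
        by (simp only: mult_ac)
      also have "... = (dyad (- (d * of_int j)) * dyad (- (d / 2 * of_int (k - j)))) * (?c * (a j powe p) * i)"
        by (simp only: eq)
      also have "... = ?c * (dyad (- (d * of_int j)) * a j powe p) * (dyad (- (d / 2 * of_int (k - j))) * i)"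
        by (simp only: mult_ac)
      finally show ?thesis .
    qed
    then show "dyad (- (d * of_int k)) *
        (?c * zsum (\<lambda>j. dyad (d / 2 * of_int (k - j)) * (a j powe p) * ind {..k} j)) =
      zsum (\<lambda>j. ?c * (dyad (- (d * of_int j)) * a j powe p) *
        (dyad (- (d / 2 * of_int (k - j))) * ind {..k} j))" by (simp only: zsum_cmult(1)[symmetric])
  qed
  also have "... = zsum (\<lambda>j. ?c * (dyad (- (d * of_int j)) * a j powe p) * geo (d / 2))"
    by (subst zsum_zsum_swap) (simp only: zsum_cmult zsum_geo')
  also have "... = c_hardy p d * zsum (\<lambda>k. dyad (- (d * of_int k)) * a k powe p)"
    by (simp only: zsum_cmult c_hardy_def) (simp only: mult_ac)
  finally show ?thesis .
qed

lemma geometric_hardy_above: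
  assumes "0 < p" "0 < d"
  shows "zsum (\<lambda>k. dyad (d * of_int k) * (zsum (cut {k..} a)) powe p)
    \<le> c_hardy p d * zsum (\<lambda>k. dyad (d * of_int k) * a k powe p)"
proof -
  have "zsum (\<lambda>k. dyad (d * of_int k) * (zsum (cut {k..} a)) powe p) =
      zsum (\<lambda>k. dyad (- (d * of_int k)) * (zsum (\<lambda>j. a (- j) * ind {..k} j)) powe p)"
    by (subst zsum_uminus[symmetric], intro nn_integral_cong, subst zsum_uminus[symmetric])
       (auto simp: indicator_def minus_le_iff)
  also have "... \<le> c_hardy p d * zsum (\<lambda>k. dyad (- (d * of_int k)) * a (- k) powe p)"
    by (rule geometric_hardy[OF assms])
  also have "zsum (\<lambda>k. dyad (- (d * of_int k)) * a (- k) powe p) =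
      zsum (\<lambda>k. dyad (d * of_int k) * a k powe p)" by (subst zsum_uminus[symmetric]) simp
  finally show ?thesis .
qed

text \<open>If S has no least element, the rays {y<..} with y in S cover S; by Lindelof countably
  many suffice, and the running minima of their endpoints form the sequence. It turns suprema over
  starting points in S into monotone limits.\<close>

lemma coinitial_sequence:
  fixes S :: "real set"
  assumes "S \<noteq> {}"
  obtains x :: "nat \<Rightarrow> real" where "\<And>n. x n \<in> S" "decseq x" "\<And>y. y \<in> S \<Longrightarrow> \<exists>n. x n \<le> y"
proof (cases "\<exists>m\<in>S. \<forall>y\<in>S. m \<le> y")
  case True
  then obtain m where "m \<in> S" "\<And>y. y \<in> S \<Longrightarrow> m \<le> y" by blast
  then show thesis by (intro that[of "\<lambda>_. m"]) (auto simp: decseq_def)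
next
  case False
  have "\<And>A. A \<in> (\<lambda>y. {y<..}) ` S \<Longrightarrow> open A" by auto
  then obtain F where F: "F \<subseteq> (\<lambda>y. {y<..}) ` S" "countable F" "\<Union>F = \<Union>((\<lambda>y. {y<..}) ` S)"
    using Lindelof[of "(\<lambda>y. {y<..}) ` S"] by metis
  obtain S' where S': "S' \<subseteq> S" "countable S'" "F = (\<lambda>y. {y<..}) ` S'"
    using F(1,2) by (meson countable_subset_image)
  have below: "\<exists>z\<in>S'. z < y" if "y \<in> S" for y
  proof -
    have "y \<in> \<Union>((\<lambda>y. {y<..}) ` S)" using False that by (force simp: not_le)
    then have "y \<in> \<Union>F" using F(3) by simp
    then show ?thesis using S'(3) by auto
  qed
  have ne: "S' \<noteq> {}" using below assms by blast
  let ?x = "\<lambda>n. Min (from_nat_into S' ` {..n})"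
  show thesis
  proof (rule that[of ?x])
    fix n
    have "?x n \<in> from_nat_into S' ` {..n}" by (intro Min_in) auto
    moreover have "from_nat_into S' ` {..n} \<subseteq> S" using from_nat_into[OF ne] S'(1) by auto
    ultimately show "?x n \<in> S" by blast
  next
    show "decseq ?x" by (auto simp: decseq_def intro!: Min_antimono)
  next
    fix y assume "y \<in> S"
    then obtain z where z: "z \<in> S'" "z < y" using below by blast
    then obtain n where "z = from_nat_into S' n" using from_nat_into_surj[OF S'(2)] by metis
    then have "?x n \<le> z" by (intro Min_le) auto
    then show "\<exists>n. ?x n \<le> y" using z(2) by (intro exI[of _ n]) linarith
  qed
qed

lemma cofinal_sequence:
  fixes S :: "real set"
  assumes "S \<noteq> {}"
  obtains x :: "nat \<Rightarrow> real" where "\<And>n. x n \<in> S" "incseq x" "\<And>y. y \<in> S \<Longrightarrow> \<exists>n. y \<le> x n"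
proof -
  have "uminus ` S \<noteq> {}" using assms by simp
  then obtain x where x: "\<And>n. x n \<in> uminus ` S" "decseq x" "\<And>y. y \<in> uminus ` S \<Longrightarrow> \<exists>n. x n \<le> y"
    using coinitial_sequence[of "uminus ` S"] by metis
  show thesis
  proof (rule that[of "\<lambda>n. - x n"])
    show "- x n \<in> S" for n using x(1)[of n] by auto
    show "incseq (\<lambda>n. - x n)" using x(2) by (auto simp: incseq_def decseq_def)
    show "\<exists>n. y \<le> - x n" if "y \<in> S" for y using x(3)[of "- y"] that by (auto simp: le_minus_iff)
  qed
qed

lemma mono_borel_measurable:
  fixes f :: "real \<Rightarrow> ennreal"
  assumes "mono f" shows "f \<in> borel_measurable borel"
proof (rule borel_measurableI_greater)
  fix y
  have "is_interval {x. y < f x}" using assms by (auto simp: is_interval_1 mono_def intro: less_le_trans)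
  then have "{x. y < f x} \<in> sets borel" by (rule real_interval_borel_measurable)
  then show "{x \<in> space borel. y < f x} \<in> sets borel" by simp
qed

lemma ennreal_half_add: "x / 2 + x / 2 = (x :: ennreal)"
  by (simp add: mult_2[symmetric] ennreal_times_divide ennreal_mult_divide_eq mult.commute[of 2])

text \<open>A lower set is an increasing union of rays {..x n} with x n in it, whether or not it
  contains its supremum, so continuity from below applies.\<close>

lemma emeasure_lower_set_le:
  fixes D :: "real set"
  assumes "sets \<nu> = sets borel" "\<And>x y. x \<in> D \<Longrightarrow> y \<le> x \<Longrightarrow> y \<in> D"
    and "\<And>x. x \<in> D \<Longrightarrow> emeasure \<nu> {..x} \<le> c"
  shows "emeasure \<nu> D \<le> c"
proof (cases "D = {}")
  case False
  then obtain x where x: "\<And>n. x n \<in> D" "incseq x" "\<And>y. y \<in> D \<Longrightarrow> \<exists>n. y \<le> x n"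
    using cofinal_sequence[of D] by metis
  have "D = (\<Union>n. {..x n})" using x assms(2) by auto
  moreover have "(SUP n. emeasure \<nu> {..x n}) = emeasure \<nu> (\<Union>n. {..x n})"
    using x(2) assms(1) by (intro SUP_emeasure_incseq) (auto simp: incseq_def intro: order_trans)
  ultimately have "emeasure \<nu> D = (SUP n. emeasure \<nu> {..x n})" by simp
  also have "... \<le> c" using assms(3) x(1) by (auto intro!: SUP_least)
  finally show ?thesis .
qed simp

section \<open>Hardy inequalities for measures on the line\<close>

text \<open>Lebesgue measure on an interval is the model. Points may have mass at this stage, so
  heads and tails at t are taken over the complementary rays {..<t} and {t..}.\<close>

locale line_measure = sigma_finite_measure M for M :: "real measure" +
  assumes id_measurable [measurable]: "(\<lambda>x. x) \<in> borel_measurable M"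
begin

abbreviation "BM \<equiv> borel_measurable M"

abbreviation I\<^sub>M (binder \<open>\<I>\<close> 10) where "I\<^sub>M \<equiv> nn_integral M"

abbreviation mass :: "real set \<Rightarrow> (real \<Rightarrow> ennreal) \<Rightarrow> ennreal" where
  "mass A g \<equiv> (\<I> s. g s * ind A s)"

lemma indicator_borel: "A \<in> sets borel \<Longrightarrow> (\<lambda>s. ind A s) \<in> BM"
  by (rule measurable_compose[OF id_measurable]) simp

lemma indicator_half_line [measurable]:
  "(\<lambda>s. ind {..<t} s) \<in> BM"
  "(\<lambda>s. ind {..t} s) \<in> BM"
  "(\<lambda>s. ind {t..} s) \<in> BM"
  "(\<lambda>s. ind {t..<t'} s) \<in> BM" by (simp_all add: indicator_borel)

lemma mono_measurable:
  fixes f :: "real \<Rightarrow> ennreal"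
  assumes "mono f" shows "f \<in> BM"
  by (rule measurable_compose[OF id_measurable mono_borel_measurable[OF assms]])

lemma antimono_measurable:
  fixes f :: "real \<Rightarrow> ennreal"
  assumes "antimono f" shows "f \<in> BM"
proof -
  have "mono (\<lambda>x. f (- x))" using assms by (auto simp: mono_def antimono_def)
  from mono_borel_measurable[OF this]
  have "(\<lambda>x. f (- (- x))) \<in> borel_measurable borel" by (rule measurable_compose[rotated]) simp
  then show ?thesis using measurable_compose[OF id_measurable] by simp
qed

lemma integral_below_measurable [measurable]:
  "(\<lambda>t. \<I> s. g s * ind {..<t} s) \<in> BM"
  by (intro mono_measurable monoI nn_integral_mono mult_left_mono) (auto simp: indicator_def)

lemma integral_above_measurable [measurable]:
  "(\<lambda>t. \<I> s. g s * ind {t..} s) \<in> BM"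
  by (intro antimono_measurable antimonoI nn_integral_mono mult_left_mono) (auto simp: indicator_def)

text \<open>Monotone convergence along a coinitial sequence of T. Tails are estimated only at points
  of T, that is where h lives; whatever is known on a level set or a band is then available at the
  starting point of the tail.\<close>

lemma nn_integral_le_tails:
  assumes [measurable]: "h \<in> BM"
    and T: "\<And>x. x \<in> space M \<Longrightarrow> x \<notin> T \<Longrightarrow> h x = 0"
    and le: "\<And>t. t \<in> T \<Longrightarrow> t \<in> space M \<Longrightarrow> (\<I> s. h s * ind {t..} s) \<le> c"
  shows "(\<I> s. h s) \<le> c"
proof (cases "T \<inter> space M = {}")
  case True
  then have "(\<I> s. h s) = (\<I> s. 0)" using T by (intro nn_integral_cong) blast
  then show ?thesis by simp
next
  case False
  then obtain x where x: "\<And>n. x n \<in> T \<inter> space M" "decseq x" "\<And>y. y \<in> T \<inter> space M \<Longrightarrow> \<exists>n. x n \<le> y"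
    using coinitial_sequence[OF False] by blast
  have "(\<I> s. h s) \<le> (\<I> s. (SUP n. h s * ind {x n..} s))"
  proof (rule nn_integral_mono)
    fix s assume s: "s \<in> space M"
    show "h s \<le> (SUP n. h s * ind {x n..} s)"
    proof (cases "s \<in> T")
      case True
      then obtain n where "x n \<le> s" using x(3) s by blast
      then show ?thesis by (intro SUP_upper2[of n]) auto
    qed (use T s in simp)
  qed
  also have "... = (SUP n. \<I> s. h s * ind {x n..} s)"
  proof (rule nn_integral_monotone_convergence_SUP)
    show "incseq (\<lambda>n s. h s * ind {x n..} s)"
    proof (intro incseq_SucI le_funI mult_left_mono)
      fix n s
      have "x (Suc n) \<le> x n" using x(2) by (simp add: decseq_SucD)
      then show "ind {x n..} s \<le> (ind {x (Suc n)..} s)" by (auto simp: indicator_def)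
    qed simp
  qed measurable
  also have "... \<le> c" using le x(1) by (auto intro!: SUP_least)
  finally show ?thesis .
qed

text \<open>This replaces integration of \<open>\<Phi>\<^sup>k d\<Phi>\<close>: at least half of the mass of \<open>h\<close> sits where the tail of
  \<open>h\<close> is at least half of the total.\<close>

lemma tail_integral_powe:
  assumes [measurable]: "h \<in> BM" and k: "0 < k"
  shows "(\<I> s. h s) powe (k + 1)
    \<le> dyad (k + 1) * (\<I> t. (\<I> s. h s * ind {t..} s) powe k * h t)"
proof -
  let ?tail = "\<lambda>t. \<I> s. h s * ind {t..} s"
  let ?m = "\<I> s. h s"
  \<comment> \<open>The restriction of h to the set where its tail is below c has tails at most c
    when started in that set, so its mass is at most c.\<close>
  have split: "?m \<le> c + (\<I> s. h s * ind {t. c \<le> ?tail t} s)" for c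
  proof -
    let ?h = "\<lambda>s. h s * ind {t. ?tail t < c} s"
    have [measurable]: "{x \<in> space M. ?tail x < c} \<in> sets M" "{x \<in> space M. c \<le> ?tail x} \<in> sets M"
      by measurable
    have m: "?h \<in> BM" "(cut {t. c \<le> ?tail t} h) \<in> BM"
      by (auto simp: indicator_def intro!: borel_measurable_times measurable_If)
    have "(\<I> s. ?h s) \<le> c"
    proof (rule nn_integral_le_tails[where T = "{t. ?tail t < c}"])
      fix t assume t: "t \<in> {t. ?tail t < c}"
      have "(\<I> s. ?h s * ind {t..} s) \<le> ?tail t" by (intro nn_integral_mono) (auto simp: indicator_def)
      then show "(\<I> s. ?h s * ind {t..} s) \<le> c" using t by simp
    qed (use m in auto)
    moreover have "?m = (\<I> s. ?h s + h s * ind {t. c \<le> ?tail t} s)"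
      by (intro nn_integral_cong) (auto simp: indicator_def)
    ultimately show ?thesis using m by (simp add: nn_integral_add add_right_mono)
  qed
  have key: "c powe k * (\<I> s. h s * ind {t. c \<le> ?tail t} s) \<le> (\<I> t. ?tail t powe k * h t)" for c
  proof -
    have [measurable]: "{x \<in> space M. c \<le> ?tail x} \<in> sets M" by measurable
    have m: "(cut {t. c \<le> ?tail t} h) \<in> BM"
      by (auto simp: indicator_def intro!: borel_measurable_times measurable_If)
    show ?thesis using k by (subst nn_integral_cmult[OF m, symmetric], intro nn_integral_mono)
        (auto simp: indicator_def intro!: mult_right_mono powe_mono)
  qed
  show ?thesis
  \<comment> \<open>An infinite mass cannot be halved; in that case the level c = 1 already leaves
    infinite mass above it.\<close>
  proof (cases "?m = top")
    case True
    have "(\<I> s. h s * ind {t. 1 \<le> ?tail t} s) = top" using split[of 1] True by (simp add: top_unique)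
    then have "(\<I> t. ?tail t powe k * h t) = top" using key[of 1] by (simp add: top_unique)
    then show ?thesis by (simp add: ennreal_mult_top)
  next
    case False
    note half = ennreal_half_add[of ?m]
    have "?m / 2 \<le> (\<I> s. h s * ind {t. ?m / 2 \<le> ?tail t} s)"
    proof -
      have "?m / 2 + ?m / 2 \<le> ?m / 2 + (\<I> s. h s * ind {t. ?m / 2 \<le> ?tail t} s)"
        using split[of "?m / 2"] half by simp
      moreover have "?m / 2 \<noteq> top" using False by (simp add: ennreal_divide_eq_top_iff)
      ultimately show ?thesis by (simp add: ennreal_add_left_cancel_le)
    qed
    then have "(?m / 2) powe k * (?m / 2) \<le> (\<I> t. ?tail t powe k * h t)"
      using key[of "?m / 2"] by (meson mult_left_mono order_trans zero_le)
    then have "(?m / 2) powe (k + 1) \<le> (\<I> t. ?tail t powe k * h t)" using k by (simp add: powe_add)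
    then have "dyad (k + 1) * (?m / 2) powe (k + 1) \<le> dyad (k + 1) * (\<I> t. ?tail t powe k * h t)"
      by (rule mult_left_mono) simp
    moreover have "dyad (k + 1) * (?m / 2) powe (k + 1) = (dyad 1 * (?m / 2)) powe (k + 1)"
      using k by (simp add: powe_mult dyad_powe)
    moreover have "dyad 1 * (?m / 2) = ?m" using half by (simp add: dyad_1 mult_2)
    ultimately show ?thesis by simp
  qed
qed

end

text \<open>The i-th block consists of the points x left of some \<rho> t on level i at which \<nu>
  {..x} has passed 2^(i-1). There 2^(i-1) < \<nu> {..x} < 2^(i+1), so a point lies in at most two
  blocks. The points left of \<rho> t outside the block have mass at most 2^(i-1), so another
  2^(i-1) lies in the block, and the hypothesis on single Borel sets bounds it by the E-measure
  \<epsilon> i of the block.\<close>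

lemma hardy_blocks:
  fixes \<nu> E :: "real measure" and \<rho> :: "real \<Rightarrow> real"
  assumes \<nu>: "sets \<nu> = sets borel" and E: "sets E = sets borel"
    and block: "\<And>t B. t \<in> X \<Longrightarrow> B \<in> sets borel \<Longrightarrow> B \<subseteq> {..<\<rho> t} \<Longrightarrow>
          emeasure \<nu> B \<le> Y t * emeasure E B powe c"
    and c: "0 < c"
  obtains \<epsilon> :: "int \<Rightarrow> ennreal"
  where "zsum \<epsilon> \<le> 2 * emeasure E UNIV"
    and "\<And>i t. t \<in> X \<Longrightarrow> dyad (of_int i) \<le> emeasure \<nu> {..<\<rho> t} \<Longrightarrow>
          emeasure \<nu> {..<\<rho> t} < dyad (of_int i + 1) \<Longrightarrow> dyad (of_int i - 1) \<le> Y t * \<epsilon> i powe c"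
proof -
  let ?N = "\<lambda>x. emeasure \<nu> {..x}" and ?G = "\<lambda>t. emeasure \<nu> {..<\<rho> t}"
  define T where "T i = {t \<in> X. dyad (of_int i) \<le> ?G t \<and> ?G t < dyad (of_int i + 1)}" for i :: int
  define B where "B i = {x. (\<exists>t\<in>T i. x < \<rho> t) \<and> dyad (of_int i - 1) < ?N x}" for i :: int
  have N_mono: "?N x \<le> ?N y" if "x \<le> y" for x y using that \<nu> by (intro emeasure_mono) auto
  have "is_interval (B i)" for i
    unfolding is_interval_1 B_def using less_le_trans[OF _ N_mono] by (auto intro: le_less_trans)
  then have B: "B i \<in> sets borel" for i by (rule real_interval_borel_measurable)
  show thesis
  proof (rule that[of "\<lambda>i. emeasure E (B i)"])
    have two: "zsum (\<lambda>i. ind (B i) x) \<le> 2" for x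
    proof (cases "\<exists>i. x \<in> B i")
      case True
      have bd: "dyad (of_int i - 1) < ?N x \<and> ?N x < dyad (of_int i + 1)" if "x \<in> B i" for i
      proof -
        from \<open>x \<in> B i\<close> obtain t where t: "t \<in> T i" "x < \<rho> t" unfolding B_def by blast
        have "?N x \<le> ?G t" using t(2) \<nu> by (intro emeasure_mono) auto
        moreover have "?G t < dyad (of_int i + 1)" using t(1) by (simp add: T_def)
        ultimately show ?thesis using that by (auto simp: B_def intro: le_less_trans)
      qed
      have "?N x \<noteq> 0" "?N x \<noteq> top" using True bd by (metis not_less_zero, metis top.extremum_strict)
      then obtain j :: int where j: "dyad (of_int j) \<le> ?N x" "?N x < dyad (of_int j + 1)"
        by (rule dyad_floor)
      have ij: "i = j \<or> i = j + 1" if "x \<in> B i" for i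
      proof -
        have "dyad (of_int i - 1) < dyad (of_int j + 1)" "dyad (of_int j) < dyad (of_int i + 1)"
          using less_trans[OF conjunct1[OF bd[OF that]] j(2)] le_less_trans[OF j(1) conjunct2[OF bd[OF that]]]
          by blast+
        then show ?thesis by simp linarith
      qed
      have "zsum (\<lambda>i. ind (B i) x) \<le> zsum (\<lambda>i. 1 * ind {j} i + 1 * ind {j + 1} i)"
        by (intro zsum_mono) (auto simp: indicator_def dest: ij)
      also have "... = 2" by (subst nn_integral_add) (simp_all only: zsum_single, simp_all)
      finally show ?thesis .
    qed simp
    have ind: "(\<lambda>x. ind (B i) x :: ennreal) \<in> borel_measurable E" for i using B[of i] E by simp
    have "zsum (\<lambda>i. emeasure E (B i)) = zsum (\<lambda>i. \<integral>\<^sup>+ x. ind (B i) x \<partial>E)" using B E by simp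
    also have "... = (\<integral>\<^sup>+ x. zsum (\<lambda>i. ind (B i) x) \<partial>E)" by (rule zsum_swap[symmetric]) (rule ind)
    also have "... \<le> (\<integral>\<^sup>+ x. 2 \<partial>E)" by (intro nn_integral_mono two)
    also have "... = 2 * emeasure E UNIV" using sets_eq_imp_space_eq[OF E] by simp
    finally show "zsum (\<lambda>i. emeasure E (B i)) \<le> 2 * emeasure E UNIV" .
  next
    fix i t assume t: "t \<in> X" "dyad (of_int i) \<le> ?G t" "?G t < dyad (of_int i + 1)"
    let ?D = "{x. x < \<rho> t \<and> ?N x \<le> dyad (of_int i - 1)}" and ?B = "{x. x < \<rho> t \<and> dyad (of_int i - 1) < ?N x}"
    have "is_interval ?D" unfolding is_interval_1
    proof safe
      fix x y z assume "?N y \<le> dyad (of_int i - 1)" "z \<le> y"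
      then show "?N z \<le> dyad (of_int i - 1)" using N_mono[of z y] by (meson order_trans)
    qed simp
    moreover have "is_interval ?B" unfolding is_interval_1 using less_le_trans[OF _ N_mono] by auto
    ultimately have m: "?D \<in> sets borel" "?B \<in> sets borel" using real_interval_borel_measurable by blast+
    have "emeasure \<nu> ?D \<le> dyad (of_int i - 1)"
    proof (rule emeasure_lower_set_le[OF \<nu>])
      fix x y assume x: "x \<in> ?D" "y \<le> x"
      have "?N y \<le> ?N x" by (rule N_mono) fact
      also have "... \<le> dyad (of_int i - 1)" using x by simp
      finally show "y \<in> ?D" using x by simp
    qed simp
    moreover have "emeasure \<nu> ?B \<le> Y t * emeasure E (B i) powe c"
    proof -
      have "emeasure \<nu> ?B \<le> Y t * emeasure E ?B powe c" using t(1) m by (intro block) auto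
      also have "... \<le> Y t * emeasure E (B i) powe c"
        using t B E c by (intro mult_left_mono powe_mono emeasure_mono) (auto simp: B_def T_def)
      finally show ?thesis .
    qed
    moreover have "?G t = emeasure \<nu> (?D \<union> ?B)" by (rule arg_cong[where f = "emeasure \<nu>"]) auto
    moreover have "... = emeasure \<nu> ?D + emeasure \<nu> ?B"
      using m \<nu> by (intro plus_emeasure[symmetric]) auto
    ultimately have "?G t \<le> dyad (of_int i - 1) + Y t * emeasure E (B i) powe c" by (simp add: add_mono)
    moreover have "dyad (of_int i) = dyad (of_int i - 1) + dyad (of_int i - 1)"
      by (simp add: dyad_double)
    ultimately have "dyad (of_int i - 1) + dyad (of_int i - 1) \<le> dyad (of_int i - 1) + Y t * emeasure E (B i) powe c"
      using t(2) by (metis order_trans)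
    then show "dyad (of_int i - 1) \<le> Y t * emeasure E (B i) powe c"
      by (simp add: ennreal_add_left_cancel_le)
  qed
qed

section \<open>Upper Hardy estimates by level sets\<close>

context line_measure
begin

definition tail :: "(real \<Rightarrow> ennreal) \<Rightarrow> real \<Rightarrow> ennreal" where
  "tail g t = mass {t..} g"

definition head :: "(real \<Rightarrow> ennreal) \<Rightarrow> real \<Rightarrow> ennreal" where
  "head g t = mass {..<t} g"

abbreviation "LQ r q u v f \<equiv> \<I> t. head (pw f r v) t powe (q / r) * u t"

lemma tail_measurable [measurable]: "tail g \<in> BM" unfolding tail_def[abs_def] by measurable

lemma head_measurable [measurable]: "head g \<in> BM" unfolding head_def[abs_def] by measurable

lemma tail_antimono: "s \<le> t \<Longrightarrow> tail g t \<le> tail g s"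
  unfolding tail_def by (intro nn_integral_mono mult_left_mono) (auto simp: indicator_def)

lemma head_mono: "s \<le> t \<Longrightarrow> head g s \<le> head g t"
  unfolding head_def by (intro nn_integral_mono mult_left_mono) (auto simp: indicator_def)

lemma tail_mono_fun: "(\<And>s. s \<in> space M \<Longrightarrow> g s \<le> h s) \<Longrightarrow> tail g t \<le> tail h t"
  unfolding tail_def by (intro nn_integral_mono mult_right_mono) auto

lemma head_mono_fun: "(\<And>s. s \<in> space M \<Longrightarrow> g s \<le> h s) \<Longrightarrow> head g t \<le> head h t"
  unfolding head_def by (intro nn_integral_mono mult_right_mono) auto

lemma le_of_tails:
  assumes "h \<in> BM"
    and "\<And>x. x \<in> space M \<Longrightarrow> x \<notin> T \<Longrightarrow> h x = 0"
    and "\<And>t. t \<in> T \<Longrightarrow> t \<in> space M \<Longrightarrow> tail h t \<le> c"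
  shows "(\<I> s. h s) \<le> c" using assms nn_integral_le_tails[of h T c] by (simp add: tail_def)

lemma tail_powe:
  assumes "h \<in> BM" "0 < k"
  shows "(\<I> s. h s) powe (k + 1) \<le> dyad (k + 1) * (\<I> t. tail h t powe k * h t)"
  using tail_integral_powe[OF assms] by (simp add: tail_def)

text \<open>The level sets of \<open>t \<mapsto> \<nu> {..<\<rho> t}\<close> reduce both Hardy inequalities below to sums over the integers.\<close>

lemma hardy_level_sum:
  fixes \<nu> E :: "real measure" and \<rho> :: "real \<Rightarrow> real"
  assumes \<nu>: "sets \<nu> = sets borel" and E: "sets E = sets borel"
    and [measurable]: "u \<in> BM" "\<rho> \<in> BM"
    and block: "\<And>t B. t \<in> space M \<Longrightarrow> B \<in> sets borel \<Longrightarrow> B \<subseteq> {..<\<rho> t} \<Longrightarrow>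
          emeasure \<nu> B \<le> Y t * emeasure E B powe c"
    and c: "0 < c" and g: "0 < g" and Efin: "emeasure E UNIV < top"
    and null: "\<And>S. S \<in> sets M \<Longrightarrow> (\<And>t. t \<in> S \<Longrightarrow> Y t = top) \<Longrightarrow> (mass S u) = 0"
  obtains \<epsilon> :: "int \<Rightarrow> ennreal" and T :: "int \<Rightarrow> real set"
  where "zsum \<epsilon> \<le> 2 * emeasure E UNIV"
    and "\<And>i. T i \<in> sets M" "\<And>i j. i \<noteq> j \<Longrightarrow> T i \<inter> T j = {}"
    and "\<And>i t. t \<in> T i \<Longrightarrow> dyad (of_int i) powe g \<le> dyad g * (Y t powe g * \<epsilon> i powe (c * g))"
    and "(\<I> t. emeasure \<nu> {..<\<rho> t} powe g * u t)
      \<le> dyad g * zsum (\<lambda>i. dyad (of_int i) powe g * mass (T i) u)"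
proof -
  let ?G = "\<lambda>t. emeasure \<nu> {..<\<rho> t}"
  obtain \<epsilon> :: "int \<Rightarrow> ennreal" where e: "zsum \<epsilon> \<le> 2 * emeasure E UNIV"
    "\<And>i t. t \<in> space M \<Longrightarrow> dyad (of_int i) \<le> ?G t \<Longrightarrow> ?G t < dyad (of_int i + 1) \<Longrightarrow>
        dyad (of_int i - 1) \<le> Y t * \<epsilon> i powe c"
  proof (rule hardy_blocks[OF \<nu> E _ c, of "space M" \<rho> Y])
    show "emeasure \<nu> B \<le> Y t * emeasure E B powe c"
      if "t \<in> space M" "B \<in> sets borel" "B \<subseteq> {..<\<rho> t}" for t B using that by (rule block)
  qed (rule that)
  have "mono (\<lambda>x. emeasure \<nu> {..<x})" using \<nu> by (intro monoI emeasure_mono) auto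
  from mono_borel_measurable[OF this] have [measurable]: "?G \<in> BM"
    by (rule measurable_compose[rotated]) measurable
  define T where "T i = {t \<in> space M. dyad (of_int i) \<le> ?G t \<and> ?G t < dyad (of_int i + 1)}" for i :: int
  have T: "T i \<in> sets M" for i unfolding T_def by measurable
  have disj: "T i \<inter> T j = {}" if "i \<noteq> j" for i j
  proof (rule ccontr)
    assume "T i \<inter> T j \<noteq> {}"
    then obtain t where t: "dyad (of_int i) \<le> ?G t" "?G t < dyad (of_int j + 1)"
      "dyad (of_int j) \<le> ?G t" "?G t < dyad (of_int i + 1)" by (auto simp: T_def)
    have "dyad (of_int i) < dyad (of_int j + 1)" "dyad (of_int j) < dyad (of_int i + 1)"
      by (rule le_less_trans[OF t(1,2)] le_less_trans[OF t(3,4)])+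
    then show False using that by simp
  qed
  have Tinf: "{t \<in> space M. ?G t = top} \<in> sets M" by measurable
  \<comment> \<open>An infinite \<nu> {..<\<rho> t} with finite E forces Y t = top, where u has no
    mass by \<open>null\<close>. Hence the dyadic levels exhaust the left-hand side.\<close>
  have Vinf: "Y t = top" if "t \<in> {t \<in> space M. ?G t = top}" for t
  proof -
    have "top \<le> Y t * emeasure E {..<\<rho> t} powe c" using block[of t "{..<\<rho> t}"] that by simp
    moreover have "emeasure E {..<\<rho> t} powe c < top"
      using Efin E c emeasure_mono[of "{..<\<rho> t}" UNIV E] by (simp add: powe_less_top_iff le_less_trans)
    ultimately show ?thesis by (auto simp: top_unique ennreal_mult_eq_top_iff)
  qed
  have "(\<I> t. u t * ind {t \<in> space M. ?G t = top} t) = 0" using Vinf by (rule null[OF Tinf])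
  then have AE0: "AE t in M. u t * ind {t \<in> space M. ?G t = top} t = 0"
    using Tinf by (subst (asm) nn_integral_0_iff_AE) (auto intro!: borel_measurable_times)
  have "(\<I> t. ?G t powe g * u t)
      \<le> (\<I> t. zsum (\<lambda>i. dyad g * dyad (of_int i) powe g * (u t * ind (T i) t)))"
  proof (rule nn_integral_mono_AE)
    show "AE t in M. ?G t powe g * u t \<le> zsum (\<lambda>i. dyad g * dyad (of_int i) powe g * (u t * ind (T i) t))"
      using AE0 AE_space
    proof eventually_elim
      case (elim t)
      show ?case
      proof (cases "?G t = 0 \<or> u t = 0")
        case False
        with elim have "?G t \<noteq> 0" "?G t \<noteq> top" by (auto simp: indicator_def)
        then obtain i :: int where i: "dyad (of_int i) \<le> ?G t" "?G t < dyad (of_int i + 1)"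
          by (rule dyad_floor)
        then have ti: "t \<in> T i" using elim by (auto simp: T_def)
        have "?G t powe g \<le> dyad (of_int i + 1) powe g" using i g by (intro powe_mono) auto
        also have "... = dyad g * dyad (of_int i) powe g"
          by (simp add: dyad_powe dyad_add[symmetric] algebra_simps)
        finally have "?G t powe g * u t \<le> dyad g * dyad (of_int i) powe g * (u t * ind (T i) t)"
          using ti by (simp add: mult_right_mono)
        also have "... \<le> zsum (\<lambda>i. dyad g * dyad (of_int i) powe g * (u t * ind (T i) t))"
          by (rule term_le_zsum)
        finally show ?thesis .
      qed (use g in auto)
    qed
  qed
  also have "... = zsum (\<lambda>i. \<I> t. dyad g * dyad (of_int i) powe g * (u t * ind (T i) t))"
    using T by (intro zsum_swap) (auto intro!: borel_measurable_times)
  also have "... = zsum (\<lambda>i. dyad g * (dyad (of_int i) powe g * mass (T i) u))"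
    using T by (intro nn_integral_cong, subst nn_integral_cmult)
      (auto intro!: borel_measurable_times simp: mult.assoc)
  finally have fin: "(\<I> t. ?G t powe g * u t)
      \<le> dyad g * zsum (\<lambda>i. dyad (of_int i) powe g * mass (T i) u)" by (simp only: zsum_cmult)
  have lev: "dyad (of_int i) powe g \<le> dyad g * (Y t powe g * \<epsilon> i powe (c * g))" if "t \<in> T i" for i t
  proof -
    have "dyad (of_int i) = dyad 1 * dyad (of_int i - 1)" by (simp add: dyad_add[symmetric])
    also have "... \<le> dyad 1 * (Y t * \<epsilon> i powe c)"
      using that e(2)[of t i] by (intro mult_left_mono) (auto simp: T_def)
    finally have "dyad (of_int i) powe g \<le> (dyad 1 * (Y t * \<epsilon> i powe c)) powe g"
      using g by (intro powe_mono) auto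
    then show ?thesis using g c by (simp add: powe_mult dyad_powe powe_powe)
  qed
  show thesis by (rule that[OF e(1) T disj lev fin])
qed

end

lemma disjoint_indicator_sum_le:
  fixes a :: "'i \<Rightarrow> ennreal"
  assumes "\<And>i j. i \<in> J \<Longrightarrow> j \<in> J \<Longrightarrow> i \<noteq> j \<Longrightarrow> A i \<inter> A j = {}"
    and "\<And>i. i \<in> J \<Longrightarrow> t \<in> A i \<Longrightarrow> a i \<le> c" and J: "finite J"
  shows "(\<Sum>i\<in>J. a i * ind (A i) t) \<le> c"
proof (cases "\<exists>i\<in>J. t \<in> A i")
  case True
  then obtain i where i: "i \<in> J" "t \<in> A i" by blast
  have "(\<Sum>i\<in>J. a i * ind (A i) t) = (\<Sum>i\<in>{i}. a i * ind (A i) t)"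
    using i assms(1) by (intro sum.mono_neutral_right J) (auto simp: indicator_def)
  then show ?thesis using assms(2) i by simp
qed (simp add: indicator_def sum.neutral)

text \<open>Duality of l^(p/q): for z = b^(1/(p - q)) both b z^q and z^p equal b^(p/(p - q)), so
  their sum X satisfies X <= D X^(q/p), and X^(q/p) is cancelled. Unit vectors z show first that X
  is finite. Only finite z are tested, since in \<open>steps_bound\<close> the resulting estimate is
  divided by a tail of u and has to be finite.\<close>

lemma powe_dual_sum:
  fixes b :: "'i \<Rightarrow> ennreal"
  assumes pq: "0 < q" "q < p" and J: "finite J" and D: "D < top"
    and le: "\<And>z :: 'i \<Rightarrow> ennreal. (\<And>i. z i < top) \<Longrightarrow> (\<Sum>i\<in>J. b i * z i powe q) \<le> D * (\<Sum>i\<in>J. z i powe p) powe (q / p)"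
  shows "(\<Sum>i\<in>J. b i powe (p / (p - q))) \<le> D powe (p / (p - q))"
proof -
  let ?X = "\<Sum>i\<in>J. b i powe (p / (p - q))"
  have p: "0 < p" "0 < p - q" "0 < p / (p - q)" using pq by auto
  have b: "b i < top" if i: "i \<in> J" for i
  proof -
    have "(\<Sum>j\<in>J. b j * ind {i} j powe q) = (\<Sum>j\<in>{i}. b j * ind {i} j powe q)"
      "(\<Sum>j\<in>J. ind {i} j powe p) = (\<Sum>j\<in>{i}. ind {i} j powe p :: ennreal)"
      using i J pq by (intro sum.mono_neutral_right; auto simp: indicator_def)+
    moreover have "ind {i} j < (top :: ennreal)" for j by (simp add: indicator_def)
    ultimately have "b i \<le> D" using le[of "ind {i}"] by simp
    then show ?thesis using D by (rule order_le_less_trans)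
  qed
  have X: "?X < top" using b p J by (simp add: ennreal_sum_less_top powe_less_top_iff)
  have 1: "b i * (b i powe (1 / (p - q))) powe q = b i powe (p / (p - q))" for i
  proof -
    have "p / (p - q) = 1 + 1 / (p - q) * q" using pq by (simp add: field_simps)
    then show ?thesis using pq powe_add[of 1 "1 / (p - q) * q" "b i"] by (simp add: powe_powe)
  qed
  have 2: "(b i powe (1 / (p - q))) powe p = b i powe (p / (p - q))" for i
    using pq by (simp add: powe_powe)
  have le: "?X \<le> D * ?X powe (q / p)"
    using le[of "\<lambda>i. if i \<in> J then b i powe (1 / (p - q)) else 0"] b p by (simp add: 1 2 powe_less_top_iff)
  show ?thesis
  proof (cases "?X = 0")
    case False
    have pw: "?X = ?X powe (q / p) * ?X powe (1 - q / p)"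
      using powe_add[of "q / p" "1 - q / p" ?X] pq by simp
    have nz: "?X powe (q / p) \<noteq> 0" "?X powe (q / p) < top"
      using False X pq by (simp_all add: powe_eq_0_iff powe_less_top_iff)
    have "?X powe (q / p) * ?X powe (1 - q / p) \<le> ?X powe (q / p) * D"
      using le pw by (simp add: mult.commute)
    then have "?X powe (1 - q / p) \<le> D" using nz by (simp add: ennreal_mult_le_mult_iff)
    moreover have "1 - q / p = (p - q) / p" using p by (simp add: field_simps)
    ultimately show ?thesis using p by (simp add: powe_le_move)
  qed simp
qed

context line_measure
begin

text \<open>With \<rho> t = t this gives the local inequality of \<open>KQ_le_AQ\<close>, with
  \<rho> t = ka t the inequality for sums over earlier bands. On level i the number 2^i is compared
  with Y t at the very point t where a tail of u begins, so the level contributes at most a multiple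
  of A \<epsilon>_i^(cg); cg >= 1 allows these powers to be summed.\<close>

lemma hardy_upper_le:
  fixes \<nu> E :: "real measure" and \<rho> :: "real \<Rightarrow> real"
  assumes \<nu>: "sets \<nu> = sets borel" and E: "sets E = sets borel"
    and meas [measurable]: "u \<in> BM" "\<rho> \<in> BM"
    and block: "\<And>t B. t \<in> space M \<Longrightarrow> B \<in> sets borel \<Longrightarrow> B \<subseteq> {..<\<rho> t} \<Longrightarrow>
          emeasure \<nu> B \<le> Y t * emeasure E B powe c"
    and c: "0 < c" and g: "0 < g" "1 \<le> c * g" and Efin: "emeasure E UNIV < top"
    and A: "A < top" "\<And>t. t \<in> space M \<Longrightarrow> tail u t * Y t powe g \<le> A"
  shows "(\<I> t. emeasure \<nu> {..<\<rho> t} powe g * u t)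
      \<le> dyad (2 * g + c * g) * (A * emeasure E UNIV powe (c * g))"
proof (rule hardy_level_sum[OF \<nu> E meas block c g(1) Efin])
  fix S assume [measurable]: "S \<in> sets M" and S: "\<And>t. t \<in> S \<Longrightarrow> Y t = top"
  have "mass S u \<le> 0"
  proof (rule le_of_tails[where T = S])
    fix t assume t: "t \<in> S" "t \<in> space M"
    have "tail u t * top \<le> A" using A(2)[OF t(2)] S[OF t(1)] g by simp
    then have "tail u t = 0" using A(1) by (auto simp: ennreal_mult_top top_unique split: if_splits)
    moreover have "tail (cut S u) t \<le> tail u t" by (rule tail_mono_fun) (auto simp: indicator_def)
    ultimately show "tail (cut S u) t \<le> 0" by simp
  qed auto
  then show "mass S u = 0" by simp
next
  fix \<epsilon> :: "int \<Rightarrow> ennreal" and T :: "int \<Rightarrow> real set"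
  assume e: "zsum \<epsilon> \<le> 2 * emeasure E UNIV"
    and T [measurable]: "\<And>i. T i \<in> sets M" and disj: "\<And>i j. i \<noteq> j \<Longrightarrow> T i \<inter> T j = {}"
    and lev: "\<And>i t. t \<in> T i \<Longrightarrow> dyad (of_int i) powe g \<le> dyad g * (Y t powe g * \<epsilon> i powe (c * g))"
    and fin: "(\<I> t. emeasure \<nu> {..<\<rho> t} powe g * u t)
      \<le> dyad g * zsum (\<lambda>i. dyad (of_int i) powe g * mass (T i) u)"
  have "dyad (of_int i) powe g * mass (T i) u \<le> dyad g * A * \<epsilon> i powe (c * g)" for i
  proof -
    let ?h = "\<lambda>t. dyad (of_int i) powe g * (u t * ind (T i) t)"
    have "(\<I> t. ?h t) \<le> dyad g * A * \<epsilon> i powe (c * g)"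
    proof (rule le_of_tails[where T = "T i"])
      fix t assume t: "t \<in> T i" "t \<in> space M"
      have "tail ?h t \<le> tail (\<lambda>t. dyad (of_int i) powe g * u t) t"
        by (rule tail_mono_fun) (auto simp: indicator_def)
      also have "... = dyad (of_int i) powe g * tail u t"
        unfolding tail_def by (subst nn_integral_cmult[symmetric]) (auto simp: mult.assoc)
      also have "... \<le> dyad g * (Y t powe g * \<epsilon> i powe (c * g)) * tail u t"
        by (intro mult_right_mono lev t) simp
      also have "... = dyad g * (tail u t * Y t powe g) * \<epsilon> i powe (c * g)" by (simp only: mult_ac)
      also have "... \<le> dyad g * A * \<epsilon> i powe (c * g)" by (intro mult_right_mono mult_left_mono A t) auto
      finally show "tail ?h t \<le> dyad g * A * \<epsilon> i powe (c * g)" .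
    qed auto
    then show ?thesis by (simp add: nn_integral_cmult)
  qed
  then have "zsum (\<lambda>i. dyad (of_int i) powe g * mass (T i) u)
      \<le> dyad g * A * zsum (\<lambda>i. \<epsilon> i powe (c * g))" by (simp only: zsum_cmult[symmetric]) (rule zsum_mono)
  also have "... \<le> dyad g * A * (2 * emeasure E UNIV) powe (c * g)"
  proof (rule mult_left_mono)
    show "zsum (\<lambda>i. \<epsilon> i powe (c * g)) \<le> (2 * emeasure E UNIV) powe (c * g)"
      using g e by (intro order_trans[OF zsum_powe_ge] powe_mono) auto
  qed simp
  also have "... = dyad g * A * (dyad (c * g) * emeasure E UNIV powe (c * g))"
    using g(2) by (simp add: powe_mult dyad_powe flip: dyad_1)
  finally have "dyad g * zsum (\<lambda>i. dyad (of_int i) powe g * mass (T i) u)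
     \<le> dyad g * (dyad g * A * (dyad (c * g) * emeasure E UNIV powe (c * g)))"
    by (rule mult_left_mono) simp
  also have "... = (dyad g * dyad g * dyad (c * g)) * (A * emeasure E UNIV powe (c * g))"
    by (simp only: mult_ac)
  also have "dyad g * dyad g * dyad (c * g) = dyad (2 * g + c * g)" by (simp add: dyad_add[symmetric])
  finally show ?thesis using fin by (rule order_trans[rotated])
qed

text \<open>For cg < 1 the sum of the powers \<epsilon>_i^(cg) is no longer bounded by the power of
  the sum, so Hoelder with l = cg is applied in i. The complementary factor is X, whose integrand is
  collected level by level.\<close>

lemma hardy_upper_less:
  fixes \<nu> E :: "real measure" and \<rho> :: "real \<Rightarrow> real"
  assumes \<nu>: "sets \<nu> = sets borel" and E: "sets E = sets borel"
    and meas [measurable]: "u \<in> BM" "\<rho> \<in> BM"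
    and block: "\<And>t B. t \<in> space M \<Longrightarrow> B \<in> sets borel \<Longrightarrow> B \<subseteq> {..<\<rho> t} \<Longrightarrow>
          emeasure \<nu> B \<le> Y t * emeasure E B powe c"
    and c: "0 < c" and g: "0 < g" "c * g < 1" and Efin: "emeasure E UNIV < top"
    and Ym [measurable]: "Y \<in> BM"
    and k: "k = c * g / (1 - c * g)" and m: "m = g / (1 - c * g)"
    and X: "X = (\<I> t. tail u t powe k * Y t powe m * u t)" "X < top"
  shows "(\<I> t. emeasure \<nu> {..<\<rho> t} powe g * u t)
      \<le> dyad (2 * g + c * g + 2) * (X powe (1 - c * g) * emeasure E UNIV powe (c * g))"
proof -
  define l where "l = c * g"
  have l: "0 < l" "l < 1" using c g by (auto simp: l_def)
  have km: "0 < k" "0 < m" "k + 1 = 1 / (1 - l)" "k = l / (1 - l)" "m = g / (1 - l)"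
    using l g by (auto simp: k m l_def field_simps)
  show ?thesis
  proof (rule hardy_level_sum[OF \<nu> E meas block c g(1) Efin])
    fix S assume [measurable]: "S \<in> sets M" and S: "\<And>t. t \<in> S \<Longrightarrow> Y t = top"
    let ?h = "\<lambda>t. u t * ind S t"
    have "AE t in M. tail u t powe k * Y t powe m * u t \<noteq> top"
      using X nn_integral_PInf_AE[of "\<lambda>t. tail u t powe k * Y t powe m * u t" M] by auto
    \<comment> \<open>Where Y = top, finiteness of X leaves only tail u t = 0 or u t = 0;
      \<open>tail_powe\<close> turns this into vanishing mass.\<close>
    then have "AE t in M. tail ?h t powe k * ?h t = 0"
    proof eventually_elim
      case (elim t)
      show ?case
      proof (cases "t \<in> S")
        case True
        then have "tail u t powe k = 0 \<or> u t = 0"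
          using elim S[OF True] km by (auto simp: ennreal_mult_eq_top_iff)
        moreover have "tail ?h t powe k \<le> tail u t powe k"
          using km by (intro powe_mono tail_mono_fun) (auto simp: indicator_def)
        ultimately show ?thesis by auto
      qed simp
    qed
    then have "(\<I> t. tail ?h t powe k * ?h t) = 0" by (subst nn_integral_0_iff_AE) auto
    then have "(\<I> t. ?h t) powe (k + 1) = 0" using tail_powe[of ?h k] km by simp
    then show "(\<I> t. ?h t) = 0" using km by (simp add: powe_eq_0_iff)
  next
    fix \<epsilon> :: "int \<Rightarrow> ennreal" and T :: "int \<Rightarrow> real set"
    assume e: "zsum \<epsilon> \<le> 2 * emeasure E UNIV"
      and T [measurable]: "\<And>i. T i \<in> sets M" and disj: "\<And>i j. i \<noteq> j \<Longrightarrow> T i \<inter> T j = {}"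
      and lev: "\<And>i t. t \<in> T i \<Longrightarrow> dyad (of_int i) powe g \<le> dyad g * (Y t powe g * \<epsilon> i powe (c * g))"
      and fin: "(\<I> t. emeasure \<nu> {..<\<rho> t} powe g * u t)
        \<le> dyad g * zsum (\<lambda>i. dyad (of_int i) powe g * mass (T i) u)"
    let ?x = "\<lambda>i. mass (T i) (\<lambda>t. tail u t powe k * Y t powe m * u t)"
    \<comment> \<open>\<open>tail_powe\<close> bounds a power of the mass of u on the level by an
      integral of tail^k u; its exponent k + 1 is 1/(1 - l), the one that Hoelder in i
      requires.\<close>
    have lev': "dyad (of_int i) powe g * mass (T i) u \<le>
        dyad (g + 1) * (\<epsilon> i powe l * ?x i powe (1 - l))" for i
    proof -
      let ?h = "\<lambda>t. u t * ind (T i) t"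
      have "(dyad (of_int i) powe g * (\<I> t. ?h t)) powe (k + 1) =
          (dyad (of_int i) powe g) powe (k + 1) * (\<I> t. ?h t) powe (k + 1)"
        by (rule powe_mult) (use km in linarith)
      also have "... \<le> (dyad (of_int i) powe g) powe (k + 1) *
           (dyad (k + 1) * (\<I> t. tail ?h t powe k * ?h t))"
        using km by (intro mult_left_mono tail_powe) auto
      also have "... = dyad (k + 1) * (\<I> t. (dyad (of_int i) powe g) powe (k + 1) * (tail ?h t powe k * ?h t))"
        by (subst nn_integral_cmult[of "\<lambda>t. tail ?h t powe k * ?h t"]) (measurable, simp only: mult_ac)
      also have "... \<le> dyad (k + 1) * (\<I> t. (dyad (g * (k + 1)) * \<epsilon> i powe k) *
          (tail u t powe k * Y t powe m * u t * ind (T i) t))"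
      proof (intro mult_left_mono nn_integral_mono)
        fix t
        show "(dyad (of_int i) powe g) powe (k + 1) * (tail ?h t powe k * ?h t) \<le>
          (dyad (g * (k + 1)) * \<epsilon> i powe k) * (tail u t powe k * Y t powe m * u t * ind (T i) t)"
        proof (cases "t \<in> T i")
          case True
          have "(dyad (of_int i) powe g) powe (k + 1) \<le> (dyad g * (Y t powe g * \<epsilon> i powe (c * g))) powe (k + 1)"
            using km l by (intro powe_mono lev True) auto
          also have "... = dyad (g * (k + 1)) * (Y t powe (g * (k + 1)) * \<epsilon> i powe (l * (k + 1)))"
            using km g l by (simp add: powe_mult dyad_powe powe_powe l_def)
          also have "g * (k + 1) = m" using km by simp
          also have "l * (k + 1) = k" using km by simp
          finally have 1: "(dyad (of_int i) powe g) powe (k + 1) \<le> dyad m * (Y t powe m * \<epsilon> i powe k)" .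
          have gk: "g * (k + 1) = m" using km by simp
          have 2: "tail ?h t powe k \<le> tail u t powe k"
            using km by (intro powe_mono tail_mono_fun) (auto simp: indicator_def)
          have "(dyad (of_int i) powe g) powe (k + 1) * (tail ?h t powe k * u t) \<le>
              dyad m * (Y t powe m * \<epsilon> i powe k) * (tail u t powe k * u t)" by (intro mult_mono 1 2) auto
          then show ?thesis using True gk by (simp add: mult_ac)
        qed simp
      qed simp
      also have "... = dyad ((g + 1) * (k + 1)) * (\<epsilon> i powe k * ?x i)"
        by (subst nn_integral_cmult) (simp_all add: algebra_simps dyad_add)
      finally have "dyad (of_int i) powe g * (\<I> t. ?h t)
          \<le> (dyad ((g + 1) * (k + 1)) * (\<epsilon> i powe k * ?x i)) powe (1 / (k + 1))"
        using km by (simp add: powe_le_move)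
      also have "1 / (k + 1) = 1 - l" using km by simp
      also have "(dyad ((g + 1) * (k + 1)) * (\<epsilon> i powe k * ?x i)) powe (1 - l) =
          dyad ((g + 1) * (k + 1) * (1 - l)) * (\<epsilon> i powe (k * (1 - l)) * ?x i powe (1 - l))"
        using l km by (simp add: powe_mult dyad_powe powe_powe)
      also have "(g + 1) * (k + 1) * (1 - l) = g + 1" using km l by simp
      also have "k * (1 - l) = l" using km l by simp
      finally show ?thesis .
    qed
    have sumx: "zsum ?x \<le> X"
    proof -
      have "zsum ?x = (\<I> t. zsum (\<lambda>i. tail u t powe k * Y t powe m * u t * ind (T i) t))"
        by (rule zsum_swap[symmetric]) measurable
      also have "... \<le> X" unfolding X(1)
        using disj by (intro nn_integral_mono zsum_least disjoint_indicator_sum_le) auto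
      finally show ?thesis .
    qed
    have "zsum (\<lambda>i. dyad (of_int i) powe g * mass (T i) u)
        \<le> dyad (g + 1) * zsum (\<lambda>i. \<epsilon> i powe l * ?x i powe (1 - l))"
      by (simp only: zsum_cmult[symmetric]) (rule zsum_mono, rule lev')
    also have "... \<le> dyad (g + 1) * (2 * (zsum \<epsilon> powe l * zsum ?x powe (1 - l)))"
      using l by (intro mult_left_mono order_trans[OF hoelder_powe le_double]) auto
    also have "... \<le> dyad (g + 1) * (2 * ((2 * emeasure E UNIV) powe l * X powe (1 - l)))"
      using l by (intro mult_left_mono mult_mono powe_mono e sumx) auto
    also have "... = dyad (g + 1) * (dyad 1 * (dyad l * emeasure E UNIV powe l * X powe (1 - l)))"
      using l by (simp add: powe_mult dyad_powe flip: dyad_1)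
    finally have "dyad g * zsum (\<lambda>i. dyad (of_int i) powe g * mass (T i) u) \<le>
      dyad g * (dyad (g + 1) * (dyad 1 * (dyad l * emeasure E UNIV powe l * X powe (1 - l))))"
      by (rule mult_left_mono) simp
    also have "... = (dyad g * (dyad (g + 1) * (dyad 1 * dyad l))) * (X powe (1 - l) * emeasure E UNIV powe l)"
      by (simp only: mult_ac)
    also have "dyad g * (dyad (g + 1) * (dyad 1 * dyad l)) = dyad (2 * g + l + 2)"
      by (simp add: dyad_add[symmetric] algebra_simps)
    finally show ?thesis using fin by (simp only: l_def[symmetric])
  qed
qed

section \<open>Lower Hardy estimates by duality\<close>

lemma tail_split_mass:
  assumes [measurable]: "u \<in> BM" "T \<in> sets M"
    and "mass T u \<noteq> 0" "mass T u < top"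
  obtains \<tau> where "\<tau> \<in> T" "\<tau> \<in> space M"
    "mass T u \<le> 2 * tail (cut T u) \<tau>"
proof -
  let ?m = "mass T u"
  \<comment> \<open>If all tails started in T were below m/2, \<open>le_of_tails\<close> would give
    m <= m/2.\<close>
  have "\<exists>\<tau>\<in>T \<inter> space M. ?m / 2 \<le> tail (cut T u) \<tau>"
  proof (rule ccontr)
    assume "\<not> ?thesis"
    then have "?m \<le> ?m / 2" by (intro le_of_tails[where T = T]) (auto simp: not_le intro: less_imp_le)
    then have "?m / 2 + ?m / 2 \<le> ?m / 2 + 0" by (simp add: ennreal_half_add)
    then have "?m / 2 \<le> 0"
      using assms(4) by (subst (asm) ennreal_add_left_cancel_le) (auto simp: ennreal_divide_eq_top_iff)
    then show False using assms(3) by (simp add: ennreal_divide_eq_0_iff)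
  qed
  then obtain \<tau> where t: "\<tau> \<in> T" "\<tau> \<in> space M" "?m / 2 \<le> tail (cut T u) \<tau>" by blast
  have "?m \<le> 2 * tail (cut T u) \<tau>" using add_mono[OF t(3) t(3)] by (simp add: ennreal_half_add mult_2)
  with t show thesis by (intro that) auto
qed

text \<open>2^x comes from rounding S up to a power of two, 2^(p/(p - q)) from keeping half of the
  mass of each level, and \<open>c_hardy\<close> from summing the masses of all higher
  levels.\<close>

definition c_lower :: "real \<Rightarrow> real \<Rightarrow> real \<Rightarrow> ennreal" where
  "c_lower p q x = dyad (x + p / (p - q)) * c_hardy (p / (p - q)) x"

text \<open>The common core of three lower bounds: N is the integral in \<open>AQ_le_KQ\<close>, and
  \<open>Rp\<close> in \<open>steps_lower\<close> and \<open>C4_lower\<close>; S^(er) is, up to a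
  constant, the size that the head of a normalised test function reaches. One test function per
  level of S is taken, they are combined with free coefficients z, and \<open>powe_dual_sum\<close>
  bounds the weighted level masses of u in l^(p/(p - q)).\<close>

lemma hardy_lower:
  fixes N :: "(real \<Rightarrow> ennreal) \<Rightarrow> ennreal"
  assumes [measurable]: "u \<in> BM" "v \<in> BM"
    and [measurable]: "S \<in> BM"
    and S: "\<And>s t. s \<in> space M \<Longrightarrow> t \<in> space M \<Longrightarrow> s \<le> t \<Longrightarrow> S s \<le> S t"
    and pqr: "0 < q" "q < p" "0 < r" "0 < e"
    and ineq: "\<And>f. f \<in> BM \<Longrightarrow>
        (LQ r q u v f) \<le> D * N f powe (q / p)"
    and Sfin: "\<And>t. t \<in> space M \<Longrightarrow> S t = top \<Longrightarrow> tail u t = 0"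
    and c: "c1 \<noteq> 0" "c1 < top" "c2 < top" and D: "D < top"
    and test: "\<And>J \<tau>. finite J \<Longrightarrow>
        (\<And>i. i \<in> J \<Longrightarrow> \<tau> i \<in> space M \<and> dyad (of_int i) \<le> S (\<tau> i) \<and> S (\<tau> i) < dyad (of_int i + 1)) \<Longrightarrow>
        \<exists>F :: int \<Rightarrow> real \<Rightarrow> ennreal.
          (\<forall>i\<in>J. F i \<in> BM \<and>
            (\<forall>t\<in>space M. \<tau> i \<le> t \<longrightarrow> c1 * dyad (of_int i * e * r) \<le> head (pw (F i) r v) t)) \<and>
          (\<forall>z. N (\<lambda>x. \<Sum>i\<in>J. z i * F i x) \<le> c2 * (\<Sum>i\<in>J. z i powe p))"
  shows "(\<I> t. tail u t powe (q / (p - q)) * S t powe (e * (p * q / (p - q))) * u t)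
     \<le> c_lower p q (e * (p * q / (p - q))) * (D * c2 powe (q / p) / c1 powe (q / r)) powe (p / (p - q))"
proof -
  define b where "b = p / (p - q)"
  define s where "s = p * q / (p - q)"
  have bs: "0 < b" "0 < s" "b = q / (p - q) + 1" "s = q * b" "0 < q / (p - q)"
    using pqr by (auto simp: b_def s_def field_simps)
  define K where "K = D * c2 powe (q / p) / c1 powe (q / r)"
  have cq: "c1 powe (q / r) \<noteq> 0" "c1 powe (q / r) < top"
    using c pqr by (simp_all add: powe_eq_0_iff powe_less_top_iff)
  have "D * c2 powe (q / p) < top" using c D pqr by (simp add: ennreal_mult_less_top powe_less_top_iff)
  then have K: "K < top" unfolding K_def using cq by (metis ennreal_divide_eq_top_iff less_top)
  have KD: "c1 powe (q / r) * x \<le> D * c2 powe (q / p) * y \<Longrightarrow> x \<le> K * y" for x y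
  proof -
    assume "c1 powe (q / r) * x \<le> D * c2 powe (q / p) * y"
    then have "c1 powe (q / r) * x / c1 powe (q / r) \<le> D * c2 powe (q / p) * y / c1 powe (q / r)"
      by (rule divide_right_mono_ennreal)
    then show ?thesis
      using cq by (simp add: K_def ennreal_mult_divide_eq mult.commute ennreal_times_divide less_top)
  qed
  define T where "T i = {t \<in> space M. dyad (of_int i) \<le> S t \<and> S t < dyad (of_int i + 1)}" for i :: int
  define \<mu> where "\<mu> i = mass (T i) u" for i
  have T [measurable]: "T i \<in> sets M" for i unfolding T_def by measurable
  have Tdisj: "T i \<inter> T j = {}" if "i \<noteq> j" for i j
  proof (rule ccontr)
    assume "T i \<inter> T j \<noteq> {}"
    then obtain t where t: "dyad (of_int i) \<le> S t" "S t < dyad (of_int j + 1)"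
      "dyad (of_int j) \<le> S t" "S t < dyad (of_int i + 1)" by (auto simp: T_def)
    have "dyad (of_int i) < dyad (of_int j + 1)" "dyad (of_int j) < dyad (of_int i + 1)"
      by (rule le_less_trans[OF t(1,2)] le_less_trans[OF t(3,4)])+
    then show False using that by simp
  qed
  \<comment> \<open>The parts of the T i from \<tau> i on are disjoint. On the i-th one the head of
    the whole combination is at least that of its i-th term, which gives the linear form to be
    dualised.\<close>
  have main: "(\<Sum>i\<in>J. (dyad (of_int i * e * q) * tail (cut (T i) u) (\<tau> i)) powe b) \<le> K powe b"
    if J: "finite J" and tau: "\<And>i. i \<in> J \<Longrightarrow> \<tau> i \<in> T i" for J \<tau>
  proof -
    let ?m = "\<lambda>i. tail (cut (T i) u) (\<tau> i)"
    obtain F :: "int \<Rightarrow> real \<Rightarrow> ennreal" where Fm: "\<And>i. i \<in> J \<Longrightarrow> F i \<in> BM"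
      and F: "\<And>i t. i \<in> J \<Longrightarrow> t \<in> space M \<Longrightarrow> \<tau> i \<le> t \<Longrightarrow> c1 * dyad (of_int i * e * r) \<le> head (pw (F i) r v) t"
      and FN: "\<And>z. N (\<lambda>x. \<Sum>i\<in>J. z i * F i x) \<le> c2 * (\<Sum>i\<in>J. z i powe p)"
      using test[OF J, of \<tau>] tau by (auto simp: T_def)
    have "(\<Sum>i\<in>J. (dyad (of_int i * e * q) * ?m i) * z i powe q) \<le> K * (\<Sum>i\<in>J. z i powe p) powe (q / p)" for z
    proof (rule KD)
      let ?f = "\<lambda>x. \<Sum>i\<in>J. z i * F i x"
      let ?a = "\<lambda>i. c1 powe (q / r) * dyad (of_int i * e * q) * z i powe q"
      have fm: "?f \<in> BM" using Fm by (intro borel_measurable_sum borel_measurable_times) auto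
      have pt: "?a i \<le> head (pw ?f r v) t powe (q / r)" if i: "i \<in> J" "t \<in> T i \<inter> {\<tau> i..}" for i t
      proof -
        have "z i powe r * (c1 * dyad (of_int i * e * r)) \<le> z i powe r * head (pw (F i) r v) t"
          using i F[of i t] by (intro mult_left_mono) (auto simp: T_def)
        also have "... = head (\<lambda>s. (z i * F i s) powe r * v s) t"
          unfolding head_def using Fm[OF i(1)] pqr
          by (subst nn_integral_cmult[symmetric]) (auto simp: powe_mult mult_ac intro!: nn_integral_cong)
        also have "... \<le> head (pw ?f r v) t"
          using pqr J i by (intro head_mono_fun mult_right_mono powe_mono member_le_sum) auto
        finally have "(z i powe r * (c1 * dyad (of_int i * e * r))) powe (q / r) \<le> head (pw ?f r v) t powe (q / r)"
          using pqr by (intro powe_mono) auto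
        moreover have "(z i powe r * (c1 * dyad (of_int i * e * r))) powe (q / r) = ?a i"
          using pqr by (simp add: powe_mult powe_powe dyad_powe mult_ac)
        ultimately show ?thesis by simp
      qed
      have disj: "(T i \<inter> {\<tau> i..}) \<inter> (T j \<inter> {\<tau> j..}) = {}" if "i \<noteq> j" for i j
        using Tdisj[OF that] by blast
      have "c1 powe (q / r) * (\<Sum>i\<in>J. (dyad (of_int i * e * q) * ?m i) * z i powe q) = (\<Sum>i\<in>J. ?a i * ?m i)"
        by (simp add: sum_distrib_left mult_ac)
      also have "... = (\<Sum>i\<in>J. \<I> t. ?a i * ind (T i \<inter> {\<tau> i..}) t * u t)" unfolding tail_def
        by (intro sum.cong refl, subst nn_integral_cmult[symmetric])
           (auto simp: indicator_inter_arith mult_ac intro!: nn_integral_cong)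
      also have "... = (\<I> t. (\<Sum>i\<in>J. ?a i * ind (T i \<inter> {\<tau> i..}) t * u t))"
        by (rule nn_integral_sum[symmetric]) (simp add: indicator_inter_arith)
      also have "... \<le> (\<I> t. head (pw ?f r v) t powe (q / r) * u t)" using pt J
        by (intro nn_integral_mono, subst sum_distrib_right[symmetric],
            intro mult_right_mono disjoint_indicator_sum_le disj) auto
      also have "... \<le> D * N ?f powe (q / p)" by (rule ineq[OF fm])
      also have "... \<le> D * (c2 * (\<Sum>i\<in>J. z i powe p)) powe (q / p)"
        using pqr FN by (intro mult_left_mono powe_mono) auto
      also have "... = D * c2 powe (q / p) * (\<Sum>i\<in>J. z i powe p) powe (q / p)"
        using pqr by (simp add: powe_mult mult.assoc)
      finally show "c1 powe (q / r) * (\<Sum>i\<in>J. (dyad (of_int i * e * q) * ?m i) * z i powe q)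
        \<le> D * c2 powe (q / p) * (\<Sum>i\<in>J. z i powe p) powe (q / p)" .
    qed
    then show ?thesis unfolding b_def by (intro powe_dual_sum[OF pqr(1,2) J K]) auto
  qed
  \<comment> \<open>Finiteness is required by \<open>tail_split_mass\<close>; it follows from
    \<open>main\<close> for the single level i with \<tau> running through T i.\<close>
  have fin: "\<mu> i < top" for i
  proof -
    have "\<mu> i \<le> dyad (- (of_int i * e * q)) * K" unfolding \<mu>_def
    proof (rule le_of_tails[where T = "T i"])
      fix t assume "t \<in> T i"
      then have "(dyad (of_int i * e * q) * tail (cut (T i) u) t) powe b \<le> K powe b"
        using main[of "{i}" "\<lambda>_. t"] by simp
      then show "tail (cut (T i) u) t \<le> dyad (- (of_int i * e * q)) * K"
        using bs by (simp add: powe_le_iff dyad_cancel)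
    qed auto
    then show ?thesis using K by (simp add: ennreal_mult_less_top le_less_trans)
  qed
  have "zsum (\<lambda>i. (dyad (of_int i * e * q) * \<mu> i) powe b) \<le> dyad b * K powe b"
  proof (rule zsum_least)
    fix J :: "int set" assume J: "finite J"
    let ?J = "{i \<in> J. \<mu> i \<noteq> 0}"
    have "\<exists>\<tau>. \<tau> \<in> T i \<and> \<mu> i \<le> 2 * tail (cut (T i) u) \<tau>" if "i \<in> ?J" for i
    proof -
      have "mass (T i) u \<noteq> 0" "mass (T i) u < top" using that fin[of i] by (simp_all add: \<mu>_def)
      from tail_split_mass[OF assms(1) T this] show ?thesis by (auto simp: \<mu>_def)
    qed
    then have "\<forall>i\<in>?J. \<exists>\<tau>. \<tau> \<in> T i \<and> \<mu> i \<le> 2 * tail (cut (T i) u) \<tau>" by blast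
    from bchoice[OF this] obtain \<tau>
      where "\<forall>i\<in>?J. \<tau> i \<in> T i \<and> \<mu> i \<le> 2 * tail (cut (T i) u) (\<tau> i)" by blast
    then have tau: "\<And>i. i \<in> ?J \<Longrightarrow> \<tau> i \<in> T i"
      "\<And>i. i \<in> ?J \<Longrightarrow> \<mu> i \<le> 2 * tail (cut (T i) u) (\<tau> i)" by blast+
    have "(\<Sum>i\<in>J. (dyad (of_int i * e * q) * \<mu> i) powe b) = (\<Sum>i\<in>?J. (dyad (of_int i * e * q) * \<mu> i) powe b)"
      using J bs by (intro sum.mono_neutral_right) auto
    also have "... \<le> (\<Sum>i\<in>?J. dyad b * (dyad (of_int i * e * q) * tail (cut (T i) u) (\<tau> i)) powe b)"
    proof (rule sum_mono)
      fix i assume i: "i \<in> ?J"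
      have "(dyad (of_int i * e * q) * \<mu> i) powe b \<le> (dyad (of_int i * e * q) * (2 * tail (cut (T i) u) (\<tau> i))) powe b"
        using i tau bs by (intro powe_mono mult_left_mono) auto
      also have "... = dyad b * (dyad (of_int i * e * q) * tail (cut (T i) u) (\<tau> i)) powe b"
        using bs(1) by (simp add: powe_mult dyad_powe mult_ac flip: dyad_1)
      finally show "(dyad (of_int i * e * q) * \<mu> i) powe b \<le> dyad b * (dyad (of_int i * e * q) * tail (cut (T i) u) (\<tau> i)) powe b" .
    qed
    also have "... \<le> dyad b * K powe b"
      unfolding sum_distrib_left[symmetric] using J tau by (intro mult_left_mono main) auto
    finally show "(\<Sum>i\<in>J. (dyad (of_int i * e * q) * \<mu> i) powe b) \<le> dyad b * K powe b" .
  qed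
  then have lev: "zsum (\<lambda>i. dyad (e * s * of_int i) * \<mu> i powe b) \<le> dyad b * K powe b"
    using bs by (simp add: powe_mult dyad_powe mult_ac)
  have null: "(\<I> t. u t * ind {t \<in> space M. S t = top} t) = 0"
  proof -
    have "(\<I> t. u t * ind {t \<in> space M. S t = top} t) \<le> 0"
    proof (rule le_of_tails[where T = "{t \<in> space M. S t = top}"])
      fix t assume t: "t \<in> {t \<in> space M. S t = top}"
      have "tail (\<lambda>t. u t * ind {t \<in> space M. S t = top} t) t \<le> tail u t"
        by (rule tail_mono_fun) (auto simp: indicator_def)
      then show "tail (\<lambda>t. u t * ind {t \<in> space M. S t = top} t) t \<le> 0" using t Sfin by simp
    qed auto
    then show ?thesis by simp
  qed
  \<comment> \<open>S is increasing, so beyond t only levels from i on occur, besides {S = top},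
    which carries no u.\<close>
  have tailT: "tail u t \<le> zsum (cut {i..} \<mu>)" if t: "t \<in> T i" for t i
  proof -
    have "tail u t \<le> (\<I> x. u x * ind {t \<in> space M. S t = top} x + zsum (\<lambda>j. u x * ind (T j) x * ind {i..} j))"
      unfolding tail_def
    proof (rule nn_integral_mono)
      fix x assume x: "x \<in> space M"
      show "u x * ind {t..} x \<le> u x * ind {t \<in> space M. S t = top} x + zsum (\<lambda>j. u x * ind (T j) x * ind {i..} j)"
      proof (cases "t \<le> x \<and> S x \<noteq> top")
        case True
        then have St: "S t \<le> S x" using S[of t x] x t by (simp add: T_def)
        then have "dyad (of_int i) \<le> S x" using t by (auto simp: T_def intro: order_trans)
        then have "S x \<noteq> 0" by (metis dyad_pos(1) not_le le_zero_eq)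
        then obtain j :: int where j: "dyad (of_int j) \<le> S x" "S x < dyad (of_int j + 1)"
          using dyad_floor True by metis
        have "dyad (of_int i) < dyad (of_int j + 1)"
          using \<open>dyad (of_int i) \<le> S x\<close> j(2) by (rule le_less_trans)
        then have "i \<le> j" by simp
        then have "u x * ind {t..} x \<le> u x * ind (T j) x * ind {i..} j"
          using j x by (auto simp: T_def indicator_def)
        also have "... \<le> zsum (\<lambda>j. u x * ind (T j) x * ind {i..} j)" by (rule term_le_zsum)
        finally show ?thesis by (simp add: add_increasing)
      qed (use x in \<open>auto simp: indicator_def\<close>)
    qed
    also have "... = 0 + (\<I> x. zsum (\<lambda>j. u x * ind (T j) x * ind {i..} j))"
      by (subst nn_integral_add) (auto simp: null)
    also have "(\<I> x. zsum (\<lambda>j. u x * ind (T j) x * ind {i..} j)) = zsum (cut {i..} \<mu>)"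
      unfolding \<mu>_def by (subst zsum_swap) (auto simp: nn_integral_multc)
    finally show ?thesis by simp
  qed
  have "(\<I> t. tail u t powe (q / (p - q)) * S t powe (e * s) * u t)
      \<le> (\<I> t. zsum (\<lambda>i. dyad (e * s) * dyad (e * s * of_int i) *
          zsum (cut {i..} \<mu>) powe (q / (p - q)) * (u t * ind (T i) t)))"
  proof (rule nn_integral_mono)
    fix t assume x: "t \<in> space M"
    show "tail u t powe (q / (p - q)) * S t powe (e * s) * u t \<le> zsum (\<lambda>i. dyad (e * s) * dyad (e * s * of_int i) *
          zsum (cut {i..} \<mu>) powe (q / (p - q)) * (u t * ind (T i) t))" (is "?l \<le> zsum ?R")
    proof (cases "S t = 0 \<or> S t = top")
      case True
      then have "S t powe (e * s) = 0 \<or> tail u t powe (q / (p - q)) = 0"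
        using Sfin[OF x] mult_pos_pos[OF pqr(4) bs(2)] bs(5) by auto
      then show ?thesis by auto
    next
      case False
      then obtain i :: int where i: "dyad (of_int i) \<le> S t" "S t < dyad (of_int i + 1)"
        using dyad_floor by metis
      then have ti: "t \<in> T i" using x by (simp add: T_def)
      have "S t powe (e * s) \<le> dyad (of_int i + 1) powe (e * s)" using i bs pqr by (intro powe_mono) auto
      also have "... = dyad (e * s) * dyad (e * s * of_int i)"
        by (simp add: dyad_powe dyad_add[symmetric] algebra_simps)
      finally have 1: "S t powe (e * s) \<le> dyad (e * s) * dyad (e * s * of_int i)" .
      have 2: "tail u t powe (q / (p - q)) \<le> zsum (cut {i..} \<mu>) powe (q / (p - q))"
        using bs by (intro powe_mono tailT ti) auto
      have "?l \<le> zsum (cut {i..} \<mu>) powe (q / (p - q)) * (dyad (e * s) * dyad (e * s * of_int i)) * u t"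
        by (intro mult_right_mono mult_mono 1 2) auto
      also have "... = ?R i" using ti by (simp add: mult_ac)
      also have "... \<le> zsum ?R" by (rule term_le_zsum)
      finally show ?thesis .
    qed
  qed
  also have "... = zsum (\<lambda>i. dyad (e * s) * dyad (e * s * of_int i) *
          zsum (cut {i..} \<mu>) powe (q / (p - q)) * \<mu> i)"
    unfolding \<mu>_def by (subst zsum_swap) (auto simp: nn_integral_cmult)
  also have "... \<le> zsum (\<lambda>i. dyad (e * s) * (dyad (e * s * of_int i) *
          zsum (cut {i..} \<mu>) powe b))"
  proof (rule zsum_mono)
    fix i :: int
    let ?Z = "zsum (cut {i..} \<mu>)"
    have "\<mu> i \<le> ?Z" using term_le_zsum[of "\<lambda>j. \<mu> j * ind {i..} j" i] by simp
    then have "?Z powe (q / (p - q)) * \<mu> i \<le> ?Z powe (q / (p - q)) * ?Z" by (rule mult_left_mono) simp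
    also have "... = ?Z powe b" using bs powe_add[of "q / (p - q)" 1 ?Z] by simp
    finally have "dyad (e * s) * dyad (e * s * of_int i) * (?Z powe (q / (p - q)) * \<mu> i) \<le>
        dyad (e * s) * dyad (e * s * of_int i) * ?Z powe b" by (rule mult_left_mono) simp
    then show "dyad (e * s) * dyad (e * s * of_int i) * ?Z powe (q / (p - q)) * \<mu> i
       \<le> dyad (e * s) * (dyad (e * s * of_int i) * ?Z powe b)" by (simp only: mult.assoc)
  qed
  also have "... = dyad (e * s) * zsum (\<lambda>i. dyad (e * s * of_int i) * zsum (cut {i..} \<mu>) powe b)"
    by (rule zsum_cmult)
  also have "... \<le> dyad (e * s) * (c_hardy b (e * s) * zsum (\<lambda>i. dyad (e * s * of_int i) * \<mu> i powe b))"
    using mult_pos_pos[OF pqr(4) bs(2)] bs(1) by (intro mult_left_mono geometric_hardy_above) auto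
  also have "... \<le> dyad (e * s) * (c_hardy b (e * s) * (dyad b * K powe b))"
    by (intro mult_left_mono lev) auto
  also have "... = c_lower p q (e * s) * K powe b" by (simp add: c_lower_def b_def dyad_add mult_ac)
  finally show ?thesis by (simp only: b_def s_def K_def)
qed

lemma c_lower_pos: "0 < q \<Longrightarrow> q < p \<Longrightarrow> c_lower p q x \<noteq> 0"
  using c_hardy_pos[of "p / (p - q)" x] by (simp add: c_lower_def)

lemma c_lower_finite: "0 < q \<Longrightarrow> q < p \<Longrightarrow> 0 < x \<Longrightarrow> c_lower p q x < top"
  by (simp add: c_lower_def ennreal_mult_less_top c_hardy_finite)

section \<open>Local constants\<close>

text \<open>\<open>VR\<close> is the \<open>r\<close>-th power of \<open>V\<^sub>r\<close>, and \<open>KQ\<close> the \<open>q\<close>-th power of the best constant in the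
  case \<open>p = 1\<close>, \<open>w = \<delta>\<^sub>b\<close>. Restrictions to subintervals are encoded by cutting off the weights.\<close>

definition VR :: "real \<Rightarrow> (real \<Rightarrow> ennreal) \<Rightarrow> ennreal" where
  "VR r v = (SUP f \<in> {f \<in> BM. (\<I> x. f x) \<le> 1}. \<I> x. f x powe r * v x)"

definition KQ :: "real \<Rightarrow> real \<Rightarrow> (real \<Rightarrow> ennreal) \<Rightarrow> (real \<Rightarrow> ennreal) \<Rightarrow> ennreal" where
  "KQ r q u v = (SUP f \<in> {f \<in> BM. (\<I> x. f x) \<le> 1}.
     (LQ r q u v f))"

lemma VR_least:
  assumes "\<And>f. f \<in> BM \<Longrightarrow> (\<I> x. f x) \<le> 1 \<Longrightarrow> (\<I> x. f x powe r * v x) \<le> c"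
  shows "VR r v \<le> c" unfolding VR_def using assms by (auto intro!: SUP_least)

lemma VR_ge:
  assumes "f \<in> BM" "(\<I> x. f x) \<le> 1"
  shows "(\<I> x. f x powe r * v x) \<le> VR r v" unfolding VR_def using assms by (auto intro!: SUP_upper)

lemma KQ_least:
  assumes "\<And>f. f \<in> BM \<Longrightarrow> (\<I> x. f x) \<le> 1 \<Longrightarrow>
    (LQ r q u v f) \<le> c"
  shows "KQ r q u v \<le> c" unfolding KQ_def using assms by (auto intro!: SUP_least)

lemma KQ_ge:
  assumes "f \<in> BM" "(\<I> x. f x) \<le> 1"
  shows "(LQ r q u v f) \<le> KQ r q u v" unfolding KQ_def using assms by (auto intro!: SUP_upper)

lemma VR_obtain:
  assumes "c < VR r v"
  obtains f where "f \<in> BM" "(\<I> x. f x) \<le> 1" "c < (\<I> x. f x powe r * v x)"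
  using assms unfolding VR_def by (auto simp: less_SUP_iff)

lemma KQ_obtain:
  assumes "c < KQ r q u v"
  obtains f where "f \<in> BM" "(\<I> x. f x) \<le> 1"
    "c < (LQ r q u v f)" using assms unfolding KQ_def by (auto simp: less_SUP_iff)

lemma VR_mono: "(\<And>x. x \<in> space M \<Longrightarrow> v x \<le> v' x) \<Longrightarrow> VR r v \<le> VR r v'"
  by (intro VR_least order_trans[OF _ VR_ge[where v = v']] nn_integral_mono) (auto intro: mult_left_mono)

lemma KQ_mono:
  assumes "0 < r" "0 < q" "\<And>x. x \<in> space M \<Longrightarrow> u x \<le> u' x" "\<And>x. x \<in> space M \<Longrightarrow> v x \<le> v' x"
  shows "KQ r q u v \<le> KQ r q u' v'" using assms
  by (intro KQ_least order_trans[OF _ KQ_ge[where v = v' and u = u']] nn_integral_mono mult_mono powe_mono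
        head_mono_fun) (auto intro: mult_left_mono)

lemma VR_cong: "(\<And>x. x \<in> space M \<Longrightarrow> v x = v' x) \<Longrightarrow> VR r v = VR r v'" by (intro antisym VR_mono) auto

lemma VR_upper:
  assumes [measurable]: "f \<in> BM" and r: "0 < r" and fin: "(\<I> x. f x) < top"
    and [measurable]: "v \<in> BM"
  shows "(\<I> x. f x powe r * v x) \<le> VR r v * (\<I> x. f x) powe r"
proof (cases "(\<I> x. f x) = 0")
  case True
  then have "AE x in M. f x = 0" by (simp add: nn_integral_0_iff_AE)
  then have "AE x in M. f x powe r * v x = 0" by eventually_elim (use r in simp)
  then have "(\<I> x. f x powe r * v x) = 0" by (subst nn_integral_0_iff_AE) auto
  then show ?thesis by simp
next
  case False
  let ?m = "\<I> x. f x"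
  have eq: "f x = ?m * (f x / ?m)" for x
    using False fin by (simp add: ennreal_times_divide ennreal_mult_divide_eq mult.commute less_top)
  have "(\<I> x. f x powe r * v x) = (\<I> x. ?m powe r * ((f x / ?m) powe r * v x))"
    using r by (subst eq) (simp add: powe_mult mult.assoc)
  also have "... = ?m powe r * (\<I> x. (f x / ?m) powe r * v x)" by (rule nn_integral_cmult) measurable
  also have "... \<le> ?m powe r * VR r v" using False fin
    by (intro mult_left_mono VR_ge) (auto simp: nn_integral_divide ennreal_divide_self less_top)
  finally show ?thesis by (simp add: mult.commute)
qed

lemma KQ_upper:
  assumes [measurable]: "f \<in> BM" and rq: "0 < r" "0 < q" and fin: "(\<I> x. f x) < top"
    and [measurable]: "v \<in> BM" "u \<in> BM"
  shows "(LQ r q u v f) \<le> KQ r q u v * (\<I> x. f x) powe q"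
proof (cases "(\<I> x. f x) = 0")
  case True
  then have "AE x in M. f x = 0" by (simp add: nn_integral_0_iff_AE)
  then have "AE s in M. f s powe r * v s * ind {..<t} s = 0" for t by eventually_elim (use rq in simp)
  then have "head (pw f r v) t = 0" for t unfolding head_def by (subst nn_integral_0_iff_AE) auto
  then show ?thesis using rq by simp
next
  case False
  let ?m = "\<I> x. f x"
  have eq: "f x = ?m * (f x / ?m)" for x
    using False fin by (simp add: ennreal_times_divide ennreal_mult_divide_eq mult.commute less_top)
  have h: "head (pw f r v) t = ?m powe r * head (\<lambda>s. (f s / ?m) powe r * v s) t" for t
  proof -
    have "head (pw f r v) t = (\<I> s. ?m powe r * ((f s / ?m) powe r * v s * ind {..<t} s))"
      unfolding head_def using rq by (subst eq) (simp add: powe_mult mult.assoc)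
    also have "... = ?m powe r * head (\<lambda>s. (f s / ?m) powe r * v s) t"
      unfolding head_def by (rule nn_integral_cmult) measurable
    finally show ?thesis .
  qed
  have "(LQ r q u v f) =
     (\<I> t. ?m powe q * (head (\<lambda>s. (f s / ?m) powe r * v s) t powe (q / r) * u t))"
    using rq by (simp add: h powe_mult powe_powe mult.assoc)
  also have "... = ?m powe q * (\<I> t. head (\<lambda>s. (f s / ?m) powe r * v s) t powe (q / r) * u t)"
    by (rule nn_integral_cmult) measurable
  also have "... \<le> ?m powe q * KQ r q u v" using False fin
    by (intro mult_left_mono KQ_ge) (auto simp: nn_integral_divide ennreal_divide_self less_top)
  finally show ?thesis by (simp add: mult.commute)
qed

lemma VR_le_tails:
  assumes [measurable]: "v \<in> BM"
    and "\<And>x. x \<in> space M \<Longrightarrow> x \<notin> T \<Longrightarrow> v x = 0"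
    and le: "\<And>t. t \<in> T \<Longrightarrow> t \<in> space M \<Longrightarrow> VR r (cut {t..} v) \<le> c"
  shows "VR r v \<le> c"
proof (rule VR_least)
  fix f assume f [measurable]: "f \<in> BM" "(\<I> x. f x) \<le> 1"
  show "(\<I> x. f x powe r * v x) \<le> c"
  proof (rule le_of_tails[where T = T])
    fix t assume t: "t \<in> T" "t \<in> space M"
    have "tail (pw f r v) t = (\<I> x. f x powe r * (v x * ind {t..} x))" by (simp add: tail_def mult.assoc)
    also have "... \<le> c" using VR_ge[OF f] le[OF t] by (rule order_trans)
    finally show "tail (pw f r v) t \<le> c" .
  qed (use assms in auto)
qed

text \<open>Along a coinitial sequence of T both the outer weight and the inner head increase to
  their limits; the product of the two suprema is reduced to one supremum through the index
  \<open>max m n\<close>.\<close>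

lemma KQ_le_tails:
  assumes [measurable]: "v \<in> BM" "u \<in> BM" and rq: "0 < r" "0 < q"
    and T: "\<And>x. x \<in> space M \<Longrightarrow> x \<notin> T \<Longrightarrow> u x = 0" "\<And>x. x \<in> space M \<Longrightarrow> x \<notin> T \<Longrightarrow> v x = 0"
    and le: "\<And>t. t \<in> T \<Longrightarrow> t \<in> space M \<Longrightarrow>
        KQ r q (cut {t..} u) (cut {t..} v) \<le> c"
  shows "KQ r q u v \<le> c"
proof (rule KQ_least)
  fix f assume f [measurable]: "f \<in> BM" "(\<I> x. f x) \<le> 1"
  show "(LQ r q u v f) \<le> c"
  proof (cases "T \<inter> space M = {}")
    case True
    then have "(LQ r q u v f) = (\<I> t. 0)"
      using T(1) by (intro nn_integral_cong) (metis disjoint_iff mult_zero_right)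
    then show ?thesis by simp
  next
    case False
    obtain x where x: "\<And>n. x n \<in> T \<inter> space M" "decseq x" "\<And>y. y \<in> T \<inter> space M \<Longrightarrow> \<exists>n. x n \<le> y"
      using coinitial_sequence[OF False] by blast
    have ind: "ind {x m..} s \<le> (ind {x n..} s)" if "m \<le> n" for m n s
      using decseqD[OF x(2) that] by (auto simp: indicator_def)
    let ?h = "\<lambda>n. head (\<lambda>s. f s powe r * (v s * ind {x n..} s))"
    have SUP: "g s = (SUP n. g s * ind {x n..} s)" if sM: "s \<in> space M" "s \<notin> T \<Longrightarrow> g s = 0" for s and g :: "real \<Rightarrow> ennreal"
    proof (rule antisym)
      show "g s \<le> (SUP n. g s * ind {x n..} s)"
      proof (cases "s \<in> T")
        case True
        then obtain n where "x n \<le> s" using x(3) sM(1) by blast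
        then show ?thesis by (intro SUP_upper2[of n]) auto
      qed (use sM in simp)
    qed (auto intro!: SUP_least simp: indicator_def)
    have hS: "head (pw f r v) t = (SUP n. ?h n t)" for t
    proof -
      have "head (pw f r v) t = (\<I> s. (SUP n. (f s powe r * v s * ind {..<t} s) * ind {x n..} s))"
        unfolding head_def using T(2) by (intro nn_integral_cong SUP) auto
      also have "... = (SUP n. mass {x n..} (\<lambda>s. (f s powe r * v s * ind {..<t} s)))"
        by (intro nn_integral_monotone_convergence_SUP incseq_SucI le_funI mult_left_mono ind) auto
      finally show ?thesis by (simp add: head_def mult_ac)
    qed
    have hm: "?h m t \<le> ?h n t" if "m \<le> n" for m n t
      using that by (intro head_mono_fun mult_left_mono ind) auto
    have "(LQ r q u v f)
        \<le> (\<I> t. (SUP n. ?h n t powe (q / r) * (u t * ind {x n..} t)))"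
    proof (rule nn_integral_mono)
      fix t assume t: "t \<in> space M"
      have "head (pw f r v) t powe (q / r) * u t = (SUP n. ?h n t powe (q / r)) * (SUP n. u t * ind {x n..} t)"
        using rq T(1) t by (subst SUP[of t u]) (auto simp: hS powe_SUP)
      also have "... \<le> (SUP n. ?h n t powe (q / r) * (u t * ind {x n..} t))"
        unfolding SUP_mult_right_ennreal SUP_mult_left_ennreal
      proof (intro SUP_least)
        fix m n
        have "?h m t powe (q / r) * (u t * ind {x n..} t)
            \<le> ?h (max m n) t powe (q / r) * (u t * ind {x (max m n)..} t)"
          using rq by (intro mult_mono powe_mono hm ind) auto
        also have "... \<le> (SUP n. ?h n t powe (q / r) * (u t * ind {x n..} t))" by (rule SUP_upper) simp
        finally show "?h m t powe (q / r) * (u t * ind {x n..} t) \<le> (SUP n. ?h n t powe (q / r) * (u t * ind {x n..} t))" .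
      qed
      finally show "head (pw f r v) t powe (q / r) * u t \<le> (SUP n. ?h n t powe (q / r) * (u t * ind {x n..} t))" .
    qed
    also have "... = (SUP n. \<I> t. ?h n t powe (q / r) * (u t * ind {x n..} t))"
      using rq by (intro nn_integral_monotone_convergence_SUP incseq_SucI le_funI mult_mono powe_mono hm ind) auto
    also have "... \<le> c"
    proof (rule SUP_least)
      fix n
      show "(\<I> t. ?h n t powe (q / r) * (u t * ind {x n..} t)) \<le> c"
        using KQ_ge[OF f] x(1)[of n] by (intro order_trans[OF _ le[of "x n"]]) auto
    qed
    finally show ?thesis .
  qed
qed

lemma VR_zsum:
  assumes [measurable]: "v \<in> BM" "h \<in> M \<rightarrow>\<^sub>M count_space UNIV"
  shows "VR r v \<le> zsum (\<lambda>j. VR r (\<lambda>s. v s * ind {j} (h s)))"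
proof (rule VR_least)
  fix f assume f [measurable]: "f \<in> BM" "(\<I> x. f x) \<le> 1"
  have "(\<I> x. f x powe r * v x) = zsum (\<lambda>j. \<I> x. f x powe r * (v x * ind {j} (h x)))"
    by (subst nn_integral_levels[of _ _ h]) (auto simp: mult.assoc)
  also have "... \<le> zsum (\<lambda>j. VR r (\<lambda>s. v s * ind {j} (h s)))" by (intro zsum_mono VR_ge f)
  finally show "(\<I> x. f x powe r * v x) \<le> zsum (\<lambda>j. VR r (\<lambda>s. v s * ind {j} (h s)))" .
qed

text \<open>Beyond t the head of f is at least its value at t, so the integral over {t..} alone
  gives the product.\<close>

lemma tail_VR_le_KQ:
  assumes [measurable]: "v \<in> BM" "u \<in> BM" and rq: "0 < r" "0 < q"
  shows "tail u t * VR r (cut {..<t} v) powe (q / r) \<le> KQ r q u v"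
proof -
  let ?F = "{f \<in> BM. (\<I> x. f x) \<le> 1}"
  have ne: "?F \<noteq> {}" by (auto intro!: exI[of _ "\<lambda>_. 0"])
  have "tail u t * VR r (cut {..<t} v) powe (q / r) =
      (SUP f\<in>?F. tail u t * (\<I> x. f x powe r * (v x * ind {..<t} x)) powe (q / r))"
    unfolding VR_def using rq ne by (subst powe_SUP) (auto simp: SUP_mult_left_ennreal)
  also have "... \<le> KQ r q u v"
  proof (rule SUP_least)
    fix f assume "f \<in> ?F"
    then have f [measurable]: "f \<in> BM" "(\<I> x. f x) \<le> 1" by auto
    have "tail u t * head (pw f r v) t powe (q / r) =
        (\<I> x. head (pw f r v) t powe (q / r) * (u x * ind {t..} x))"
      unfolding tail_def by (subst nn_integral_cmult) (auto simp: mult.commute)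
    also have "... \<le> (LQ r q u v f)"
      using rq by (intro nn_integral_mono) (auto simp: indicator_def intro!: mult_right_mono powe_mono head_mono)
    also have "... \<le> KQ r q u v" by (rule KQ_ge[OF f])
    finally show "tail u t * (\<I> x. f x powe r * (v x * ind {..<t} x)) powe (q / r) \<le> KQ r q u v"
      by (simp add: head_def mult_ac)
  qed
  finally show ?thesis .
qed

section \<open>Explicit form of the local constant\<close>

lemma VR_below_mono: "mono (\<lambda>t. VR r (cut {..<t} v))"
  by (intro monoI VR_mono mult_left_mono) (auto simp: indicator_def)

lemma VR_below_measurable [measurable]: "(\<lambda>t. VR r (cut {..<t} v)) \<in> BM"
  by (rule mono_measurable[OF VR_below_mono])

text \<open>The classical expressions for the Hardy constant with p = 1: an integral for q < 1, a
  supremum for q >= 1. The outer exponent 1 - q makes it homogeneous of degree 1 in u, as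
  \<open>KQ\<close> is.\<close>

definition AQ :: "real \<Rightarrow> real \<Rightarrow> (real \<Rightarrow> ennreal) \<Rightarrow> (real \<Rightarrow> ennreal) \<Rightarrow> ennreal" where
  "AQ r q u v =
     (if q < 1 then (\<I> t. tail u t powe (q / (1 - q)) *
         VR r (cut {..<t} v) powe (q / r / (1 - q)) * u t) powe (1 - q)
      else (SUP t\<in>space M. tail u t * VR r (cut {..<t} v) powe (q / r)))"

lemma emeasure_image_density:
  assumes "g \<in> BM" "h \<in> BM" "B \<in> sets borel"
  shows "emeasure (distr (density M g) borel h) B = (\<I> s. g s * ind B (h s))"
proof -
  have "h -` B \<inter> space M \<in> sets M" using assms by (auto intro: measurable_sets)
  then have "emeasure (density M g) (h -` B \<inter> space M) = (\<I> s. g s * ind (h -` B \<inter> space M) s)"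
    using assms by (simp add: emeasure_density)
  also have "... = (\<I> s. g s * ind B (h s))" by (intro nn_integral_cong) (auto simp: indicator_def)
  finally show ?thesis using assms by (simp add: emeasure_distr)
qed

text \<open>The Hardy inequalities for measures with \<rho> t = t, c = r and g = q/r, so that cg = q
  decides the case. E is f dx, and the block hypothesis is the definition of \<open>VR\<close>
  applied to f restricted to B.\<close>

lemma KQ_le_AQ:
  assumes meas [measurable]: "v \<in> BM" "u \<in> BM" and rq: "0 < r" "0 < q"
  shows "KQ r q u v \<le> dyad (2 * (q / r) + q + 2) * AQ r q u v"
proof (cases "AQ r q u v = top")
  case True
  then show ?thesis by (simp add: ennreal_mult_top)
next
  case False
  let ?Y = "\<lambda>t. VR r (cut {..<t} v)"
  show ?thesis
  proof (rule KQ_least)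
    fix f assume f [measurable]: "f \<in> BM" and f1: "(\<I> x. f x) \<le> 1"
    let ?\<nu> = "distr (density M (pw f r v)) borel (\<lambda>x. x)"
    let ?E = "distr (density M f) borel (\<lambda>x. x)"
    have \<nu>B: "emeasure ?\<nu> B = mass B (pw f r v)" if "B \<in> sets borel" for B
      using that by (subst emeasure_image_density) auto
    have EB: "emeasure ?E B = mass B f" if "B \<in> sets borel" for B
      using that by (subst emeasure_image_density) auto
    have E1: "emeasure ?E UNIV \<le> 1" using f1 by (simp add: EB)
    have block: "emeasure ?\<nu> B \<le> ?Y t * emeasure ?E B powe r" if B: "B \<in> sets borel" "B \<subseteq> {..<t}" for t B
    proof -
      have [measurable]: "(\<lambda>s. ind B s) \<in> BM" by (rule indicator_borel) fact
      have "emeasure ?\<nu> B = (\<I> s. (f s * ind B s) powe r * (v s * ind {..<t} s))"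
        unfolding \<nu>B[OF B(1)] using B rq by (intro nn_integral_cong) (auto simp: indicator_def)
      also have "... \<le> ?Y t * mass B f powe r"
      proof (rule VR_upper)
        have "mass B f \<le> (\<I> s. f s)" by (intro nn_integral_mono) (auto simp: indicator_def)
        then show "mass B f < top" using f1 by (auto intro: le_less_trans order_trans)
      qed (use rq in auto)
      finally show ?thesis by (simp add: EB[OF B(1)])
    qed
    have lhs: "(LQ r q u v f) =
        (\<I> t. emeasure ?\<nu> {..<t} powe (q / r) * u t)" by (simp add: \<nu>B head_def)
    have E_le: "emeasure ?E UNIV powe x \<le> 1" if "0 < x" for x
      using E1 that powe_mono[of "emeasure ?E UNIV" 1 x] by simp
    have Efin: "emeasure ?E UNIV < top" using E1 by (auto intro: le_less_trans)
    show "(LQ r q u v f) \<le> dyad (2 * (q / r) + q + 2) * AQ r q u v"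
    proof (cases "q < 1")
      case True
      define X where "X = (\<I> t. tail u t powe (q / (1 - q)) * ?Y t powe (q / r / (1 - q)) * u t)"
      have AX: "AQ r q u v = X powe (1 - q)" using True by (simp add: AQ_def X_def)
      then have "X < top" using False True by (simp add: powe_eq_top_iff less_top)
      then have "(\<I> t. emeasure ?\<nu> {..<t} powe (q / r) * u t)
        \<le> dyad (2 * (q / r) + r * (q / r) + 2) * (X powe (1 - r * (q / r)) * emeasure ?E UNIV powe (r * (q / r)))"
        using rq True Efin
        by (intro hardy_upper_less[where Y = ?Y and k = "q / (1 - q)" and m = "q / r / (1 - q)"] block)
           (auto simp: X_def)
      also have "... \<le> dyad (2 * (q / r) + q + 2) * (X powe (1 - q) * 1)"
        using rq mult_left_mono[OF E_le[OF rq(2)], of "X powe (1 - q)"] by (auto intro!: mult_left_mono)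
      finally show ?thesis using lhs AX by simp
    next
      case q1: False
      have "AQ r q u v = (SUP t\<in>space M. tail u t * ?Y t powe (q / r))" using q1 by (simp add: AQ_def)
      then have "tail u t * ?Y t powe (q / r) \<le> AQ r q u v" if "t \<in> space M" for t
        using that by (auto intro: SUP_upper)
      then have "(\<I> t. emeasure ?\<nu> {..<t} powe (q / r) * u t)
          \<le> dyad (2 * (q / r) + r * (q / r)) * (AQ r q u v * emeasure ?E UNIV powe (r * (q / r)))"
        using rq q1 False Efin by (intro hardy_upper_le[where Y = ?Y] block) (auto simp: less_top)
      also have "... \<le> dyad (2 * (q / r) + q + 2) * (AQ r q u v * 1)"
        using rq E_le[OF rq(2)] by (intro mult_mono) auto
      finally show ?thesis using lhs by simp
    qed
  qed
qed

definition c_local :: "real \<Rightarrow> real \<Rightarrow> ennreal" where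
  "c_local r q = (if q < 1 then c_lower 1 q (q / r / (1 - q)) powe (1 - q) * dyad (q / r) else 1)"

text \<open>For q < 1 this is \<open>hardy_lower\<close> with p = 1, N the integral, S t the value
  of \<open>VR\<close> left of t and e = 1/r; almost extremal functions of \<open>VR\<close> serve
  as test functions. KQ = 0 is separate: with 0 * top = 0 the inequality fed into
  \<open>hardy_lower\<close> would claim too much for f of infinite integral.\<close>

lemma AQ_le_KQ:
  assumes meas [measurable]: "v \<in> BM" "u \<in> BM" and rq: "0 < r" "0 < q"
  shows "AQ r q u v \<le> c_local r q * KQ r q u v"
proof (cases "q < 1")
  case False
  then show ?thesis using tail_VR_le_KQ[OF meas rq] by (auto simp: AQ_def c_local_def intro!: SUP_least)
next
  case True
  let ?Y = "\<lambda>t. VR r (cut {..<t} v)"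
  let ?X = "\<I> t. tail u t powe (q / (1 - q)) * ?Y t powe (q / r / (1 - q)) * u t"
  have cl: "c_local r q \<noteq> 0" using True rq c_lower_pos[of q 1] by (simp add: c_local_def powe_eq_0_iff)
  have AX: "AQ r q u v = ?X powe (1 - q)" using True by (simp add: AQ_def)
  consider "KQ r q u v = 0" | "KQ r q u v = top" | "KQ r q u v \<noteq> 0" "KQ r q u v < top"
    by (metis less_top)
  then show ?thesis
  proof cases
    case 1
    have z: "tail u t = 0 \<or> ?Y t powe (q / r) = 0" for t using tail_VR_le_KQ[OF meas rq, of t] 1 by simp
    have "tail u t powe (q / (1 - q)) * ?Y t powe (q / r / (1 - q)) * u t = 0" for t
      using z[of t] rq True by (auto simp: powe_eq_0_iff)
    then have "?X = (\<I> t. 0)" by (simp only:)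
    then show ?thesis using True by (simp add: AX)
  next
    case 2
    then show ?thesis using cl by (simp add: ennreal_mult_top)
  next
    case 3
    have "?X \<le> c_lower 1 q (1 / r * (1 * q / (1 - q))) *
        (KQ r q u v * 1 powe (q / 1) / dyad (- 1) powe (q / r)) powe (1 / (1 - q))"
    proof -
      have e: "1 / r * (1 * q / (1 - q)) = q / r / (1 - q)" by simp
      have "(\<I> t. tail u t powe (q / (1 - q)) * ?Y t powe (1 / r * (1 * q / (1 - q))) * u t) \<le>
        c_lower 1 q (1 / r * (1 * q / (1 - q))) *
        (KQ r q u v * 1 powe (q / 1) / dyad (- 1) powe (q / r)) powe (1 / (1 - q))"
      proof (rule hardy_lower[where N = "\<lambda>f. \<I> x. f x", OF meas(2,1) VR_below_measurable monoD[OF VR_below_mono] rq(2) True rq(1)])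
        fix f :: "real \<Rightarrow> ennreal" assume f: "f \<in> BM"
        show "(LQ r q u v f) \<le> KQ r q u v * (\<I> x. f x) powe (q / 1)"
        proof (cases "(\<I> x. f x) = top")
          case True
          then show ?thesis using 3 rq by (simp add: ennreal_mult_top)
        next
          case False
          then show ?thesis using KQ_upper[OF f rq _ meas] by (simp add: less_top)
        qed
      next
        fix t assume "?Y t = top"
        then show "tail u t = 0"
          using tail_VR_le_KQ[OF meas rq, of t] 3 rq by (auto simp: ennreal_mult_top top_unique split: if_splits)
      next
        fix J :: "int set" and \<tau>
        assume J: "finite J" and tau: "\<And>i. i \<in> J \<Longrightarrow> \<tau> i \<in> space M \<and> dyad (of_int i) \<le> ?Y (\<tau> i) \<and> ?Y (\<tau> i) < dyad (of_int i + 1)"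
        have "\<exists>f. f \<in> BM \<and> (\<I> x. f x) \<le> 1 \<and> dyad (of_int i - 1) < (\<I> x. f x powe r * (v x * ind {..<\<tau> i} x))"
          if "i \<in> J" for i
        proof -
          have "dyad (of_int i - 1) < dyad (of_int i)" by simp
          also have "... \<le> ?Y (\<tau> i)" using tau that by blast
          finally show ?thesis using VR_obtain by metis
        qed
        then obtain F where F: "\<And>i. i \<in> J \<Longrightarrow> F i \<in> BM" "\<And>i. i \<in> J \<Longrightarrow> (\<I> x. F i x) \<le> 1"
          "\<And>i. i \<in> J \<Longrightarrow> dyad (of_int i - 1) < head (pw (F i) r v) (\<tau> i)"
          unfolding head_def mult.assoc by metis
        have "dyad (- 1) * dyad (of_int i * (1 / r) * r) \<le> head (pw (F i) r v) t" if "i \<in> J" "\<tau> i \<le> t" for i t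
        proof -
          have "dyad (- 1) * dyad (of_int i * (1 / r) * r) = dyad (of_int i - 1)"
            using rq by (simp add: dyad_add[symmetric])
          also have "... \<le> head (pw (F i) r v) (\<tau> i)" using F(3)[OF that(1)] by simp
          also have "... \<le> head (pw (F i) r v) t" by (rule head_mono) fact
          finally show ?thesis .
        qed
        moreover have "(\<I> x. (\<Sum>i\<in>J. z i * F i x)) \<le> 1 * (\<Sum>i\<in>J. z i powe 1)" for z :: "int \<Rightarrow> ennreal"
        proof -
          have "(\<I> x. (\<Sum>i\<in>J. z i * F i x)) = (\<Sum>i\<in>J. z i * (\<I> x. F i x))"
            using F(1) by (subst nn_integral_sum) (auto simp: nn_integral_cmult)
          also have "... \<le> (\<Sum>i\<in>J. z i * 1)" by (intro sum_mono mult_left_mono F) auto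
          finally show ?thesis by simp
        qed
        ultimately show "\<exists>F :: int \<Rightarrow> real \<Rightarrow> ennreal. (\<forall>i\<in>J. F i \<in> BM \<and>
            (\<forall>t\<in>space M. \<tau> i \<le> t \<longrightarrow> dyad (- 1) * dyad (of_int i * (1 / r) * r) \<le> head (pw (F i) r v) t)) \<and>
          (\<forall>z. (\<I> x. (\<Sum>i\<in>J. z i * F i x)) \<le> 1 * (\<Sum>i\<in>J. z i powe 1))"
          using F(1) by (intro exI[of _ F]) blast
      qed (use 3 rq in auto)
      then show ?thesis by (simp only: e)
    qed
    also have "KQ r q u v * 1 powe (q / 1) / dyad (- 1) powe (q / r) = dyad (q / r) * KQ r q u v"
    proof -
      have "dyad (q / r) * KQ r q u v * dyad (- (q / r)) = (dyad (q / r) * dyad (- (q / r))) * KQ r q u v"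
        by (simp only: mult_ac)
      then have "KQ r q u v / dyad (- (q / r)) = dyad (q / r) * KQ r q u v * dyad (- (q / r)) / dyad (- (q / r))"
        by (simp only: dyad_minus mult_1)
      also have "... = dyad (q / r) * KQ r q u v" by (subst ennreal_mult_divide_eq) auto
      finally show ?thesis by (simp add: dyad_powe)
    qed
    finally have "AQ r q u v \<le> (c_lower 1 q (1 / r * (1 * q / (1 - q))) * (dyad (q / r) * KQ r q u v) powe (1 / (1 - q))) powe (1 - q)"
      unfolding AX using True by (intro powe_mono) auto
    also have "... = c_local r q * KQ r q u v"
      using True by (simp add: powe_mult powe_powe c_local_def mult.assoc)
    finally show ?thesis .
  qed
qed

end

section \<open>Necessity\<close>

lemma ennreal_le_divideI:
  fixes a x y :: ennreal
  assumes "a * x \<le> y" "a \<noteq> 0" "y < top" shows "x \<le> y / a"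
proof (cases "a = top")
  case True
  then have "x = 0" using assms by (auto simp: ennreal_top_mult top_unique split: if_splits)
  then show ?thesis by simp
next
  case False
  have "a * x / a \<le> y / a" using assms(1) by (rule divide_right_mono_ennreal)
  then show ?thesis using assms(2) False by (simp add: mult.commute[of a] ennreal_mult_divide_eq)
qed

lemma ennreal_times_divide_le: "a * (y / a) \<le> (y :: ennreal)"
proof (cases "a = 0 \<or> a = top")
  case False
  then show ?thesis by (simp add: ennreal_times_divide mult.commute[of a] ennreal_mult_divide_eq)
qed auto

locale hardy_setting = line_measure M for M :: "real measure" +
  fixes u v w :: "real \<Rightarrow> ennreal" and p q r :: real
  assumes uvw [measurable]: "u \<in> borel_measurable M" "v \<in> borel_measurable M" "w \<in> borel_measurable M"
    and pos: "0 < p" "0 < q" "0 < r" "r \<le> 1"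
    and W_pos: "\<And>x. x \<in> space M \<Longrightarrow> 0 < tail w x" and W_fin: "\<And>x. x \<in> space M \<Longrightarrow> tail w x < top"
begin

definition Lq :: "(real \<Rightarrow> ennreal) \<Rightarrow> ennreal" where
  "Lq f = (LQ r q u v f)"

definition Rp :: "(real \<Rightarrow> ennreal) \<Rightarrow> ennreal" where
  "Rp f = (\<I> t. head f t powe p * w t)"

text \<open>The inequality of the theorem raised to the power q, so D stands for C^q; in this form
  the left side is linear in u.\<close>

definition bounded_by :: "ennreal \<Rightarrow> bool" where
  "bounded_by D \<longleftrightarrow> (\<forall>f\<in>BM. Lq f \<le> D * Rp f powe (q / p))"

text \<open>A band function \<open>ka\<close> discretises \<open>W = \<integral>\<^bsub>x\<^esub>\<^bsup>b\<^esup> w\<close>: on \<open>{ka = k}\<close> the function \<open>W\<close> is comparable to \<open>2\<^sup>-\<^sup>k\<close>.\<close>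

definition band :: "(real \<Rightarrow> int) \<Rightarrow> bool" where
  "band ka \<longleftrightarrow> mono_on (space M) ka \<and>
     (\<forall>t\<in>space M. dyad (- of_int (ka t) - 2) \<le> tail w t \<and> tail w t \<le> dyad (- of_int (ka t)))"

abbreviation "KQ\<^sub>c A \<equiv> KQ r q (cut A u) (cut A v)"

abbreviation "AQ\<^sub>c A \<equiv> AQ r q (cut A u) (cut A v)"

lemma band_monoD: "band ka \<Longrightarrow> s \<in> space M \<Longrightarrow> t \<in> space M \<Longrightarrow> s \<le> t \<Longrightarrow> ka s \<le> ka t"
  by (auto simp: band_def mono_on_def)

lemma band_ge: "band ka \<Longrightarrow> t \<in> space M \<Longrightarrow> dyad (- of_int (ka t) - 2) \<le> tail w t" by (auto simp: band_def)

lemma band_le: "band ka \<Longrightarrow> t \<in> space M \<Longrightarrow> tail w t \<le> dyad (- of_int (ka t))" by (auto simp: band_def)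

lemma mono_int_measurable:
  fixes ka :: "real \<Rightarrow> int"
  assumes "\<And>s t. s \<in> space M \<Longrightarrow> t \<in> space M \<Longrightarrow> s \<le> t \<Longrightarrow> ka s \<le> ka t"
  shows "ka \<in> M \<rightarrow>\<^sub>M count_space UNIV"
proof -
  have le: "{t \<in> space M. ka t \<le> k} \<in> sets M" for k
  proof -
    let ?D = "{y. \<exists>t\<in>space M. ka t \<le> k \<and> y \<le> t}"
    have "is_interval ?D" unfolding is_interval_1 by (auto intro: order_trans)
    then have "?D \<in> sets borel" by (rule real_interval_borel_measurable)
    then have "(\<lambda>x. x) -` ?D \<inter> space M \<in> sets M" by (rule measurable_sets[OF id_measurable])
    also have "(\<lambda>x. x) -` ?D \<inter> space M = {t \<in> space M. ka t \<le> k}"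
      using assms by (auto intro: order_trans)
    finally show ?thesis .
  qed
  have "ka -` {k} \<inter> space M \<in> sets M" for k
  proof -
    have "ka -` {k} \<inter> space M = {t \<in> space M. ka t \<le> k} - {t \<in> space M. ka t \<le> k - 1}" by auto
    also have "... \<in> sets M" by (intro sets.Diff le)
    finally show ?thesis .
  qed
  then show ?thesis by (intro measurable_count_space_eq2_countable[THEN iffD2]) auto
qed

lemma band_measurable: "band ka \<Longrightarrow> ka \<in> M \<rightarrow>\<^sub>M count_space UNIV"
  by (rule mono_int_measurable) (rule band_monoD)

lemma band_set: "band ka \<Longrightarrow> (\<lambda>x. ind {t. P (ka t)} x) \<in> BM"
  using measurable_compose[OF band_measurable, of ka "\<lambda>k. ind {k. P k} k :: ennreal" borel]
  by (simp add: indicator_def)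

lemma level_set: "band ka \<Longrightarrow> (\<lambda>x. ind {t. ka t = j} x) \<in> BM" by (rule band_set)

lemma zsum_bands:
  assumes "band ka" "g \<in> BM"
  shows "(\<I> x. g x) = zsum (\<lambda>k. mass {t. ka t = k} g)"
  using nn_integral_levels[OF assms(2) band_measurable[OF assms(1)]] by (simp add: indicator_def)

lemma band_mass:
  assumes k: "band ka"
  shows "mass {t. ka t \<ge> k} w \<le> dyad (- of_int k)"
proof (rule le_of_tails[where T = "{t. k \<le> ka t}"])
  fix t assume t: "t \<in> {t. k \<le> ka t}" "t \<in> space M"
  have "tail (cut {t. ka t \<ge> k} w) t \<le> tail w t" by (rule tail_mono_fun) (auto simp: indicator_def)
  also have "... \<le> dyad (- of_int (ka t))" using band_le[OF k t(2)] .
  also have "... \<le> dyad (- of_int k)" using t by simp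
  finally show "tail (cut {t. ka t \<ge> k} w) t \<le> dyad (- of_int k)" .
qed (use band_set[OF k, of "\<lambda>x. k \<le> x"] in auto)

lemma band_mass_eq:
  assumes k: "band ka"
  shows "mass {t. ka t = k} w \<le> dyad (- of_int k)"
  by (rule order_trans[OF nn_integral_mono band_mass[OF k, of k]]) (auto simp: indicator_def)

lemma band_integral_le:
  assumes k: "band ka"
  shows "(\<I> t. w t * Z (ka t)) \<le> zsum (\<lambda>k. Z k * dyad (- of_int k))"
proof -
  have m: "(\<lambda>t. Z (ka t)) \<in> BM" by (rule measurable_compose[OF band_measurable[OF k]]) simp
  have "(\<I> t. w t * Z (ka t)) = zsum (\<lambda>k. mass {t. ka t = k} (\<lambda>t. w t * Z (ka t)))"
    using m by (intro zsum_bands[OF k]) auto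
  also have "... = zsum (\<lambda>k. \<I> t. Z k * (w t * ind {t. ka t = k} t))"
    by (intro nn_integral_cong) (auto simp: indicator_def mult.commute)
  also have "... = zsum (\<lambda>k. Z k * mass {t. ka t = k} w)"
    using band_set[OF k] by (intro nn_integral_cong nn_integral_cmult) auto
  also have "... \<le> zsum (\<lambda>k. Z k * dyad (- of_int k))"
    by (intro zsum_mono mult_left_mono band_mass_eq[OF k]) auto
  finally show ?thesis .
qed

text \<open>A band has w-mass at most 2^(-k) and the bound for F is constant on bands, so the
  integral is dominated by a weighted sum of p-th powers of partial sums:
  \<open>geometric_hardy\<close> with d = 1.\<close>

lemma Rp_upper_steps:
  assumes k: "band ka" and le: "\<And>t. t \<in> space M \<Longrightarrow> head f t \<le> zsum (cut {..ka t} z)"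
  shows "Rp f \<le> c_hardy p 1 * zsum (\<lambda>j. dyad (- of_int j) * z j powe p)"
proof -
  let ?Z = "\<lambda>k. zsum (cut {..k} z) powe p"
  have "Rp f \<le> (\<I> t. w t * ?Z (ka t))"
    unfolding Rp_def mult.commute[of _ "w _"] using pos le by (intro nn_integral_mono mult_left_mono powe_mono) auto
  also have "... \<le> zsum (\<lambda>k. ?Z k * dyad (- of_int k))" by (rule band_integral_le[OF k])
  also have "... \<le> c_hardy p 1 * zsum (\<lambda>j. dyad (- of_int j) * z j powe p)"
    using geometric_hardy[of p 1 z] pos by (simp add: mult.commute)
  finally show ?thesis .
qed

lemma Rp_upper:
  assumes k: "band ka" and [measurable]: "f \<in> BM"
  shows "Rp f \<le> c_hardy p 1 * zsum (\<lambda>j. dyad (- of_int j) * mass {t. ka t = j} f powe p)"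
proof (rule Rp_upper_steps[OF k])
  fix t assume t: "t \<in> space M"
  have "head f t = zsum (\<lambda>j. mass {t. ka t = j} (cut {..<t} f))"
    unfolding head_def by (rule zsum_bands[OF k]) measurable
  also have "... \<le> zsum (\<lambda>j. (mass {t. ka t = j} f) * ind {..ka t} j)"
  proof (rule zsum_mono)
    fix j
    show "mass {t. ka t = j} (cut {..<t} f)
      \<le> mass {t. ka t = j} f * ind {..ka t} j"
    proof (cases "j \<le> ka t")
      case True
      then show ?thesis by (auto intro!: nn_integral_mono simp: indicator_def)
    next
      case False
      then have "mass {t. ka t = j} (cut {..<t} f) = (\<I> x. 0)"
        using band_monoD[OF k _ t] by (intro nn_integral_cong) (force simp: indicator_def)
      then show ?thesis by simp
    qed
  qed
  finally show "head f t \<le> zsum (\<lambda>j. (mass {t. ka t = j} f) * ind {..ka t} j)" .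
qed

lemma tail_head_le_Lq:
  "tail u t * head (pw f r v) t powe (q / r) \<le> Lq f"
proof -
  have "tail u t * head (pw f r v) t powe (q / r) =
      (\<I> x. head (pw f r v) t powe (q / r) * (u x * ind {t..} x))"
    unfolding tail_def by (subst nn_integral_cmult) (auto simp: mult.commute)
  also have "... \<le> Lq f" unfolding Lq_def
    using pos by (intro nn_integral_mono) (auto simp: indicator_def intro!: mult_right_mono powe_mono head_mono)
  finally show ?thesis .
qed

text \<open>Functions of total mass at most 1 living in the upper set A have F <= 1 on A and F = 0
  before it, so their \<open>Rp\<close> is at most the w-mass of A. Used with A = {x..} and with A
  the union of the bands from j on.\<close>

lemma KQ_cut_le:
  assumes D: "bounded_by D"
    and up: "\<And>s t. s \<in> A \<Longrightarrow> s \<in> space M \<Longrightarrow> t \<in> space M \<Longrightarrow> s \<le> t \<Longrightarrow> t \<in> A"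
    and A [measurable]: "(\<lambda>x. ind A x) \<in> BM"
  shows "KQ\<^sub>c A \<le> D * mass A w powe (q / p)"
proof (rule KQ_least)
  fix f assume f [measurable]: "f \<in> BM" and f1: "(\<I> x. f x) \<le> 1"
  let ?g = "cut A f"
  have "(\<I> t. head (\<lambda>s. f s powe r * cut A v s) t powe (q / r) * cut A u t) \<le> Lq ?g" unfolding Lq_def
  proof (intro nn_integral_mono mult_mono powe_mono)
    show "head (\<lambda>s. f s powe r * cut A v s) t \<le> head (pw ?g r v) t" for t
      by (rule head_mono_fun) (auto simp: indicator_def)
  qed (use pos in \<open>auto simp: indicator_def\<close>)
  also have "Lq ?g \<le> D * Rp ?g powe (q / p)" using D by (simp add: bounded_by_def)
  also have "Rp ?g \<le> mass A w" unfolding Rp_def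
  proof (rule nn_integral_mono)
    fix t assume t: "t \<in> space M"
    show "head ?g t powe p * w t \<le> w t * ind A t"
    proof (cases "t \<in> A")
      case True
      have "head ?g t \<le> (\<I> x. f x)"
        unfolding head_def by (intro nn_integral_mono) (auto simp: indicator_def)
      then have "head ?g t powe p \<le> 1 powe p" using pos f1 by (intro powe_mono) auto
      then show ?thesis using True mult_right_mono[of "head ?g t powe p" 1 "w t"] by simp
    next
      case False
      then have "head ?g t = (\<I> x. 0)"
        unfolding head_def using up t by (intro nn_integral_cong) (force simp: indicator_def)
      then show ?thesis using pos by simp
    qed
  qed
  then have "D * Rp ?g powe (q / p) \<le> D * mass A w powe (q / p)"
    using pos by (intro mult_left_mono powe_mono) auto
  finally show "(\<I> t. head (\<lambda>s. f s powe r * cut A v s) t powe (q / r) * cut A u t)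
     \<le> D * mass A w powe (q / p)" .
qed

lemma tail_VR_cut_le:
  assumes t: "t \<in> space M"
    and up: "\<And>s t. s \<in> A \<Longrightarrow> s \<in> space M \<Longrightarrow> t \<in> space M \<Longrightarrow> s \<le> t \<Longrightarrow> t \<in> A"
    and A [measurable]: "(\<lambda>x. ind A x) \<in> BM"
  shows "tail u t * VR r (cut {..<t} (cut A v)) powe (q / r) \<le> KQ\<^sub>c A"
proof (cases "t \<in> A")
  case True
  then have "tail u t = tail (cut A u) t"
    unfolding tail_def using up t by (intro nn_integral_cong) (force simp: indicator_def)
  then show ?thesis using tail_VR_le_KQ[of "cut A v" "cut A u" r q t] pos by simp
next
  case False
  have "VR r (cut {..<t} (cut A v)) \<le> 0"
  proof (rule VR_least)
    fix f :: "real \<Rightarrow> ennreal"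
    have "(\<I> x. f x powe r * cut {..<t} (cut A v) x) = (\<I> x. 0)"
      using up t False by (intro nn_integral_cong) (force simp: indicator_def)
    then show "(\<I> x. f x powe r * cut {..<t} (cut A v) x) \<le> 0" by simp
  qed
  then show ?thesis using pos by simp
qed

text \<open>1/\<theta> = 1/r - 1/p, the exponent by which Hoelder passes from l^p to l^r.\<close>

definition \<theta> :: real where "\<theta> = p * r / (p - r)"

text \<open>\<open>steps\<close> is the \<open>\<theta>\<close>-th power of the best constant for \<open>\<integral> f\<^sup>r v\<close> against \<open>\<integral> F\<^sup>p w\<close>, summed over the
  bands.\<close>

definition steps :: "(real \<Rightarrow> int) \<Rightarrow> (real \<Rightarrow> ennreal) \<Rightarrow> int \<Rightarrow> ennreal" where
  "steps ka g j = (dyad (of_int j * r / p) * VR r (cut {t. ka t = j} g)) powe (p / (p - r))"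

text \<open>Half of a supremum is attained if it is positive and finite; otherwise the zero function
  is taken, whence the finiteness condition in the last conclusion.\<close>

lemma obtain_band_functions:
  assumes k: "band ka" and [measurable]: "g \<in> BM"
  obtains h where "\<And>j. h j \<in> BM" "\<And>j x. ka x \<noteq> j \<Longrightarrow> h j x = 0" "\<And>j. (\<I> x. h j x) \<le> 1"
    "\<And>j. VR r (cut {t. ka t = j} g) < top \<Longrightarrow>
        VR r (cut {t. ka t = j} g) \<le> 2 * (\<I> x. h j x powe r * g x)"
proof -
  have "\<exists>h. h \<in> BM \<and> (\<forall>x. ka x \<noteq> j \<longrightarrow> h x = 0) \<and> (\<I> x. h x) \<le> 1 \<and>
    (VR r (cut {t. ka t = j} g) < top \<longrightarrow> VR r (cut {t. ka t = j} g) \<le> 2 * (\<I> x. h x powe r * g x))" for j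
  proof (cases "VR r (cut {t. ka t = j} g) = 0 \<or> VR r (cut {t. ka t = j} g) = top")
    case True
    then show ?thesis by (intro exI[of _ "\<lambda>_. 0"]) auto
  next
    case False
    let ?V = "VR r (cut {t. ka t = j} g)"
    have "?V / 2 < ?V"
    proof (rule ccontr)
      assume "\<not> ?thesis"
      then have "?V / 2 + ?V / 2 \<le> ?V / 2 + 0" by (simp add: ennreal_half_add)
      then have "?V / 2 \<le> 0"
        using False by (subst (asm) ennreal_add_left_cancel_le) (auto simp: ennreal_divide_eq_top_iff)
      then show False using False by (simp add: ennreal_divide_eq_0_iff)
    qed
    then obtain f where f [measurable]: "f \<in> BM" and f1: "(\<I> x. f x) \<le> 1"
      and fV: "?V / 2 < (\<I> x. f x powe r * cut {t. ka t = j} g x)" by (rule VR_obtain)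
    note [measurable] = level_set[OF k]
    let ?h = "cut {t. ka t = j} f"
    have "(\<I> x. ?h x powe r * g x) = (\<I> x. f x powe r * cut {t. ka t = j} g x)"
      using pos by (intro nn_integral_cong) (auto simp: indicator_def)
    then have "?V \<le> 2 * (\<I> x. ?h x powe r * g x)"
      using add_mono[OF less_imp_le[OF fV] less_imp_le[OF fV]] by (simp add: ennreal_half_add mult_2)
    moreover have "(\<I> x. ?h x) \<le> (\<I> x. f x)" by (intro nn_integral_mono) (auto simp: indicator_def)
    ultimately show ?thesis using f1 by (intro exI[of _ ?h]) (auto intro: order_trans)
  qed
  then have "\<forall>j. \<exists>h. h \<in> BM \<and> (\<forall>x. ka x \<noteq> j \<longrightarrow> h x = 0) \<and> (\<I> x. h x) \<le> 1 \<and>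
    (VR r (cut {t. ka t = j} g) < top \<longrightarrow> VR r (cut {t. ka t = j} g) \<le> 2 * (\<I> x. h x powe r * g x))"
    by blast
  from choice[OF this] obtain h where h: "\<forall>j. h j \<in> BM \<and> (\<forall>x. ka x \<noteq> j \<longrightarrow> h j x = 0) \<and> (\<I> x. h j x) \<le> 1 \<and>
    (VR r (cut {t. ka t = j} g) < top \<longrightarrow> VR r (cut {t. ka t = j} g) \<le> 2 * (\<I> x. h j x powe r * g x))"
    by blast
  show thesis by (rule that[of h]) (use h in blast)+
qed

text \<open>Test functions are sums of 2^(j/p) z_j h_j with h_j almost extremal for
  \<open>VR\<close> on band j. The factor 2^(j/p) makes \<open>Rp\<close> at most a multiple of the
  sum of the z_j^p, while the head at t collects z_j^r with the coefficients 2^(jr/p) V_j.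
  \<open>powe_dual_sum\<close> with r in place of q then yields the power p/(p - r).\<close>

lemma steps_bound:
  assumes k: "band ka" and D: "bounded_by D" "D < top" and rp: "r < p" and t: "t \<in> space M"
  shows "tail u t powe (\<theta> / q) * zsum (steps ka (cut {..<t} v))
    \<le> (2 * c_hardy p 1 powe (r / p)) powe (p / (p - r)) * D powe (\<theta> / q)"
proof (cases "tail u t = 0")
  case True
  then show ?thesis using rp pos by (simp add: \<theta>_def)
next
  case False
  have \<theta>: "0 < \<theta>" "\<theta> / q = r / q * (p / (p - r))" "0 < p / (p - r)" using rp pos by (auto simp: \<theta>_def mult.commute)
  let ?g = "cut {..<t} v"
  let ?V = "\<lambda>j. VR r (cut {t. ka t = j} ?g)"
  \<comment> \<open>Almost extremal h_j exist only for finite values. Testing on the bands from j on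
    bounds the tail of u at t times a power of this value, and that tail is positive here.\<close>
  have Vfin: "?V j < top" for j
  proof -
    let ?A = "{t. j \<le> ka t}"
    have [measurable]: "(\<lambda>x. ind ?A x) \<in> BM" by (rule band_set[OF k])
    have up: "s' \<in> ?A" if "s \<in> ?A" "s \<in> space M" "s' \<in> space M" "s \<le> s'" for s s'
      using band_monoD[OF k, of s s'] that by auto
    have "tail u t * VR r (cut {..<t} (cut ?A v)) powe (q / r) \<le> KQ\<^sub>c ?A"
      using up by (intro tail_VR_cut_le[OF t]) auto
    also have "... \<le> D * mass ?A w powe (q / p)" using up by (intro KQ_cut_le[OF D(1)]) auto
    also have "... \<le> D * dyad (- of_int j) powe (q / p)"
      using pos by (intro mult_left_mono powe_mono band_mass[OF k]) auto
    also have "... < top" using D(2) by (simp add: dyad_powe ennreal_mult_less_top)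
    finally have "VR r (cut {..<t} (cut ?A v)) powe (q / r) < top"
      using False by (auto simp: ennreal_mult_less_top)
    then have "VR r (cut {..<t} (cut ?A v)) < top" using pos by (simp add: powe_less_top_iff)
    moreover have "?V j \<le> VR r (cut {..<t} (cut ?A v))" by (rule VR_mono) (auto simp: indicator_def)
    ultimately show ?thesis by (rule le_less_trans[rotated])
  qed
  have gm: "?g \<in> BM" by measurable
  obtain h where h: "\<And>j. h j \<in> BM" "\<And>j x. ka x \<noteq> j \<Longrightarrow> h j x = 0"
      "\<And>j. (\<I> x. h j x) \<le> 1"
      and hV: "\<And>j. ?V j < top \<Longrightarrow> ?V j \<le> 2 * (\<I> x. h j x powe r * ?g x)"
    by (rule obtain_band_functions[OF k gm]) (rule that; assumption)
  note [measurable] = h(1)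
  let ?X = "2 * (D * c_hardy p 1 powe (q / p) / tail u t) powe (r / q)"
  have Dc: "D * c_hardy p 1 powe (q / p) < top"
    using D(2) c_hardy_finite[of p 1] pos by (simp add: ennreal_mult_less_top powe_less_top_iff)
  have Xfin: "?X < top"
  proof -
    have "D * c_hardy p 1 powe (q / p) / tail u t < top"
      using Dc False by (metis ennreal_divide_eq_top_iff less_top)
    then show ?thesis using pos by (simp add: ennreal_mult_less_top powe_less_top_iff)
  qed
  have key: "(\<Sum>j\<in>J. (dyad (of_int j * r / p) * ?V j) * z j powe r) \<le> ?X * (\<Sum>j\<in>J. z j powe p) powe (r / p)"
    if J: "finite J" and zfin: "\<And>i. z i < top" for J and z :: "int \<Rightarrow> ennreal"
  proof -
    let ?f = "\<lambda>x. \<Sum>j\<in>J. dyad (of_int j / p) * z j * h j x"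
    have fm [measurable]: "?f \<in> BM" by measurable
    note [measurable] = level_set[OF k]
    have fj: "?f x = dyad (of_int (ka x) / p) * z (ka x) * h (ka x) x" if "ka x \<in> J" for x
    proof -
      have "?f x = (\<Sum>j\<in>{ka x}. dyad (of_int j / p) * z j * h j x)"
        using that J h(2) by (intro sum.mono_neutral_right) auto
      then show ?thesis by simp
    qed
    have f0: "?f x = 0" if "ka x \<notin> J" for x
    proof (intro sum.neutral ballI)
      fix j assume "j \<in> J"
      then have "ka x \<noteq> j" using that by auto
      then show "dyad (of_int j / p) * z j * h j x = 0" using h(2) by simp
    qed
    have "(\<Sum>j\<in>J. (dyad (of_int j * r / p) * ?V j) * z j powe r)
        \<le> (\<Sum>j\<in>J. 2 * mass {t. ka t = j} (pw ?f r ?g))"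
    proof (rule sum_mono)
      fix j assume j: "j \<in> J"
      have "(dyad (of_int j * r / p) * ?V j) * z j powe r
          \<le> (dyad (of_int j * r / p) * (2 * (\<I> x. h j x powe r * ?g x))) * z j powe r"
        by (intro mult_right_mono mult_left_mono hV Vfin) auto
      also have "... = 2 * (\<I> x. dyad (of_int j * r / p) * z j powe r * (h j x powe r * ?g x))"
        by (subst nn_integral_cmult) (auto simp: mult_ac)
      also have "(\<I> x. dyad (of_int j * r / p) * z j powe r * (h j x powe r * ?g x)) =
          (mass {t. ka t = j} (pw ?f r ?g))"
      proof (rule nn_integral_cong)
        fix x
        show "dyad (of_int j * r / p) * z j powe r * (h j x powe r * ?g x) =
            ?f x powe r * ?g x * ind {t. ka t = j} x"
        proof (cases "ka x = j")
          case True
          then show ?thesis using fj[of x] j pos by (simp add: powe_mult dyad_powe mult_ac)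
        next
          case False
          then show ?thesis using h(2)[of x j] pos by simp
        qed
      qed
      finally show "(dyad (of_int j * r / p) * ?V j) * z j powe r
          \<le> 2 * mass {t. ka t = j} (pw ?f r ?g)" .
    qed
    also have "... \<le> 2 * head (pw ?f r v) t"
    proof -
      have "(\<Sum>j\<in>J. mass {t. ka t = j} (pw ?f r ?g))
          \<le> zsum (\<lambda>j. mass {t. ka t = j} (pw ?f r ?g))" by (rule sum_le_zsum[OF J])
      also have "... = (\<I> x. ?f x powe r * ?g x)" by (rule zsum_bands[OF k, symmetric]) measurable
      also have "... = head (pw ?f r v) t" by (simp add: head_def mult.assoc)
      finally show ?thesis unfolding sum_distrib_left[symmetric] by (rule mult_left_mono) simp
    qed
    finally have le: "(\<Sum>j\<in>J. (dyad (of_int j * r / p) * ?V j) * z j powe r) \<le> 2 * head (pw ?f r v) t" .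
    have fin: "(\<Sum>j\<in>J. z j powe p) < top" using zfin J pos by (simp add: powe_less_top_iff)
    have "head (pw ?f r v) t powe (q / r)
        \<le> D * (c_hardy p 1 * (\<Sum>j\<in>J. z j powe p)) powe (q / p) / tail u t"
    proof (rule ennreal_le_divideI[OF _ False])
      have "tail u t * head (pw ?f r v) t powe (q / r) \<le> Lq ?f" by (rule tail_head_le_Lq)
      also have "... \<le> D * Rp ?f powe (q / p)" using D by (auto simp: bounded_by_def)
      also have "Rp ?f \<le> c_hardy p 1 * zsum (\<lambda>j. dyad (- of_int j) * mass {t. ka t = j} ?f powe p)"
        by (rule Rp_upper[OF k]) measurable
      also have "zsum (\<lambda>j. dyad (- of_int j) * mass {t. ka t = j} ?f powe p)
          \<le> zsum (\<lambda>j. z j powe p * ind J j)"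
      proof (rule zsum_mono)
        fix j
        show "dyad (- of_int j) * mass {t. ka t = j} ?f powe p \<le> z j powe p * ind J j"
        proof (cases "j \<in> J")
          case True
          have "mass {t. ka t = j} ?f = (\<I> x. dyad (of_int j / p) * z j * h j x)"
            using fj True h(2) by (intro nn_integral_cong) (auto simp: indicator_def)
          also have "... = dyad (of_int j / p) * z j * (\<I> x. h j x)" by (rule nn_integral_cmult) measurable
          also have "... \<le> dyad (of_int j / p) * z j * 1" by (intro mult_left_mono h) auto
          finally have "mass {t. ka t = j} ?f powe p \<le> (dyad (of_int j / p) * z j) powe p"
            using pos by (intro powe_mono) auto
          also have "... = dyad (of_int j) * z j powe p" using pos by (simp add: powe_mult dyad_powe)
          finally have "dyad (- of_int j) * mass {t. ka t = j} ?f powe p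
              \<le> dyad (- of_int j) * (dyad (of_int j) * z j powe p)" by (rule mult_left_mono) simp
          then show ?thesis using True by (simp add: mult.assoc[symmetric] dyad_minus)
        next
          case False
          have "mass {t. ka t = j} ?f = (\<I> x. 0)"
            using f0 False by (intro nn_integral_cong) (auto simp: indicator_def)
          then show ?thesis using pos by simp
        qed
      qed
      also have "... = (\<Sum>j\<in>J. z j powe p)"
        using J by (subst nn_integral_count_space'[of J]) (auto simp: indicator_def intro!: sum.cong)
      finally show "tail u t * head (pw ?f r v) t powe (q / r)
          \<le> D * (c_hardy p 1 * (\<Sum>j\<in>J. z j powe p)) powe (q / p)"
        using pos by (simp add: mult_left_mono powe_mono)
      show "D * (c_hardy p 1 * (\<Sum>j\<in>J. z j powe p)) powe (q / p) < top"
        using D(2) fin c_hardy_finite[of p 1] pos by (simp add: ennreal_mult_less_top powe_less_top_iff)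
    qed
    also have "... = D * c_hardy p 1 powe (q / p) / tail u t * (\<Sum>j\<in>J. z j powe p) powe (q / p)"
      using pos by (simp add: powe_mult divide_ennreal_def mult_ac)
    finally have "head (pw ?f r v) t
        \<le> (D * c_hardy p 1 powe (q / p) / tail u t * (\<Sum>j\<in>J. z j powe p) powe (q / p)) powe (1 / (q / r))"
      using pos by (subst powe_le_move[symmetric]) auto
    also have "... = (D * c_hardy p 1 powe (q / p) / tail u t) powe (r / q) * (\<Sum>j\<in>J. z j powe p) powe (r / p)"
      using pos by (simp add: powe_mult powe_powe)
    finally have "2 * head (pw ?f r v) t \<le> ?X * (\<Sum>j\<in>J. z j powe p) powe (r / p)"
      unfolding mult.assoc by (rule mult_left_mono) simp
    with le show ?thesis by (rule order_trans)
  qed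
  have "zsum (\<lambda>j. (dyad (of_int j * r / p) * ?V j) powe (p / (p - r))) \<le> ?X powe (p / (p - r))"
    using key by (intro zsum_least powe_dual_sum[OF pos(3) rp _ Xfin]) auto
  then have "tail u t powe (\<theta> / q) * zsum (steps ka ?g) \<le> tail u t powe (\<theta> / q) * ?X powe (p / (p - r))"
    unfolding steps_def by (rule mult_left_mono) simp
  also have "... \<le> (2 * c_hardy p 1 powe (r / p)) powe (p / (p - r)) * D powe (\<theta> / q)"
  proof -
    have "tail u t powe (\<theta> / q) * ?X powe (p / (p - r)) =
        2 powe (p / (p - r)) * (tail u t * (D * c_hardy p 1 powe (q / p) / tail u t)) powe (\<theta> / q)"
    proof -
      have tq: "0 < \<theta> / q" using \<theta>(1) pos by simp
      have "(Y powe (r / q)) powe (p / (p - r)) = Y powe (\<theta> / q)" for Y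
        using \<theta>(3) pos by (subst powe_powe) (simp_all only: \<theta>(2) divide_pos_pos)
      then show ?thesis by (simp only: powe_mult[OF \<theta>(3)] powe_mult[OF tq] mult_ac)
    qed
    also have "... \<le> 2 powe (p / (p - r)) * (D * c_hardy p 1 powe (q / p)) powe (\<theta> / q)"
      using divide_pos_pos[OF \<theta>(1) pos(2)] by (intro mult_left_mono powe_mono ennreal_times_divide_le) auto
    also have "... = (2 * c_hardy p 1 powe (r / p)) powe (p / (p - r)) * D powe (\<theta> / q)"
    proof -
      have "q / p * (\<theta> / q) = r / p * (p / (p - r))" using pos by (simp add: \<theta>_def)
      moreover have "0 < q / p" "0 < r / p" "0 < \<theta> / q" using \<theta>(1) pos by auto
      ultimately show ?thesis using \<theta>(3) by (simp add: powe_mult powe_powe mult_ac)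
    qed
    finally show ?thesis .
  qed
  finally show ?thesis .
qed

end

lemma sum_two_powe_le:
  fixes x :: "int \<Rightarrow> ennreal"
  assumes "0 < p" and J: "finite J" and two: "\<And>i. i \<in> J \<Longrightarrow> x i \<noteq> 0 \<Longrightarrow> i = m \<or> i = m + 1"
  shows "(\<Sum>i\<in>J. x i) powe p \<le> dyad p * (\<Sum>i\<in>J. x i powe p)"
proof -
  let ?T = "\<Sum>i\<in>J. x i powe p"
  have le: "x i \<le> ?T powe (1 / p)" if "i \<in> J" for i
    using that J assms(1) by (subst powe_le_move[symmetric]) (auto intro: member_le_sum)
  have "(\<Sum>i\<in>J. x i) = (\<Sum>i\<in>J \<inter> {m, m + 1}. x i)" using J two by (intro sum.mono_neutral_right) auto
  also have "... \<le> (\<Sum>i\<in>J \<inter> {m, m + 1}. ?T powe (1 / p))" by (intro sum_mono le) auto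
  also have "... \<le> (\<Sum>i\<in>{m, m + 1}. ?T powe (1 / p))" by (intro sum_mono2) auto
  also have "... = dyad 1 * ?T powe (1 / p)" by (simp add: dyad_1 mult_2)
  finally have "(\<Sum>i\<in>J. x i) powe p \<le> (dyad 1 * ?T powe (1 / p)) powe p"
    using assms(1) by (intro powe_mono) auto
  also have "... = dyad p * ?T" using assms(1) by (simp add: powe_mult powe_powe dyad_powe)
  finally show ?thesis .
qed

text \<open>Discrete form of the splitting in \<open>hardy_blocks\<close>: the terms whose partial
  sum is still at most 2^(i-1) add up to at most 2^(i-1), as the last of them shows, while the total
  is at least 2^i.\<close>

lemma zsum_block_ge:
  fixes \<beta> :: "int \<Rightarrow> ennreal"
  assumes "dyad (of_int i) \<le> zsum (cut {..<k} \<beta>)"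
  shows "dyad (of_int i - 1) \<le>
    zsum (\<lambda>j. \<beta> j * ind {j. j < k \<and> dyad (of_int i - 1) < zsum (cut {..j} \<beta>)} j)"
proof -
  let ?P = "\<lambda>j. zsum (cut {..j} \<beta>)"
  let ?d = "dyad (of_int i - 1)"
  have "zsum (cut {j. j < k \<and> ?P j \<le> ?d} \<beta>) \<le> ?d"
  proof (rule zsum_least)
    fix J :: "int set" assume J: "finite J"
    let ?K = "J \<inter> {j. j < k \<and> ?P j \<le> ?d}"
    show "(\<Sum>j\<in>J. \<beta> j * ind {j. j < k \<and> ?P j \<le> ?d} j) \<le> ?d"
    proof (cases "?K = {}")
      case True
      then have "(\<Sum>j\<in>J. \<beta> j * ind {j. j < k \<and> ?P j \<le> ?d} j) = 0"
        by (intro sum.neutral) (auto simp: indicator_def)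
      then show ?thesis by simp
    next
      case False
      let ?m = "Max ?K"
      have m: "?m \<in> ?K" using J False by (intro Max_in) auto
      have "(\<Sum>j\<in>J. \<beta> j * ind {j. j < k \<and> ?P j \<le> ?d} j) \<le> (\<Sum>j\<in>J. \<beta> j * ind {..?m} j)"
        using J by (intro sum_mono mult_left_mono) (auto simp: indicator_def intro!: Max_ge)
      also have "... \<le> ?P ?m" by (rule sum_le_zsum[OF J])
      also have "... \<le> ?d" using m by simp
      finally show ?thesis .
    qed
  qed
  moreover have "zsum (cut {..<k} \<beta>) =
      zsum (\<lambda>j. \<beta> j * ind {j. j < k \<and> ?P j \<le> ?d} j + \<beta> j * ind {j. j < k \<and> ?d < ?P j} j)"
    by (intro nn_integral_cong) (auto simp: indicator_def)
  ultimately have "dyad (of_int i) \<le> ?d + zsum (cut {j. j < k \<and> ?d < ?P j} \<beta>)"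
    using assms by (simp add: nn_integral_add) (meson add_right_mono order_trans)
  moreover have "dyad (of_int i) = ?d + ?d" by (simp add: dyad_double)
  ultimately have "?d + ?d \<le> ?d + zsum (cut {j. j < k \<and> ?d < ?P j} \<beta>)" by simp
  then show ?thesis by (simp add: ennreal_add_left_cancel_le)
qed

section \<open>Test functions for the sum over the earlier bands; necessity of \<open>C3\<close> and
  \<open>C4\<close>\<close>

context hardy_setting
begin

definition c_steps :: ennreal where "c_steps = c_hardy p 1 * dyad (p + 1)"

text \<open>\<open>hardy_lower\<close> with N = \<open>Rp\<close>, e = 1/\<theta> and S the sum of
  \<open>steps\<close> over the bands before that of t. The i-th test function lives on the block of
  bands where this sum lies between 2^(i-1) and 2^(i+1); its coefficients are those of equality in
  Hoelder's inequality, normalised by 2^(-i/p). A band belongs to at most two blocks, so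
  \<open>Rp\<close> of a combination is bounded by a multiple of the sum of the z^p.\<close>

lemma steps_lower:
  assumes k: "band ka" and D: "bounded_by D" "D < top" and rp: "r < p" and qp: "q < p"
  shows "(\<I> t. tail u t powe (q / (p - q)) *
        zsum (\<lambda>j. steps ka v j * ind {..<ka t} j) powe (1 / \<theta> * (p * q / (p - q))) * u t)
     \<le> c_lower p q (1 / \<theta> * (p * q / (p - q))) * (D * c_steps powe (q / p) / dyad (- 2) powe (q / r)) powe (p / (p - q))"
proof -
  have \<theta>: "0 < \<theta>" "1 / \<theta> = 1 / r - 1 / p" "0 < p / (p - r)" "\<theta> = r * (p / (p - r))"
    using rp pos by (auto simp: \<theta>_def field_simps)
  let ?\<beta> = "steps ka v"
  let ?S = "\<lambda>t. zsum (cut {..<ka t} ?\<beta>)"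
  let ?V = "\<lambda>j. VR r (cut {t. ka t = j} v)"
  have Sm: "?S \<in> BM" by (rule measurable_compose[OF band_measurable[OF k]]) simp
  obtain h where h: "\<And>j. h j \<in> BM" "\<And>j x. ka x \<noteq> j \<Longrightarrow> h j x = 0"
      "\<And>j. (\<I> x. h j x) \<le> 1"
      and hV: "\<And>j. ?V j < top \<Longrightarrow> ?V j \<le> 2 * (\<I> x. h j x powe r * v x)"
    by (rule obtain_band_functions[OF k uvw(2)]) (rule that; assumption)
  note [measurable] = h(1)
  note [measurable] = level_set[OF k]
  show ?thesis
  proof (rule hardy_lower[where N = Rp, OF uvw(1,2) Sm _ pos(2) qp pos(3)])
    fix s t assume "s \<in> space M" "t \<in> space M" "s \<le> t"
    then have "ka s \<le> ka t" by (rule band_monoD[OF k])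
    then show "?S s \<le> ?S t" by (intro zsum_mono mult_left_mono) (auto simp: indicator_def)
  next
    fix f :: "real \<Rightarrow> ennreal" assume "f \<in> BM"
    then show "(LQ r q u v f) \<le> D * Rp f powe (q / p)" using D(1) by (simp add: bounded_by_def Lq_def)
  next
    \<comment> \<open>By \<open>steps_bound\<close> with D < top, an infinite S is possible only
      where the tail of u vanishes.\<close>
    fix t assume t: "t \<in> space M" "?S t = top"
    have "?S t \<le> zsum (steps ka (cut {..<t} v))"
    proof (rule zsum_mono)
      fix j
      show "?\<beta> j * ind {..<ka t} j \<le> steps ka (cut {..<t} v) j"
      proof (cases "j < ka t")
        case True
        have "?V j \<le> VR r (cut {t. ka t = j} (cut {..<t} v))"
          using band_monoD[OF k t(1)] True by (intro VR_mono) (force simp: indicator_def not_less)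
        then show ?thesis using True \<theta> by (auto simp: steps_def intro!: powe_mono mult_left_mono)
      qed simp
    qed
    then have "tail u t powe (\<theta> / q) * top \<le> tail u t powe (\<theta> / q) * zsum (steps ka (cut {..<t} v))"
      using t by (intro mult_left_mono) auto
    also have "... \<le> (2 * c_hardy p 1 powe (r / p)) powe (p / (p - r)) * D powe (\<theta> / q)"
      by (rule steps_bound[OF k D rp t(1)])
    also have "... < top"
      using D(2) \<theta>(1,3) pos c_hardy_finite[of p 1] by (simp add: ennreal_mult_less_top powe_less_top_iff)
    finally have "tail u t powe (\<theta> / q) = 0" by (auto simp: ennreal_mult_top split: if_splits)
    then show "tail u t = 0" using \<theta>(1) pos by (simp add: powe_eq_0_iff)
  next
    show "c_steps < top" using c_hardy_finite[of p 1] pos by (simp add: c_steps_def ennreal_mult_less_top)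
    fix J :: "int set" and \<tau>
    assume J: "finite J" and tau: "\<And>i. i \<in> J \<Longrightarrow> \<tau> i \<in> space M \<and> dyad (of_int i) \<le> ?S (\<tau> i) \<and> ?S (\<tau> i) < dyad (of_int i + 1)"
    let ?P = "\<lambda>j. zsum (cut {..j} ?\<beta>)"
    define blk where "blk i = {j. j < ka (\<tau> i) \<and> dyad (of_int i - 1) < ?P j}" for i :: int
    \<comment> \<open>Extremal choice: a_j^r V_j and 2^(-j) a_j^p both equal \<beta>_j for finite
      V_j, so the head and \<open>Rp\<close> both become sums of \<beta> over the block.\<close>
    define a where "a j = dyad (of_int j / p) * ?\<beta> j powe (1 / p)" for j :: int
    define F where "F i x = dyad (- (of_int i / p)) * zsum (\<lambda>j. a j * ind (blk i) j * h j x)" for i x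
    have Fm [measurable]: "F i \<in> BM" for i unfolding F_def by measurable
    have Fx: "F i x = dyad (- (of_int i / p)) * a (ka x) * ind (blk i) (ka x) * h (ka x) x" for i x
    proof -
      have "zsum (\<lambda>j. a j * ind (blk i) j * h j x) = zsum (\<lambda>j. a j * ind (blk i) j * h j x * ind {ka x} j)"
        using h(2)[of x] by (intro nn_integral_cong) (auto simp: indicator_def)
      also have "... = a (ka x) * ind (blk i) (ka x) * h (ka x) x" by (rule zsum_single)
      finally show ?thesis by (simp add: F_def mult.assoc)
    qed
    have blk_sum: "zsum (cut (blk i) ?\<beta>) \<le> dyad (of_int i + 1)"
      "dyad (of_int i - 1) \<le> zsum (cut (blk i) ?\<beta>)" if "i \<in> J" for i
    proof -
      have "zsum (cut (blk i) ?\<beta>) \<le> ?S (\<tau> i)"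
        by (intro zsum_mono mult_left_mono) (auto simp: indicator_def blk_def)
      then show "zsum (cut (blk i) ?\<beta>) \<le> dyad (of_int i + 1)" using tau[OF that] by auto
      show "dyad (of_int i - 1) \<le> zsum (cut (blk i) ?\<beta>)"
        unfolding blk_def using tau[OF that] by (intro zsum_block_ge) auto
    qed
    have V_fin: "?V j < top" if "i \<in> J" "j \<in> blk i" for i j
    proof -
      have "?\<beta> j \<le> ?P j" using term_le_zsum[of "\<lambda>l. ?\<beta> l * ind {..j} l" j] by simp
      also have "... \<le> ?S (\<tau> i)"
        using that by (intro zsum_mono mult_left_mono) (auto simp: indicator_def blk_def)
      also have "... < top" using tau[OF that(1)] by (auto intro: less_trans)
      finally show ?thesis using \<theta>(3) by (auto simp: steps_def powe_less_top_iff ennreal_mult_less_top)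
    qed
    have head_F: "dyad (- 2) * dyad (of_int i * (1 / \<theta>) * r) \<le> head (pw (F i) r v) t"
      if i: "i \<in> J" and t: "\<tau> i \<le> t" "t \<in> space M" for i t
    proof -
      have bV: "a j powe r * ?V j = ?\<beta> j" for j
      proof -
        have "a j powe r * ?V j = ?\<beta> j powe (r / p) * (dyad (of_int j * r / p) * ?V j)"
          using pos by (simp add: a_def powe_mult powe_powe dyad_powe mult_ac)
        also have "dyad (of_int j * r / p) * ?V j = ?\<beta> j powe ((p - r) / p)"
          using \<theta> rp pos by (simp add: steps_def powe_powe)
        also have "?\<beta> j powe (r / p) * ?\<beta> j powe ((p - r) / p) = ?\<beta> j powe (r / p + (p - r) / p)"
          using rp pos by (intro powe_add[symmetric]) auto
        also have "r / p + (p - r) / p = 1" using pos by (simp add: field_simps)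
        finally show ?thesis by simp
      qed
      have "dyad (- 2) * dyad (of_int i * (1 / \<theta>) * r) = dyad (- (of_int i * r / p) - 1) * dyad (of_int i - 1)"
        unfolding \<theta>(2) dyad_add[symmetric] using pos by (intro arg_cong[where f = dyad]) (simp add: field_simps)
      also have "... \<le> dyad (- (of_int i * r / p) - 1) * zsum (cut (blk i) ?\<beta>)"
        using blk_sum[OF i] by (intro mult_left_mono) auto
      also have "... = zsum (\<lambda>j. dyad (- (of_int i * r / p) - 1) * (a j powe r * ?V j * ind (blk i) j))"
        by (simp only: zsum_cmult bV)
      also have "... \<le> zsum (\<lambda>j. mass {t. ka t = j} (\<lambda>x. F i x powe r * v x * ind {..<t} x))"
      proof (rule zsum_mono)
        fix j
        show "dyad (- (of_int i * r / p) - 1) * (a j powe r * ?V j * ind (blk i) j) \<le>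
          (mass {t. ka t = j} (\<lambda>x. F i x powe r * v x * ind {..<t} x))"
        proof (cases "j \<in> blk i")
          case True
          then have jt: "j < ka (\<tau> i)" by (simp add: blk_def)
          have "dyad (- (of_int i * r / p) - 1) * (a j powe r * ?V j * ind (blk i) j)
            \<le> dyad (- (of_int i * r / p) - 1) * (a j powe r * (2 * (\<I> x. h j x powe r * v x)))"
            using True V_fin[OF i True] by (auto intro!: mult_left_mono hV)
          also have "... = (dyad (- (of_int i * r / p) - 1) * dyad 1) * (a j powe r * (\<I> x. h j x powe r * v x))"
            by (simp only: dyad_1 mult_ac)
          also have "... = dyad (- (of_int i * r / p)) * a j powe r * (\<I> x. h j x powe r * v x)"
            by (simp add: dyad_add[symmetric] mult.assoc)
          also have "... = (\<I> x. dyad (- (of_int i * r / p)) * a j powe r * (h j x powe r * v x))"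
            by (rule nn_integral_cmult[symmetric]) measurable
          also have "... = mass {t. ka t = j} (\<lambda>x. F i x powe r * v x * ind {..<t} x)"
          proof (rule nn_integral_cong)
            fix x assume x: "x \<in> space M"
            show "dyad (- (of_int i * r / p)) * a j powe r * (h j x powe r * v x) =
              F i x powe r * v x * ind {..<t} x * ind {t. ka t = j} x"
            proof (cases "ka x = j")
              case False
              then show ?thesis using h(2)[OF False] pos by simp
            next
              case kx: True
              have "x < \<tau> i" using band_monoD[OF k, of "\<tau> i" x] tau[OF i] x kx jt by force
              then have "x < t" using t by simp
              then show ?thesis using kx True pos by (simp add: Fx powe_mult dyad_powe mult_ac)
            qed
          qed
          finally show ?thesis .
        qed simp
      qed
      also have "... = head (pw (F i) r v) t"
        unfolding head_def by (rule zsum_bands[OF k, symmetric]) measurable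
      finally show ?thesis .
    qed
    have N_F: "Rp (\<lambda>x. \<Sum>i\<in>J. z i * F i x) \<le> c_steps * (\<Sum>i\<in>J. z i powe p)" for z :: "int \<Rightarrow> ennreal"
    proof -
      let ?f = "\<lambda>x. \<Sum>i\<in>J. z i * F i x"
      let ?x = "\<lambda>j i. z i * dyad (- (of_int i / p)) * ind (blk i) j"
      have fm: "?f \<in> BM" by measurable
      have "Rp ?f \<le> c_hardy p 1 * zsum (\<lambda>j. dyad (- of_int j) * mass {t. ka t = j} ?f powe p)"
        by (rule Rp_upper[OF k fm])
      also have "zsum (\<lambda>j. dyad (- of_int j) * mass {t. ka t = j} ?f powe p)
         \<le> zsum (\<lambda>j. \<Sum>i\<in>J. dyad p * (z i powe p * (dyad (- of_int i) * (?\<beta> j * ind (blk i) j))))"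
      proof (rule zsum_mono)
        fix j
        have "mass {t. ka t = j} ?f = (\<I> x. (a j * (\<Sum>i\<in>J. ?x j i)) * h j x)"
        proof (rule nn_integral_cong)
          fix x
          show "?f x * ind {t. ka t = j} x = (a j * (\<Sum>i\<in>J. ?x j i)) * h j x"
          proof (cases "ka x = j")
            case True
            then show ?thesis by (simp add: Fx sum_distrib_left sum_distrib_right mult_ac)
          next
            case False
            then show ?thesis using h(2)[OF False] by simp
          qed
        qed
        also have "... = (a j * (\<Sum>i\<in>J. ?x j i)) * (\<I> x. h j x)" by (rule nn_integral_cmult) measurable
        also have "... \<le> (a j * (\<Sum>i\<in>J. ?x j i)) * 1" by (intro mult_left_mono h) auto
        finally have "mass {t. ka t = j} ?f powe p \<le> (a j * (\<Sum>i\<in>J. ?x j i)) powe p"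
          using pos by (intro powe_mono) auto
        also have "... = dyad (of_int j) * ?\<beta> j * (\<Sum>i\<in>J. ?x j i) powe p"
          using pos by (simp add: a_def powe_mult powe_powe dyad_powe)
        also have "... \<le> dyad (of_int j) * ?\<beta> j * (dyad p * (\<Sum>i\<in>J. ?x j i powe p))"
        proof (cases "\<exists>i\<in>J. j \<in> blk i")
          case False
          then have "(\<Sum>i\<in>J. ?x j i) = 0" by (intro sum.neutral) (auto simp: indicator_def)
          then show ?thesis using pos by simp
        next
          case True
          \<comment> \<open>Membership of j in block i determines the partial sum up to j within a
            factor 4, which leaves two values of i.\<close>
          have bd: "dyad (of_int i - 1) < ?P j \<and> ?P j < dyad (of_int i + 1)" if "i \<in> J" "j \<in> blk i" for i
          proof -
            have "?P j \<le> ?S (\<tau> i)"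
              using that by (intro zsum_mono mult_left_mono) (auto simp: indicator_def blk_def)
            also have "... < dyad (of_int i + 1)" using tau[OF that(1)] by blast
            finally show ?thesis using that by (simp add: blk_def)
          qed
          then have "?P j \<noteq> 0" "?P j \<noteq> top"
            using True bd by (metis not_less_zero, metis top.extremum_strict)
          then obtain m :: int where m: "dyad (of_int m) \<le> ?P j" "?P j < dyad (of_int m + 1)"
            by (rule dyad_floor)
          have ij: "i = m \<or> i = m + 1" if "i \<in> J" "j \<in> blk i" for i
          proof -
            have "dyad (of_int i - 1) < dyad (of_int m + 1)" "dyad (of_int m) < dyad (of_int i + 1)"
              using less_trans[OF conjunct1[OF bd[OF that]] m(2)] le_less_trans[OF m(1) conjunct2[OF bd[OF that]]]
              by blast+
            then show ?thesis by simp linarith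
          qed
          show ?thesis
            using ij by (intro mult_left_mono sum_two_powe_le[OF pos(1) J, of _ m]) (auto simp: indicator_def split: if_splits)
        qed
        finally have "dyad (- of_int j) * mass {t. ka t = j} ?f powe p
            \<le> dyad (- of_int j) * (dyad (of_int j) * ?\<beta> j * (dyad p * (\<Sum>i\<in>J. ?x j i powe p)))"
          by (rule mult_left_mono) simp
        also have "... = (dyad (- of_int j) * dyad (of_int j)) * (?\<beta> j * (dyad p * (\<Sum>i\<in>J. ?x j i powe p)))"
          by (simp only: mult.assoc)
        also have "... = ?\<beta> j * (dyad p * (\<Sum>i\<in>J. ?x j i powe p))" by (simp add: dyad_minus)
        also have "... = (\<Sum>i\<in>J. dyad p * (z i powe p * (dyad (- of_int i) * (?\<beta> j * ind (blk i) j))))"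
          unfolding sum_distrib_left using pos
          by (intro sum.cong refl) (auto simp: powe_mult dyad_powe indicator_def mult_ac)
        finally show "dyad (- of_int j) * mass {t. ka t = j} ?f powe p
            \<le> (\<Sum>i\<in>J. dyad p * (z i powe p * (dyad (- of_int i) * (?\<beta> j * ind (blk i) j))))" .
      qed
      also have "... = (\<Sum>i\<in>J. dyad p * (z i powe p * (dyad (- of_int i) * zsum (cut (blk i) ?\<beta>))))"
        by (subst nn_integral_sum) (simp_all only: zsum_cmult, simp_all)
      also have "... \<le> (\<Sum>i\<in>J. dyad p * (z i powe p * (dyad (- of_int i) * dyad (of_int i + 1))))"
        by (intro sum_mono mult_left_mono blk_sum) auto
      also have "... = (\<Sum>i\<in>J. dyad (p + 1) * z i powe p)"
        by (intro sum.cong refl) (simp add: dyad_add[symmetric], simp add: dyad_add mult_ac)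
      finally show ?thesis by (simp add: c_steps_def sum_distrib_left mult_left_mono mult.assoc)
    qed
    show "\<exists>F :: int \<Rightarrow> real \<Rightarrow> ennreal. (\<forall>i\<in>J. F i \<in> BM \<and>
        (\<forall>t\<in>space M. \<tau> i \<le> t \<longrightarrow> dyad (- 2) * dyad (of_int i * (1 / \<theta>) * r) \<le> head (pw (F i) r v) t)) \<and>
        (\<forall>z. Rp (\<lambda>x. \<Sum>i\<in>J. z i * F i x) \<le> c_steps * (\<Sum>i\<in>J. z i powe p))"
      using Fm head_F N_F by (intro exI[of _ F]) blast
  qed (use D \<theta>(1) in auto)
qed

text \<open>\<open>P x t\<close> is \<open>V\<^sub>r(x,t)\<^sup>r\<close>, \<open>K x t\<close> the \<open>q\<close>-th power of the local Hardy constant of \<open>(x,t)\<close>.\<close>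

definition P :: "real \<Rightarrow> real \<Rightarrow> ennreal" where "P x t = VR r (cut {x..<t} v)"

definition K :: "real \<Rightarrow> real \<Rightarrow> ennreal" where "K x t = KQ\<^sub>c {x..<t}"

text \<open>The integral inside \<open>C3\<close> and \<open>C6\<close>, since P^(p/(p - r)) is
  V_r^\<theta>. It is the continuous counterpart of the sum of \<open>steps\<close> over the bands
  before x.\<close>

definition Q :: "real \<Rightarrow> ennreal" where
  "Q x = mass {..<x} (\<lambda>s. tail w s powe (- (p / (p - r))) * w s * P s x powe (p / (p - r)))"

definition \<Psi> :: "real \<Rightarrow> real \<Rightarrow> ennreal" where
  "\<Psi> y x = mass {y..<x} (\<lambda>t. tail u t powe (q / (p - q)) * u t)"

lemma P_mono: "x' \<le> x \<Longrightarrow> t \<le> t' \<Longrightarrow> P x t \<le> P x' t'"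
  unfolding P_def by (intro VR_mono mult_left_mono) (auto simp: indicator_def)

lemma P_mono1: "mono (P x)" and P_antimono: "antimono (\<lambda>x. P x t)"
  by (auto intro!: monoI antimonoI P_mono)

lemma P_measurable [measurable]: "P x \<in> BM" "(\<lambda>x. P x t) \<in> BM"
  using mono_measurable[OF P_mono1] antimono_measurable[OF P_antimono] by auto

lemma Q_mono:
  assumes "r < p" "x \<le> y" shows "Q x \<le> Q y"
proof -
  have nn: "0 \<le> p / (p - r)" using assms pos by (intro divide_nonneg_nonneg) auto
  have "P s x powe (p / (p - r)) \<le> P s y powe (p / (p - r))" for s
    by (intro powe_mono P_mono nn assms(2)) simp
  then show ?thesis unfolding Q_def using assms(2)
    by (intro nn_integral_mono mult_mono[OF mult_left_mono]) (auto simp: indicator_def)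
qed

lemma KQ_tail_le:
  assumes D: "bounded_by D" shows "KQ\<^sub>c {x..} \<le> D * tail w x powe (q / p)"
  using KQ_cut_le[OF D, of "{x..}"] by (simp add: tail_def)

text \<open>Up to taking q-th roots this is the necessity of \<open>C1\<close> at the pair (x,
  t).\<close>

lemma tail_P_le: 
  assumes D: "bounded_by D" and t: "t \<in> space M"
  shows "tail u t * P x t powe (q / r) \<le> D * tail w x powe (q / p)"
proof -
  have "tail u t * VR r (cut {..<t} (cut {x..} v)) powe (q / r) \<le> KQ\<^sub>c {x..}"
    by (rule tail_VR_cut_le[OF t]) auto
  also have "cut {..<t} (cut {x..} v) = cut {x..<t} v" by (auto simp: indicator_def)
  finally show ?thesis using KQ_tail_le[OF D] unfolding P_def by (rule order_trans)
qed

lemma W_powe_cancel: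
  assumes "x \<in> space M" "0 < c" shows "tail w x powe (- c) * tail w x powe c = 1"
  using W_pos[OF assms(1)] W_fin[OF assms(1)] assms(2) by (intro powe_neg_mult) auto

lemma tail_P_W_le: 
  assumes D: "bounded_by D" and t: "t \<in> space M" and x: "x \<in> space M"
  shows "tail u t powe (r / q) * (tail w x powe (- (r / p)) * P x t) \<le> D powe (r / q)"
proof -
  have "(tail u t * P x t powe (q / r)) powe (r / q) \<le> (D * tail w x powe (q / p)) powe (r / q)"
    using pos tail_P_le[OF D t] by (intro powe_mono) auto
  then have "tail u t powe (r / q) * P x t \<le> D powe (r / q) * tail w x powe (r / p)"
    using pos by (simp add: powe_mult powe_powe)
  then have "tail w x powe (- (r / p)) * (tail u t powe (r / q) * P x t)
     \<le> tail w x powe (- (r / p)) * (D powe (r / q) * tail w x powe (r / p))"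
    by (rule mult_left_mono) simp
  also have "... = D powe (r / q) * (tail w x powe (- (r / p)) * tail w x powe (r / p))" by (simp only: mult_ac)
  also have "... = D powe (r / q)" using x pos by (subst W_powe_cancel) auto
  finally show ?thesis by (simp only: mult_ac)
qed

text \<open>For s in band k, P s x is at most the sum of the values of \<open>VR\<close> on the
  bands from k on. With b = p/(p - r) the weight W^(-b) w contributes a multiple of 2^((b - 1)k) on
  band k, and b - 1 > 0 lets \<open>geometric_hardy_above\<close> remove the inner sums.\<close>

lemma Q_le_steps:
  assumes k: "band ka" and rp: "r < p"
  shows "Q x \<le> dyad (2 * (p / (p - r))) * c_hardy (p / (p - r)) (p / (p - r) - 1) * zsum (steps ka (cut {..<x} v))"
proof -
  define b where "b = p / (p - r)"
  have b: "0 < b" "0 < b - 1" "b - 1 = r / p * b" using rp pos by (auto simp: b_def field_simps)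
  let ?V = "\<lambda>j. VR r (cut {t. ka t = j} (cut {..<x} v))"
  let ?Z = "\<lambda>k. zsum (cut {k..} ?V) powe b"
  have PV: "P s x \<le> zsum (cut {ka s..} ?V)" if s: "s \<in> space M" for s
  proof -
    have [measurable]: "cut {s..<x} v \<in> BM" by measurable
    have "P s x \<le> zsum (\<lambda>j. VR r (\<lambda>t. cut {s..<x} v t * ind {j} (ka t)))"
      unfolding P_def by (rule VR_zsum[OF _ band_measurable[OF k]]) measurable
    also have "... \<le> zsum (cut {ka s..} ?V)"
    proof (rule zsum_mono)
      fix j
      show "VR r (\<lambda>t. cut {s..<x} v t * ind {j} (ka t)) \<le> ?V j * ind {ka s..} j"
      proof (cases "ka s \<le> j")
        case True
        then show ?thesis by (auto intro!: VR_mono simp: indicator_def)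
      next
        case False
        have "VR r (\<lambda>t. cut {s..<x} v t * ind {j} (ka t)) = VR r (\<lambda>t. 0)"
          using band_monoD[OF k s] False by (intro VR_cong) (force simp: indicator_def)
        also have "... \<le> 0" by (rule VR_least) simp
        finally show ?thesis by simp
      qed
    qed
    finally show ?thesis .
  qed
  have Zm: "(\<lambda>s. ?Z (ka s)) \<in> BM" by (rule measurable_compose[OF band_measurable[OF k]]) simp
  have dm: "(\<lambda>s. dyad ((of_int (ka s) + 2) * b)) \<in> BM"
    by (rule measurable_compose[OF band_measurable[OF k]]) simp
  note [measurable] = Zm dm
  have "Q x \<le> (\<I> s. dyad ((of_int (ka s) + 2) * b) * w s * ?Z (ka s))" unfolding Q_def b_def[symmetric]
  proof (rule nn_integral_mono)
    fix s assume s: "s \<in> space M"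
    have "dyad (- (of_int (ka s)) - 2) \<le> tail w s" by (rule band_ge[OF k s])
    then have "tail w s powe (- b) \<le> dyad (- ((- of_int (ka s) - 2) * b))"
      using b by (intro powe_neg_dyad_le) auto
    also have "... = dyad ((of_int (ka s) + 2) * b)" by (simp add: algebra_simps)
    finally have "tail w s powe (- b) * w s * P s x powe b \<le> dyad ((of_int (ka s) + 2) * b) * w s * ?Z (ka s)"
      using b PV[OF s] by (intro mult_mono powe_mono) auto
    then show "tail w s powe (- b) * w s * P s x powe b * ind {..<x} s
        \<le> dyad ((of_int (ka s) + 2) * b) * w s * ?Z (ka s)" by (auto simp: indicator_def)
  qed
  also have "... = zsum (\<lambda>k. mass {t. ka t = k} (\<lambda>s. dyad ((of_int (ka s) + 2) * b) * w s * ?Z (ka s)))"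
    by (rule zsum_bands[OF k]) measurable
  also have "... = zsum (\<lambda>k. dyad ((of_int k + 2) * b) * ?Z k * mass {t. ka t = k} w)"
    using band_set[OF k] by (intro nn_integral_cong, subst nn_integral_cmult[symmetric])
       (auto simp: indicator_def mult_ac intro!: nn_integral_cong)
  also have "... \<le> zsum (\<lambda>k. dyad ((of_int k + 2) * b) * ?Z k * dyad (- of_int k))"
    by (intro zsum_mono mult_left_mono band_mass_eq[OF k]) auto
  also have "... = zsum (\<lambda>k. dyad (2 * b) * (dyad ((b - 1) * of_int k) * ?Z k))"
  proof (intro nn_integral_cong)
    fix k :: int
    have "dyad ((of_int k + 2) * b) * ?Z k * dyad (- of_int k) = dyad ((of_int k + 2) * b) * dyad (- of_int k) * ?Z k"
      by (simp only: mult_ac)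
    also have "dyad ((of_int k + 2) * b) * dyad (- of_int k) = dyad (2 * b) * dyad ((b - 1) * of_int k)"
      by (simp add: dyad_add[symmetric] algebra_simps)
    finally show "dyad ((of_int k + 2) * b) * ?Z k * dyad (- of_int k) = dyad (2 * b) * (dyad ((b - 1) * of_int k) * ?Z k)"
      by (simp only: mult.assoc)
  qed
  also have "... = dyad (2 * b) * zsum (\<lambda>k. dyad ((b - 1) * of_int k) * ?Z k)" by (rule zsum_cmult)
  also have "... \<le> dyad (2 * b) * (c_hardy b (b - 1) * zsum (\<lambda>k. dyad ((b - 1) * of_int k) * ?V k powe b))"
    using b by (intro mult_left_mono geometric_hardy_above) auto
  also have "zsum (\<lambda>k. dyad ((b - 1) * of_int k) * ?V k powe b) = zsum (steps ka (cut {..<x} v))"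
    unfolding steps_def b_def[symmetric] using b
    by (intro nn_integral_cong) (simp add: powe_mult dyad_powe mult_ac)
  finally show ?thesis by (simp only: b_def[symmetric] mult.assoc)
qed

lemma C3_lower:
  assumes k: "band ka" and D: "bounded_by D" "D < top" and rp: "r < p" and x: "x \<in> space M"
  shows "tail u x powe (\<theta> / q) * Q x \<le>
    dyad (2 * (p / (p - r))) * c_hardy (p / (p - r)) (p / (p - r) - 1) *
      ((2 * c_hardy p 1 powe (r / p)) powe (p / (p - r)) * D powe (\<theta> / q))"
proof -
  let ?c = "dyad (2 * (p / (p - r))) * c_hardy (p / (p - r)) (p / (p - r) - 1)"
  have "tail u x powe (\<theta> / q) * Q x \<le> tail u x powe (\<theta> / q) * (?c * zsum (steps ka (cut {..<x} v)))"
    by (intro mult_left_mono Q_le_steps[OF k rp]) simp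
  also have "... = ?c * (tail u x powe (\<theta> / q) * zsum (steps ka (cut {..<x} v)))" by (simp only: mult_ac)
  also have "... \<le> ?c * ((2 * c_hardy p 1 powe (r / p)) powe (p / (p - r)) * D powe (\<theta> / q))"
    by (intro mult_left_mono steps_bound[OF k D rp x]) simp
  finally show ?thesis .
qed

text \<open>Normalised like V_r^r; raised to the power pq/((p - q)r) it is the essential supremum
  inside \<open>C4\<close>.\<close>

definition S4 :: "real \<Rightarrow> ennreal" where
  "S4 t = (SUP x\<in>{x\<in>space M. x < t}. tail w x powe (- (r / p)) * P x t)"

text \<open>\<open>hardy_lower\<close> with S = \<open>S4\<close> and e = 1/r. The test functions
  are single functions W(x)^(-1/p) f with f on {x..}, each with \<open>Rp\<close> at most 1. Their
  overlap does no harm, because p <= 1 makes F^p subadditive.\<close>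

lemma C4_lower:
  assumes D: "bounded_by D" "D < top" and qp: "q < p" "p \<le> 1"
  shows "(\<I> t. tail u t powe (q / (p - q)) * S4 t powe (1 / r * (p * q / (p - q))) * u t)
     \<le> c_lower p q (1 / r * (p * q / (p - q))) * (D * 1 powe (q / p) / dyad (- 1) powe (q / r)) powe (p / (p - q))"
proof -
  have S_mono: "S4 s \<le> S4 t" if "s \<le> t" for s t
    unfolding S4_def using that by (intro SUP_mono) (auto intro!: bexI mult_left_mono P_mono)
  then have [measurable]: "S4 \<in> BM" by (intro mono_measurable monoI)
  show ?thesis
  proof (rule hardy_lower[where N = Rp, OF uvw(1,2) _ _ pos(2) qp(1) pos(3)])
    fix s t :: real assume "s \<le> t" then show "S4 s \<le> S4 t" by (rule S_mono)
  next
    fix f :: "real \<Rightarrow> ennreal" assume "f \<in> BM"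
    then show "(LQ r q u v f) \<le> D * Rp f powe (q / p)" using D(1) by (simp add: bounded_by_def Lq_def)
  next
    fix t assume t: "t \<in> space M" "S4 t = top"
    have "tail u t powe (r / q) * S4 t \<le> D powe (r / q)"
    proof (cases "{x\<in>space M. x < t} = {}")
      case True
      then have "S4 t = 0" unfolding S4_def by (simp only: image_empty Sup_empty bot_ennreal)
      then show ?thesis by simp
    next
      case False
      then show ?thesis unfolding S4_def SUP_mult_left_ennreal
        using tail_P_W_le[OF D(1) t(1)] by (auto intro!: SUP_least)
    qed
    also have "... < top" using D(2) pos by (simp add: powe_less_top_iff)
    finally have "tail u t powe (r / q) = 0" using t(2) by (auto simp: ennreal_mult_top split: if_splits)
    then show "tail u t = 0" using pos by (simp add: powe_eq_0_iff)
  next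
    fix J :: "int set" and \<tau>
    assume J: "finite J" and tau: "\<And>i. i \<in> J \<Longrightarrow> \<tau> i \<in> space M \<and> dyad (of_int i) \<le> S4 (\<tau> i) \<and> S4 (\<tau> i) < dyad (of_int i + 1)"
    have "\<exists>F. F \<in> BM \<and> Rp F \<le> 1 \<and> dyad (of_int i - 1) \<le> head (pw F r v) (\<tau> i)" if i: "i \<in> J" for i
    proof -
      have "dyad (of_int i - 1) < dyad (of_int i)" by simp
      also have "... \<le> S4 (\<tau> i)" using tau[OF i] by blast
      finally obtain x where x: "x \<in> space M" "x < \<tau> i" "dyad (of_int i - 1) < tail w x powe (- (r / p)) * P x (\<tau> i)"
        unfolding S4_def less_SUP_iff by auto
      have "{f \<in> BM. (\<I> x. f x) \<le> 1} \<noteq> {}" by (auto intro!: exI[of _ "\<lambda>_. 0"])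
      then obtain f where f [measurable]: "f \<in> BM" and f1: "(\<I> x. f x) \<le> 1"
        and fx: "dyad (of_int i - 1) < tail w x powe (- (r / p)) * (\<I> s. f s powe r * cut {x..<\<tau> i} v s)"
        using x(3) unfolding P_def VR_def SUP_mult_left_ennreal less_SUP_iff by auto
      let ?F = "\<lambda>s. tail w x powe (- (1 / p)) * cut {x..} f s"
      have "Rp ?F \<le> (\<I> t. tail w x powe (- 1) * (w t * ind {x..} t))" unfolding Rp_def
      proof (rule nn_integral_mono)
        fix t assume t: "t \<in> space M"
        have h: "head ?F t = tail w x powe (- (1 / p)) * head (cut {x..} f) t"
          unfolding head_def by (subst nn_integral_cmult[symmetric]) (auto simp: mult.assoc)
        show "head ?F t powe p * w t \<le> tail w x powe (- 1) * (w t * ind {x..} t)"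
        proof (cases "x \<le> t")
          case True
          have "head (cut {x..} f) t \<le> (\<I> x. f x)"
            unfolding head_def by (intro nn_integral_mono) (auto simp: indicator_def)
          then have "head ?F t \<le> tail w x powe (- (1 / p)) * 1"
            unfolding h using f1 by (intro mult_left_mono) auto
          then have "head ?F t powe p \<le> (tail w x powe (- (1 / p))) powe p"
            using pos by (simp add: powe_mono)
          also have "... = tail w x powe (- 1)" using pos by (simp add: powe_neg_powe)
          finally show ?thesis using True by (simp add: mult_right_mono)
        next
          case False
          then have "head (cut {x..} f) t = (\<I> x. 0)"
            unfolding head_def by (intro nn_integral_cong) (auto simp: indicator_def)
          then show ?thesis using pos h by simp
        qed
      qed
      also have "... = tail w x powe (- 1) * tail w x powe 1" unfolding tail_def by (subst nn_integral_cmult) auto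
      also have "... = 1" using x by (intro W_powe_cancel) auto
      finally have "Rp ?F \<le> 1" .
      moreover have "tail w x powe (- (r / p)) * (\<I> s. f s powe r * cut {x..<\<tau> i} v s) = head (pw ?F r v) (\<tau> i)"
      proof -
        have "(\<I> s. tail w x powe (- (r / p)) * (f s powe r * cut {x..<\<tau> i} v s)) = head (pw ?F r v) (\<tau> i)"
          unfolding head_def using pos
          by (intro nn_integral_cong) (auto simp: indicator_def powe_mult powe_neg_powe mult.assoc)
        then show ?thesis by (subst nn_integral_cmult[symmetric]) auto
      qed
      moreover have "?F \<in> BM" by measurable
      ultimately show ?thesis using fx by (intro exI[of _ ?F]) auto
    qed
    then have "\<forall>i\<in>J. \<exists>F. F \<in> BM \<and> Rp F \<le> 1 \<and> dyad (of_int i - 1) \<le> head (pw F r v) (\<tau> i)" by blast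
    from bchoice[OF this] obtain F where F: "\<forall>i\<in>J. F i \<in> BM \<and> Rp (F i) \<le> 1 \<and>
      dyad (of_int i - 1) \<le> head (pw (F i) r v) (\<tau> i)" by blast
    have "dyad (- 1) * dyad (of_int i * (1 / r) * r) \<le> head (pw (F i) r v) t" if "i \<in> J" "\<tau> i \<le> t" for i t
    proof -
      have "dyad (- 1) * dyad (of_int i * (1 / r) * r) = dyad (of_int i - 1)"
        using pos by (simp add: dyad_add[symmetric])
      also have "... \<le> head (pw (F i) r v) (\<tau> i)" using F that(1) by simp
      also have "... \<le> head (pw (F i) r v) t" by (rule head_mono) fact
      finally show ?thesis .
    qed
    moreover have "Rp (\<lambda>x. \<Sum>i\<in>J. z i * F i x) \<le> 1 * (\<Sum>i\<in>J. z i powe p)" for z :: "int \<Rightarrow> ennreal"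
    proof -
      have "Rp (\<lambda>x. \<Sum>i\<in>J. z i * F i x) \<le> (\<I> t. (\<Sum>i\<in>J. z i powe p * (head (F i) t powe p * w t)))"
        unfolding Rp_def
      proof (rule nn_integral_mono)
        fix t
        have "head (\<lambda>x. \<Sum>i\<in>J. z i * F i x) t = (\<Sum>i\<in>J. z i * head (F i) t)"
          unfolding head_def sum_distrib_right using F
          by (subst nn_integral_sum) (auto intro!: sum.cong simp: mult.assoc nn_integral_cmult)
        then have "head (\<lambda>x. \<Sum>i\<in>J. z i * F i x) t powe p \<le> (\<Sum>i\<in>J. (z i * head (F i) t) powe p)"
          using sum_powe_le[OF pos(1) qp(2) J] by simp
        then have "head (\<lambda>x. \<Sum>i\<in>J. z i * F i x) t powe p * w t \<le> (\<Sum>i\<in>J. (z i * head (F i) t) powe p) * w t"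
          by (rule mult_right_mono) simp
        also have "... = (\<Sum>i\<in>J. z i powe p * (head (F i) t powe p * w t))"
          using pos by (simp add: powe_mult sum_distrib_right mult.assoc)
        finally show "head (\<lambda>x. \<Sum>i\<in>J. z i * F i x) t powe p * w t \<le> (\<Sum>i\<in>J. z i powe p * (head (F i) t powe p * w t))" .
      qed
      also have "... = (\<Sum>i\<in>J. z i powe p * Rp (F i))"
        unfolding Rp_def by (subst nn_integral_sum) (auto simp: nn_integral_cmult)
      also have "... \<le> (\<Sum>i\<in>J. z i powe p * 1)" using F by (intro sum_mono mult_left_mono) auto
      finally show ?thesis by simp
    qed
    ultimately show "\<exists>F :: int \<Rightarrow> real \<Rightarrow> ennreal. (\<forall>i\<in>J. F i \<in> BM \<and>
        (\<forall>t\<in>space M. \<tau> i \<le> t \<longrightarrow> dyad (- 1) * dyad (of_int i * (1 / r) * r) \<le> head (pw (F i) r v) t)) \<and>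
        (\<forall>z. Rp (\<lambda>x. \<Sum>i\<in>J. z i * F i x) \<le> 1 * (\<Sum>i\<in>J. z i powe p))" using F by (intro exI[of _ F]) blast
  qed (use D pos in auto)
qed

end

lemma card_window_le:
  fixes J :: "int set"
  assumes "finite J" shows "(\<Sum>j\<in>J. ind {j. j \<le> k \<and> k \<le> j + int m} j) \<le> (of_nat (Suc m) :: ennreal)"
proof -
  have "(\<Sum>j\<in>J. ind {j. j \<le> k \<and> k \<le> j + int m} j) = (of_nat (card (J \<inter> {k - int m..k})) :: ennreal)"
    using assms by (simp add: indicator_def sum.If_cases) (auto intro!: arg_cong[where f = card])
  moreover have "card (J \<inter> {k - int m..k}) \<le> card {k - int m..k}" by (intro card_mono) auto
  ultimately show ?thesis by (simp add: of_nat_mono del: of_nat_Suc)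
qed

text \<open>A window of m + 1 bands costs the factor (m + 1)^b, which is to be absorbed by half of a
  decay 2^(-m). This follows from 1 + y <= 2 * 2^y at y = m/(2b); the maximum covers the case 2b <
  1.\<close>

lemma Suc_powe_le:
  assumes "0 < b"
  shows "(of_nat (Suc m) :: ennreal) powe b \<le> ennreal (2 * max 1 (2 * b)) powe b * dyad (of_nat m / 2)"
proof -
  have "real (Suc m) \<le> 2 * max 1 (2 * b) * 2 powr (of_nat m / (2 * b))"
  proof -
    let ?y = "of_nat m / (2 * b)"
    have y: "0 \<le> ?y" using assms by simp
    have "1 + y \<le> 2 * 2 powr y" if y: "0 \<le> y" for y :: real
    proof -
      have "1 / 2 \<le> ln (2 :: real)" using exp_half_le2 by (subst ln_ge_iff) auto
      then have "1 + y / 2 \<le> 1 + y * ln 2" using mult_left_mono[OF _ y, of "1/2" "ln 2"] by simp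
      also have "... \<le> exp (y * ln 2)" by (rule exp_ge_add_one_self)
      finally have "1 + y / 2 \<le> 2 powr y" by (simp add: powr_def)
      then show ?thesis using y by linarith
    qed
    from this[OF y] have "1 + ?y \<le> 2 * 2 powr ?y" .
    then have "max 1 (2 * b) * (1 + ?y) \<le> max 1 (2 * b) * (2 * 2 powr ?y)" by (rule mult_left_mono) simp
    moreover have "real (Suc m) \<le> max 1 (2 * b) * (1 + ?y)"
    proof -
      have "real m = 2 * b * ?y" using assms by simp
      also have "... \<le> max 1 (2 * b) * ?y" using y by (intro mult_right_mono) auto
      finally show ?thesis by (simp add: algebra_simps)
    qed
    ultimately have "real (Suc m) \<le> max 1 (2 * b) * (2 * 2 powr ?y)" by linarith
    then show ?thesis by (simp add: mult_ac)
  qed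
  then have "(of_nat (Suc m) :: ennreal) \<le> ennreal (2 * max 1 (2 * b)) * dyad (of_nat m / (2 * b))"
    unfolding dyad_def ennreal_of_nat_eq_real_of_nat by (subst ennreal_mult[symmetric]) (auto intro!: ennreal_leI simp del: of_nat_Suc)
  then have "(of_nat (Suc m) :: ennreal) powe b \<le> (ennreal (2 * max 1 (2 * b)) * dyad (of_nat m / (2 * b))) powe b"
    using assms by (intro powe_mono) auto
  also have "... = ennreal (2 * max 1 (2 * b)) powe b * dyad (of_nat m / 2)"
    using assms by (simp add: powe_mult dyad_powe)
  finally show ?thesis .
qed

section \<open>Necessity of the local conditions for q < p\<close>

context hardy_setting
begin

abbreviation window :: "(real \<Rightarrow> int) \<Rightarrow> int \<Rightarrow> nat \<Rightarrow> real set" where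
  "window ka j m \<equiv> {t. j \<le> ka t \<and> ka t \<le> j + int m}"

definition KW :: "(real \<Rightarrow> int) \<Rightarrow> int \<Rightarrow> nat \<Rightarrow> ennreal" where
  "KW ka j m = KQ r q (cut (window ka j m) u) (cut (window ka j m) v)"

text \<open>Almost extremal functions of all windows of the same length are added. On the left each
  t lies in at most m + 1 windows, whence the factor; on the right the j-th summand starts at band j
  and its primitive is at most 2^(j/p) z_j, so the estimate of \<open>Rp\<close> does not see
  m.\<close>

lemma window_sum:
  assumes k: "band ka" and D: "bounded_by D" "D < top" and qp: "q < p"
  shows "zsum (\<lambda>j. (dyad (of_int j * (q / p)) * KW ka j m) powe (p / (p - q)))
    \<le> (of_nat (Suc m) * (2 * (D * c_hardy p 1 powe (q / p)))) powe (p / (p - q))"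
proof (rule zsum_least, rule powe_dual_sum[OF pos(2) qp])
  have c: "c_hardy p 1 < top" using pos by (intro c_hardy_finite) auto
  then show "of_nat (Suc m) * (2 * (D * c_hardy p 1 powe (q / p))) < top"
    using D(2) pos by (simp add: ennreal_mult_less_top powe_less_top_iff of_nat_less_top del: of_nat_Suc)
  fix J :: "int set" and z :: "int \<Rightarrow> ennreal" assume J: "finite J"
  note [measurable] = band_set[OF k]
  have ind_ge: "(\<lambda>x. ind {t. j \<le> ka t} x) \<in> BM" for j by (rule band_set[OF k])
  have ind_w: "(\<lambda>x. ind (window ka j m) x :: ennreal) \<in> BM" for j
    by (rule band_set[OF k, of "\<lambda>i. j \<le> i \<and> i \<le> j + int m"])
  note [measurable] = ind_ge ind_w
  have Kfin: "KW ka j m < top" for j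
  proof -
    have "KW ka j m \<le> KQ\<^sub>c {t. j \<le> ka t}"
      unfolding KW_def using pos by (intro KQ_mono) (auto simp: indicator_def)
    also have "... \<le> D * mass {t. j \<le> ka t} w powe (q / p)"
      using band_monoD[OF k] by (intro KQ_cut_le[OF D(1)]) (auto intro: order_trans)
    also have "... \<le> D * dyad (- of_int j) powe (q / p)"
      using pos by (intro mult_left_mono powe_mono band_mass[OF k]) auto
    also have "... < top" using D(2) by (simp add: dyad_powe ennreal_mult_less_top)
    finally show ?thesis .
  qed
  have "\<exists>f. f \<in> BM \<and> (\<I> x. f x) \<le> 1 \<and>
    KW ka j m \<le> 2 * (\<I> t. head (\<lambda>s. f s powe r * cut (window ka j m) v s) t powe (q / r) * cut (window ka j m) u t)" for j
  proof (cases "KW ka j m = 0")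
    case True
    then show ?thesis by (intro exI[of _ "\<lambda>_. 0"]) auto
  next
    case False
    let ?K = "KW ka j m"
    have "?K / 2 < ?K"
    proof (rule ccontr)
      assume "\<not> ?thesis"
      then have "?K / 2 + ?K / 2 \<le> ?K / 2 + 0" by (simp add: ennreal_half_add)
      then have "?K / 2 \<le> 0"
        using Kfin[of j] by (subst (asm) ennreal_add_left_cancel_le) (auto simp: ennreal_divide_eq_top_iff)
      then show False using False by (simp add: ennreal_divide_eq_0_iff)
    qed
    then obtain f where "f \<in> BM" "(\<I> x. f x) \<le> 1"
      and f: "?K / 2 < (\<I> t. head (\<lambda>s. f s powe r * cut (window ka j m) v s) t powe (q / r) * cut (window ka j m) u t)"
      unfolding KW_def by (rule KQ_obtain)
    then show ?thesis using add_mono[OF less_imp_le[OF f] less_imp_le[OF f]]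
      by (intro exI[of _ f]) (simp add: ennreal_half_add mult_2)
  qed
  then have "\<forall>j. \<exists>f. f \<in> BM \<and> (\<I> x. f x) \<le> 1 \<and>
    KW ka j m \<le> 2 * (\<I> t. head (\<lambda>s. f s powe r * cut (window ka j m) v s) t powe (q / r) * cut (window ka j m) u t)"
    by blast
  from choice[OF this] obtain f where fc: "\<forall>j. f j \<in> BM \<and> (\<I> x. f j x) \<le> 1 \<and>
    KW ka j m \<le> 2 * (\<I> t. head (\<lambda>s. f j s powe r * cut (window ka j m) v s) t powe (q / r) * cut (window ka j m) u t)"
    by blast
  have fm [measurable]: "f j \<in> BM" for j using fc by blast
  let ?f = "\<lambda>x. \<Sum>j\<in>J. dyad (of_int j / p) * z j * cut {t. j \<le> ka t} (f j) x"
  let ?H = "\<lambda>t. head (pw ?f r v) t powe (q / r)"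
  have Fm [measurable]: "?f \<in> BM" by measurable
  have "(\<Sum>j\<in>J. (dyad (of_int j * (q / p)) * KW ka j m) * z j powe q)
      \<le> (\<Sum>j\<in>J. 2 * (\<I> t. ?H t * cut (window ka j m) u t))"
  proof (rule sum_mono)
    fix j assume j: "j \<in> J"
    let ?h = "\<lambda>t. head (\<lambda>s. f j s powe r * cut (window ka j m) v s) t"
    have hH: "(dyad (of_int j * (q / p)) * z j powe q) * ?h t powe (q / r) \<le> ?H t" for t
    proof -
      have "dyad (of_int j * (r / p)) * z j powe r * ?h t =
          head (\<lambda>s. (dyad (of_int j / p) * z j * f j s) powe r * cut (window ka j m) v s) t"
        unfolding head_def using pos
        by (subst nn_integral_cmult[symmetric]) (auto simp: powe_mult dyad_powe mult_ac)
      also have "... \<le> head (pw ?f r v) t"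
      proof (rule head_mono_fun)
        fix s
        show "(dyad (of_int j / p) * z j * f j s) powe r * cut (window ka j m) v s \<le> ?f s powe r * v s"
        proof (cases "s \<in> window ka j m")
          case True
          have "dyad (of_int j / p) * z j * cut {t. j \<le> ka t} (f j) s \<le> ?f s"
            using J j by (intro member_le_sum) auto
          then have "dyad (of_int j / p) * z j * f j s \<le> ?f s" using True by simp
          then show ?thesis using True pos by (auto intro!: mult_right_mono powe_mono)
        qed simp
      qed
      finally have "(dyad (of_int j * (r / p)) * z j powe r * ?h t) powe (q / r) \<le> ?H t"
        using pos by (intro powe_mono) auto
      then show ?thesis using pos by (simp add: powe_mult powe_powe dyad_powe)
    qed
    have "(dyad (of_int j * (q / p)) * KW ka j m) * z j powe q
        \<le> (dyad (of_int j * (q / p)) * (2 * (\<I> t. ?h t powe (q / r) * cut (window ka j m) u t))) * z j powe q"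
      using fc by (intro mult_right_mono mult_left_mono) auto
    also have "... = 2 * (\<I> t. (dyad (of_int j * (q / p)) * z j powe q) * (?h t powe (q / r) * cut (window ka j m) u t))"
      by (subst nn_integral_cmult) (auto simp: mult_ac)
    also have "... \<le> 2 * (\<I> t. ?H t * cut (window ka j m) u t)"
    proof (intro mult_left_mono nn_integral_mono)
      fix t
      show "(dyad (of_int j * (q / p)) * z j powe q) * (?h t powe (q / r) * cut (window ka j m) u t) \<le> ?H t * cut (window ka j m) u t"
        using mult_right_mono[OF hH, of "cut (window ka j m) u t" t] by (simp only: mult.assoc zero_le simp_thms)
    qed simp
    finally show "(dyad (of_int j * (q / p)) * KW ka j m) * z j powe q \<le> 2 * (\<I> t. ?H t * cut (window ka j m) u t)" .
  qed
  also have "... = 2 * (\<I> t. (\<Sum>j\<in>J. ?H t * cut (window ka j m) u t))"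
    by (subst nn_integral_sum) (auto simp: sum_distrib_left)
  also have "... \<le> 2 * (\<I> t. of_nat (Suc m) * (?H t * u t))"
  proof (intro mult_left_mono nn_integral_mono)
    fix t
    have "(\<Sum>j\<in>J. ?H t * cut (window ka j m) u t) =
        (\<Sum>j\<in>J. ind {j. j \<le> ka t \<and> ka t \<le> j + int m} j) * (?H t * u t)"
      unfolding sum_distrib_right by (intro sum.cong refl) (auto simp: indicator_def)
    also have "... \<le> of_nat (Suc m) * (?H t * u t)" by (intro mult_right_mono card_window_le J) simp
    finally show "(\<Sum>j\<in>J. ?H t * cut (window ka j m) u t) \<le> of_nat (Suc m) * (?H t * u t)" .
  qed simp
  also have "... = 2 * (of_nat (Suc m) * Lq ?f)" unfolding Lq_def by (subst nn_integral_cmult) auto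
  also have "... \<le> 2 * (of_nat (Suc m) * (D * Rp ?f powe (q / p)))"
    using D(1) by (intro mult_left_mono) (auto simp: bounded_by_def)
  also have "... \<le> 2 * (of_nat (Suc m) * (D * (c_hardy p 1 * (\<Sum>j\<in>J. z j powe p)) powe (q / p)))"
  proof (intro mult_left_mono powe_mono)
    have "Rp ?f \<le> c_hardy p 1 * zsum (\<lambda>j. dyad (- of_int j) * (dyad (of_int j / p) * z j * ind J j) powe p)"
    proof (rule Rp_upper_steps[OF k])
      fix t assume t: "t \<in> space M"
      have "head ?f t = (\<Sum>j\<in>J. dyad (of_int j / p) * z j * head (cut {t. j \<le> ka t} (f j)) t)"
        unfolding head_def sum_distrib_right
        by (subst nn_integral_sum) (auto intro!: sum.cong simp: mult.assoc nn_integral_cmult)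
      also have "... \<le> (\<Sum>j\<in>J. dyad (of_int j / p) * z j * ind {..ka t} j)"
      proof (intro sum_mono mult_left_mono)
        fix j
        show "head (cut {t. j \<le> ka t} (f j)) t \<le> ind {..ka t} j"
        proof (cases "j \<le> ka t")
          case True
          have "head (cut {t. j \<le> ka t} (f j)) t \<le> (\<I> x. f j x)"
            unfolding head_def by (intro nn_integral_mono) (auto simp: indicator_def)
          also have "... \<le> 1" using fc by blast
          finally show ?thesis using True by simp
        next
          case False
          then have "head (cut {t. j \<le> ka t} (f j)) t = (\<I> x. 0)"
            unfolding head_def using band_monoD[OF k _ t] by (intro nn_integral_cong) (force simp: indicator_def)
          then show ?thesis by simp
        qed
      qed simp
      also have "... = (\<Sum>j\<in>J. dyad (of_int j / p) * z j * ind J j * ind {..ka t} j)"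
        by (intro sum.cong) auto
      also have "... \<le> zsum (\<lambda>j. dyad (of_int j / p) * z j * ind J j * ind {..ka t} j)"
        by (rule sum_le_zsum[OF J])
      finally show "head ?f t \<le> zsum (\<lambda>j. dyad (of_int j / p) * z j * ind J j * ind {..ka t} j)" .
    qed
    also have "zsum (\<lambda>j. dyad (- of_int j) * (dyad (of_int j / p) * z j * ind J j) powe p) = (\<Sum>j\<in>J. z j powe p)"
    proof -
      have "dyad (- of_int j) * (dyad (of_int j / p) * z j * ind J j) powe p = z j powe p * ind J j" for j
      proof (cases "j \<in> J")
        case True
        have "dyad (- of_int j) * (dyad (of_int j / p) * z j * ind J j) powe p = (dyad (- of_int j) * dyad (of_int j)) * z j powe p"
          using True pos by (simp add: powe_mult dyad_powe mult.assoc)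
        then show ?thesis using True by (simp add: dyad_minus)
      qed (use pos in simp)
      then have "zsum (\<lambda>j. dyad (- of_int j) * (dyad (of_int j / p) * z j * ind J j) powe p) =
          zsum (\<lambda>j. z j powe p * ind J j)" by (simp only:)
      also have "... = (\<Sum>j\<in>J. z j powe p)"
        using J by (subst nn_integral_count_space'[of J]) (auto simp: indicator_def intro!: sum.cong)
      finally show ?thesis .
    qed
    finally show "Rp ?f \<le> c_hardy p 1 * (\<Sum>j\<in>J. z j powe p)" .
  qed (use pos in auto)
  also have "... = of_nat (Suc m) * (2 * (D * c_hardy p 1 powe (q / p))) * (\<Sum>j\<in>J. z j powe p) powe (q / p)"
    using pos by (simp add: powe_mult mult_ac del: of_nat_Suc)
  finally show "(\<Sum>j\<in>J. (dyad (of_int j * (q / p)) * KW ka j m) * z j powe q)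
    \<le> of_nat (Suc m) * (2 * (D * c_hardy p 1 powe (q / p))) * (\<Sum>j\<in>J. z j powe p) powe (q / p)" .
qed

definition c_window :: ennreal where
  "c_window = dyad (2 * (p / (p - q))) * (ennreal (2 * max 1 (2 * (p / (p - q)))) powe (p / (p - q)) * geo (1 / 2))
     * (2 * c_hardy p 1 powe (q / p)) powe (p / (p - q))"

text \<open>A pair y < x lies in the window from \<open>ka y\<close> to \<open>ka x\<close>, and the
  supremum over y is bounded by a sum over the starting band. If n is the distance of the two bands,
  the w-mass of the last band leaves a factor 2^(-n) against the power of n + 1 lost in
  \<open>window_sum\<close>.\<close>

lemma window_lower:
  assumes k: "band ka" and D: "bounded_by D" "D < top" and qp: "q < p"
  shows "(\<I> x. w x * (SUP y\<in>{y\<in>space M. y < x}. (tail w y powe (- 1) * K y x) powe (p / (p - q))))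
     \<le> c_window * D powe (p / (p - q))"
proof -
  define b where "b = p / (p - q)"
  have b: "0 < b" "b - 1 = q / p * b" using qp pos by (auto simp: b_def field_simps)
  let ?c = "2 * (D * c_hardy p 1 powe (q / p))" and ?e = "ennreal (2 * max 1 (2 * b)) powe b"
  let ?T = "\<lambda>i n. dyad ((of_int i + 2) * b) * KW ka i n powe b"
  let ?Z = "\<lambda>k. zsum (\<lambda>i. ?T i (nat (k - i)) * ind {..k} i)"
  have pt: "(SUP y\<in>{y\<in>space M. y < x}. (tail w y powe (- 1) * K y x) powe b) \<le> ?Z (ka x)" if x: "x \<in> space M" for x
  proof (rule SUP_least)
    fix y assume "y \<in> {y \<in> space M. y < x}"
    then have y: "y \<in> space M" "y < x" by auto
    have yx: "ka y \<le> ka x" using band_monoD[OF k y(1) x] y by simp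
    have "dyad (- of_int (ka y) - 2) \<le> tail w y" by (rule band_ge[OF k y(1)])
    then have "tail w y powe (- 1) \<le> dyad (- ((- of_int (ka y) - 2) * 1))" by (intro powe_neg_dyad_le) auto
    moreover have "K y x \<le> KW ka (ka y) (nat (ka x - ka y))"
    proof -
      have "ka y \<le> ka t \<and> ka t \<le> ka x" if "t \<in> space M" "y \<le> t" "t < x" for t
        using band_monoD[OF k y(1) that(1)] band_monoD[OF k that(1) x] that by simp
      then show ?thesis unfolding K_def KW_def using yx pos by (intro KQ_mono) (auto simp: indicator_def)
    qed
    ultimately have "(tail w y powe (- 1) * K y x) powe b \<le> (dyad (of_int (ka y) + 2) * KW ka (ka y) (nat (ka x - ka y))) powe b"
      using b by (intro powe_mono mult_mono) (auto simp: algebra_simps)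
    also have "... = ?T (ka y) (nat (ka x - ka y)) * ind {..ka x} (ka y)"
      using b yx by (simp add: powe_mult dyad_powe)
    also have "... \<le> ?Z (ka x)" by (rule term_le_zsum)
    finally show "(tail w y powe (- 1) * K y x) powe b \<le> ?Z (ka x)" .
  qed
  have "(\<I> x. w x * (SUP y\<in>{y\<in>space M. y < x}. (tail w y powe (- 1) * K y x) powe b))
      \<le> (\<I> x. w x * ?Z (ka x))" using pt by (intro nn_integral_mono mult_left_mono) auto
  also have "... \<le> zsum (\<lambda>k. ?Z k * dyad (- of_int k))" by (rule band_integral_le[OF k])
  also have "... = zsum (\<lambda>k. zsum (\<lambda>i. dyad (- of_int k) * (?T i (nat (k - i)) * ind {..k} i)))"
    by (simp only: zsum_cmult mult.commute)
  \<comment> \<open>The substitution n = k - i groups the windows by length, as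
    \<open>window_sum\<close> requires.\<close>
  also have "... = zsum (\<lambda>k. zsum (\<lambda>n. dyad (- of_int k) * (?T (k - n) (nat n) * ind {0..} n)))"
  proof (rule nn_integral_cong)
    fix k :: int
    show "zsum (\<lambda>i. dyad (- of_int k) * (?T i (nat (k - i)) * ind {..k} i)) =
        zsum (\<lambda>n. dyad (- of_int k) * (?T (k - n) (nat n) * ind {0..} n))"
      using zsum_diff[of "\<lambda>i. dyad (- of_int k) * (?T i (nat (k - i)) * ind {..k} i)" k]
      by (simp add: indicator_def)
  qed
  also have "... = zsum (\<lambda>n. zsum (\<lambda>k. dyad (- of_int k) * (?T (k - n) (nat n) * ind {0..} n)))"
    by (rule zsum_zsum_swap)
  also have "... = zsum (\<lambda>n. zsum (\<lambda>i. dyad (- of_int (i + n)) * (?T i (nat n) * ind {0..} n)))"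
  proof (rule nn_integral_cong)
    fix n :: int
    show "zsum (\<lambda>k. dyad (- of_int k) * (?T (k - n) (nat n) * ind {0..} n)) =
        zsum (\<lambda>i. dyad (- of_int (i + n)) * (?T i (nat n) * ind {0..} n))"
      using zsum_shift[of "\<lambda>k. dyad (- of_int k) * (?T (k - n) (nat n) * ind {0..} n)" n] by simp
  qed
  also have "... = zsum (\<lambda>n. (dyad (2 * b) * dyad (- of_int n) * ind {0..} n) *
      zsum (\<lambda>i. (dyad (of_int i * (q / p)) * KW ka i (nat n)) powe b))"
  proof (intro nn_integral_cong)
    fix n :: int
    have "dyad (- of_int (i + n)) * ?T i (nat n) = dyad (2 * b) * dyad (- of_int n) * (dyad (of_int i * (q / p)) * KW ka i (nat n)) powe b" for i
    proof -
      have "dyad (- of_int (i + n)) * ?T i (nat n) = (dyad (- of_int (i + n)) * dyad ((of_int i + 2) * b)) * KW ka i (nat n) powe b"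
        by (simp only: mult.assoc)
      also have "dyad (- of_int (i + n)) * dyad ((of_int i + 2) * b) = dyad (2 * b - of_int n + of_int i * (b - 1))"
        by (simp add: dyad_add[symmetric] algebra_simps)
      also have "... = dyad (2 * b) * dyad (- of_int n) * dyad (of_int i * (q / p) * b)"
        unfolding b(2) by (simp add: dyad_add[symmetric] mult.assoc)
      finally show ?thesis using b by (simp add: powe_mult dyad_powe mult.assoc)
    qed
    then have "dyad (- of_int (i + n)) * (?T i (nat n) * ind {0..} n) =
      (dyad (2 * b) * dyad (- of_int n) * ind {0..} n) * (dyad (of_int i * (q / p)) * KW ka i (nat n)) powe b" for i
      by (simp add: mult.assoc[symmetric]) (simp add: mult_ac)
    then show "zsum (\<lambda>i. dyad (- of_int (i + n)) * (?T i (nat n) * ind {0..} n)) =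
      (dyad (2 * b) * dyad (- of_int n) * ind {0..} n) *
      zsum (\<lambda>i. (dyad (of_int i * (q / p)) * KW ka i (nat n)) powe b)" by (simp only: zsum_cmult)
  qed
  also have "... \<le> zsum (\<lambda>n. (dyad (2 * b) * dyad (- of_int n) * ind {0..} n) *
      ((?e * dyad (of_int n / 2)) * ?c powe b))"
  proof (rule zsum_mono)
    fix n :: int
    show "(dyad (2 * b) * dyad (- of_int n) * ind {0..} n) *
      zsum (\<lambda>i. (dyad (of_int i * (q / p)) * KW ka i (nat n)) powe b)
      \<le> (dyad (2 * b) * dyad (- of_int n) * ind {0..} n) *
      ((?e * dyad (of_int n / 2)) * ?c powe b)"
    proof (cases "0 \<le> n")
      case True
      have "zsum (\<lambda>i. (dyad (of_int i * (q / p)) * KW ka i (nat n)) powe b)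
        \<le> (of_nat (Suc (nat n)) * ?c) powe b" unfolding b_def by (rule window_sum[OF k D qp])
      also have "... = of_nat (Suc (nat n)) powe b * ?c powe b" by (rule powe_mult[OF b(1)])
      also have "... \<le> (?e * dyad (of_nat (nat n) / 2)) * ?c powe b"
        by (intro mult_right_mono Suc_powe_le b) simp
      finally show ?thesis using True by (intro mult_left_mono) auto
    qed simp
  qed
  also have "... = zsum (\<lambda>n. (dyad (2 * b) * ?e * ?c powe b) *
      (dyad (- (1 / 2 * of_int n)) * ind {0..} n))"
  proof (intro nn_integral_cong)
    fix n :: int
    have eq: "dyad (- of_int n) * dyad (of_int n / 2) = dyad (- (1 / 2 * of_int n))" by (simp add: dyad_add[symmetric])
    have "(dyad (2 * b) * dyad (- of_int n) * ind {0..} n) *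
      ((?e * dyad (of_int n / 2)) * ?c powe b) =
      (dyad (2 * b) * ?e * ?c powe b) *
      ((dyad (- of_int n) * dyad (of_int n / 2)) * ind {0..} n)" by (simp only: mult_ac)
    then show "(dyad (2 * b) * dyad (- of_int n) * ind {0..} n) *
      ((?e * dyad (of_int n / 2)) * ?c powe b) =
      (dyad (2 * b) * ?e * ?c powe b) *
      (dyad (- (1 / 2 * of_int n)) * ind {0..} n)" by (simp only: eq)
  qed
  also have "... = (dyad (2 * b) * ?e * ?c powe b) * geo (1 / 2)" by (simp only: zsum_cmult geo_def)
  also have "... = c_window * D powe b"
    unfolding c_window_def b_def[symmetric] using b by (simp add: powe_mult mult_ac)
  finally show ?thesis by (simp only: b_def)
qed

lemma c_window_finite: "q < p \<Longrightarrow> c_window < top" using geo_finite[of "1/2"] c_hardy_finite[of p 1] pos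
  by (simp add: c_window_def ennreal_mult_less_top powe_less_top_iff)

section \<open>Necessity of \<open>C6\<close>\<close>

definition \<eta> :: real where "\<eta> = (p - r) * q / ((p - q) * r)"

text \<open>\<eta> is the exponent of the last factor in \<open>C6\<close>. The final two identities
  say that it turns the power \<theta>/q of \<open>C3_lower\<close> into p/(p - q), and that it is
  the exponent of S in \<open>steps_lower\<close>.\<close>

lemma exponent_eqs:
  assumes "r < p" "q < p"
  shows "0 < \<theta>" "0 < \<eta>" "0 < p / (p - q)" "0 < q / (p - q)" "p / (p - q) = q / (p - q) + 1"
    "\<theta> / q * \<eta> = p / (p - q)" "1 / \<theta> * (p * q / (p - q)) = \<eta>"
proof -
  have 1: "x * r / a / q * (a * q / (b * r)) = x / b" if "a \<noteq> 0" "b \<noteq> 0" for x a b using that pos by simp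
  have 2: "1 / (x * r / a) * (x * q / b) = a * q / (b * r)" if "x \<noteq> 0" "a \<noteq> 0" "b \<noteq> 0" for x a b
    using that pos by simp
  show "0 < \<theta>" "0 < \<eta>" "0 < p / (p - q)" "0 < q / (p - q)" "p / (p - q) = q / (p - q) + 1"
    using assms pos by (auto simp: \<theta>_def \<eta>_def field_simps)
  show "\<theta> / q * \<eta> = p / (p - q)" "1 / \<theta> * (p * q / (p - q)) = \<eta>"
    unfolding \<theta>_def \<eta>_def using assms pos 1[of "p - r" "p - q" p] 2[of p "p - r" "p - q"] by simp_all
qed

definition c_Q :: ennreal where
  "c_Q = dyad (2 * (p / (p - r))) * c_hardy (p / (p - r)) (p / (p - r) - 1)"

definition c_six :: ennreal where
  "c_six = dyad 2 * geo 1 * (2 * (c_Q powe \<eta> *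
     (c_lower p q \<eta> * (c_steps powe (q / p) / dyad (- 2) powe (q / r)) powe (p / (p - q)))))"

lemma c_Q_finite: "r < p \<Longrightarrow> c_Q < top" using c_hardy_finite[of "p / (p - r)" "p / (p - r) - 1"] pos
  by (simp add: c_Q_def ennreal_mult_less_top field_simps)

lemma c_steps_finite: "c_steps < top"
  using c_hardy_finite[of p 1] pos by (simp add: c_steps_def ennreal_mult_less_top)

lemma c_six_finite: assumes "r < p" "q < p" shows "c_six < top"
proof -
  have "c_steps powe (q / p) < top" "dyad (- 2) powe (q / r) \<noteq> 0"
    using c_steps_finite pos by (simp_all add: powe_less_top_iff dyad_powe)
  then have "c_steps powe (q / p) / dyad (- 2) powe (q / r) < top"
    by (metis ennreal_divide_eq_top_iff less_top)
  then show ?thesis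
    using exponent_eqs[OF assms] c_Q_finite[OF assms(1)] geo_finite[of 1] c_lower_finite[OF pos(2) assms(2), of \<eta>]
    by (simp add: c_six_def ennreal_mult_less_top powe_less_top_iff)
qed

lemma steps_zero: "r < p \<Longrightarrow> (\<And>x. x \<in> space M \<Longrightarrow> ka x = j \<Longrightarrow> g x = 0) \<Longrightarrow> steps ka g j = 0"
proof -
  assume rp: "r < p" and z: "\<And>x. x \<in> space M \<Longrightarrow> ka x = j \<Longrightarrow> g x = 0"
  have "VR r (cut {t. ka t = j} g) = VR r (\<lambda>t. 0)" using z by (intro VR_cong) (auto simp: indicator_def)
  also have "... \<le> 0" by (rule VR_least) simp
  finally show ?thesis using rp pos by (simp add: steps_def)
qed

text \<open>For y inside a band, Q y is not controlled by the sum of \<open>steps\<close> over the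
  strictly earlier bands. In each of finitely many bands an almost optimal point y i is chosen, and
  the band function is changed so that y i becomes the left end of its band;
  \<open>steps_lower\<close> is then applied to the new band function. Since \<Psi> is an integral,
  the supremum over y reduces to the suprema \<open>m i\<close> belonging to single bands.\<close>

lemma C6_lower:
  assumes k: "band ka" and fine: "\<And>t. t \<in> space M \<Longrightarrow> dyad (- of_int (ka t) - 1) \<le> tail w t"
    and D: "bounded_by D" "D < top" and rp: "r < p" and qp: "q < p"
  shows "(\<I> x. w x * (SUP y\<in>{y\<in>space M. y < x}. tail w y powe (- 1) * \<Psi> y x * Q y powe \<eta>))
     \<le> c_six * D powe (p / (p - q))"
proof -
  define b where "b = p / (p - q)"
  define k0 where "k0 = q / (p - q)"
  note ex = exponent_eqs[OF rp qp, folded b_def k0_def]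
  define g where "g t = tail u t powe k0 * u t" for t
  have gm [measurable]: "g \<in> BM" unfolding g_def[abs_def] by measurable
  note [measurable] = level_set[OF k]
  define G where "G i y = tail (cut {t. ka t = i} g) y" for i y
  define m where "m i = (SUP y\<in>{y\<in>space M. ka y = i}. G i y * Q y powe \<eta>)" for i
  \<comment> \<open>Finiteness allows an almost optimal point to be chosen. It comes from
    \<open>C3_lower\<close>, since G i y is at most the tail of u at y to the power p/(p -
    q).\<close>
  have m_fin: "m i < top" for i
  proof -
    let ?B = "c_Q * ((2 * c_hardy p 1 powe (r / p)) powe (p / (p - r)) * D powe (\<theta> / q))"
    have "m i \<le> ?B powe \<eta>"
    proof (cases "{y\<in>space M. ka y = i} = {}")
      case True
      have "m i = 0" unfolding m_def True by (simp only: image_empty Sup_empty bot_ennreal)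
      then show ?thesis by simp
    next
      case False
      show ?thesis unfolding m_def
      proof (rule SUP_least)
        fix y assume y: "y \<in> {y\<in>space M. ka y = i}"
        have "G i y \<le> (\<I> t. tail u y powe k0 * (u t * ind {y..} t))"
          unfolding G_def g_def tail_def[of "\<lambda>t. tail u t powe k0 * u t * ind {t. ka t = i} t"]
        proof (rule nn_integral_mono)
          fix t
          show "tail u t powe k0 * u t * ind {t. ka t = i} t * ind {y..} t
            \<le> tail u y powe k0 * (u t * ind {y..} t)"
          proof (cases "y \<le> t \<and> ka t = i")
            case True
            have "tail u t powe k0 \<le> tail u y powe k0" using True ex by (intro powe_mono tail_antimono) auto
            then show ?thesis using True by (simp add: mult_right_mono)
          next
            case False
            then show ?thesis by (auto simp: indicator_def)
          qed
        qed
        also have "... = tail u y powe k0 * tail u y" unfolding tail_def[of u y] by (rule nn_integral_cmult) measurable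
        also have "... = tail u y powe b" using powe_add[of k0 1 "tail u y"] ex by simp
        also have "... = (tail u y powe (\<theta> / q)) powe \<eta>"
        proof -
          have "0 < \<theta> / q" using ex(1) pos by simp
          then show ?thesis using ex(2) by (subst powe_powe) (simp_all only: ex(6))
        qed
        finally have "G i y * Q y powe \<eta> \<le> (tail u y powe (\<theta> / q)) powe \<eta> * Q y powe \<eta>"
          by (rule mult_right_mono) simp
        also have "... = (tail u y powe (\<theta> / q) * Q y) powe \<eta>" by (rule powe_mult[OF ex(2), symmetric])
        also have "... \<le> ?B powe \<eta>"
          using ex(2) C3_lower[OF k D rp, of y] y by (intro powe_mono) (auto simp: c_Q_def)
        finally show "G i y * Q y powe \<eta> \<le> ?B powe \<eta>" .
      qed
    qed
    also have "?B powe \<eta> < top"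
    proof -
      have "0 < \<theta> / q" "0 < p / (p - r)" using ex(1) pos rp by auto
      then show ?thesis using ex(2) c_Q_finite[OF rp] c_hardy_finite[of p 1] pos D(2)
        by (simp add: ennreal_mult_less_top powe_less_top_iff)
    qed
    finally show ?thesis .
  qed
  let ?L = "c_lower p q \<eta> * (D * c_steps powe (q / p) / dyad (- 2) powe (q / r)) powe b"
  have m_sum: "zsum m \<le> 2 * (c_Q powe \<eta> * ?L)"
  proof (rule zsum_least)
    fix J :: "int set" assume J: "finite J"
    let ?J = "{i\<in>J. m i \<noteq> 0}"
    have "\<exists>y. y \<in> space M \<and> ka y = i \<and> m i \<le> 2 * (G i y * Q y powe \<eta>)" if i: "i \<in> ?J" for i
    proof -
      have "m i / 2 < m i"
      proof (rule ccontr)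
        assume "\<not> ?thesis"
        then have "m i / 2 + m i / 2 \<le> m i / 2 + 0" by (simp add: ennreal_half_add)
        then have "m i / 2 \<le> 0"
          using m_fin[of i] by (subst (asm) ennreal_add_left_cancel_le) (auto simp: ennreal_divide_eq_top_iff)
        then show False using i by (simp add: ennreal_divide_eq_0_iff)
      qed
      then obtain y where y: "y \<in> space M" "ka y = i" "m i / 2 < G i y * Q y powe \<eta>"
        unfolding m_def[of i] less_SUP_iff by auto
      have "m i \<le> 2 * (G i y * Q y powe \<eta>)"
        using add_mono[OF less_imp_le[OF y(3)] less_imp_le[OF y(3)]] by (simp add: ennreal_half_add mult_2)
      with y show ?thesis by blast
    qed
    then have "\<forall>i\<in>?J. \<exists>y. y \<in> space M \<and> ka y = i \<and> m i \<le> 2 * (G i y * Q y powe \<eta>)" by blast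
    from bchoice[OF this] obtain y where y: "\<forall>i\<in>?J. y i \<in> space M \<and> ka (y i) = i \<and> m i \<le> 2 * (G i (y i) * Q (y i) powe \<eta>)"
      by blast
    \<comment> \<open>Only the part of a selected band from its point y i on keeps its number;
      everything else is lowered by 1. By \<open>fine\<close> W still agrees with 2^(-ka') within a
      factor 4, and all points left of y i have numbers below i.\<close>
    define ka' where "ka' t = (if ka t \<in> ?J \<and> y (ka t) \<le> t then ka t else ka t - 1)" for t
    have k'_bounds: "ka t - 1 \<le> ka' t" "ka' t \<le> ka t" for t by (auto simp: ka'_def)
    have k': "band ka'" unfolding band_def
    proof (intro conjI ballI mono_onI)
      fix s t assume st: "s \<in> space M" "t \<in> space M" "s \<le> t"
      show "ka' s \<le> ka' t"
      proof (cases "ka s = ka t")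
        case True
        then show ?thesis using st(3) by (auto simp: ka'_def)
      next
        case False
        then have "ka s \<le> ka t - 1" using band_monoD[OF k st] by simp
        then show ?thesis using k'_bounds[of s] k'_bounds[of t] by simp
      qed
    next
      fix t assume t: "t \<in> space M"
      have "dyad (- of_int (ka' t) - 2) \<le> dyad (- of_int (ka t) - 1)" using k'_bounds(1)[of t] by simp
      then show "dyad (- of_int (ka' t) - 2) \<le> tail w t" using fine[OF t] by (rule order_trans)
      have "dyad (- of_int (ka t)) \<le> dyad (- of_int (ka' t))" using k'_bounds(2)[of t] by simp
      with band_le[OF k t] show "tail w t \<le> dyad (- of_int (ka' t))" by (rule order_trans)
    qed
    let ?S = "\<lambda>t. zsum (\<lambda>j. steps ka' v j * ind {..<ka' t} j)"
    have Sm [measurable]: "?S \<in> BM" by (rule measurable_compose[OF band_measurable[OF k']]) simp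
    have QS: "Q (y i) \<le> c_Q * ?S t" if i: "i \<in> ?J" and t: "ka t = i" "y i \<le> t" for i t
    proof -
      have kt: "ka' t = i" using i t by (simp add: ka'_def)
      have below: "ka' s < i" if s: "s \<in> space M" "s < y i" for s
      proof -
        have "ka s \<le> i" using band_monoD[OF k s(1), of "y i"] y i s(2) by auto
        then show ?thesis using s(2) k'_bounds(2)[of s] by (cases "ka s = i") (auto simp: ka'_def)
      qed
      have "Q (y i) \<le> c_Q * zsum (steps ka' (cut {..<y i} v))"
        unfolding c_Q_def by (rule Q_le_steps[OF k' rp])
      also have "... \<le> c_Q * ?S t"
      proof (intro mult_left_mono zsum_mono)
        fix j
        show "steps ka' (cut {..<y i} v) j \<le> steps ka' v j * ind {..<ka' t} j"
        proof (cases "j < i")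
          case True
          have "0 \<le> p / (p - r)" using rp pos by simp
          moreover have "VR r (cut {t. ka' t = j} (cut {..<y i} v)) \<le> VR r (cut {t. ka' t = j} v)"
            by (rule VR_mono) (auto simp: indicator_def)
          ultimately show ?thesis using True kt by (simp add: steps_def powe_mono mult_left_mono)
        next
          case False
          then have "steps ka' (cut {..<y i} v) j = 0"
            using below by (intro steps_zero rp) (force simp: indicator_def)
          then show ?thesis by simp
        qed
      qed simp
      finally show ?thesis .
    qed
    have "(\<Sum>i\<in>J. m i) = (\<Sum>i\<in>?J. m i)" using J by (intro sum.mono_neutral_right) auto
    also have "... \<le> (\<Sum>i\<in>?J. 2 * mass {t. ka t = i} (\<lambda>t. g t * (c_Q * ?S t) powe \<eta>))"
    proof (rule sum_mono)
      fix i assume i: "i \<in> ?J"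
      have "m i \<le> 2 * (G i (y i) * Q (y i) powe \<eta>)" using y i by blast
      also have "G i (y i) * Q (y i) powe \<eta> = (\<I> t. (cut {t. ka t = i} g t * ind {y i..} t) * Q (y i) powe \<eta>)"
        unfolding G_def tail_def by (rule nn_integral_multc[symmetric]) measurable
      also have "... \<le> mass {t. ka t = i} (\<lambda>t. g t * (c_Q * ?S t) powe \<eta>)"
      proof (rule nn_integral_mono)
        fix t
        show "(cut {t. ka t = i} g t * ind {y i..} t) * Q (y i) powe \<eta> \<le> g t * (c_Q * ?S t) powe \<eta> * ind {t. ka t = i} t"
        proof (cases "ka t = i \<and> y i \<le> t")
          case True
          then have "g t * Q (y i) powe \<eta> \<le> g t * (c_Q * ?S t) powe \<eta>"
            using ex(2) by (intro mult_left_mono powe_mono QS[OF i]) auto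
          then show ?thesis using True by simp
        next
          case False
          then show ?thesis by (auto simp: indicator_def)
        qed
      qed
      finally show "m i \<le> 2 * mass {t. ka t = i} (\<lambda>t. g t * (c_Q * ?S t) powe \<eta>)"
        by (simp add: mult_left_mono)
    qed
    also have "... = 2 * (\<Sum>i\<in>?J. mass {t. ka t = i} (\<lambda>t. g t * (c_Q * ?S t) powe \<eta>))"
      by (rule sum_distrib_left[symmetric])
    also have "... \<le> 2 * zsum (\<lambda>i. mass {t. ka t = i} (\<lambda>t. g t * (c_Q * ?S t) powe \<eta>))"
      using J by (intro mult_left_mono sum_le_zsum) auto
    also have "zsum (\<lambda>i. mass {t. ka t = i} (\<lambda>t. g t * (c_Q * ?S t) powe \<eta>)) = (\<I> t. g t * (c_Q * ?S t) powe \<eta>)"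
      by (rule zsum_bands[OF k, symmetric]) measurable
    also have "... = (\<I> t. c_Q powe \<eta> * (tail u t powe k0 * ?S t powe \<eta> * u t))"
      using ex(2) by (intro nn_integral_cong) (simp add: g_def powe_mult mult_ac)
    also have "... = c_Q powe \<eta> * (\<I> t. tail u t powe k0 * ?S t powe \<eta> * u t)"
      by (rule nn_integral_cmult) measurable
    also have "... \<le> c_Q powe \<eta> * ?L"
      using steps_lower[OF k' D rp qp, folded b_def k0_def] unfolding ex(7) by (intro mult_left_mono) auto
    finally show "(\<Sum>i\<in>J. m i) \<le> 2 * (c_Q powe \<eta> * ?L)" by (simp add: mult_left_mono)
  qed
  let ?Z = "\<lambda>k. zsum (\<lambda>i. dyad (of_int i + 2) * m i * ind {..k} i)"
  \<comment> \<open>\<Psi> y x is split over the bands i between those of y and x. There 1/W(y) is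
    at most 2^(i+2), and Q y <= Q t for t right of y, which brings in \<open>m i\<close>.\<close>
  have pt: "(SUP y\<in>{y\<in>space M. y < x}. tail w y powe (- 1) * \<Psi> y x * Q y powe \<eta>) \<le> ?Z (ka x)" if x: "x \<in> space M" for x
  proof (rule SUP_least)
    fix y assume "y \<in> {y \<in> space M. y < x}"
    then have y: "y \<in> space M" "y < x" by auto
    have "dyad (- of_int (ka y) - 2) \<le> tail w y" by (rule band_ge[OF k y(1)])
    then have "tail w y powe (- 1) \<le> dyad (- ((- of_int (ka y) - 2) * 1))" by (intro powe_neg_dyad_le) auto
    then have W: "tail w y powe (- 1) \<le> dyad (of_int (ka y) + 2)" by (simp add: algebra_simps)
    have "\<Psi> y x * Q y powe \<eta> = (\<I> t. g t * ind {y..<x} t * Q y powe \<eta>)"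
      unfolding \<Psi>_def k0_def[symmetric] g_def[symmetric] by (rule nn_integral_multc[symmetric]) measurable
    also have "... = zsum (\<lambda>i. mass {t. ka t = i} (\<lambda>t. g t * ind {y..<x} t * Q y powe \<eta>))"
      by (rule zsum_bands[OF k]) measurable
    finally have eq: "tail w y powe (- 1) * \<Psi> y x * Q y powe \<eta> =
        zsum (\<lambda>i. tail w y powe (- 1) * mass {t. ka t = i} (\<lambda>t. g t * ind {y..<x} t * Q y powe \<eta>))"
      by (simp only: mult.assoc zsum_cmult)
    show "tail w y powe (- 1) * \<Psi> y x * Q y powe \<eta> \<le> ?Z (ka x)" unfolding eq
    proof (rule zsum_mono)
      fix i
      let ?h = "\<lambda>t. g t * ind {y..<x} t * Q y powe \<eta> * ind {t. ka t = i} t"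
      show "tail w y powe (- 1) * (\<I> t. ?h t) \<le> dyad (of_int i + 2) * m i * ind {..ka x} i"
      proof (cases "ka y \<le> i \<and> i \<le> ka x")
        case False
        have "?h t = 0" if "t \<in> space M" for t
          using False band_monoD[OF k y(1) that] band_monoD[OF k that x] by (auto simp: indicator_def)
        then have "(\<I> t. ?h t) = (\<I> t. 0)" by (intro nn_integral_cong) blast
        then show ?thesis by simp
      next
        case True
        have "(\<I> t. ?h t) \<le> m i"
        proof (rule le_of_tails[where T = "{t. ka t = i \<and> y \<le> t}"])
          fix t assume t: "t \<in> {t. ka t = i \<and> y \<le> t}" "t \<in> space M"
          have "tail ?h t \<le> tail (\<lambda>s. cut {t. ka t = i} g s * Q t powe \<eta>) t"
            using t ex(2) Q_mono[OF rp, of y t]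
            by (intro tail_mono_fun) (auto simp: indicator_def intro!: mult_left_mono powe_mono)
          also have "... = G i t * Q t powe \<eta>"
            unfolding G_def tail_def by (subst nn_integral_multc[symmetric]) (auto simp: mult_ac)
          also have "... \<le> m i" unfolding m_def using t by (intro SUP_upper) auto
          finally show "tail ?h t \<le> m i" .
        next
          show "?h \<in> BM" by measurable
          show "?h t = 0" if "t \<notin> {t. ka t = i \<and> y \<le> t}" for t using that by (cases "ka t = i") auto
        qed
        then have "tail w y powe (- 1) * (\<I> t. ?h t) \<le> dyad (of_int (ka y) + 2) * m i"
          by (intro mult_mono W) auto
        also have "... \<le> dyad (of_int i + 2) * m i" using True by (intro mult_right_mono) auto
        finally show ?thesis using True by simp
      qed
    qed
  qed
  have "(\<I> x. w x * (SUP y\<in>{y\<in>space M. y < x}. tail w y powe (- 1) * \<Psi> y x * Q y powe \<eta>))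
      \<le> (\<I> x. w x * ?Z (ka x))" using pt by (intro nn_integral_mono mult_left_mono) auto
  also have "... \<le> zsum (\<lambda>k. ?Z k * dyad (- of_int k))" by (rule band_integral_le[OF k])
  also have "... = zsum (\<lambda>k. zsum (\<lambda>i. dyad (of_int i + 2) * m i * ind {..k} i * dyad (- of_int k)))"
    by (simp only: zsum_cmult)
  also have "... = zsum (\<lambda>i. zsum (\<lambda>k. dyad (of_int i + 2) * m i * ind {..k} i * dyad (- of_int k)))"
    by (rule zsum_zsum_swap)
  also have "... = zsum (\<lambda>i. zsum (\<lambda>k. dyad 2 * m i * (dyad (- (1 * of_int (k - i))) * ind {..k} i)))"
  proof (intro nn_integral_cong)
    fix i k :: int
    have eq: "dyad (of_int i + 2) * dyad (- of_int k) = dyad 2 * dyad (- (1 * of_int (k - i)))"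
      by (simp add: dyad_add[symmetric] algebra_simps)
    have "dyad (of_int i + 2) * m i * ind {..k} i * dyad (- of_int k) =
        (dyad (of_int i + 2) * dyad (- of_int k)) * (m i * ind {..k} i)" by (simp only: mult_ac)
    also have "... = dyad 2 * m i * (dyad (- (1 * of_int (k - i))) * ind {..k} i)"
      unfolding eq by (simp only: mult_ac)
    finally show "dyad (of_int i + 2) * m i * ind {..k} i * dyad (- of_int k) =
      dyad 2 * m i * (dyad (- (1 * of_int (k - i))) * ind {..k} i)" .
  qed
  also have "... = dyad 2 * geo 1 * zsum m" by (simp only: zsum_cmult zsum_geo') (simp only: mult_ac)
  also have "... \<le> dyad 2 * geo 1 * (2 * (c_Q powe \<eta> * ?L))" by (intro mult_left_mono m_sum) simp
  also have "... = c_six * D powe b"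
  proof -
    have "D * c_steps powe (q / p) / dyad (- 2) powe (q / r) = D * (c_steps powe (q / p) / dyad (- 2) powe (q / r))"
      by (simp add: ennreal_times_divide)
    then show ?thesis unfolding c_six_def b_def[symmetric] using ex(3) by (simp add: powe_mult mult_ac)
  qed
  finally show ?thesis by (simp only: b_def)
qed

end

text \<open>Sequences become measures on the line carried by the integers, so that the Hardy
  inequalities for measures also cover sums over bands.\<close>

lemma emeasure_int_sum:
  assumes "B \<in> sets borel"
  shows "emeasure (distr (density (count_space UNIV) e) borel real_of_int) B = zsum (\<lambda>k. e k * ind B (of_int k))"
proof -
  have "emeasure (distr (density (count_space UNIV) e) borel real_of_int) B =
      emeasure (density (count_space UNIV) e) (real_of_int -` B \<inter> UNIV)"
    using assms by (subst emeasure_distr) auto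
  also have "... = zsum (cut (real_of_int -` B) e)" by (subst emeasure_density) auto
  finally show ?thesis by (simp add: indicator_def)
qed

context hardy_setting
begin

section \<open>Sufficiency\<close>

abbreviation VB :: "(real \<Rightarrow> int) \<Rightarrow> int \<Rightarrow> ennreal" where
  "VB ka j \<equiv> VR r (cut {t. ka t = j} v)"

abbreviation bm :: "(real \<Rightarrow> int) \<Rightarrow> (real \<Rightarrow> ennreal) \<Rightarrow> int \<Rightarrow> ennreal" where
  "bm ka f \<equiv> \<lambda>k. dyad (- of_int k) * mass {t. ka t = k} f powe p"

text \<open>The last condition makes the band after each nonempty band heavy, which lets integrals
  against w dominate discrete sums. The factor 2 in the lower bound for W is the room that
  \<open>C6_lower\<close> uses up.\<close>

definition full_band :: "(real \<Rightarrow> int) \<Rightarrow> bool" where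
  "full_band ka \<longleftrightarrow> band ka \<and>
     (\<forall>t\<in>space M. dyad (- of_int (ka t) - 1) \<le> tail w t \<and>
        dyad (- of_int (ka t) - 2) \<le> mass {s. ka s = ka t + 1} w)"

lemma full_bandD:
  assumes "full_band ka"
  shows "band ka" "\<And>t. t \<in> space M \<Longrightarrow> dyad (- of_int (ka t) - 1) \<le> tail w t"
    "\<And>t. t \<in> space M \<Longrightarrow> dyad (- of_int (ka t) - 2) \<le> mass {s. ka s = ka t + 1} w"
  using assms by (auto simp: full_band_def)

text \<open>On band k + 1 the primitive F is at least the whole mass of f on band k, and that band
  has w-mass at least 2^(-k-2) if band k is nonempty.\<close>

lemma Rp_lower:
  assumes k: "full_band ka" and [measurable]: "f \<in> BM"
  shows "zsum (bm ka f) \<le> dyad 2 * Rp f"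
proof -
  note kb = full_bandD(1)[OF k]
  note [measurable] = level_set[OF kb]
  let ?a = "\<lambda>k. mass {t. ka t = k} f"
  have "zsum (\<lambda>k. dyad (- of_int k) * ?a k powe p)
      \<le> zsum (\<lambda>k. dyad 2 * mass {t. ka t = k + 1} (\<lambda>t. head f t powe p * w t))"
  proof (rule zsum_mono)
    fix k
    show "dyad (- of_int k) * ?a k powe p \<le> dyad 2 * mass {t. ka t = k + 1} (\<lambda>t. head f t powe p * w t)"
    proof (cases "\<exists>t\<in>space M. ka t = k")
      case False
      then have "?a k = (\<I> x. 0)" by (intro nn_integral_cong) (auto simp: indicator_def)
      then show ?thesis using pos by simp
    next
      case True
      then have mass: "dyad (- of_int k - 2) \<le> mass {s. ka s = k + 1} w"
        using full_bandD(3)[OF k] by auto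
      have "dyad (- of_int k) * ?a k powe p = dyad 2 * (?a k powe p * dyad (- of_int k - 2))"
        by (simp add: mult.left_commute[of "dyad 2"] mult.commute[of _ "?a k powe p"] dyad_add[symmetric])
      also have "... \<le> dyad 2 * (?a k powe p * mass {s. ka s = k + 1} w)"
        by (intro mult_left_mono mass) auto
      also have "... = dyad 2 * (\<I> s. ?a k powe p * (w s * ind {s. ka s = k + 1} s))"
        by (subst nn_integral_cmult) auto
      also have "... \<le> dyad 2 * mass {t. ka t = k + 1} (\<lambda>t. head f t powe p * w t)"
      proof (intro mult_left_mono nn_integral_mono)
        fix s assume s: "s \<in> space M"
        show "?a k powe p * (w s * ind {s. ka s = k + 1} s) \<le> head f s powe p * w s * ind {t. ka t = k + 1} s"
        proof (cases "ka s = k + 1")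
          case True
          have "t < s" if "t \<in> space M" "ka t = k" for t
            using band_monoD[OF kb s that(1)] that True by (cases "s \<le> t") auto
          then have "?a k \<le> head f s"
            unfolding head_def by (intro nn_integral_mono) (auto simp: indicator_def)
          then show ?thesis using True pos by (simp add: mult_right_mono powe_mono)
        qed simp
      qed simp
      finally show ?thesis .
    qed
  qed
  also have "... = dyad 2 * zsum (\<lambda>k. mass {t. ka t = k + 1} (\<lambda>t. head f t powe p * w t))"
    by (rule zsum_cmult)
  also have "zsum (\<lambda>k. mass {t. ka t = k + 1} (\<lambda>t. head f t powe p * w t)) =
      zsum (\<lambda>k. mass {t. ka t = k} (\<lambda>t. head f t powe p * w t))" by (rule zsum_shift)
  also have "... = Rp f" unfolding Rp_def by (rule zsum_bands[OF kb, symmetric]) measurable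
  finally show ?thesis .
qed

lemma Lq_split:
  assumes k: "band ka" and f [measurable]: "f \<in> BM"
    and fin: "\<And>k. (mass {t. ka t = k} f) < top"
  shows "Lq f \<le> dyad (q / r) *
    ((\<I> t. (mass {s. ka s < ka t} (pw f r v)) powe (q / r) * u t) +
     zsum (\<lambda>k. KW ka k 0 * mass {t. ka t = k} f powe q))"
proof -
  note [measurable] = level_set[OF k]
  have [measurable]: "(\<lambda>x. ind {t. ka t < j} x) \<in> BM" for j by (rule band_set[OF k])
  let ?f = "\<lambda>k. cut {t. ka t = k} f" and ?v = "\<lambda>k. cut {t. ka t = k} v" and ?u = "\<lambda>k. cut {t. ka t = k} u"
  let ?A = "\<lambda>t. mass {s. ka s < ka t} (pw f r v)"
  let ?B = "\<lambda>t. head (\<lambda>s. f s powe r * v s * ind {s. ka s = ka t} s) t"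
  let ?Bk = "\<lambda>k t. head (pw (?f k) r (?v k)) t"
  have Am [measurable]: "?A \<in> BM"
    by (rule measurable_compose[OF band_measurable[OF k], where g = "\<lambda>k. mass {s. ka s < k} (pw f r v)"]) simp
  have BBk: "?B t = ?Bk (ka t) t" for t
    unfolding head_def using pos by (intro nn_integral_cong) (auto simp: indicator_def)
  have hd: "head (pw f r v) t \<le> ?A t + ?Bk (ka t) t" if t: "t \<in> space M" for t
  proof -
    have "head (pw f r v) t \<le> (\<I> s. f s powe r * v s * ind {s. ka s < ka t} s +
        f s powe r * v s * ind {s. ka s = ka t} s * ind {..<t} s)" unfolding head_def
    proof (rule nn_integral_mono)
      fix s assume s: "s \<in> space M"
      show "f s powe r * v s * ind {..<t} s \<le> f s powe r * v s * ind {s. ka s < ka t} s +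
        f s powe r * v s * ind {s. ka s = ka t} s * ind {..<t} s"
      proof (cases "s < t")
        case True
        then have "ka s < ka t \<or> ka s = ka t" using band_monoD[OF k s t] by auto
        then show ?thesis using True by auto
      qed simp
    qed
    also have "... = ?A t + ?B t" unfolding head_def by (subst nn_integral_add) auto
    finally show ?thesis unfolding BBk .
  qed
  have "Lq f \<le> (\<I> t. dyad (q / r) * (?A t powe (q / r) * u t) +
      dyad (q / r) * (zsum (\<lambda>k. ?Bk k t powe (q / r) * ?u k t)))" unfolding Lq_def
  proof (rule nn_integral_mono)
    fix t assume t: "t \<in> space M"
    have "head (pw f r v) t powe (q / r) * u t \<le> (?A t + ?Bk (ka t) t) powe (q / r) * u t"
      using pos hd[OF t] by (intro mult_right_mono powe_mono) auto
    also have "... \<le> dyad (q / r) * (?A t powe (q / r) + ?Bk (ka t) t powe (q / r)) * u t"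
      using pos powe_add_le[of "q / r"] by (intro mult_right_mono) (auto simp: dyad_def)
    also have "... = dyad (q / r) * (?A t powe (q / r) * u t) + dyad (q / r) * (?Bk (ka t) t powe (q / r) * ?u (ka t) t)"
      by (simp add: distrib_left distrib_right mult.assoc)
    also have "... \<le> dyad (q / r) * (?A t powe (q / r) * u t) + dyad (q / r) * (zsum (\<lambda>k. ?Bk k t powe (q / r) * ?u k t))"
      by (intro add_left_mono mult_left_mono term_le_zsum) simp
    finally show "head (pw f r v) t powe (q / r) * u t \<le> dyad (q / r) * (?A t powe (q / r) * u t) +
      dyad (q / r) * (zsum (\<lambda>k. ?Bk k t powe (q / r) * ?u k t))" .
  qed
  also have "... = dyad (q / r) * (\<I> t. ?A t powe (q / r) * u t) +
      dyad (q / r) * zsum (\<lambda>k. \<I> t. ?Bk k t powe (q / r) * ?u k t)"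
    by (subst nn_integral_add, (measurable)[2], subst (1 2) nn_integral_cmult, (measurable)[2], subst zsum_swap) auto
  also have "... \<le> dyad (q / r) * (\<I> t. ?A t powe (q / r) * u t) +
      dyad (q / r) * zsum (\<lambda>k. KW ka k 0 * mass {t. ka t = k} f powe q)"
  proof (intro add_left_mono mult_left_mono zsum_mono)
    fix k
    have w0: "window ka k 0 = {t. ka t = k}" by auto
    have "(\<I> t. ?Bk k t powe (q / r) * ?u k t) \<le> KQ r q (?u k) (?v k) * (\<I> x. ?f k x) powe q"
      using pos fin[of k] by (intro KQ_upper) auto
    then show "(\<I> t. ?Bk k t powe (q / r) * ?u k t) \<le> KW ka k 0 * mass {t. ka t = k} f powe q"
      unfolding KW_def w0 .
  qed simp
  finally show ?thesis by (simp add: distrib_left)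
qed

lemma bands_block:
  assumes k: "band ka" and f [measurable]: "f \<in> BM"
    and fin: "\<And>k. (mass {t. ka t = k} f) < top"
    and B: "(B :: real set) \<in> sets borel"
  shows "emeasure (distr (density M (pw f r v)) borel (\<lambda>x. real_of_int (ka x))) B \<le>
    zsum (\<lambda>k. dyad (of_int k * r / p) * VB ka k *
      (bm ka f k) powe (r / p) * ind B (of_int k))"
proof -
  note [measurable] = level_set[OF k]
  have km [measurable]: "(\<lambda>x. of_int (ka x) :: real) \<in> BM"
    by (rule measurable_compose[OF band_measurable[OF k]]) simp
  have [measurable]: "(\<lambda>x. ind B (of_int (ka x) :: real) :: ennreal) \<in> BM"
    by (rule measurable_compose[OF km]) (use B in simp)
  let ?a = "\<lambda>k. mass {t. ka t = k} f"
  have "emeasure (distr (density M (pw f r v)) borel (\<lambda>x. real_of_int (ka x))) B =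
      (\<I> s. f s powe r * v s * ind B (of_int (ka s)))" using B by (intro emeasure_image_density) auto
  also have "... = zsum (\<lambda>k. mass {t. ka t = k} (\<lambda>s. f s powe r * v s * ind B (of_int (ka s))))"
    by (rule zsum_bands[OF k]) measurable
  also have "... \<le> zsum (\<lambda>k. dyad (of_int k * r / p) * VB ka k * (dyad (- of_int k) * ?a k powe p) powe (r / p) * ind B (of_int k))"
  proof (rule zsum_mono)
    fix k
    have "mass {t. ka t = k} (\<lambda>s. f s powe r * v s * ind B (of_int (ka s))) =
        (\<I> s. cut {t. ka t = k} f s powe r * cut {t. ka t = k} v s * ind B (of_int k))"
      using pos by (intro nn_integral_cong) (auto simp: indicator_def)
    also have "... = (\<I> s. cut {t. ka t = k} f s powe r * cut {t. ka t = k} v s) * ind B (of_int k)"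
      by (rule nn_integral_multc) measurable
    also have "... \<le> (VB ka k * ?a k powe r) * ind B (of_int k)"
      using pos fin[of k] by (intro mult_right_mono VR_upper) auto
    also have "VB ka k * ?a k powe r = dyad (of_int k * r / p) * VB ka k * (dyad (- of_int k) * ?a k powe p) powe (r / p)"
    proof -
      have "dyad (of_int k * r / p) * VB ka k * (dyad (- of_int k) * ?a k powe p) powe (r / p) =
          (dyad (of_int k * r / p) * dyad (- (of_int k * r / p))) * (VB ka k * ?a k powe r)"
        using pos by (simp add: powe_mult powe_powe dyad_powe mult_ac)
      then show ?thesis by (simp add: dyad_minus)
    qed
    finally show "mass {t. ka t = k} (\<lambda>s. f s powe r * v s * ind B (of_int (ka s)))
      \<le> dyad (of_int k * r / p) * VB ka k * (dyad (- of_int k) * ?a k powe p) powe (r / p) * ind B (of_int k)" .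
  qed
  finally show ?thesis .
qed

text \<open>The block hypothesis of the Hardy inequalities in discrete form, with exponent c = r/p;
  e k plays the role of 2^(-k) m_k^p, where m_k is the mass of f on band k.\<close>

definition block_bound :: "(real \<Rightarrow> int) \<Rightarrow> (real \<Rightarrow> ennreal) \<Rightarrow> bool" where
  "block_bound ka Y \<longleftrightarrow> (\<forall>t\<in>space M. \<forall>e::int \<Rightarrow> ennreal. (\<forall>k. ka t \<le> k \<longrightarrow> e k = 0) \<longrightarrow>
     zsum (\<lambda>k. dyad (of_int k * r / p) * VB ka k * e k powe (r / p)) \<le> Y t * zsum e powe (r / p))"

lemma global_block:
  assumes k: "band ka" and Y: "block_bound ka Y" and f [measurable]: "f \<in> BM"
    and fin: "\<And>k. (mass {t. ka t = k} f) < top"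
    and t: "t \<in> space M" and B: "B \<in> sets borel" "B \<subseteq> {..<of_int (ka t)}"
  shows "emeasure (distr (density M (pw f r v)) borel (\<lambda>x. real_of_int (ka x))) B \<le> Y t *
    emeasure (distr (density (count_space UNIV)
      (bm ka f)) borel real_of_int) B powe (r / p)"
proof -
  let ?e = "\<lambda>k. bm ka f k"
  let ?eB = "\<lambda>k. ?e k * ind B (of_int k)"
  have "zsum (\<lambda>k. dyad (of_int k * r / p) * VB ka k * ?e k powe (r / p) * ind B (of_int k)) =
      zsum (\<lambda>k. dyad (of_int k * r / p) * VB ka k * ?eB k powe (r / p))"
    using pos by (intro nn_integral_cong) (auto simp: indicator_def)
  also have "... \<le> Y t * zsum ?eB powe (r / p)"
  proof -
    have "?eB k = 0" if "ka t \<le> k" for k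
    proof -
      have "of_int k \<notin> B" using that B(2) by (auto simp: subset_iff)
      then show ?thesis by simp
    qed
    then show ?thesis using Y t by (auto simp: block_bound_def)
  qed
  finally show ?thesis
    using bands_block[OF k f fin B(1)] unfolding emeasure_int_sum[OF B(1)] by (rule order_trans[rotated])
qed

definition c_suff :: ennreal where "c_suff = dyad (q / r) * (dyad (2 * (q / r) + q / p + 2) + 2) * dyad (2 * q / p)"

lemma c_suff_props: "c_suff < top" "c_suff \<noteq> 0" by (simp_all add: c_suff_def ennreal_mult_less_top)

text \<open>The passage to discrete sums presupposes finite band masses. If \<open>Rp f\<close> is
  finite, \<open>Rp_lower\<close> provides them; otherwise A \<noteq> 0 makes the right side
  infinite.\<close>

lemma suff_common:
  assumes k: "full_band ka" and A: "A \<noteq> 0"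
    and glob: "\<And>f. f \<in> BM \<Longrightarrow> (\<And>k. (mass {t. ka t = k} f) < top) \<Longrightarrow>
      zsum (bm ka f) < top \<Longrightarrow>
      (\<I> t. (mass {s. ka s < ka t} (pw f r v)) powe (q / r) * u t)
      \<le> dyad (2 * (q / r) + q / p + 2) * (A *
          zsum (bm ka f) powe (q / p))"
    and loc: "\<And>a. zsum (\<lambda>k. KW ka k 0 * a k powe q) \<le> 2 * (A * zsum (\<lambda>k. dyad (- of_int k) * a k powe p) powe (q / p))"
  shows "bounded_by (c_suff * A)" unfolding bounded_by_def
proof
  fix f :: "real \<Rightarrow> ennreal" assume f [measurable]: "f \<in> BM"
  let ?a = "\<lambda>k. mass {t. ka t = k} f"
  let ?N = "zsum (\<lambda>k. dyad (- of_int k) * ?a k powe p)"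
  show "Lq f \<le> c_suff * A * Rp f powe (q / p)"
  proof (cases "Rp f = top")
    case True
    then show ?thesis using A c_suff_props pos by (simp add: ennreal_mult_top)
  next
    case False
    have N: "?N \<le> dyad 2 * Rp f" by (rule Rp_lower[OF k f])
    also have "... < top" using False by (simp add: ennreal_mult_less_top less_top)
    finally have Nfin: "?N < top" .
    have fin: "?a k < top" for k
    proof -
      have "dyad (- of_int k) * ?a k powe p \<le> ?N" by (rule term_le_zsum)
      then have "dyad (- of_int k) * ?a k powe p < top" using Nfin by (rule le_less_trans)
      then show ?thesis using pos by (auto simp: ennreal_mult_less_top powe_less_top_iff powe_eq_0_iff)
    qed
    have "Lq f \<le> dyad (q / r) *
      ((\<I> t. (mass {s. ka s < ka t} (pw f r v)) powe (q / r) * u t) +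
       zsum (\<lambda>k. KW ka k 0 * ?a k powe q))" by (rule Lq_split[OF full_bandD(1)[OF k] f fin])
    also have "... \<le> dyad (q / r) * (dyad (2 * (q / r) + q / p + 2) * (A * ?N powe (q / p)) + 2 * (A * ?N powe (q / p)))"
      by (intro mult_left_mono add_mono loc glob f fin Nfin) simp
    also have "... = dyad (q / r) * (dyad (2 * (q / r) + q / p + 2) + 2) * A * ?N powe (q / p)"
      by (simp add: distrib_left distrib_right mult_ac)
    also have "... \<le> dyad (q / r) * (dyad (2 * (q / r) + q / p + 2) + 2) * A * (dyad 2 * Rp f) powe (q / p)"
      using pos N by (intro mult_left_mono powe_mono) auto
    also have "... = c_suff * A * Rp f powe (q / p)"
      using pos by (simp add: c_suff_def powe_mult dyad_powe mult_ac)
    finally show ?thesis .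
  qed
qed

lemma glob_eq:
  assumes k: "band ka" and f [measurable]: "f \<in> BM"
  shows "mass {s. ka s < ka t} (pw f r v) =
    emeasure (distr (density M (pw f r v)) borel (\<lambda>x. real_of_int (ka x))) {..<of_int (ka t)}"
proof -
  have [measurable]: "(\<lambda>x. of_int (ka x) :: real) \<in> BM"
    by (rule measurable_compose[OF band_measurable[OF k]]) simp
  show ?thesis by (subst emeasure_image_density) (auto simp: indicator_def)
qed

text \<open>\<open>hardy_upper_le\<close> with \<rho> t = ka t, c = r/p and g = q/r, hence cg = q/p
  >= 1; the local parts are summed by the embedding of l^1 into l^(q/p).\<close>

lemma suff_le:
  assumes k: "full_band ka" and pq: "p \<le> q" and A: "A \<noteq> 0" "A < top"
    and Y: "block_bound ka Y" "\<And>t. t \<in> space M \<Longrightarrow> tail u t * Y t powe (q / r) \<le> A"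
    and KA: "\<And>k. dyad (of_int k * q / p) * KW ka k 0 \<le> A"
  shows "bounded_by (c_suff * A)"
proof (rule suff_common[OF k A(1)])
  fix f :: "real \<Rightarrow> ennreal" assume f: "f \<in> BM" and fin: "\<And>k. (mass {t. ka t = k} f) < top"
    and Nfin: "zsum (bm ka f) < top"
  note kb = full_bandD(1)[OF k]
  have km: "(\<lambda>x. of_int (ka x) :: real) \<in> BM"
    by (rule measurable_compose[OF band_measurable[OF kb]]) simp
  let ?\<nu> = "distr (density M (pw f r v)) borel (\<lambda>x. of_int (ka x) :: real)"
  let ?E = "distr (density (count_space UNIV)
      (bm ka f)) borel real_of_int"
  have EN: "emeasure ?E UNIV = zsum (bm ka f)" by (subst emeasure_int_sum) auto
  have "(\<I> t. emeasure ?\<nu> {..<of_int (ka t)} powe (q / r) * u t)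
     \<le> dyad (2 * (q / r) + r / p * (q / r)) * (A * emeasure ?E UNIV powe (r / p * (q / r)))"
  proof (rule hardy_upper_le[where Y = Y, OF _ _ uvw(1) km])
    fix t B assume "t \<in> space M" "B \<in> sets borel" "B \<subseteq> {..<of_int (ka t) :: real}"
    then show "emeasure ?\<nu> B \<le> Y t * emeasure ?E B powe (r / p)"
      by (intro global_block[OF kb Y(1) f fin])
  next
    show "emeasure ?E UNIV < top" using Nfin EN by simp
  qed (use A Y pos pq in auto)
  also have "... \<le> dyad (2 * (q / r) + q / p + 2) * (A * emeasure ?E UNIV powe (q / p))"
    using pos by (intro mult_mono mult_left_mono) auto
  finally show "(\<I> t. (mass {s. ka s < ka t} (pw f r v)) powe (q / r) * u t)
      \<le> dyad (2 * (q / r) + q / p + 2) * (A *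
          zsum (bm ka f) powe (q / p))" unfolding glob_eq[OF kb f] EN .
next
  fix a :: "int \<Rightarrow> ennreal"
  have "zsum (\<lambda>k. KW ka k 0 * a k powe q) \<le> zsum (\<lambda>k. A * (dyad (- of_int k) * a k powe p) powe (q / p))"
  proof (rule zsum_mono)
    fix k
    have "KW ka k 0 \<le> dyad (- (of_int k * q / p)) * A" using KA[of k] by (simp add: dyad_cancel)
    then have "KW ka k 0 * a k powe q \<le> dyad (- (of_int k * q / p)) * A * a k powe q" by (rule mult_right_mono) simp
    also have "... = A * (dyad (- of_int k) * a k powe p) powe (q / p)"
      using pos by (simp add: powe_mult powe_powe dyad_powe mult_ac)
    finally show "KW ka k 0 * a k powe q \<le> A * (dyad (- of_int k) * a k powe p) powe (q / p)" .
  qed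
  also have "... = A * zsum (\<lambda>k. (dyad (- of_int k) * a k powe p) powe (q / p))" by (rule zsum_cmult)
  also have "... \<le> A * zsum (\<lambda>k. dyad (- of_int k) * a k powe p) powe (q / p)"
    using pq pos by (intro mult_left_mono zsum_powe_ge) auto
  also have "... \<le> 2 * (A * zsum (\<lambda>k. dyad (- of_int k) * a k powe p) powe (q / p))"
    by (simp add: mult_2 add_increasing)
  finally show "zsum (\<lambda>k. KW ka k 0 * a k powe q) \<le> 2 * (A * zsum (\<lambda>k. dyad (- of_int k) * a k powe p) powe (q / p))" .
qed

text \<open>The same substitution with cg = q/p < 1, so \<open>hardy_upper_less\<close> applies; the
  local parts are summed by Hoelder with exponents p/(p - q) and p/q.\<close>

lemma suff_less:
  assumes k: "full_band ka" and qp: "q < p" and A: "A \<noteq> 0" "A < top"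
    and Y: "block_bound ka Y" "Y \<in> BM"
      "(\<I> t. tail u t powe (q / (p - q)) * Y t powe (1 / r * (p * q / (p - q))) * u t) \<le> A powe (p / (p - q))"
    and KA: "zsum (\<lambda>k. (dyad (of_int k * q / p) * KW ka k 0) powe (p / (p - q))) \<le> A powe (p / (p - q))"
  shows "bounded_by (c_suff * A)"
proof (rule suff_common[OF k A(1)])
  have e: "1 - q / p = (p - q) / p" "0 < p / (p - q)" "0 < (p - q) / p" using pos qp by (auto simp: field_simps)
  fix f :: "real \<Rightarrow> ennreal" assume f: "f \<in> BM" and fin: "\<And>k. (mass {t. ka t = k} f) < top"
    and Nfin: "zsum (bm ka f) < top"
  note kb = full_bandD(1)[OF k]
  have km: "(\<lambda>x. of_int (ka x) :: real) \<in> BM"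
    by (rule measurable_compose[OF band_measurable[OF kb]]) simp
  let ?\<nu> = "distr (density M (pw f r v)) borel (\<lambda>x. of_int (ka x) :: real)"
  let ?E = "distr (density (count_space UNIV)
      (bm ka f)) borel real_of_int"
  have EN: "emeasure ?E UNIV = zsum (bm ka f)" by (subst emeasure_int_sum) auto
  define X where "X = (\<I> t. tail u t powe (q / (p - q)) * Y t powe (1 / r * (p * q / (p - q))) * u t)"
  have Xfin: "X < top" using Y(3) A(2) e by (auto simp: X_def powe_less_top_iff intro: le_less_trans)
  have cg: "r / p * (q / r) = q / p" using pos by simp
  have kk: "q / (p - q) = q / p / (1 - q / p)" "1 / r * (p * q / (p - q)) = q / r / (1 - q / p)"
    using pos qp by (auto simp: field_simps)
  have "(\<I> t. emeasure ?\<nu> {..<of_int (ka t)} powe (q / r) * u t)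
     \<le> dyad (2 * (q / r) + r / p * (q / r) + 2) * (X powe (1 - r / p * (q / r)) * emeasure ?E UNIV powe (r / p * (q / r)))"
  proof (rule hardy_upper_less[where Y = Y and k = "q / (p - q)" and m = "1 / r * (p * q / (p - q))", OF _ _ uvw(1) km])
    fix t B assume "t \<in> space M" "B \<in> sets borel" "B \<subseteq> {..<of_int (ka t) :: real}"
    then show "emeasure ?\<nu> B \<le> Y t * emeasure ?E B powe (r / p)"
      by (intro global_block[OF kb Y(1) f fin])
  next
    show "emeasure ?E UNIV < top" using Nfin EN by simp
    show "q / (p - q) = r / p * (q / r) / (1 - r / p * (q / r))"
      "1 / r * (p * q / (p - q)) = q / r / (1 - r / p * (q / r))" unfolding cg by (fact kk)+
    show "r / p * (q / r) < 1" unfolding cg using qp pos by simp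
  qed (use Y X_def Xfin pos in auto)
  also have "... \<le> dyad (2 * (q / r) + q / p + 2) * (A * emeasure ?E UNIV powe (q / p))"
  proof -
    have "X powe (1 - q / p) \<le> (A powe (p / (p - q))) powe (1 - q / p)"
      unfolding e(1) using Y(3) e by (intro powe_mono) (auto simp: X_def)
    also have "... = A" unfolding e(1) using e qp pos by (simp add: powe_powe)
    finally show ?thesis unfolding cg by (intro mult_left_mono mult_right_mono) auto
  qed
  finally show "(\<I> t. (mass {s. ka s < ka t} (pw f r v)) powe (q / r) * u t)
      \<le> dyad (2 * (q / r) + q / p + 2) * (A *
          zsum (bm ka f) powe (q / p))" unfolding glob_eq[OF kb f] EN .
next
  have e: "1 - (p - q) / p = q / p" "0 < p / (p - q)" "0 < (p - q) / p" "(p - q) / p < 1" "p / (p - q) * ((p - q) / p) = 1"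
    using pos qp by (auto simp: field_simps)
  fix a :: "int \<Rightarrow> ennreal"
  let ?F = "\<lambda>k. (dyad (of_int k * q / p) * KW ka k 0) powe (p / (p - q))"
  let ?G = "\<lambda>k. dyad (- of_int k) * a k powe p"
  have "zsum (\<lambda>k. KW ka k 0 * a k powe q) = zsum (\<lambda>k. ?F k powe ((p - q) / p) * ?G k powe (1 - (p - q) / p))"
  proof (rule nn_integral_cong)
    fix k
    have "?F k powe ((p - q) / p) * ?G k powe (1 - (p - q) / p) =
        (dyad (of_int k * q / p) * KW ka k 0) * (dyad (- (of_int k * q / p)) * a k powe q)"
      unfolding powe_powe[OF e(2,3)] e(1) e(5) using pos by (simp add: powe_mult powe_powe dyad_powe)
    also have "... = (dyad (of_int k * q / p) * dyad (- (of_int k * q / p))) * (KW ka k 0 * a k powe q)"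
      by (simp only: mult_ac)
    finally show "KW ka k 0 * a k powe q = ?F k powe ((p - q) / p) * ?G k powe (1 - (p - q) / p)"
      by (simp add: dyad_minus)
  qed
  also have "... \<le> 2 * (zsum ?F powe ((p - q) / p) * zsum ?G powe (1 - (p - q) / p))"
    using e by (intro order_trans[OF hoelder_powe le_double]) auto
  also have "... \<le> 2 * ((A powe (p / (p - q))) powe ((p - q) / p) * zsum ?G powe (q / p))"
    unfolding e(1) using KA e by (intro mult_left_mono mult_right_mono powe_mono) auto
  also have "(A powe (p / (p - q))) powe ((p - q) / p) = A" unfolding powe_powe[OF e(2,3)] e(5) by simp
  finally show "zsum (\<lambda>k. KW ka k 0 * a k powe q) \<le> 2 * (A * zsum ?G powe (q / p))" .
qed

end

text \<open>All nonzero indices lie within distance 1 of any one of them, m. The same m serves every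
  g supported where f is, so a sum and the sum of its powers can be compared term by term.\<close>

lemma zsum_near_eq:
  fixes f :: "int \<Rightarrow> ennreal"
  assumes "\<And>i j. f i \<noteq> 0 \<Longrightarrow> f j \<noteq> 0 \<Longrightarrow> i \<le> j + 1"
  obtains m where "\<And>g :: int \<Rightarrow> ennreal. (\<And>j. g j \<noteq> 0 \<Longrightarrow> f j \<noteq> 0) \<Longrightarrow> zsum g = g (m - 1) + (g m + g (m + 1))"
proof (cases "\<exists>m. f m \<noteq> 0")
  case False
  then have "zsum g = g (0 - 1) + (g 0 + g (0 + 1))" if "\<And>j. g j \<noteq> 0 \<Longrightarrow> f j \<noteq> 0" for g :: "int \<Rightarrow> ennreal"
  proof -
    have "g = (\<lambda>_. 0)" using that False by auto
    then show ?thesis by simp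
  qed
  then show thesis by (rule that)
next
  case True
  then obtain m where m: "f m \<noteq> 0" by blast
  have near: "j = m - 1 \<or> j = m \<or> j = m + 1" if "f j \<noteq> 0" for j
    using assms[OF that m] assms[OF m that] by linarith
  have "zsum g = g (m - 1) + (g m + g (m + 1))" if g: "\<And>j. g j \<noteq> 0 \<Longrightarrow> f j \<noteq> 0" for g :: "int \<Rightarrow> ennreal"
  proof -
    have "zsum g = zsum (\<lambda>j. g j * ind {m - 1} j + (g j * ind {m} j + g j * ind {m + 1} j))"
      using near g by (intro nn_integral_cong) (fastforce simp: indicator_def)
    also have "... = g (m - 1) + (g m + g (m + 1))"
      by (simp only: nn_integral_add zsum_single measurable_count_space_eq1 space_borel Pi_UNIV UNIV_I)
    finally show ?thesis .
  qed
  then show thesis by (rule that)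
qed

lemma zsum_near_le:
  fixes f :: "int \<Rightarrow> ennreal"
  assumes "\<And>i j. f i \<noteq> 0 \<Longrightarrow> f j \<noteq> 0 \<Longrightarrow> i \<le> j + 1" and c: "\<And>j. f j \<le> c"
  shows "zsum f \<le> 3 * c"
proof -
  obtain m where z: "\<And>g :: int \<Rightarrow> ennreal. (\<And>j. g j \<noteq> 0 \<Longrightarrow> f j \<noteq> 0) \<Longrightarrow> zsum g = g (m - 1) + (g m + g (m + 1))"
    using zsum_near_eq[OF assms(1)] by blast
  have "zsum f = f (m - 1) + (f m + f (m + 1))" by (rule z)
  also have "... \<le> c + (c + c)" by (intro add_mono c)
  also have "... = 1 * c + (1 * c + 1 * c)" by simp
  also have "... = 3 * c" by (simp only: distrib_right[symmetric]) simp
  finally show ?thesis .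
qed

lemma zsum_near:
  fixes f :: "int \<Rightarrow> ennreal"
  assumes near: "\<And>i j. f i \<noteq> 0 \<Longrightarrow> f j \<noteq> 0 \<Longrightarrow> i \<le> j + 1" and c: "0 < c"
  shows "zsum f powe c \<le> dyad (2 * c) * zsum (\<lambda>j. f j powe c)"
proof -
  obtain m where z: "\<And>g :: int \<Rightarrow> ennreal. (\<And>j. g j \<noteq> 0 \<Longrightarrow> f j \<noteq> 0) \<Longrightarrow> zsum g = g (m - 1) + (g m + g (m + 1))"
    using zsum_near_eq[OF near] by blast
  have "zsum f powe c = (f (m - 1) + (f m + f (m + 1))) powe c" by (subst z) auto
  also have "... \<le> dyad c * (f (m - 1) powe c + (f m + f (m + 1)) powe c)"
    using powe_add_le[OF c] by (simp add: dyad_def)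
  also have "... \<le> dyad c * (f (m - 1) powe c + dyad c * (f m powe c + f (m + 1) powe c))"
    using powe_add_le[OF c] by (intro mult_left_mono add_left_mono) (auto simp: dyad_def)
  also have "... \<le> dyad c * (dyad c * f (m - 1) powe c + dyad c * (f m powe c + f (m + 1) powe c))"
  proof (intro mult_left_mono add_right_mono)
    have "1 * f (m - 1) powe c \<le> dyad c * f (m - 1) powe c"
      using c dyad_mono[of 0 c] by (intro mult_right_mono) auto
    then show "f (m - 1) powe c \<le> dyad c * f (m - 1) powe c" by simp
  qed simp
  also have "... = dyad (2 * c) * (f (m - 1) powe c + (f m powe c + f (m + 1) powe c))"
    by (simp add: distrib_left mult.assoc[symmetric] dyad_add[symmetric])
  also have "... = dyad (2 * c) * zsum (\<lambda>j. f j powe c)" using c by (subst z) (auto simp: powe_eq_0_iff)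
  finally show ?thesis .
qed

section \<open>Existence of full bands\<close>

context hardy_setting
begin

lemma tail_level_measurable: "(\<lambda>s. ind {s. tail w s < c} s) \<in> BM"
proof -
  have "(\<lambda>x. ind {..<c} x) \<in> borel_measurable borel" by simp
  from measurable_compose[OF tail_measurable this] show ?thesis by (simp add: indicator_def)
qed

text \<open>Continuity of W, as points are null: along a cofinal sequence of {W >= c} the tails stay
  at least c, and their limit is carried by {W < c} up to a possible last point of {W >= c}.\<close>

lemma mass_below_level:
  assumes null: "\<And>x. emeasure M {x} = 0" and t: "t \<in> space M" "c \<le> tail w t"
  shows "c \<le> mass {s. tail w s < c} w"
proof -
  note [measurable] = tail_level_measurable[of c]
  let ?U = "{s \<in> space M. c \<le> tail w s}"
  have U: "?U \<noteq> {}" using t by auto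
  obtain x where x: "\<And>n. x n \<in> ?U" "incseq x" "\<And>y. y \<in> ?U \<Longrightarrow> \<exists>n. y \<le> x n"
    by (rule cofinal_sequence[OF U]) (rule that; assumption)
  have "c \<le> (INF n. tail w (x n))" using x(1) by (auto intro: INF_greatest)
  also have "... = (\<I> s. (INF n. w s * ind {x n..} s))" unfolding tail_def
  proof (rule nn_integral_monotone_convergence_INF_decseq[symmetric])
    show "decseq (\<lambda>n s. w s * ind {x n..} s)"
    proof (intro decseq_SucI le_funI mult_left_mono)
      fix n s
      have "x n \<le> x (Suc n)" using x(2) by (simp add: incseq_SucD)
      then show "ind {x (Suc n)..} s \<le> (ind {x n..} s)" by (auto simp: indicator_def)
    qed simp
    show "mass {x 0..} w < \<infinity>" using W_fin[of "x 0"] x(1)[of 0] by (simp add: tail_def)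
  qed measurable
  also have "... \<le> mass {s. tail w s < c} w"
  proof (rule nn_integral_mono_AE)
    have "AE s in M. s \<notin> {s \<in> ?U. \<forall>n. x n \<le> s}"
    proof (cases "{s \<in> ?U. \<forall>n. x n \<le> s} = {}")
      case False
      then obtain z where z: "z \<in> ?U" "\<forall>n. x n \<le> z" by blast
      have "s = z" if s: "s \<in> {s \<in> ?U. \<forall>n. x n \<le> s}" for s
      proof -
        obtain n where n: "s \<le> x n" using x(3)[of s] s by blast
        obtain m where m: "z \<le> x m" using x(3)[OF z(1)] by blast
        have "x n \<le> z" "x m \<le> s" using z s by blast+
        with n m show ?thesis by linarith
      qed
      then have eq: "{s \<in> ?U. \<forall>n. x n \<le> s} = {z}" using z by blast
      have zM: "(\<lambda>x. x) -` {z} \<inter> space M \<in> sets M" by (rule measurable_sets[OF id_measurable]) simp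
      have zeq: "(\<lambda>x. x) -` {z} \<inter> space M = {z}" using z by auto
      have "{z} \<in> sets M" using zM by (simp only: zeq)
      then have "{z} \<in> null_sets M" using null by auto
      then show ?thesis unfolding eq by (auto dest: AE_not_in)
    qed simp
    then show "AE s in M. (INF n. w s * ind {x n..} s) \<le> w s * ind {s. tail w s < c} s" using AE_space
    proof eventually_elim
      case (elim s)
      show ?case
      proof (cases "tail w s < c")
        case True
        then show ?thesis by (intro INF_lower2[of 0]) (auto simp: indicator_def)
      next
        case False
        then obtain n where "\<not> x n \<le> s" using elim by (auto simp: not_less)
        then show ?thesis by (intro INF_lower2[of n]) auto
      qed
    qed
  qed
  finally show ?thesis .
qed

text \<open>ka is the integer k with 2^(-k-1) <= W < 2^(-k). By \<open>mass_below_level\<close> the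
  set {W < 2^(-k-1)} has w-mass at least 2^(-k-1); at most 2^(-k-2) of it lies in {W < 2^(-k-2)},
  and the rest is on band k + 1.\<close>

lemma full_band_exists:
  assumes null: "\<And>x. emeasure M {x} = 0"
  obtains ka where "full_band ka"
proof -
  have "\<forall>t\<in>space M. \<exists>k::int. dyad (- of_int k - 1) \<le> tail w t \<and> tail w t < dyad (- of_int k)"
  proof
    fix t assume t: "t \<in> space M"
    have "tail w t \<noteq> 0" "tail w t \<noteq> top" using W_pos[OF t] W_fin[OF t] by auto
    then obtain i :: int where "dyad (of_int i) \<le> tail w t" "tail w t < dyad (of_int i + 1)" by (rule dyad_floor)
    then show "\<exists>k::int. dyad (- of_int k - 1) \<le> tail w t \<and> tail w t < dyad (- of_int k)"
      by (intro exI[of _ "- i - 1"]) (simp add: algebra_simps)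
  qed
  from bchoice[OF this] obtain ka :: "real \<Rightarrow> int"
    where ka: "\<forall>t\<in>space M. dyad (- of_int (ka t) - 1) \<le> tail w t \<and> tail w t < dyad (- of_int (ka t))" by blast
  have mono: "ka s \<le> ka t" if st: "s \<in> space M" "t \<in> space M" "s \<le> t" for s t
  proof -
    have "dyad (- of_int (ka t) - 1) \<le> tail w t" using ka st by blast
    also have "... \<le> tail w s" by (rule tail_antimono) fact
    also have "... < dyad (- of_int (ka s))" using ka st by blast
    finally show ?thesis by simp
  qed
  have b: "band ka" unfolding band_def
  proof (intro conjI ballI mono_onI)
    fix t assume t: "t \<in> space M"
    have "dyad (- of_int (ka t) - 2) \<le> dyad (- of_int (ka t) - 1)" by simp
    also have "... \<le> tail w t" using ka t by blast
    finally show "dyad (- of_int (ka t) - 2) \<le> tail w t" .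
    show "tail w t \<le> dyad (- of_int (ka t))" using ka t by (auto intro: less_imp_le)
  qed (rule mono)
  have "full_band ka" unfolding full_band_def
  proof (intro conjI b ballI)
    fix t assume t: "t \<in> space M"
    show "dyad (- of_int (ka t) - 1) \<le> tail w t" using ka t by blast
    let ?d = "dyad (- of_int (ka t) - 2)"
    let ?I = "mass {s. ka s = ka t + 1} w"
    have m1: "(\<lambda>x. ind {s. ka s = ka t + 1} x) \<in> BM" by (rule band_set[OF b])
    have m2: "(\<lambda>x. ind {s. tail w s < ?d} x) \<in> BM" by (rule tail_level_measurable)
    have "dyad (- of_int (ka t) - 1) \<le> mass {s. tail w s < dyad (- of_int (ka t) - 1)} w"
      using ka t by (intro mass_below_level[OF null t]) auto
    also have "... \<le> (\<I> s. w s * ind {s. ka s = ka t + 1} s + w s * ind {s. tail w s < ?d} s)"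
    proof (rule nn_integral_mono)
      fix s assume s: "s \<in> space M"
      have "ka s = ka t + 1" if "tail w s < dyad (- of_int (ka t) - 1)" "\<not> tail w s < ?d"
      proof -
        have "dyad (- of_int (ka s) - 1) < dyad (- of_int (ka t) - 1)"
          using ka s that(1) by (blast intro: le_less_trans)
        moreover have "dyad (- of_int (ka t) - 2) < dyad (- of_int (ka s))"
        proof -
          have "dyad (- of_int (ka t) - 2) \<le> tail w s" using that(2) by simp
          also have "tail w s < dyad (- of_int (ka s))" using ka s by blast
          finally show ?thesis .
        qed
        ultimately show ?thesis by simp
      qed
      then show "w s * ind {s. tail w s < dyad (- of_int (ka t) - 1)} s
          \<le> w s * ind {s. ka s = ka t + 1} s + w s * ind {s. tail w s < ?d} s"
        by (auto simp: indicator_def)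
    qed
    also have "... = ?I + mass {s. tail w s < ?d} w" using m1 m2 by (intro nn_integral_add) auto
    also have "mass {s. tail w s < ?d} w \<le> ?d"
    proof (rule le_of_tails[where T = "{s. tail w s < ?d}"])
      fix s assume s: "s \<in> {s. tail w s < ?d}"
      have "tail (cut {s. tail w s < ?d} w) s \<le> tail w s" by (rule tail_mono_fun) (auto simp: indicator_def)
      then show "tail (cut {s. tail w s < ?d} w) s \<le> ?d" using s by (auto intro: order_trans less_imp_le)
    qed (use m2 in auto)
    finally have "dyad (- of_int (ka t) - 1) \<le> ?d + ?I" by (simp add: add_left_mono add.commute)
    moreover have "dyad (- of_int (ka t) - 1) = ?d + ?d"
    proof -
      have e: "- real_of_int (ka t) - 1 = (- of_int (ka t) - 2) + 1" by simp
      show ?thesis unfolding e by (rule dyad_double[symmetric])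
    qed
    ultimately have "?d + ?d \<le> ?d + ?I" by simp
    then show "?d \<le> ?I" by (simp add: ennreal_add_left_cancel_le)
  qed
  then show thesis by (rule that)
qed

section \<open>Block bounds and sufficiency in each range of exponents\<close>

lemma VR_cmult: "g \<in> BM \<Longrightarrow> VR r (\<lambda>x. c * g x) = c * VR r g"
proof -
  assume [measurable]: "g \<in> BM"
  have ne: "{f \<in> BM. (\<I> x. f x) \<le> 1} \<noteq> {}" by (auto intro!: exI[of _ "\<lambda>_. 0"])
  show ?thesis unfolding VR_def SUP_mult_left_ennreal
    by (intro SUP_cong refl, subst nn_integral_cmult[symmetric]) (auto simp: mult_ac)
qed

text \<open>Bounds for P x t with x in the band pass to the whole band by
  \<open>VR_le_tails\<close>, even if the band has no first point.\<close>

lemma VB_le: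
  assumes k: "band ka" and t: "t \<in> space M" "j < ka t"
    and le: "\<And>x. x \<in> space M \<Longrightarrow> ka x = j \<Longrightarrow> a * P x t \<le> c"
  shows "a * VB ka j \<le> c"
proof -
  note [measurable] = level_set[OF k]
  have "a * VB ka j = VR r (\<lambda>s. a * cut {t. ka t = j} v s)" by (rule VR_cmult[symmetric]) measurable
  also have "... \<le> c"
  proof (rule VR_le_tails[where T = "{t. ka t = j}"])
    fix x assume x: "x \<in> {t. ka t = j}" "x \<in> space M"
    have "s < t" if "s \<in> space M" "ka s = j" for s
      using band_monoD[OF k t(1) that(1)] that t(2) by (cases "t \<le> s") auto
    then have "VR r (\<lambda>s. a * cut {t. ka t = j} v s * ind {x..} s) \<le> VR r (\<lambda>s. a * cut {x..<t} v s)"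
      by (intro VR_mono) (auto simp: indicator_def)
    also have "... = a * P x t" unfolding P_def by (rule VR_cmult) measurable
    also have "... \<le> c" using le x by blast
    finally show "VR r (\<lambda>s. a * cut {t. ka t = j} v s * ind {x..} s) \<le> c" .
  qed auto
  finally show ?thesis .
qed

lemma KW_le:
  assumes k: "band ka"
    and le: "\<And>y. y \<in> space M \<Longrightarrow> ka y = j \<Longrightarrow>
      KQ r q (cut ({t. ka t = j} \<inter> {y..}) u) (cut ({t. ka t = j} \<inter> {y..}) v) \<le> c"
  shows "KW ka j 0 \<le> c"
proof -
  note [measurable] = level_set[OF k]
  have w0: "window ka j 0 = {t. ka t = j}" by auto
  show ?thesis unfolding KW_def w0
  proof (rule KQ_le_tails[where T = "{t. ka t = j}"])
    fix y assume "y \<in> {t. ka t = j}" "y \<in> space M"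
    then show "KQ r q (\<lambda>s. cut {t. ka t = j} u s * ind {y..} s) (\<lambda>s. cut {t. ka t = j} v s * ind {y..} s) \<le> c"
      using le[of y] by (simp add: indicator_inter_arith mult.assoc)
  qed (use pos in auto)
qed

lemma band_next:
  assumes k: "full_band ka" and t: "t \<in> space M" shows "\<exists>s\<in>space M. ka s = ka t + 1"
proof (rule ccontr)
  assume "\<not> ?thesis"
  then have "mass {s. ka s = ka t + 1} w = (\<I> s. 0)"
    by (intro nn_integral_cong) (auto simp: indicator_def)
  then show False using full_bandD(3)[OF k t] by simp
qed

text \<open>Nonempty bands form an upper set of integers, so missing bands occur only at the left
  end of the interval.\<close>

lemma band_later:
  assumes k: "full_band ka" and t: "t \<in> space M" and "ka t \<le> j" shows "\<exists>s\<in>space M. ka s = j"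
  using assms(3)
proof (induction rule: int_ge_induct)
  case base
  then show ?case using t by blast
next
  case (step i)
  then obtain s where "s \<in> space M" "ka s = i" by blast
  then show ?case using band_next[OF k, of s] by auto
qed

definition YS :: "(real \<Rightarrow> int) \<Rightarrow> real \<Rightarrow> ennreal" where
  "YS ka t = (SUP j\<in>{..<ka t}. dyad (of_int j * r / p) * VB ka j)"

text \<open>Here r/p >= 1, so the sum of the powers e^(r/p) is at most the power of the sum, and the
  coefficients enter through their supremum.\<close>

lemma block_bound_YS:
  assumes "p \<le> r" shows "block_bound ka (YS ka)" unfolding block_bound_def
proof (intro ballI allI impI)
  fix t and e :: "int \<Rightarrow> ennreal" assume e: "\<forall>k. ka t \<le> k \<longrightarrow> e k = 0"
  have "zsum (\<lambda>k. dyad (of_int k * r / p) * VB ka k * e k powe (r / p)) \<le> zsum (\<lambda>k. YS ka t * e k powe (r / p))"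
  proof (rule zsum_mono)
    fix k
    show "dyad (of_int k * r / p) * VB ka k * e k powe (r / p) \<le> YS ka t * e k powe (r / p)"
    proof (cases "k < ka t")
      case True
      then have "dyad (of_int k * r / p) * VB ka k \<le> YS ka t" unfolding YS_def by (intro SUP_upper) auto
      then show ?thesis by (rule mult_right_mono) simp
    qed (use e pos in auto)
  qed
  also have "... = YS ka t * zsum (\<lambda>k. e k powe (r / p))" by (rule zsum_cmult)
  also have "... \<le> YS ka t * zsum e powe (r / p)"
    using assms pos by (intro mult_left_mono zsum_powe_ge) auto
  finally show "zsum (\<lambda>k. dyad (of_int k * r / p) * VB ka k * e k powe (r / p)) \<le> YS ka t * zsum e powe (r / p)" .
qed

definition SS :: "(real \<Rightarrow> int) \<Rightarrow> real \<Rightarrow> ennreal" where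
  "SS ka t = zsum (\<lambda>j. steps ka v j * ind {..<ka t} j)"

text \<open>Here r/p < 1: Hoelder with weights (p - r)/p and r/p turns the coefficients into the sum
  of \<open>steps\<close>.\<close>

lemma block_bound_SS:
  assumes "r < p" shows "block_bound ka (\<lambda>t. 2 * SS ka t powe ((p - r) / p))" unfolding block_bound_def
proof (intro ballI allI impI)
  have l: "0 < (p - r) / p" "(p - r) / p < 1" "1 - (p - r) / p = r / p" "0 < p / (p - r)" "p / (p - r) * ((p - r) / p) = 1"
    using assms pos by (auto simp: field_simps)
  fix t and e :: "int \<Rightarrow> ennreal" assume e: "\<forall>k. ka t \<le> k \<longrightarrow> e k = 0"
  let ?F = "\<lambda>j. steps ka v j * ind {..<ka t} j"
  have "zsum (\<lambda>k. dyad (of_int k * r / p) * VB ka k * e k powe (r / p)) =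
      zsum (\<lambda>k. ?F k powe ((p - r) / p) * e k powe (1 - (p - r) / p))"
  proof (rule nn_integral_cong)
    fix k
    show "dyad (of_int k * r / p) * VB ka k * e k powe (r / p) = ?F k powe ((p - r) / p) * e k powe (1 - (p - r) / p)"
    proof (cases "k < ka t")
      case True
      have "steps ka v k powe ((p - r) / p) = dyad (of_int k * r / p) * VB ka k"
        unfolding steps_def powe_powe[OF l(4,1)] l(5) by simp
      then show ?thesis using True by (simp only: l(3)) simp
    next
      case False
      then show ?thesis using e pos l by (auto simp: l(3))
    qed
  qed
  also have "... \<le> 2 * (zsum ?F powe ((p - r) / p) * zsum e powe (1 - (p - r) / p))"
    using l by (intro order_trans[OF hoelder_powe le_double]) auto
  finally show "zsum (\<lambda>k. dyad (of_int k * r / p) * VB ka k * e k powe (r / p)) \<le> 2 * SS ka t powe ((p - r) / p) * zsum e powe (r / p)"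
    unfolding l(3) SS_def by (simp only: mult.assoc)
qed

text \<open>The bands without a full predecessor: there are at most two nonempty ones, at the left end of the interval.\<close>

definition early :: "(real \<Rightarrow> int) \<Rightarrow> int \<Rightarrow> bool" where
  "early ka j \<longleftrightarrow> \<not> (\<exists>s\<in>space M. ka s = j - 2)"

lemma steps_empty:
  assumes "r < p" "\<not> (\<exists>s\<in>space M. ka s = j)" shows "steps ka g j = 0"
  using assms by (intro steps_zero) auto

text \<open>If band j is nonempty and i >= j + 2, then band i - 2 is nonempty by
  \<open>band_later\<close>, so i is not early.\<close>

lemma early_near:
  assumes k: "full_band ka" and rp: "r < p"
    and i: "early ka i" "steps ka g i \<noteq> 0" and j: "early ka j" "steps ka g j \<noteq> 0"
  shows "i \<le> j + 1"
proof (rule ccontr)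
  assume "\<not> ?thesis"
  moreover obtain s where "s \<in> space M" "ka s = j" using j(2) steps_empty[OF rp] by blast
  ultimately have "\<exists>s\<in>space M. ka s = i - 2" using band_later[OF k, of s "i - 2"] by auto
  then show False using i(1) by (simp add: early_def)
qed

text \<open>The term of band j is compared with the integral \<open>Q\<close> over band j - 1: for s
  there, P s t dominates the value of \<open>VR\<close> on band j, and W(s)^(-b) is at least
  2^((j-1)b). Band j - 1 is known to be heavy only if band j - 2 is nonempty, which is the origin of
  \<open>early\<close>.\<close>

lemma late_steps_le_Q:
  assumes k: "full_band ka" and rp: "r < p" and t: "t \<in> space M"
  shows "zsum (\<lambda>j. steps ka v j * ind {j. j < ka t \<and> \<not> early ka j} j) \<le> dyad (p / (p - r)) * Q t"
proof -
  define b where "b = p / (p - r)"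
  have b: "0 < b" "b - 1 = r / p * b" using rp pos by (auto simp: b_def field_simps)
  note kb = full_bandD(1)[OF k]
  note [measurable] = level_set[OF kb]
  let ?g = "\<lambda>s. tail w s powe (- b) * w s * P s t powe b * ind {..<t} s"
  have "zsum (\<lambda>j. steps ka v j * ind {j. j < ka t \<and> \<not> early ka j} j)
      \<le> zsum (\<lambda>j. dyad b * mass {s. ka s = j - 1} ?g)"
  proof (rule zsum_mono)
    fix j
    show "steps ka v j * ind {j. j < ka t \<and> \<not> early ka j} j \<le> dyad b * mass {s. ka s = j - 1} ?g"
    proof (cases "j < ka t \<and> \<not> early ka j")
      case True
      then obtain z where z: "z \<in> space M" "ka z = j - 2" by (auto simp: early_def)
      have mass: "dyad (- of_int j) \<le> mass {s. ka s = j - 1} w"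
        using full_bandD(3)[OF k z(1)] z(2) by (simp add: algebra_simps)
      have "steps ka v j = dyad b * (dyad ((of_int j - 1) * b) * VB ka j powe b * dyad (- of_int j))"
      proof -
        have "steps ka v j = dyad (of_int j * (r / p * b)) * VB ka j powe b"
          unfolding steps_def b_def[symmetric] using b(1) by (simp add: powe_mult dyad_powe mult.assoc)
        also have "of_int j * (r / p * b) = b + ((of_int j - 1) * b + (- of_int j))"
          unfolding b(2)[symmetric] by (simp add: algebra_simps)
        finally show ?thesis by (simp only: dyad_add mult_ac)
      qed
      also have "... \<le> dyad b * (dyad ((of_int j - 1) * b) * VB ka j powe b * mass {s. ka s = j - 1} w)"
        by (intro mult_left_mono mass) auto
      also have "... = dyad b * (\<I> s. dyad ((of_int j - 1) * b) * VB ka j powe b * (w s * ind {s. ka s = j - 1} s))"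
        by (subst nn_integral_cmult) auto
      also have "... \<le> dyad b * mass {s. ka s = j - 1} ?g"
      proof (intro mult_left_mono nn_integral_mono)
        fix s assume s: "s \<in> space M"
        show "dyad ((of_int j - 1) * b) * VB ka j powe b * (w s * ind {s. ka s = j - 1} s) \<le> ?g s * ind {s. ka s = j - 1} s"
        proof (cases "ka s = j - 1")
          case sj: True
          have st: "s < t" using band_monoD[OF kb t s] sj True by (cases "t \<le> s") auto
          have "tail w s \<le> dyad (- of_int (ka s))" by (rule band_le[OF kb s])
          then have "dyad (- (- of_int (ka s) * b)) \<le> tail w s powe (- b)"
            using W_pos[OF s] b by (intro powe_neg_dyad_ge) auto
          moreover have "- (- of_int (ka s) * b) = (of_int j - 1) * b"
          proof -
            have "real_of_int j - 1 = of_int (ka s)" using sj by simp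
            then show ?thesis by (simp only: minus_mult_minus mult_minus_left minus_minus)
          qed
          ultimately have W: "dyad ((of_int j - 1) * b) \<le> tail w s powe (- b)" by (simp only:)
          have "VB ka j \<le> P s t" unfolding P_def
          proof (rule VR_mono)
            fix x assume x: "x \<in> space M"
            have "s \<le> x \<and> x < t" if "ka x = j"
              using band_monoD[OF kb x s] band_monoD[OF kb t x] sj True that by (cases "s \<le> x"; cases "t \<le> x") auto
            then show "cut {t. ka t = j} v x \<le> cut {s..<t} v x" by (auto simp: indicator_def)
          qed
          then have "dyad ((of_int j - 1) * b) * VB ka j powe b * w s \<le> tail w s powe (- b) * P s t powe b * w s"
            using b by (intro mult_mono W powe_mono) auto
          then show ?thesis using sj st by (simp add: mult_ac)
        qed simp
      qed simp
      finally show ?thesis using True by simp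
    qed simp
  qed
  also have "... = dyad b * zsum (\<lambda>j. mass {s. ka s = j - 1} ?g)" by (rule zsum_cmult)
  also have "zsum (\<lambda>j. mass {s. ka s = j - 1} ?g) = zsum (\<lambda>j. mass {s. ka s = j} ?g)"
    using zsum_shift[of "\<lambda>j. mass {s. ka s = j} ?g" "- 1"] by simp
  also have "... = Q t" unfolding Q_def b_def[symmetric] by (rule zsum_bands[OF kb, symmetric]) measurable
  finally show ?thesis by (simp only: b_def)
qed

lemma tail_VB_le:
  assumes k: "band ka" and t: "t \<in> space M" "j < ka t"
    and H: "\<And>x. x \<in> space M \<Longrightarrow> tail u t * P x t powe (q / r) \<le> A * tail w x powe (q / p)"
  shows "tail u t powe (r / q) * (dyad (of_int j * r / p) * VB ka j) \<le> A powe (r / q)"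
proof -
  have "(tail u t powe (r / q) * dyad (of_int j * r / p)) * VB ka j \<le> A powe (r / q)"
  proof (rule VB_le[OF k t])
    fix x assume x: "x \<in> space M" "ka x = j"
    have "(tail u t * P x t powe (q / r)) powe (r / q) \<le> (A * dyad (- of_int j) powe (q / p)) powe (r / q)"
      using pos band_le[OF k x(1)] x by (intro powe_mono order_trans[OF H] mult_left_mono) auto
    then have "tail u t powe (r / q) * P x t \<le> A powe (r / q) * dyad (- (of_int j * r / p))"
      using pos by (simp add: powe_mult powe_powe dyad_powe)
    then have "dyad (of_int j * r / p) * (tail u t powe (r / q) * P x t)
        \<le> dyad (of_int j * r / p) * (A powe (r / q) * dyad (- (of_int j * r / p)))"
      by (rule mult_left_mono) simp
    also have "... = (dyad (of_int j * r / p) * dyad (- (of_int j * r / p))) * A powe (r / q)" by (simp only: mult_ac)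
    also have "... = A powe (r / q)" by (simp add: dyad_minus)
    finally show "tail u t powe (r / q) * dyad (of_int j * r / p) * P x t \<le> A powe (r / q)" by (simp only: mult_ac)
  qed
  then show ?thesis by (simp only: mult.assoc)
qed

lemma tail_P_le_KQ: "t \<in> space M \<Longrightarrow> tail u t * P x t powe (q / r) \<le> KQ\<^sub>c {x..}"
proof -
  assume t: "t \<in> space M"
  have "tail u t * VR r (cut {..<t} (cut {x..} v)) powe (q / r) \<le> KQ\<^sub>c {x..}"
    by (rule tail_VR_cut_le[OF t]) auto
  also have "cut {..<t} (cut {x..} v) = cut {x..<t} v" by (auto simp: indicator_def)
  finally show ?thesis unfolding P_def .
qed

lemma KW_le_of_KQ:
  assumes k: "band ka" and H: "\<And>x. x \<in> space M \<Longrightarrow> KQ\<^sub>c {x..} \<le> A * tail w x powe (q / p)"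
  shows "dyad (of_int j * q / p) * KW ka j 0 \<le> A"
proof -
  have "KW ka j 0 \<le> A * dyad (- (of_int j * q / p))"
  proof (rule KW_le[OF k])
    fix y assume y: "y \<in> space M" "ka y = j"
    have "KQ r q (cut ({t. ka t = j} \<inter> {y..}) u) (cut ({t. ka t = j} \<inter> {y..}) v) \<le> KQ\<^sub>c {y..}"
      using pos by (intro KQ_mono) (auto simp: indicator_def)
    also have "... \<le> A * tail w y powe (q / p)" by (rule H[OF y(1)])
    also have "... \<le> A * dyad (- of_int j) powe (q / p)"
      using band_le[OF k y(1)] y pos by (intro mult_left_mono powe_mono) auto
    finally show "KQ r q (cut ({t. ka t = j} \<inter> {y..}) u) (cut ({t. ka t = j} \<inter> {y..}) v) \<le> A * dyad (- (of_int j * q / p))"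
      by (simp add: dyad_powe)
  qed
  then show ?thesis by (simp add: dyad_cancel mult.commute)
qed

text \<open>The hypothesis on half-lines serves twice: cut down to one band it bounds the local
  constant, and through \<open>tail_P_le_KQ\<close> it bounds the contribution of each earlier
  band.\<close>

lemma sufficient_i_ii:
  assumes k: "full_band ka" and pq: "p \<le> r" "p \<le> q" and A: "A \<noteq> 0" "A < top"
    and H: "\<And>x. x \<in> space M \<Longrightarrow> KQ\<^sub>c {x..} \<le> A * tail w x powe (q / p)"
  shows "bounded_by (c_suff * A)"
proof (rule suff_le[OF k pq(2) A block_bound_YS[OF pq(1)]])
  note kb = full_bandD(1)[OF k]
  show "dyad (of_int j * q / p) * KW ka j 0 \<le> A" for j by (rule KW_le_of_KQ[OF kb H])
  fix t assume t: "t \<in> space M"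
  have "tail u t powe (r / q) * YS ka t \<le> A powe (r / q)" unfolding YS_def SUP_mult_left_ennreal
    using tail_P_le_KQ[OF t] H by (intro SUP_least tail_VB_le[OF kb t]) (auto intro: order_trans)
  then have "(tail u t powe (r / q) * YS ka t) powe (q / r) \<le> (A powe (r / q)) powe (q / r)"
    using pos by (intro powe_mono) auto
  then show "tail u t * YS ka t powe (q / r) \<le> A" using pos by (simp add: powe_mult powe_powe)
qed

lemma SS_split:
  "SS ka t = zsum (\<lambda>j. steps ka v j * ind {j. j < ka t \<and> \<not> early ka j} j) +
     zsum (\<lambda>j. steps ka v j * ind {j. j < ka t \<and> early ka j} j)" unfolding SS_def
  by (subst nn_integral_add[symmetric]) (auto intro!: nn_integral_cong simp: indicator_def)

lemma one_le_dyad: "0 \<le> x \<Longrightarrow> 1 \<le> dyad x" using dyad_mono[of 0 x] by simp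

lemma tail_steps_le:
  assumes k: "band ka" and t: "t \<in> space M" "j < ka t" and rp: "r < p"
    and H: "\<And>x. x \<in> space M \<Longrightarrow> tail u t * P x t powe (q / r) \<le> A * tail w x powe (q / p)"
  shows "tail u t powe (\<theta> / q) * steps ka v j \<le> A powe (\<theta> / q)"
proof -
  have b: "0 < p / (p - r)" "0 < r / q" "r / q * (p / (p - r)) = \<theta> / q" using rp pos by (auto simp: \<theta>_def mult.commute)
  have "(tail u t powe (r / q) * (dyad (of_int j * r / p) * VB ka j)) powe (p / (p - r)) \<le> (A powe (r / q)) powe (p / (p - r))"
    using b by (intro powe_mono tail_VB_le[OF k t H]) auto
  then show ?thesis unfolding powe_mult[OF b(1)] powe_powe[OF b(2,1)] b(3) steps_def .
qed

text \<open>Late bands are covered by \<open>Q\<close>, that is by \<open>C3\<close>. For the early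
  ones each term is bounded through the hypothesis on \<open>KQ\<^sub>c\<close>, and
  \<open>zsum_near_le\<close> adds them up.\<close>

lemma sufficient_iii_iv:
  assumes k: "full_band ka" and pq: "r < p" "p \<le> q" and A: "A \<noteq> 0" "A < top"
    and H: "\<And>x. x \<in> space M \<Longrightarrow> KQ\<^sub>c {x..} \<le> A * tail w x powe (q / p)"
    and H3: "\<And>t. t \<in> space M \<Longrightarrow> tail u t powe (\<theta> / q) * Q t \<le> A powe (\<theta> / q)"
  shows "bounded_by (c_suff * (dyad (q / r) * (dyad (p / (p - r)) + 3) powe (q / \<theta>) * A))"
proof (rule suff_le[OF k pq(2) _ _ block_bound_SS[OF pq(1)]])
  note kb = full_bandD(1)[OF k]
  have \<theta>: "0 < \<theta>" "0 < \<theta> / q" "0 < q / \<theta>" "\<theta> / q * (q / \<theta>) = 1" "(p - r) / p * (q / r) = q / \<theta>"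
    using pq pos by (simp_all add: \<theta>_def)
  have pr: "0 < p / (p - r)" "0 < (p - r) / p" "0 < q / r" using pq pos by auto
  let ?c = "dyad (p / (p - r)) + 3"
  have "1 \<le> ?c" using one_le_dyad[of "p / (p - r)"] pr by (auto intro: order_trans add_increasing2)
  then have "1 powe (q / \<theta>) \<le> ?c powe (q / \<theta>)" using \<theta> by (intro powe_mono) auto
  then have c1: "1 * 1 \<le> dyad (q / r) * ?c powe (q / \<theta>)" using pr by (intro mult_mono one_le_dyad) auto
  show "dyad (q / r) * ?c powe (q / \<theta>) * A \<noteq> 0" "dyad (q / r) * ?c powe (q / \<theta>) * A < top"
    using A \<theta> by (auto simp: powe_eq_0_iff ennreal_mult_less_top powe_less_top_iff)
  have "1 * 1 * A \<le> dyad (q / r) * ?c powe (q / \<theta>) * A" by (intro mult_right_mono c1) simp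
  then show "dyad (of_int j * q / p) * KW ka j 0 \<le> dyad (q / r) * ?c powe (q / \<theta>) * A" for j
    using KW_le_of_KQ[OF kb H, of j] by (auto intro: order_trans)
  fix t assume t: "t \<in> space M"
  have HP: "tail u t * P x t powe (q / r) \<le> A * tail w x powe (q / p)" if "x \<in> space M" for x
    using tail_P_le_KQ[OF t] H[OF that] by (rule order_trans)
  let ?T = "tail u t powe (\<theta> / q)"
  have late: "?T * zsum (\<lambda>j. steps ka v j * ind {j. j < ka t \<and> \<not> early ka j} j) \<le> dyad (p / (p - r)) * A powe (\<theta> / q)"
  proof -
    have "?T * zsum (\<lambda>j. steps ka v j * ind {j. j < ka t \<and> \<not> early ka j} j) \<le> ?T * (dyad (p / (p - r)) * Q t)"
      by (intro mult_left_mono late_steps_le_Q[OF k pq(1) t]) simp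
    also have "... = dyad (p / (p - r)) * (?T * Q t)" by (simp only: mult_ac)
    also have "... \<le> dyad (p / (p - r)) * A powe (\<theta> / q)" by (intro mult_left_mono H3[OF t]) simp
    finally show ?thesis .
  qed
  have early: "zsum (\<lambda>j. ?T * (steps ka v j * ind {j. j < ka t \<and> early ka j} j)) \<le> 3 * A powe (\<theta> / q)"
  proof (rule zsum_near_le)
    fix i j
    assume "?T * (steps ka v i * ind {j. j < ka t \<and> early ka j} i) \<noteq> 0" "?T * (steps ka v j * ind {j. j < ka t \<and> early ka j} j) \<noteq> 0"
    then show "i \<le> j + 1" by (intro early_near[OF k pq(1)]) (auto simp: indicator_def split: if_splits)
  next
    fix j
    show "?T * (steps ka v j * ind {j. j < ka t \<and> early ka j} j) \<le> A powe (\<theta> / q)"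
      using tail_steps_le[OF kb t _ pq(1) HP, of j] by (simp add: indicator_def)
  qed
  have "?T * SS ka t \<le> ?c * A powe (\<theta> / q)"
    using add_mono[OF late early] by (simp only: SS_split[of ka t] distrib_left distrib_right zsum_cmult)
  then have "(?T * SS ka t) powe (q / \<theta>) \<le> (?c * A powe (\<theta> / q)) powe (q / \<theta>)"
    using \<theta> by (intro powe_mono) auto
  then have "tail u t * SS ka t powe (q / \<theta>) \<le> ?c powe (q / \<theta>) * A"
    unfolding powe_mult[OF \<theta>(3)] powe_powe[OF \<theta>(2,3)] \<theta>(4) by simp
  then have "dyad (q / r) * (tail u t * SS ka t powe (q / \<theta>)) \<le> dyad (q / r) * (?c powe (q / \<theta>) * A)"
    by (rule mult_left_mono) simp
  moreover have "tail u t * (2 * SS ka t powe ((p - r) / p)) powe (q / r) = dyad (q / r) * (tail u t * SS ka t powe (q / \<theta>))"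
    unfolding powe_mult[OF pr(3)] powe_powe[OF pr(2,3)] \<theta>(5) by (simp add: dyad_powe mult_ac flip: dyad_1)
  ultimately show "tail u t * (2 * SS ka t powe ((p - r) / p)) powe (q / r) \<le> dyad (q / r) * ?c powe (q / \<theta>) * A"
    by (simp only: mult.assoc)
qed

text \<open>The inner supremum of \<open>C5\<close> and \<open>C7\<close>, with the local constant
  \<open>K\<close> in place of its explicit expression.\<close>

definition S5 :: "real \<Rightarrow> ennreal" where
  "S5 x = (SUP y\<in>{y\<in>space M. y < x}. (tail w y powe (- 1) * K y x) powe (p / (p - q)))"

definition S6 :: "real \<Rightarrow> ennreal" where
  "S6 x = (SUP y\<in>{y\<in>space M. y < x}. tail w y powe (- 1) * \<Psi> y x * Q y powe \<eta>)"

lemma S5_measurable [measurable]: "q < p \<Longrightarrow> S5 \<in> BM"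
proof (intro mono_measurable monoI)
  fix x x' :: real assume qp: "q < p" and x: "x \<le> x'"
  have "K y x \<le> K y x'" for y unfolding K_def using pos x by (intro KQ_mono) (auto simp: indicator_def)
  then show "S5 x \<le> S5 x'"
    unfolding S5_def using x qp pos by (intro SUP_mono) (auto intro!: bexI powe_mono mult_left_mono)
qed

lemma S6_measurable [measurable]: "S6 \<in> BM"
proof (intro mono_measurable monoI)
  fix x x' :: real assume x: "x \<le> x'"
  have "\<Psi> y x \<le> \<Psi> y x'" for y
    unfolding \<Psi>_def using x by (intro nn_integral_mono mult_left_mono) (auto simp: indicator_def)
  then show "S6 x \<le> S6 x'"
    unfolding S6_def using x by (intro SUP_mono) (auto intro!: bexI mult_right_mono mult_left_mono)
qed

text \<open>A converse to \<open>band_integral_le\<close>: if band j is nonempty, band j + 1 has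
  w-mass at least 2^(-j-2), and there S dominates c j.\<close>

lemma next_band_sum:
  assumes k: "full_band ka" and [measurable]: "S \<in> BM"
    and le: "\<And>j x. x \<in> space M \<Longrightarrow> ka x = j + 1 \<Longrightarrow> c j \<le> S x"
    and zero: "\<And>j. \<not> (\<exists>s\<in>space M. ka s = j) \<Longrightarrow> c j = 0"
  shows "zsum (\<lambda>j. dyad (- of_int j) * c j) \<le> dyad 2 * (\<I> x. w x * S x)"
proof -
  note kb = full_bandD(1)[OF k]
  note [measurable] = level_set[OF kb]
  have "zsum (\<lambda>j. dyad (- of_int j) * c j) \<le> zsum (\<lambda>j. dyad 2 * mass {t. ka t = j + 1} (\<lambda>x. w x * S x))"
  proof (rule zsum_mono)
    fix j
    show "dyad (- of_int j) * c j \<le> dyad 2 * mass {t. ka t = j + 1} (\<lambda>x. w x * S x)"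
    proof (cases "\<exists>s\<in>space M. ka s = j")
      case False
      then show ?thesis using zero by simp
    next
      case True
      then have mass: "dyad (- of_int j - 2) \<le> mass {s. ka s = j + 1} w"
        using full_bandD(3)[OF k] by auto
      have "dyad (- of_int j) * c j = dyad 2 * (c j * dyad (- of_int j - 2))"
        by (simp add: mult.left_commute[of "dyad 2"] mult.commute[of _ "c j"] dyad_add[symmetric])
      also have "... \<le> dyad 2 * (c j * mass {s. ka s = j + 1} w)" by (intro mult_left_mono mass) auto
      also have "... = dyad 2 * (\<I> s. c j * (w s * ind {s. ka s = j + 1} s))"
        by (subst nn_integral_cmult) auto
      also have "... \<le> dyad 2 * mass {t. ka t = j + 1} (\<lambda>x. w x * S x)"
      proof (intro mult_left_mono nn_integral_mono)
        fix s assume "s \<in> space M"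
        then show "c j * (w s * ind {s. ka s = j + 1} s) \<le> w s * S s * ind {t. ka t = j + 1} s"
          using le[of s j] by (auto simp: indicator_def mult.commute[of "c j"] intro: mult_left_mono)
      qed simp
      finally show ?thesis .
    qed
  qed
  also have "... = dyad 2 * zsum (\<lambda>j. mass {t. ka t = j + 1} (\<lambda>x. w x * S x))" by (rule zsum_cmult)
  also have "zsum (\<lambda>j. mass {t. ka t = j + 1} (\<lambda>x. w x * S x)) = zsum (\<lambda>j. mass {t. ka t = j} (\<lambda>x. w x * S x))"
    by (rule zsum_shift)
  also have "... = (\<I> x. w x * S x)" by (rule zsum_bands[OF kb, symmetric]) measurable
  finally show ?thesis .
qed

text \<open>For y in band j and x in band j + 1, the interval from y to x contains the rest of band
  j after y, and 1/W(y) is at least 2^j; so \<open>S5\<close> at x dominates the local constant of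
  band j.\<close>

lemma KW_sum_le:
  assumes k: "full_band ka" and qp: "q < p"
  shows "zsum (\<lambda>j. (dyad (of_int j * q / p) * KW ka j 0) powe (p / (p - q))) \<le> dyad 2 * (\<I> x. w x * S5 x)"
proof -
  define b where "b = p / (p - q)"
  have b: "0 < b" "b - 1 = q / p * b" using qp pos by (auto simp: b_def field_simps)
  note kb = full_bandD(1)[OF k]
  let ?c = "\<lambda>j. (dyad (of_int j) * KW ka j 0) powe b"
  have "zsum (\<lambda>j. (dyad (of_int j * q / p) * KW ka j 0) powe b) = zsum (\<lambda>j. dyad (- of_int j) * ?c j)"
  proof (rule nn_integral_cong)
    fix j :: int
    have "(dyad (of_int j * q / p) * KW ka j 0) powe b = dyad (of_int j * (q / p * b)) * KW ka j 0 powe b"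
      using b(1) by (simp add: powe_mult dyad_powe mult_ac)
    also have "of_int j * (q / p * b) = - of_int j + of_int j * b" unfolding b(2)[symmetric] by (simp add: algebra_simps)
    finally show "(dyad (of_int j * q / p) * KW ka j 0) powe b = dyad (- of_int j) * ?c j"
      using b(1) by (simp only: dyad_add powe_mult dyad_powe mult.assoc)
  qed
  also have "... \<le> dyad 2 * (\<I> x. w x * S5 x)"
  proof (rule next_band_sum[OF k S5_measurable[OF qp]])
    fix j x assume x: "x \<in> space M" "ka x = j + 1"
    have "KW ka j 0 \<le> dyad (- of_int j) * S5 x powe (1 / b)"
    proof (rule KW_le[OF kb])
      fix y assume y: "y \<in> space M" "ka y = j"
      have yx: "y < x" using band_monoD[OF kb x(1) y(1)] x y by (cases "x \<le> y") auto
      have below: "s < x" if "s \<in> space M" "ka s = j" for s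
        using band_monoD[OF kb x(1) that(1)] x that by (cases "x \<le> s") auto
      have "tail w y \<le> dyad (- of_int j)" using band_le[OF kb y(1)] y by simp
      then have "dyad (- (- of_int j * 1)) \<le> tail w y powe (- 1)"
        using W_pos[OF y(1)] by (intro powe_neg_dyad_ge) auto
      then have W: "dyad (of_int j) \<le> tail w y powe (- 1)" by simp
      have "KQ r q (cut ({t. ka t = j} \<inter> {y..}) u) (cut ({t. ka t = j} \<inter> {y..}) v) \<le> K y x"
        unfolding K_def using below pos by (intro KQ_mono) (auto simp: indicator_def)
      moreover have "dyad (of_int j) * K y x \<le> tail w y powe (- 1) * K y x" by (intro mult_right_mono W) simp
      moreover have "(tail w y powe (- 1) * K y x) powe b \<le> S5 x"
        unfolding S5_def b_def using y yx by (intro SUP_upper) auto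
      then have "tail w y powe (- 1) * K y x \<le> S5 x powe (1 / b)" using b(1) by (simp add: powe_le_move)
      ultimately have "dyad (of_int j) * KQ r q (cut ({t. ka t = j} \<inter> {y..}) u) (cut ({t. ka t = j} \<inter> {y..}) v) \<le> S5 x powe (1 / b)"
        by (meson mult_left_mono order_trans zero_le)
      then show "KQ r q (cut ({t. ka t = j} \<inter> {y..}) u) (cut ({t. ka t = j} \<inter> {y..}) v) \<le> dyad (- of_int j) * S5 x powe (1 / b)"
        by (simp add: dyad_cancel)
    qed
    then have "dyad (of_int j) * KW ka j 0 \<le> S5 x powe (1 / b)" by (simp add: dyad_cancel)
    then show "?c j \<le> S5 x" using b(1) by (simp add: powe_le_move)
  next
    fix j assume "\<not> (\<exists>s\<in>space M. ka s = j)"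
    then have "KW ka j 0 \<le> 0" by (intro KW_le[OF kb]) auto
    then show "?c j = 0" using b(1) by simp
  qed
  finally show ?thesis by (simp only: b_def)
qed

text \<open>On band j the number 2^(jr/p) is at most W^(-r/p), which gives \<open>YS\<close> <=
  \<open>S4\<close>; the local part is \<open>KW_sum_le\<close>.\<close>

lemma sufficient_v:
  assumes k: "full_band ka" and pq: "p \<le> r" "q < p" and A: "A \<noteq> 0" "A < top"
    and H4: "(\<I> t. tail u t powe (q / (p - q)) * S4 t powe (1 / r * (p * q / (p - q))) * u t) \<le> A powe (p / (p - q))"
    and H5: "(\<I> x. w x * S5 x) \<le> A powe (p / (p - q))"
  shows "bounded_by (c_suff * (dyad (2 * (p - q) / p) * A))"
proof -
  define b where "b = p / (p - q)"
  have b: "0 < b" "2 * (p - q) / p * b = 2" "0 \<le> 2 * (p - q) / p" "0 < 1 / r * (p * q / (p - q))"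
    using pq pos by (auto simp: b_def field_simps)
  note kb = full_bandD(1)[OF k]
  have Ab: "(dyad (2 * (p - q) / p) * A) powe b = dyad 2 * A powe b"
    unfolding powe_mult[OF b(1)] dyad_powe b(2) ..
  have A1: "A powe b \<le> dyad 2 * A powe b" using mult_right_mono[OF one_le_dyad[of 2], of "A powe b"] by simp
  have Y4: "YS ka t \<le> S4 t" if t: "t \<in> space M" for t unfolding YS_def
  proof (rule SUP_least)
    fix j assume j: "j \<in> {..<ka t}"
    show "dyad (of_int j * r / p) * VB ka j \<le> S4 t"
    proof (rule VB_le[OF kb t])
      fix x assume x: "x \<in> space M" "ka x = j"
      have xt: "x < t" using band_monoD[OF kb t x(1)] x j by (cases "t \<le> x") auto
      have "tail w x \<le> dyad (- of_int j)" using band_le[OF kb x(1)] x by simp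
      then have "dyad (- (- of_int j * (r / p))) \<le> tail w x powe (- (r / p))"
        using W_pos[OF x(1)] pos by (intro powe_neg_dyad_ge) auto
      then have "dyad (of_int j * r / p) * P x t \<le> tail w x powe (- (r / p)) * P x t"
        by (intro mult_right_mono) auto
      also have "... \<le> S4 t" unfolding S4_def using x xt by (intro SUP_upper) auto
      finally show "dyad (of_int j * r / p) * P x t \<le> S4 t" .
    qed (use j in auto)
  qed
  show ?thesis
  proof (rule suff_less[OF k pq(2) _ _ block_bound_YS[OF pq(1)], folded b_def])
    show "dyad (2 * (p - q) / p) * A \<noteq> 0" "dyad (2 * (p - q) / p) * A < top"
      using A by (auto simp: ennreal_mult_less_top)
    show "YS ka \<in> BM"
      using measurable_compose[OF band_measurable[OF kb], of "\<lambda>k. SUP j\<in>{..<k}. dyad (of_int j * r / p) * VB ka j" borel]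
      by (simp add: YS_def[abs_def])
    have "(\<I> t. tail u t powe (q / (p - q)) * YS ka t powe (1 / r * (p * q / (p - q))) * u t)
       \<le> (\<I> t. tail u t powe (q / (p - q)) * S4 t powe (1 / r * (p * q / (p - q))) * u t)"
      using Y4 b(4) by (intro nn_integral_mono mult_right_mono mult_left_mono powe_mono) auto
    also have "... \<le> A powe b" using H4 by (simp only: b_def)
    also note A1
    finally show "(\<I> t. tail u t powe (q / (p - q)) * YS ka t powe (1 / r * (p * q / (p - q))) * u t)
       \<le> (dyad (2 * (p - q) / p) * A) powe b" unfolding Ab .
    have "zsum (\<lambda>j. (dyad (of_int j * q / p) * KW ka j 0) powe b) \<le> dyad 2 * (\<I> x. w x * S5 x)"
      unfolding b_def by (rule KW_sum_le[OF k pq(2)])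
    also have "... \<le> dyad 2 * A powe b" using H5 by (intro mult_left_mono) (auto simp: b_def)
    finally show "zsum (\<lambda>j. (dyad (of_int j * q / p) * KW ka j 0) powe b) \<le> (dyad (2 * (p - q) / p) * A) powe b" unfolding Ab .
  qed
qed

definition c_vi :: ennreal where
  "c_vi = dyad (1 / r * (p * q / (p - q)) + \<eta>) * (dyad (p / (p - r) * \<eta> + 2) + dyad (2 * \<eta>) * 3) + dyad 2"

text \<open>\<open>SS\<close> is the sum of a late part R1, controlled by \<open>Q\<close> and hence
  by \<open>C6\<close>, and an early part R2. \<open>Q\<close> does not dominate the early bands;
  for these the pointwise condition H1, which is \<open>C1\<close>, is used.\<close>

lemma sufficient_vi_vii:
  assumes k: "full_band ka" and pq: "r < p" "q < p" and A: "A \<noteq> 0" "A < top"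
    and H1: "\<And>x t. x \<in> space M \<Longrightarrow> t \<in> space M \<Longrightarrow> tail u t * P x t powe (q / r) \<le> A * tail w x powe (q / p)"
    and H5: "(\<I> x. w x * S5 x) \<le> A powe (p / (p - q))"
    and H6: "(\<I> x. w x * S6 x) \<le> A powe (p / (p - q))"
  shows "bounded_by (c_suff * (c_vi powe ((p - q) / p) * A))"
proof -
  define b where "b = p / (p - q)"
  define k0 where "k0 = q / (p - q)"
  define b' where "b' = p / (p - r)"
  note ex = exponent_eqs[OF pq, folded b_def k0_def]
  have b: "0 < b" "0 < (p - q) / p" "(p - q) / p * b = 1" "0 < b'" "b' * \<eta> = q / r * b" "0 < q / r"
    "(p - r) / p * (1 / r * (p * q / (p - q))) = \<eta>" "0 < 1 / r * (p * q / (p - q))" "0 < (p - r) / p"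
    using pq pos by (auto simp: b_def b'_def \<eta>_def mult.commute)
  note kb = full_bandD(1)[OF k]
  note [measurable] = level_set[OF kb]
  have indgt [measurable]: "(\<lambda>x. ind {t. j < ka t} x) \<in> BM" for j by (rule band_set[OF kb])
  define g where "g t = tail u t powe k0 * u t" for t
  have gm [measurable]: "g \<in> BM" unfolding g_def[abs_def] by measurable
  have cA: "(c_vi powe ((p - q) / p) * A) powe b = c_vi * A powe b"
    unfolding powe_mult[OF b(1)] powe_powe[OF b(2,1)] b(3) by simp
  define R1 where "R1 i = zsum (\<lambda>j. steps ka v j * ind {j. j < i \<and> \<not> early ka j} j)" for i
  define R2 where "R2 i = zsum (\<lambda>j. steps ka v j * ind {j. j < i \<and> early ka j} j)" for i
  have SS: "SS ka t = R1 (ka t) + R2 (ka t)" for t by (simp only: SS_split R1_def R2_def)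
  note [measurable] = band_measurable[OF kb]
  have comp [measurable]: "(\<lambda>t. h (ka t)) \<in> BM" for h :: "int \<Rightarrow> ennreal"
    by (rule measurable_compose[OF band_measurable[OF kb]]) simp
  have I1: "(\<I> t. g t * R1 (ka t) powe \<eta>) \<le> dyad (b' * \<eta> + 2) * A powe b"
  proof -
    let ?G = "\<lambda>j. mass {t. ka t = j} (\<lambda>t. g t * R1 (ka t) powe \<eta>)"
    have "(\<I> t. g t * R1 (ka t) powe \<eta>) = zsum ?G" by (rule zsum_bands[OF kb]) measurable
    \<comment> \<open>Rescaled to the form 2^(-j) c j of \<open>next_band_sum\<close>; the supremum
      \<open>S6\<close> at x in band j + 1 reaches every y in band j, and the interval from y to x
      contains the rest of that band.\<close>
    also have "... = zsum (\<lambda>j. dyad (b' * \<eta>) * (dyad (- of_int j) * (dyad (of_int j - b' * \<eta>) * ?G j)))"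
    proof (rule nn_integral_cong)
      fix j :: int
      have "dyad (b' * \<eta>) * dyad (- of_int j) * dyad (of_int j - b' * \<eta>) = 1" by (simp add: dyad_add[symmetric])
      then show "?G j = dyad (b' * \<eta>) * (dyad (- of_int j) * (dyad (of_int j - b' * \<eta>) * ?G j))"
        by (simp only: mult.assoc[symmetric] mult_1)
    qed
    also have "... = dyad (b' * \<eta>) * zsum (\<lambda>j. dyad (- of_int j) * (dyad (of_int j - b' * \<eta>) * ?G j))" by (rule zsum_cmult)
    also have "... \<le> dyad (b' * \<eta>) * (dyad 2 * (\<I> x. w x * S6 x))"
    proof (intro mult_left_mono next_band_sum[OF k S6_measurable])
      fix j x assume x: "x \<in> space M" "ka x = j + 1"
      have "?G j \<le> dyad (- (of_int j - b' * \<eta>)) * S6 x"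
      proof (rule le_of_tails[where T = "{t. ka t = j}"])
        fix y assume y: "y \<in> {t. ka t = j}" "y \<in> space M"
        have yx: "y < x" using band_monoD[OF kb x(1) y(2)] x y by (cases "x \<le> y") auto
        have below: "s < x" if "s \<in> space M" "ka s = j" for s
          using band_monoD[OF kb x(1) that(1)] x that by (cases "x \<le> s") auto
        have "tail w y \<le> dyad (- of_int j)" using band_le[OF kb y(2)] y by simp
        then have "dyad (- (- of_int j * 1)) \<le> tail w y powe (- 1)"
          using W_pos[OF y(2)] by (intro powe_neg_dyad_ge) auto
        then have W: "dyad (of_int j) \<le> tail w y powe (- 1)" by simp
        have "R1 j \<le> dyad b' * Q y" using late_steps_le_Q[OF k pq(1) y(2)] y by (simp add: R1_def b'_def)
        then have "R1 j powe \<eta> \<le> (dyad b' * Q y) powe \<eta>" using ex(2) by (intro powe_mono) auto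
        then have R1: "R1 j powe \<eta> \<le> dyad (b' * \<eta>) * Q y powe \<eta>" by (simp only: powe_mult[OF ex(2)] dyad_powe)
        have "tail (\<lambda>t. g t * R1 (ka t) powe \<eta> * ind {t. ka t = j} t) y \<le>
            (\<I> t. (g t * ind {y..<x} t) * R1 j powe \<eta>)"
          unfolding tail_def[of "\<lambda>t. g t * R1 (ka t) powe \<eta> * ind {t. ka t = j} t"]
          using below by (intro nn_integral_mono) (auto simp: indicator_def)
        also have "... = \<Psi> y x * R1 j powe \<eta>"
          unfolding \<Psi>_def k0_def[symmetric] g_def by (rule nn_integral_multc) measurable
        also have "... \<le> \<Psi> y x * (dyad (b' * \<eta>) * Q y powe \<eta>)" by (intro mult_left_mono R1) simp
        finally have "dyad (of_int j) * tail (\<lambda>t. g t * R1 (ka t) powe \<eta> * ind {t. ka t = j} t) y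
          \<le> tail w y powe (- 1) * (\<Psi> y x * (dyad (b' * \<eta>) * Q y powe \<eta>))" by (intro mult_mono W) auto
        also have "... = dyad (b' * \<eta>) * (tail w y powe (- 1) * \<Psi> y x * Q y powe \<eta>)" by (simp only: mult_ac)
        also have "... \<le> dyad (b' * \<eta>) * S6 x"
          unfolding S6_def using y yx by (intro mult_left_mono SUP_upper) auto
        finally have "tail (\<lambda>t. g t * R1 (ka t) powe \<eta> * ind {t. ka t = j} t) y \<le> dyad (- of_int j) * (dyad (b' * \<eta>) * S6 x)"
          by (simp only: dyad_cancel)
        also have "... = dyad (- (of_int j - b' * \<eta>)) * S6 x"
          by (simp add: mult.assoc[symmetric] dyad_add[symmetric])
        finally show "tail (\<lambda>t. g t * R1 (ka t) powe \<eta> * ind {t. ka t = j} t) y \<le> dyad (- (of_int j - b' * \<eta>)) * S6 x" .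
      qed (measurable, auto)
      then show "dyad (of_int j - b' * \<eta>) * ?G j \<le> S6 x" by (simp only: dyad_cancel)
    next
      fix j assume "\<not> (\<exists>s\<in>space M. ka s = j)"
      then have "?G j = (\<I> x. 0)" by (intro nn_integral_cong) (auto simp: indicator_def)
      then show "dyad (of_int j - b' * \<eta>) * ?G j = 0" by simp
    qed simp
    also have "... \<le> dyad (b' * \<eta>) * (dyad 2 * A powe b)" using H6 by (intro mult_left_mono) (auto simp: b_def)
    also have "... = dyad (b' * \<eta> + 2) * A powe b" by (simp only: dyad_add mult.assoc)
    finally show ?thesis .
  qed
  have I2: "(\<I> t. g t * R2 (ka t) powe \<eta>) \<le> dyad (2 * \<eta>) * 3 * A powe b"
  proof -
    let ?s = "\<lambda>j. steps ka v j powe \<eta> * ind {j. early ka j} j"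
    let ?H = "\<lambda>j. ?s j * mass {t. j < ka t} g"
    have "(\<I> t. g t * R2 (ka t) powe \<eta>) \<le> (\<I> t. dyad (2 * \<eta>) * zsum (\<lambda>j. ?s j * (g t * ind {t. j < ka t} t)))"
    proof (rule nn_integral_mono)
      fix t
      have "R2 (ka t) powe \<eta> \<le> dyad (2 * \<eta>) * zsum (\<lambda>j. (steps ka v j * ind {j. j < ka t \<and> early ka j} j) powe \<eta>)"
        unfolding R2_def
      proof (rule zsum_near[OF _ ex(2)])
        fix i j
        assume "steps ka v i * ind {j. j < ka t \<and> early ka j} i \<noteq> 0" "steps ka v j * ind {j. j < ka t \<and> early ka j} j \<noteq> 0"
        then show "i \<le> j + 1" by (intro early_near[OF k pq(1)]) (auto simp: indicator_def split: if_splits)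
      qed
      also have "zsum (\<lambda>j. (steps ka v j * ind {j. j < ka t \<and> early ka j} j) powe \<eta>) = zsum (\<lambda>j. ?s j * ind {t. j < ka t} t)"
        using ex(2) by (intro nn_integral_cong) (auto simp: indicator_def)
      finally have "g t * R2 (ka t) powe \<eta> \<le> g t * (dyad (2 * \<eta>) * zsum (\<lambda>j. ?s j * ind {t. j < ka t} t))"
        by (rule mult_left_mono) simp
      also have "... = dyad (2 * \<eta>) * (g t * zsum (\<lambda>j. ?s j * ind {t. j < ka t} t))" by (simp only: mult_ac)
      also have "g t * zsum (\<lambda>j. ?s j * ind {t. j < ka t} t) = zsum (\<lambda>j. ?s j * (g t * ind {t. j < ka t} t))"
        by (subst zsum_cmult[symmetric]) (simp only: mult_ac)
      finally show "g t * R2 (ka t) powe \<eta> \<le> dyad (2 * \<eta>) * zsum (\<lambda>j. ?s j * (g t * ind {t. j < ka t} t))" .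
    qed
    also have "... = dyad (2 * \<eta>) * (\<I> t. zsum (\<lambda>j. ?s j * (g t * ind {t. j < ka t} t)))"
      by (rule nn_integral_cmult) measurable
    also have "(\<I> t. zsum (\<lambda>j. ?s j * (g t * ind {t. j < ka t} t))) = zsum (\<lambda>j. \<I> t. ?s j * (g t * ind {t. j < ka t} t))"
      by (rule zsum_swap) measurable
    also have "... = zsum ?H" by (intro nn_integral_cong nn_integral_cmult) measurable
    \<comment> \<open>Beyond band j the mass of g is at most the b-th power of the mass of u. H1
      bounds this mass of u times X^(q/r) by A, so each early term is at most A^b.\<close>
    also have "zsum ?H \<le> 3 * A powe b"
    proof (rule zsum_near_le)
      fix i j assume ij: "?H i \<noteq> 0" "?H j \<noteq> 0"
      have "early ka l \<and> steps ka v l \<noteq> 0" if "?H l \<noteq> 0" for l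
        using that ex(2) by (auto simp: indicator_def split: if_splits)
      with ij show "i \<le> j + 1" by (intro early_near[OF k pq(1)]) blast+
    next
      fix j
      let ?U = "mass {t. j < ka t} u"
      let ?X = "dyad (of_int j * r / p) * VB ka j"
      have UX: "?X powe (q / r) * ?U \<le> A"
      proof -
        have "(\<I> t. ?X powe (q / r) * (u t * ind {t. j < ka t} t)) \<le> A"
        proof (rule le_of_tails[where T = "{t. j < ka t}"])
          fix t assume t: "t \<in> {t. j < ka t}" "t \<in> space M"
          have "tail (\<lambda>t. ?X powe (q / r) * (u t * ind {t. j < ka t} t)) t \<le> tail (\<lambda>t. ?X powe (q / r) * u t) t"
            by (rule tail_mono_fun) (auto simp: indicator_def)
          also have "... = ?X powe (q / r) * tail u t"
            unfolding tail_def by (subst nn_integral_cmult[symmetric]) (auto simp: mult.assoc)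
          also have "... = (tail u t powe (r / q) * ?X) powe (q / r)"
            using pos by (simp add: powe_mult powe_powe mult.commute)
          also have "... \<le> (A powe (r / q)) powe (q / r)"
            using b(6) t H1[OF _ t(2)] by (intro powe_mono tail_VB_le[OF kb t(2)]) auto
          also have "... = A" using pos by (simp add: powe_powe)
          finally show "tail (\<lambda>t. ?X powe (q / r) * (u t * ind {t. j < ka t} t)) t \<le> A" .
        qed auto
        then show ?thesis by (subst nn_integral_cmult[symmetric]) auto
      qed
      have gU: "mass {t. j < ka t} g \<le> ?U powe b"
      proof -
        have "mass {t. j < ka t} g \<le> (\<I> t. ?U powe k0 * (u t * ind {t. j < ka t} t))"
        proof (rule nn_integral_mono)
          fix t assume t: "t \<in> space M"
          show "g t * ind {t. j < ka t} t \<le> ?U powe k0 * (u t * ind {t. j < ka t} t)"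
          proof (cases "j < ka t")
            case True
            have "tail u t \<le> ?U" unfolding tail_def
            proof (rule nn_integral_mono)
              fix s assume s: "s \<in> space M"
              show "u s * ind {t..} s \<le> u s * ind {t. j < ka t} s"
                using band_monoD[OF kb t s] True by (auto simp: indicator_def)
            qed
            then have "tail u t powe k0 \<le> ?U powe k0" using ex(4) by (intro powe_mono) auto
            then show ?thesis using True by (simp add: g_def mult_right_mono)
          qed simp
        qed
        also have "... = ?U powe k0 * ?U" by (rule nn_integral_cmult) measurable
        also have "... = ?U powe b" using powe_add[of k0 1 ?U] ex by simp
        finally show ?thesis .
      qed
      have st: "steps ka v j powe \<eta> = (?X powe (q / r)) powe b"
        unfolding steps_def b'_def[symmetric] powe_powe[OF b(4) ex(2)] powe_powe[OF b(6,1)] b(5) ..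
      have "?H j \<le> steps ka v j powe \<eta> * ?U powe b" by (intro mult_mono gU) (auto simp: indicator_def)
      also have "... = (?X powe (q / r) * ?U) powe b"
        unfolding st by (rule powe_mult[OF b(1), symmetric])
      also have "... \<le> A powe b" using b(1) by (intro powe_mono UX) auto
      finally show "?H j \<le> A powe b" .
    qed
    finally show ?thesis by (simp add: mult_left_mono mult.assoc)
  qed
  show ?thesis
  proof (rule suff_less[OF k pq(2) _ _ block_bound_SS[OF pq(1)], folded b_def k0_def])
    have "c_vi < top" "c_vi \<noteq> 0" by (auto simp: c_vi_def ennreal_mult_less_top)
    then show "c_vi powe ((p - q) / p) * A \<noteq> 0" "c_vi powe ((p - q) / p) * A < top"
      using A b(2) by (auto simp: ennreal_mult_less_top powe_less_top_iff powe_eq_0_iff)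
    show "(\<lambda>t. 2 * SS ka t powe ((p - r) / p)) \<in> BM" unfolding SS by measurable
    have "(\<I> t. tail u t powe k0 * (2 * SS ka t powe ((p - r) / p)) powe (1 / r * (p * q / (p - q))) * u t)
       \<le> (\<I> t. dyad (1 / r * (p * q / (p - q)) + \<eta>) * (g t * R1 (ka t) powe \<eta> + g t * R2 (ka t) powe \<eta>))"
    proof (rule nn_integral_mono)
      fix t
      let ?z = "1 / r * (p * q / (p - q))"
      have "tail u t powe k0 * (2 * SS ka t powe ((p - r) / p)) powe ?z * u t = g t * (dyad ?z * SS ka t powe \<eta>)"
        unfolding powe_mult[OF b(8)] powe_powe[OF b(9,8)] b(7) g_def by (simp add: dyad_powe mult_ac flip: dyad_1)
      also have "... \<le> g t * (dyad ?z * (dyad \<eta> * (R1 (ka t) powe \<eta> + R2 (ka t) powe \<eta>)))"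
        unfolding SS using powe_add_le[OF ex(2)] by (intro mult_left_mono) (auto simp: dyad_def)
      also have "... = dyad (?z + \<eta>) * (g t * R1 (ka t) powe \<eta> + g t * R2 (ka t) powe \<eta>)"
        by (simp only: dyad_add distrib_left mult_ac)
      finally show "tail u t powe k0 * (2 * SS ka t powe ((p - r) / p)) powe ?z * u t
        \<le> dyad (?z + \<eta>) * (g t * R1 (ka t) powe \<eta> + g t * R2 (ka t) powe \<eta>)" .
    qed
    also have "... = dyad (1 / r * (p * q / (p - q)) + \<eta>) *
        ((\<I> t. g t * R1 (ka t) powe \<eta>) + (\<I> t. g t * R2 (ka t) powe \<eta>))"
      by (subst nn_integral_cmult, measurable, subst nn_integral_add) auto
    also have "... \<le> dyad (1 / r * (p * q / (p - q)) + \<eta>) * (dyad (b' * \<eta> + 2) * A powe b + dyad (2 * \<eta>) * 3 * A powe b)"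
      by (intro mult_left_mono add_mono I1 I2) simp
    also have "... \<le> c_vi * A powe b"
      by (simp add: c_vi_def b'_def distrib_left distrib_right mult.assoc)
    finally show "(\<I> t. tail u t powe k0 * (2 * SS ka t powe ((p - r) / p)) powe (1 / r * (p * q / (p - q))) * u t)
      \<le> (c_vi powe ((p - q) / p) * A) powe b" unfolding cA .
    have "zsum (\<lambda>j. (dyad (of_int j * q / p) * KW ka j 0) powe b) \<le> dyad 2 * (\<I> x. w x * S5 x)"
      unfolding b_def by (rule KW_sum_le[OF k pq(2)])
    also have "... \<le> dyad 2 * A powe b" using H5 by (intro mult_left_mono) (auto simp: b_def)
    also have "... \<le> c_vi * A powe b" by (intro mult_right_mono) (auto simp: c_vi_def)
    finally show "zsum (\<lambda>j. (dyad (of_int j * q / p) * KW ka j 0) powe b) \<le> (c_vi powe ((p - q) / p) * A) powe b" unfolding cA .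
  qed
qed

end

section \<open>\<open>VR\<close> as a dual norm, and one-sided limits of integrals\<close>

context line_measure
begin

lemma finite_exhaustion:
  obtains F where "\<And>n::nat. F n \<in> sets M" "\<And>n. emeasure M (F n) < top" "incseq F" "(\<Union>n. F n) = space M"
  using sigma_finite_incseq by (metis less_top infinity_ennreal_def image_subset_iff UNIV_I)

text \<open>Hoelder gives one direction. For the other, v^(1/(1 - r)) divided by its integral is the
  extremal f; as this integral may be infinite, v is first truncated to min(v, n) on a set of finite
  measure, and n tends to infinity.\<close>

lemma VR_eq_integral:
  assumes r: "0 < r" "r < 1" and [measurable]: "v \<in> BM"
  shows "VR r v = (\<I> x. v x powe (1 / (1 - r))) powe (1 - r)"
proof (rule antisym)
  let ?s = "1 / (1 - r)"
  have s: "0 < ?s" "?s * (1 - r) = 1" using r by simp_all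
  show "VR r v \<le> (\<I> x. v x powe ?s) powe (1 - r)"
  proof (rule VR_least)
    fix f assume [measurable]: "f \<in> BM" and f: "(\<I> x. f x) \<le> 1"
    have "(\<I> x. f x powe r * v x) = (\<I> x. f x powe r * (v x powe ?s) powe (1 - r))"
      using r s by (subst powe_powe) auto
    also have "... \<le> (\<I> x. f x) powe r * (\<I> x. v x powe ?s) powe (1 - r)"
      using r by (intro hoelder_powe) auto
    also have "... \<le> 1 powe r * (\<I> x. v x powe ?s) powe (1 - r)"
      using r f by (intro mult_right_mono powe_mono) auto
    finally show "(\<I> x. f x powe r * v x) \<le> (\<I> x. v x powe ?s) powe (1 - r)" by simp
  qed
  obtain F where F [measurable]: "\<And>n::nat. F n \<in> sets M" and Ff: "\<And>n. emeasure M (F n) < top"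
    and Fi: "incseq F" and FU: "(\<Union>n. F n) = space M" using finite_exhaustion by blast
  define h where "h n x = min (v x) (of_nat n) * ind (F n) x" for n x
  have hm [measurable]: "h n \<in> BM" for n unfolding h_def by measurable
  have hinc: "h m x \<le> h n x" if "m \<le> n" for m n x unfolding h_def using that incseqD[OF Fi that]
    by (intro mult_mono min.mono) (auto simp: indicator_def)
  have hSUP: "v x \<le> (SUP n. h n x)" if x: "x \<in> space M" for x
  proof (rule le_SUP_iff[THEN iffD2], intro allI impI)
    fix y assume y: "y < v x"
    have "y < top" using y by (auto intro: less_le_trans)
    then obtain n where n: "y < of_nat n" using ennreal_Ex_less_of_nat by blast
    obtain m where m: "x \<in> F m" using x FU by blast
    have "y < min (v x) (of_nat (max m n))" using y n by (auto intro: less_le_trans simp: max_def)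
    moreover have "x \<in> F (max m n)" using m incseqD[OF Fi, of m "max m n"] by auto
    ultimately have "y < h (max m n) x" by (simp add: h_def)
    then show "\<exists>n\<in>UNIV. y < h n x" by blast
  qed
  have "(\<I> x. v x powe ?s) \<le> (\<I> x. (SUP n. h n x powe ?s))"
  proof (rule nn_integral_mono)
    fix x assume "x \<in> space M"
    then have "v x powe ?s \<le> (SUP n. h n x) powe ?s" using s by (intro powe_mono hSUP) auto
    then show "v x powe ?s \<le> (SUP n. h n x powe ?s)" using s by (simp add: powe_SUP)
  qed
  also have "... = (SUP n. \<I> x. h n x powe ?s)"
    using s by (intro nn_integral_monotone_convergence_SUP incseq_SucI le_funI powe_mono hinc) auto
  finally have "(\<I> x. v x powe ?s) powe (1 - r) \<le> (SUP n. (\<I> x. h n x powe ?s)) powe (1 - r)"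
    using r by (intro powe_mono) auto
  also have "... = (SUP n. (\<I> x. h n x powe ?s) powe (1 - r))" using r by (intro powe_SUP) auto
  also have "... \<le> VR r v"
  proof (rule SUP_least)
    fix n
    let ?g = "\<lambda>x. h n x powe ?s" and ?G = "\<I> x. h n x powe ?s"
    have "?g x \<le> of_nat n powe ?s * ind (F n) x" for x
      using s unfolding h_def by (auto simp: indicator_def intro!: powe_mono)
    then have "?G \<le> mass (F n) (\<lambda>x. of_nat n powe ?s)" by (rule nn_integral_mono)
    also have "... = of_nat n powe ?s * emeasure M (F n)" by (simp add: nn_integral_cmult_indicator)
    also have "... < top"
      using Ff[of n] s by (simp add: ennreal_mult_less_top powe_less_top_iff of_nat_less_top)
    finally have Gf: "?G < top" .
    show "?G powe (1 - r) \<le> VR r v"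
    proof (cases "?G = 0")
      case False
      \<comment> \<open>For s = 1/(1 - r) the identity sr + 1 = s makes the test function reproduce
        its own integrand.\<close>
      have eq: "?g x powe r * h n x = ?g x" for x
      proof -
        have e: "?s * r + 1 = ?s" "0 < ?s * r" using r by (simp_all add: field_simps)
        show ?thesis
          unfolding powe_powe[OF s(1) r(1)] using powe_add[of "?s * r" 1 "h n x"] e by (simp only: powe_one_right zero_less_one)
      qed
      have "?g x = ?G * (?g x / ?G)" for x
        using False Gf by (simp add: ennreal_times_divide ennreal_mult_divide_eq mult.commute less_top)
      then have "?g x powe r = ?G powe r * (?g x / ?G) powe r" for x using r by (metis powe_mult)
      then have "?G = (\<I> x. ?G powe r * ((?g x / ?G) powe r * h n x))" using eq by (simp add: mult.assoc)
      also have "... = ?G powe r * (\<I> x. (?g x / ?G) powe r * h n x)"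
        by (rule nn_integral_cmult) measurable
      also have "... \<le> ?G powe r * (\<I> x. (?g x / ?G) powe r * v x)"
        by (intro mult_left_mono nn_integral_mono) (auto simp: h_def indicator_def)
      also have "... \<le> ?G powe r * VR r v"
        using False Gf by (intro mult_left_mono VR_ge) (auto simp: nn_integral_divide ennreal_divide_self less_top)
      finally have "?G powe r * ?G powe (1 - r) \<le> ?G powe r * VR r v"
        using powe_add[of r "1 - r" ?G] r by simp
      moreover have "?G powe r \<noteq> 0" "?G powe r \<noteq> top"
        using False Gf r by (simp_all add: powe_eq_0_iff powe_eq_top_iff less_top)
      ultimately show ?thesis by (simp add: ennreal_mult_le_mult_iff)
    qed (use r in simp)
  qed
  finally show "(\<I> x. v x powe ?s) powe (1 - r) \<le> VR r v" .
qed

text \<open>If the essential supremum were larger, the normalised indicator of a part of {v > VR 1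
  v} of positive finite measure would exceed the supremum that defines \<open>VR\<close>.\<close>

lemma VR_one_eq_esssup:
  assumes [measurable]: "v \<in> BM" shows "VR 1 v = esssup M v"
proof (rule antisym)
  show "VR 1 v \<le> esssup M v"
  proof (rule VR_least)
    fix f assume [measurable]: "f \<in> BM" and f: "(\<I> x. f x) \<le> 1"
    have "(\<I> x. f x powe 1 * v x) \<le> (\<I> x. f x * esssup M v)"
      using esssup_AE[of v M] by (intro nn_integral_mono_AE) (auto elim!: eventually_mono intro: mult_left_mono)
    also have "... \<le> esssup M v"
      using mult_right_mono[OF f, of "esssup M v"] by (simp add: nn_integral_multc)
    finally show "(\<I> x. f x powe 1 * v x) \<le> esssup M v" .
  qed
next
  show "esssup M v \<le> VR 1 v"
  proof (rule ccontr)
    assume "\<not> esssup M v \<le> VR 1 v"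
    then have z: "VR 1 v < esssup M v" by simp
    let ?S = "{x \<in> space M. v x > VR 1 v}"
    have pos: "emeasure M ?S > 0" by (rule esssup_pos_measure[OF assms z])
    obtain F where F [measurable]: "\<And>n::nat. F n \<in> sets M" and Ff: "\<And>n. emeasure M (F n) < top"
      and Fi: "incseq F" and FU: "(\<Union>n. F n) = space M" using finite_exhaustion by blast
    have "\<exists>n. emeasure M (?S \<inter> F n) \<noteq> 0"
    proof (rule ccontr)
      assume "\<not> (\<exists>n. emeasure M (?S \<inter> F n) \<noteq> 0)"
      then have "emeasure M (\<Union>n. ?S \<inter> F n) = 0" by (intro emeasure_UN_eq_0) auto
      moreover have "(\<Union>n. ?S \<inter> F n) = ?S" using FU by blast
      ultimately show False using pos by simp
    qed
    then obtain n where n: "emeasure M (?S \<inter> F n) \<noteq> 0" by blast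
    let ?T = "?S \<inter> F n"
    let ?f = "\<lambda>x. ind ?T x / emeasure M ?T"
    have T [measurable]: "?T \<in> sets M" by measurable
    have "emeasure M ?T \<le> emeasure M (F n)" by (intro emeasure_mono) auto
    then have fin: "emeasure M ?T < top" using Ff[of n] by (rule le_less_trans)
    have f1: "(\<I> x. ?f x) = 1" using n fin by (simp add: nn_integral_divide ennreal_divide_self less_top)
    have c: "0 \<le> VR 1 v" "VR 1 v < top" using z by (auto intro: less_le_trans)
    have "(\<I> x. ?f x * VR 1 v) < (\<I> x. ?f x * v x)"
    proof (rule nn_integral_less)
      show "(\<I> x. ?f x * VR 1 v) \<noteq> \<infinity>" using c f1 by (simp add: nn_integral_multc less_top)
      show "AE x in M. ?f x * VR 1 v \<le> ?f x * v x"
        by (intro AE_I2) (auto simp: indicator_def intro!: mult_left_mono)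
      show "\<not> (AE x in M. ?f x * v x \<le> ?f x * VR 1 v)"
      proof
        assume "AE x in M. ?f x * v x \<le> ?f x * VR 1 v"
        then have "AE x in M. x \<notin> ?T"
        proof eventually_elim
          case (elim x)
          show ?case
          proof
            assume x: "x \<in> ?T"
            have "1 / emeasure M ?T \<noteq> 0" "1 / emeasure M ?T \<noteq> top"
              using n fin by (auto simp: ennreal_divide_eq_0_iff ennreal_divide_eq_top_iff less_top)
            then show False using elim x by (auto simp: ennreal_mult_le_mult_iff)
          qed
        qed
        then have "emeasure M ?T = 0" using AE_iff_null_sets[OF T] by (simp add: null_sets_def)
        then show False using n by simp
      qed
    qed auto
    then have "VR 1 v < (\<I> x. ?f x powe 1 * v x)" using f1 by (simp add: nn_integral_multc)
    also have "... \<le> VR 1 v" using f1 by (intro VR_ge) auto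
    finally show False by simp
  qed
qed

lemma VR_cong_AE:
  assumes "AE x in M. v x = v' x" shows "VR r v = VR r v'"
proof -
  have "(\<I> x. f x powe r * v x) = (\<I> x. f x powe r * v' x)" for f
    using assms by (intro nn_integral_cong_AE) (auto elim!: eventually_mono)
  then show ?thesis unfolding VR_def by simp
qed

text \<open>This lemma and its counterpart at the left endpoint give the one-sided continuity by
  which essential suprema become suprema.\<close>

lemma integral_le_of_left:
  assumes [measurable]: "g \<in> BM" and xt: "x < t"
    and le: "\<And>s. x < s \<Longrightarrow> s < t \<Longrightarrow> (mass {x..<s} g) \<le> c"
  shows "mass {x..<t} g \<le> c"
proof -
  \<comment> \<open>The summand 2 keeps s n strictly between x and t already for n = 0.\<close>
  define s where "s n = t - (t - x) / (real n + 2)" for n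
  have sb: "x < s n" "s n < t" for n
  proof -
    have "(t - x) / (real n + 2) < t - x" using xt by (simp add: divide_less_eq mult_less_cancel_left1)
    then show "x < s n" by (simp add: s_def)
  qed (use xt in \<open>simp add: s_def\<close>)
  have sinc: "s n \<le> s (Suc n)" for n
    using xt unfolding s_def by (intro diff_left_mono divide_left_mono) (auto simp: add_pos_nonneg)
  have sup: "\<exists>n. y < s n" if "y < t" for y
  proof -
    obtain n where "(t - x) / (t - y) < real n" using reals_Archimedean2 by blast
    then have "(t - x) / (t - y) < real n + 2" by simp
    then have "t - x < (real n + 2) * (t - y)" using that by (simp add: divide_less_eq)
    then have "(t - x) / (real n + 2) < t - y" by (simp add: divide_less_eq mult.commute)
    then show ?thesis by (intro exI[of _ n]) (simp add: s_def)
  qed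
  have "mass {x..<t} g \<le> (\<I> y. (SUP n. g y * ind {x..<s n} y))"
  proof (rule nn_integral_mono)
    fix y
    show "g y * ind {x..<t} y \<le> (SUP n. g y * ind {x..<s n} y)"
    proof (cases "y \<in> {x..<t}")
      case True
      then obtain n where "y < s n" using sup by auto
      then show ?thesis using True by (intro SUP_upper2[of n]) auto
    qed simp
  qed
  also have "... = (SUP n. mass {x..<s n} g)"
  proof (rule nn_integral_monotone_convergence_SUP)
    show "incseq (\<lambda>n y. g y * ind {x..<s n} y)"
    proof (intro incseq_SucI le_funI mult_left_mono)
      fix n y
      show "ind {x..<s n} y \<le> (ind {x..<s (Suc n)} y)" using sinc[of n] by (auto simp: indicator_def)
    qed simp
  qed measurable
  also have "... \<le> c" using sb by (intro SUP_least le)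
  finally show ?thesis .
qed

lemma integral_le_of_right:
  assumes [measurable]: "g \<in> BM" and nul: "emeasure M {x} = 0"
    and sing: "{x} \<in> sets M"
    and le: "\<And>y. x < y \<Longrightarrow> y < t \<Longrightarrow> y \<in> space M \<Longrightarrow> (mass {y..<t} g) \<le> c"
  shows "mass {x..<t} g \<le> c"
proof -
  have "AE s in M. s \<noteq> x" using nul sing by (intro AE_I[where N = "{x}"]) auto
  then have "mass {x..<t} g = mass {x<..<t} g"
    by (intro nn_integral_cong_AE) (auto elim!: eventually_mono simp: indicator_def)
  also have "... \<le> c"
  proof (rule nn_integral_le_tails[where T = "{x<..<t}"])
    fix y assume y: "y \<in> {x<..<t}" "y \<in> space M"
    have "mass {y..} (cut {x<..<t} g) \<le> mass {y..<t} g"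
      by (intro nn_integral_mono) (auto simp: indicator_def)
    also have "... \<le> c" using y by (intro le) auto
    finally show "mass {y..} (cut {x<..<t} g) \<le> c" .
  qed (auto simp: indicator_def)
  finally show ?thesis .
qed

lemma VR_zero_fun: "0 < r \<Longrightarrow> (\<And>x. x \<in> space M \<Longrightarrow> v x = 0) \<Longrightarrow> VR r v = 0"
proof -
  assume r: "0 < r" and v: "\<And>x. x \<in> space M \<Longrightarrow> v x = 0"
  have "(\<I> x. f x powe r * v x) = 0" for f using v by (subst nn_integral_cong[where v = "\<lambda>_. 0"]) auto
  then have "VR r v \<le> 0" by (intro VR_least) auto
  then show ?thesis by simp
qed

end

section \<open>Lebesgue measure on an interval\<close>

lemma einterval_between: "x \<in> einterval a b \<Longrightarrow> y \<in> einterval a b \<Longrightarrow> x \<le> z \<Longrightarrow> z \<le> y \<Longrightarrow> z \<in> einterval a b"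
  unfolding einterval_iff by (meson ereal_less_eq(3) less_le_trans le_less_trans)

lemma einterval_mono: "a \<le> \<alpha> \<Longrightarrow> \<beta> \<le> b \<Longrightarrow> einterval \<alpha> \<beta> \<subseteq> einterval a b"
  by (auto simp: einterval_iff intro: le_less_trans less_le_trans)

lemma einterval_sets [simp]: "einterval a b \<in> sets lebesgue" using borel_einterval by simp

lemma space_einterval [simp]: "space (lebesgue_on (einterval a b)) = einterval a b"
  by (simp add: space_restrict_space)

lemma line_measure_lebesgue_on: "line_measure (lebesgue_on (einterval a b))"
proof -
  have U: "(\<Union>n::nat. {- real n..real n}) = UNIV"
  proof (rule UNIV_eq_I[symmetric])
    fix x :: real
    obtain n where "\<bar>x\<bar> \<le> real n" using real_arch_simple by blast
    then have "x \<in> {- real n..real n}" by (simp add: abs_le_iff)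
    then show "x \<in> (\<Union>n::nat. {- real n..real n})" by blast
  qed
  have "sigma_finite_measure (lebesgue :: real measure)"
    by (rule sigma_finite_measure.intro, rule exI[of _ "range (\<lambda>n::nat. {- real n..real n})"])
       (auto simp: U)
  then interpret sigma_finite_measure "lebesgue_on (einterval a b)"
    by (rule sigma_finite_measure_restrict_space) simp
  show ?thesis by unfold_locales (intro measurable_restrict_space1 measurable_completion, simp)
qed

lemma null_point: "emeasure (lebesgue_on (einterval a b)) {x} = 0"
proof (cases "x \<in> einterval a b")
  case True
  then show ?thesis by (simp add: emeasure_restrict_space)
next
  case False
  then have "{x} \<notin> sets (lebesgue_on (einterval a b))"
    using sets.sets_into_space[of "{x}" "lebesgue_on (einterval a b)"] by auto
  then show ?thesis by (rule emeasure_notin_sets)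
qed

lemma point_sets: "x \<in> einterval a b \<Longrightarrow> {x} \<in> sets (lebesgue_on (einterval a b))"
  by (simp add: sets_restrict_space_iff)

lemma AE_neq: "AE s in lebesgue_on (einterval a b). s \<noteq> x"
proof (cases "x \<in> einterval a b")
  case True
  then show ?thesis using null_point[where x = x and a = a and b = b] point_sets[OF True] by (intro AE_I[where N = "{x}"]) auto
next
  case False
  then show ?thesis by (intro AE_I2) auto
qed

lemma integ_subinterval:
  assumes "a \<le> \<alpha>" "\<beta> \<le> b"
  shows "integ \<alpha> \<beta> g = (\<integral>\<^sup>+ s. g s * ind (einterval \<alpha> \<beta>) s \<partial>(lebesgue_on (einterval a b)))"
proof -
  have "einterval a b \<inter> einterval \<alpha> \<beta> = einterval \<alpha> \<beta>" using einterval_mono[OF assms] by blast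
  then have "restrict_space (lebesgue_on (einterval a b)) (einterval \<alpha> \<beta>) = lebesgue_on (einterval \<alpha> \<beta>)"
    by (subst restrict_restrict_space) auto
  moreover have "einterval \<alpha> \<beta> \<inter> einterval a b \<in> sets (lebesgue_on (einterval a b))"
    by (subst sets_restrict_space_iff) auto
  ultimately show ?thesis
    using nn_integral_restrict_space[of "einterval \<alpha> \<beta>" "lebesgue_on (einterval a b)" g] by simp
qed

lemma esssup_restrict_space:
  fixes f :: "'a \<Rightarrow> ennreal"
  assumes I: "I \<inter> space M \<in> sets M" and f [measurable]: "f \<in> borel_measurable M"
  shows "esssup (restrict_space M I) f = esssup M (cut I f)"
proof -
  have "f \<in> borel_measurable (restrict_space M I)" using f by (rule measurable_restrict_space1)
  moreover have "(cut I f) \<in> borel_measurable M"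
    using calculation I by (simp add: borel_measurable_restrict_space_iff_ennreal)
  moreover have "(AE x in restrict_space M I. f x \<le> z) \<longleftrightarrow> (AE x in M. f x * ind I x \<le> z)" for z
    unfolding AE_restrict_space_iff[OF I] by (intro AE_cong) (auto simp: indicator_def)
  ultimately show ?thesis by (simp add: esssup_eq_AE)
qed

lemma ess_sup_cong:
  assumes "\<And>x. x \<in> einterval \<alpha> \<beta> \<Longrightarrow> f x = g x" shows "ess_sup \<alpha> \<beta> f = ess_sup \<alpha> \<beta> g"
proof -
  have "f \<in> borel_measurable (lebesgue_on (einterval \<alpha> \<beta>)) \<longleftrightarrow> g \<in> borel_measurable (lebesgue_on (einterval \<alpha> \<beta>))"
    using assms by (intro measurable_cong) auto
  moreover have "AE x in lebesgue_on (einterval \<alpha> \<beta>). f x = g x" using assms by (intro AE_I2) auto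
  ultimately show ?thesis by (metis esssup_AE_cong esssup_non_measurable)
qed

text \<open>The essential suprema in the statement are suprema, since any number that their functions exceed
  at a point is exceeded on a whole interval at one side of it.\<close>

lemma ess_sup_eq_SUP:
  assumes F: "F \<in> borel_measurable (lebesgue_on (einterval \<alpha> \<beta>))"
    and lsc: "\<And>x z. x \<in> einterval \<alpha> \<beta> \<Longrightarrow> z < F x \<Longrightarrow>
      \<exists>c d. c < d \<and> {c<..<d} \<subseteq> einterval \<alpha> \<beta> \<and> (\<forall>y\<in>{c<..<d}. z < F y)"
  shows "ess_sup \<alpha> \<beta> F = (SUP x\<in>einterval \<alpha> \<beta>. F x)"
proof (rule antisym)
  show "ess_sup \<alpha> \<beta> F \<le> (SUP x\<in>einterval \<alpha> \<beta>. F x)"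
    using F by (intro esssup_I AE_I2) (auto intro: SUP_upper)
  show "(SUP x\<in>einterval \<alpha> \<beta>. F x) \<le> ess_sup \<alpha> \<beta> F"
  proof (intro SUP_least leI notI)
    fix x assume "x \<in> einterval \<alpha> \<beta>" "ess_sup \<alpha> \<beta> F < F x"
    then obtain c d where cd: "c < d" "{c<..<d} \<subseteq> einterval \<alpha> \<beta>" "\<forall>y\<in>{c<..<d}. ess_sup \<alpha> \<beta> F < F y"
      using lsc by blast
    have "AE y in lebesgue. y \<in> einterval \<alpha> \<beta> \<longrightarrow> F y \<le> ess_sup \<alpha> \<beta> F"
      using esssup_AE[of F "lebesgue_on (einterval \<alpha> \<beta>)"] by (subst (asm) AE_restrict_space_iff) auto
    then have "AE y in lebesgue. y \<notin> {c<..<d}"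
      by eventually_elim (use cd in \<open>auto simp: not_le[symmetric]\<close>)
    then have "{c<..<d} \<in> null_sets lebesgue" by (subst AE_iff_null_sets) auto
    then show False using cd(1) by (simp add: null_sets_def)
  qed
qed

text \<open>A is monotone on the interval only; the running supremum over points of the interval is
  monotone on the whole line and agrees with A inside.\<close>

lemma mono_on_measurable_interval:
  fixes A :: "real \<Rightarrow> ennreal"
  assumes "\<And>x y. x \<in> einterval \<alpha> \<beta> \<Longrightarrow> y \<in> einterval \<alpha> \<beta> \<Longrightarrow> x \<le> y \<Longrightarrow> A x \<le> A y"
  shows "A \<in> borel_measurable (lebesgue_on (einterval \<alpha> \<beta>))"
proof -
  interpret line_measure "lebesgue_on (einterval \<alpha> \<beta>)" by (rule line_measure_lebesgue_on)
  let ?A = "\<lambda>x. SUP y\<in>einterval \<alpha> \<beta> \<inter> {..x}. A y"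
  have "?A \<in> borel_measurable (lebesgue_on (einterval \<alpha> \<beta>))"
    by (intro mono_measurable monoI SUP_subset_mono) auto
  moreover have "?A x = A x" if "x \<in> einterval \<alpha> \<beta>" for x
    using that assms by (intro antisym SUP_least SUP_upper) auto
  ultimately show ?thesis using measurable_cong[of "lebesgue_on (einterval \<alpha> \<beta>)" ?A A] by simp
qed

lemma antimono_on_measurable_interval:
  fixes A :: "real \<Rightarrow> ennreal"
  assumes "\<And>x y. x \<in> einterval \<alpha> \<beta> \<Longrightarrow> y \<in> einterval \<alpha> \<beta> \<Longrightarrow> x \<le> y \<Longrightarrow> A y \<le> A x"
  shows "A \<in> borel_measurable (lebesgue_on (einterval \<alpha> \<beta>))"
proof -
  interpret line_measure "lebesgue_on (einterval \<alpha> \<beta>)" by (rule line_measure_lebesgue_on)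
  let ?A = "\<lambda>x. SUP y\<in>einterval \<alpha> \<beta> \<inter> {x..}. A y"
  have "?A \<in> borel_measurable (lebesgue_on (einterval \<alpha> \<beta>))"
    by (intro antimono_measurable antimonoI SUP_subset_mono) auto
  moreover have "?A x = A x" if "x \<in> einterval \<alpha> \<beta>" for x
    using that assms by (intro antisym SUP_least SUP_upper) auto
  ultimately show ?thesis using measurable_cong[of "lebesgue_on (einterval \<alpha> \<beta>)" ?A A] by simp
qed

text \<open>If z < A x * B x, approximating B from the right gives y > x with z < A x * B y, and
  between x and y both factors are at least as large as these.\<close>

lemma ess_sup_mono_antimono:
  fixes A B :: "real \<Rightarrow> ennreal"
  assumes A: "\<And>x y. x \<in> einterval \<alpha> \<beta> \<Longrightarrow> y \<in> einterval \<alpha> \<beta> \<Longrightarrow> x \<le> y \<Longrightarrow> A x \<le> A y"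
    and B: "\<And>x y. x \<in> einterval \<alpha> \<beta> \<Longrightarrow> y \<in> einterval \<alpha> \<beta> \<Longrightarrow> x \<le> y \<Longrightarrow> B y \<le> B x"
    and lsc: "\<And>x. x \<in> einterval \<alpha> \<beta> \<Longrightarrow> B x \<le> (SUP y\<in>einterval \<alpha> \<beta> \<inter> {x<..}. B y)"
  shows "ess_sup \<alpha> \<beta> (\<lambda>x. A x * B x) = (SUP x\<in>einterval \<alpha> \<beta>. A x * B x)"
proof (rule ess_sup_eq_SUP)
  show "(\<lambda>x. A x * B x) \<in> borel_measurable (lebesgue_on (einterval \<alpha> \<beta>))"
    by (intro borel_measurable_times_ennreal mono_on_measurable_interval antimono_on_measurable_interval A B)
  fix x z assume x: "x \<in> einterval \<alpha> \<beta>" and z: "z < A x * B x"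
  note z
  also have "A x * B x \<le> A x * (SUP y\<in>einterval \<alpha> \<beta> \<inter> {x<..}. B y)" by (intro mult_left_mono lsc x) simp
  also have "... = (SUP y\<in>einterval \<alpha> \<beta> \<inter> {x<..}. A x * B y)" by (rule SUP_mult_left_ennreal)
  finally obtain y where y: "y \<in> einterval \<alpha> \<beta>" "x < y" "z < A x * B y" by (auto simp: less_SUP_iff)
  show "\<exists>c d. c < d \<and> {c<..<d} \<subseteq> einterval \<alpha> \<beta> \<and> (\<forall>y\<in>{c<..<d}. z < A y * B y)"
  proof (intro exI conjI ballI)
    show "{x<..<y} \<subseteq> einterval \<alpha> \<beta>" using einterval_between[OF x y(1)] by auto
    fix x' assume x': "x' \<in> {x<..<y}"
    then have "x' \<in> einterval \<alpha> \<beta>" using einterval_between[OF x y(1), of x'] by auto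
    then have "A x * B y \<le> A x' * B x'" using x x' y by (intro mult_mono A B) auto
    with y(3) show "z < A x' * B x'" by (rule less_le_trans)
  qed (rule y(2))
qed

text \<open>Mirror image: here the approximated factor increases, and the interval lies to the left
  of x.\<close>

lemma ess_sup_antimono_mono:
  fixes A B :: "real \<Rightarrow> ennreal"
  assumes A: "\<And>x y. x \<in> einterval \<alpha> \<beta> \<Longrightarrow> y \<in> einterval \<alpha> \<beta> \<Longrightarrow> x \<le> y \<Longrightarrow> A y \<le> A x"
    and B: "\<And>x y. x \<in> einterval \<alpha> \<beta> \<Longrightarrow> y \<in> einterval \<alpha> \<beta> \<Longrightarrow> x \<le> y \<Longrightarrow> B x \<le> B y"
    and lsc: "\<And>x. x \<in> einterval \<alpha> \<beta> \<Longrightarrow> B x \<le> (SUP y\<in>einterval \<alpha> \<beta> \<inter> {..<x}. B y)"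
  shows "ess_sup \<alpha> \<beta> (\<lambda>x. A x * B x) = (SUP x\<in>einterval \<alpha> \<beta>. A x * B x)"
proof (rule ess_sup_eq_SUP)
  show "(\<lambda>x. A x * B x) \<in> borel_measurable (lebesgue_on (einterval \<alpha> \<beta>))"
    by (intro borel_measurable_times_ennreal mono_on_measurable_interval antimono_on_measurable_interval A B)
  fix x z assume x: "x \<in> einterval \<alpha> \<beta>" and z: "z < A x * B x"
  note z
  also have "A x * B x \<le> A x * (SUP y\<in>einterval \<alpha> \<beta> \<inter> {..<x}. B y)" by (intro mult_left_mono lsc x) simp
  also have "... = (SUP y\<in>einterval \<alpha> \<beta> \<inter> {..<x}. A x * B y)" by (rule SUP_mult_left_ennreal)
  finally obtain y where y: "y \<in> einterval \<alpha> \<beta>" "y < x" "z < A x * B y" by (auto simp: less_SUP_iff)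
  show "\<exists>c d. c < d \<and> {c<..<d} \<subseteq> einterval \<alpha> \<beta> \<and> (\<forall>y\<in>{c<..<d}. z < A y * B y)"
  proof (intro exI conjI ballI)
    show "{y<..<x} \<subseteq> einterval \<alpha> \<beta>" using einterval_between[OF y(1) x] by auto
    fix x' assume x': "x' \<in> {y<..<x}"
    then have "x' \<in> einterval \<alpha> \<beta>" using einterval_between[OF y(1) x, of x'] by auto
    then have "A x * B y \<le> A x' * B x'" using x x' y by (intro mult_mono A B) auto
    with y(3) show "z < A x' * B x'" by (rule less_le_trans)
  qed (rule y(2))
qed

lemma tail_lebesgue_on:
  assumes "x \<in> einterval a b"
  shows "line_measure.tail (lebesgue_on (einterval a b)) g x = integ (ereal x) b g"
proof -
  have "integ (ereal x) b g = (\<integral>\<^sup>+ s. g s * ind (einterval (ereal x) b) s \<partial>(lebesgue_on (einterval a b)))"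
    using assms by (intro integ_subinterval) (auto simp: einterval_iff)
  also have "... = (\<integral>\<^sup>+ s. g s * ind {x..} s \<partial>(lebesgue_on (einterval a b)))"
  proof (rule nn_integral_cong_AE)
    show "AE s in lebesgue_on (einterval a b). g s * ind (einterval (ereal x) b) s = g s * ind {x..} s"
      using AE_neq[where x = x and a = a and b = b] AE_space[of "lebesgue_on (einterval a b)"]
      by eventually_elim (auto simp: indicator_def einterval_iff)
  qed
  finally show ?thesis by (simp add: line_measure.tail_def[OF line_measure_lebesgue_on])
qed

locale interval_weights =
  fixes a b :: ereal and u v w :: "real \<Rightarrow> ennreal" and p q r :: real
  assumes ab: "a < b" and weights: "weight a b u" "weight a b v" "weight a b w"
    and W: "\<And>x. x \<in> einterval a b \<Longrightarrow> 0 < integ (ereal x) b w \<and> integ (ereal x) b w < \<infinity>"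
    and exponents: "0 < p" "0 < q" "0 < r" "r \<le> 1"
begin

abbreviation "S \<equiv> einterval a b"

abbreviation "L \<equiv> lebesgue_on S"

abbreviation I\<^sub>L (binder \<open>\<I>\<close> 10) where "I\<^sub>L \<equiv> nn_integral L"

end

sublocale interval_weights \<subseteq> hardy_setting "lebesgue_on (einterval a b)" u v w p q r
proof -
  interpret line_measure "lebesgue_on (einterval a b)" by (rule line_measure_lebesgue_on)
  show "hardy_setting (lebesgue_on (einterval a b)) u v w p q r"
    by unfold_locales (use weights W exponents in \<open>auto simp: weight_def tail_lebesgue_on\<close>)
qed

section \<open>One-sided continuity of V_r and removal of essential suprema\<close>

context interval_weights
begin

lemma integ_tail: "x \<in> S \<Longrightarrow> integ (ereal x) b g = tail g x" by (simp add: tail_lebesgue_on)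

lemma integ_head:
  assumes "x \<in> S" shows "integ a (ereal x) g = head g x"
proof -
  have "integ a (ereal x) g = (\<I> s. g s * ind (einterval a (ereal x)) s)"
    using assms by (intro integ_subinterval) (auto simp: einterval_iff)
  also have "... = head g x"
    unfolding head_def by (intro nn_integral_cong) (auto simp: indicator_def einterval_iff)
  finally show ?thesis .
qed

lemma integ_mid:
  assumes "x \<in> S" "y \<in> S"
  shows "integ (ereal x) (ereal y) g = mass {x..<y} g"
proof -
  have "integ (ereal x) (ereal y) g = (\<I> s. g s * ind (einterval (ereal x) (ereal y)) s)"
    using assms by (intro integ_subinterval) (auto simp: einterval_iff)
  also have "... = mass {x..<y} g"
  proof (rule nn_integral_cong_AE)
    show "AE s in L. g s * ind (einterval (ereal x) (ereal y)) s = g s * ind {x..<y} s"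
      using AE_neq[where x = x and a = a and b = b]
      by eventually_elim (auto simp: indicator_def einterval_iff)
  qed
  finally show ?thesis .
qed

text \<open>Both cases of the definition of V_r are dual norms, by \<open>VR_eq_integral\<close> for
  r < 1 and \<open>VR_one_eq_esssup\<close> for r = 1; the left endpoint, which only
  \<open>P\<close> includes, is a null set.\<close>

lemma V_eq:
  assumes x: "x \<in> S" and t: "t \<in> S"
  shows "V r v (ereal x) (ereal t) = P x t powe (1 / r)"
proof (cases "r < 1")
  case True
  have e: "0 < 1 / (1 - r)" "0 < 1 - r" "0 < 1 / r" using True pos by auto
  have "P x t = (\<I> s. (v s * ind {x..<t} s) powe (1 / (1 - r))) powe (1 - r)"
    unfolding P_def using pos True by (intro VR_eq_integral) auto
  also have "(\<I> s. (v s * ind {x..<t} s) powe (1 / (1 - r))) = integ (ereal x) (ereal t) (\<lambda>s. v s powe (1 / (1 - r)))"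
    unfolding integ_mid[OF x t] using e by (intro nn_integral_cong) (auto simp: indicator_def)
  finally show ?thesis using True unfolding V_def by (simp add: powe_powe[OF e(2,3)])
next
  case False
  then have r1: "r = 1" using pos by simp
  have "einterval (ereal x) (ereal t) \<subseteq> S" using x t by (intro einterval_mono) (auto simp: einterval_iff)
  then have sub: "S \<inter> einterval (ereal x) (ereal t) = einterval (ereal x) (ereal t)" by blast
  have rs: "restrict_space L (einterval (ereal x) (ereal t)) = lebesgue_on (einterval (ereal x) (ereal t))"
    by (subst restrict_restrict_space) (auto simp: sub simp del: einterval_eq)
  have "V r v (ereal x) (ereal t) = esssup (restrict_space L (einterval (ereal x) (ereal t))) v"
    unfolding V_def rs using False by simp
  also have "... = esssup L (cut (einterval (ereal x) (ereal t)) v)"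
    by (rule esssup_restrict_space) (auto simp: sets_restrict_space_iff simp del: einterval_eq)
  also have "... = VR r (cut (einterval (ereal x) (ereal t)) v)"
    unfolding r1 by (rule VR_one_eq_esssup[symmetric]) auto
  also have "... = P x t" unfolding P_def
  proof (rule VR_cong_AE)
    show "AE s in L. v s * ind (einterval (ereal x) (ereal t)) s = v s * ind {x..<t} s"
      using AE_neq[where x = x and a = a and b = b]
      by eventually_elim (auto simp: indicator_def einterval_iff)
  qed
  finally show ?thesis by (simp add: r1)
qed

lemma P_zero: "t \<le> x \<Longrightarrow> P x t = 0" unfolding P_def using pos by (intro VR_zero_fun) auto

text \<open>P is a supremum over f of integrals over [x, t), and each of these is approximated by
  those over [y, t) with y > x, since points are null.\<close>

lemma P_right:
  assumes "x \<in> S" "x < t"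
  shows "P x t \<le> (SUP y\<in>S \<inter> {x<..<t}. P y t)" unfolding P_def
proof (rule VR_least)
  fix f assume f [measurable]: "f \<in> borel_measurable L" and f1: "(\<I> s. f s) \<le> 1"
  have "mass {x..<t} (\<lambda>s. (f s powe r * v s)) \<le> (SUP y\<in>S \<inter> {x<..<t}. P y t)"
  proof (rule integral_le_of_right)
    fix y assume y: "x < y" "y < t" "y \<in> space L"
    have "mass {y..<t} (\<lambda>s. (f s powe r * v s)) \<le> P y t"
      unfolding P_def using VR_ge[OF f f1] by (simp add: mult.assoc)
    also have "... \<le> (SUP y\<in>S \<inter> {x<..<t}. P y t)" using y by (intro SUP_upper) auto
    finally show "mass {y..<t} (\<lambda>s. (f s powe r * v s)) \<le> (SUP y\<in>S \<inter> {x<..<t}. P y t)" .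
  qed (use assms in \<open>auto simp: null_point point_sets\<close>)
  then show "(\<I> s. f s powe r * (v s * ind {x..<t} s)) \<le> (SUP y\<in>S \<inter> {x<..<t}. VR r (cut {y..<t} v))"
    by (simp add: mult.assoc P_def)
qed

lemma P_left:
  assumes "x < t"
  shows "P x t \<le> (SUP s\<in>{x<..<t}. P x s)" unfolding P_def
proof (rule VR_least)
  fix f assume f [measurable]: "f \<in> borel_measurable L" and f1: "(\<I> s. f s) \<le> 1"
  have "mass {x..<t} (\<lambda>s. (f s powe r * v s)) \<le> (SUP s\<in>{x<..<t}. P x s)"
  proof (rule integral_le_of_left)
    fix y assume y: "x < y" "y < t"
    have "mass {x..<y} (\<lambda>s. (f s powe r * v s)) \<le> P x y"
      unfolding P_def using VR_ge[OF f f1] by (simp add: mult.assoc)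
    also have "... \<le> (SUP s\<in>{x<..<t}. P x s)" using y by (intro SUP_upper) auto
    finally show "mass {x..<y} (\<lambda>s. (f s powe r * v s)) \<le> (SUP s\<in>{x<..<t}. P x s)" .
  qed (use assms in auto)
  then show "(\<I> s. f s powe r * (v s * ind {x..<t} s)) \<le> (SUP s\<in>{x<..<t}. VR r (cut {x..<s} v))"
    by (simp add: mult.assoc P_def)
qed

lemma P_right_powe:
  assumes "x \<in> S" "x < t" "t \<in> S" "0 < c"
  shows "P x t powe c \<le> (SUP y\<in>S \<inter> {x<..<t}. P y t powe c)"
proof -
  have "(x + t) / 2 \<in> S \<inter> {x<..<t}"
    using einterval_between[OF assms(1,3), of "(x + t) / 2"] assms(2) by auto
  then have "S \<inter> {x<..<t} \<noteq> {}" by blast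
  then show ?thesis using powe_mono[OF P_right[OF assms(1,2)], of c] assms(4) by (simp add: powe_SUP)
qed

lemma P_left_powe:
  assumes "x < t" "0 < c"
  shows "P x t powe c \<le> (SUP s\<in>{x<..<t}. P x s powe c)"
  using powe_mono[OF P_left[OF assms(1)], of c] assms by (simp add: powe_SUP)

lemma ess_sup_P_inner:
  assumes x: "x \<in> S" and \<beta>: "\<beta> \<le> b" and c: "0 < c"
    and A: "\<And>s t. s \<in> einterval a \<beta> \<Longrightarrow> t \<in> einterval a \<beta> \<Longrightarrow> s \<le> t \<Longrightarrow> A t \<le> A s"
  shows "ess_sup (ereal x) \<beta> (\<lambda>t. A t * P x t powe c) = (SUP t\<in>einterval (ereal x) \<beta>. A t * P x t powe c)"
proof (rule ess_sup_antimono_mono)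
  have sub: "einterval (ereal x) \<beta> \<subseteq> einterval a \<beta>"
    using x by (intro einterval_mono) (auto simp: einterval_iff)
  show "A t \<le> A s" if "s \<in> einterval (ereal x) \<beta>" "t \<in> einterval (ereal x) \<beta>" "s \<le> t" for s t
    using that sub by (intro A) auto
  show "P x s powe c \<le> P x t powe c" if "s \<le> t" for s t using that c by (intro powe_mono P_mono) auto
  fix t assume t: "t \<in> einterval (ereal x) \<beta>"
  then have xt: "x < t" by (simp add: einterval_iff)
  have "ereal s < \<beta>" if "s < t" for s
    using that t less_trans[of "ereal s" "ereal t" \<beta>] by (simp add: einterval_iff)
  then have "{x<..<t} \<subseteq> einterval (ereal x) \<beta> \<inter> {..<t}" by (auto simp: einterval_iff)
  then have "(SUP s\<in>{x<..<t}. P x s powe c) \<le> (SUP y\<in>einterval (ereal x) \<beta> \<inter> {..<t}. P x y powe c)"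
    by (rule SUP_subset_mono) simp
  with P_left_powe[OF xt c] show "P x t powe c \<le> (SUP y\<in>einterval (ereal x) \<beta> \<inter> {..<t}. P x y powe c)"
    by (rule order_trans)
qed

text \<open>Stated for any right end \<beta>, to cover \<open>C1\<close> with \<beta> = b and
  \<open>C7\<close> with \<beta> = x. The inner supremum decreases in x and inherits approximation
  from the right from \<open>P_right_powe\<close>.\<close>

lemma ess_sup_P_outer:
  assumes \<beta>: "\<beta> \<le> b" and c: "0 < c"
    and A: "\<And>s t. s \<in> einterval a \<beta> \<Longrightarrow> t \<in> einterval a \<beta> \<Longrightarrow> s \<le> t \<Longrightarrow> A t \<le> A s"
    and B: "\<And>s t. s \<in> einterval a \<beta> \<Longrightarrow> t \<in> einterval a \<beta> \<Longrightarrow> s \<le> t \<Longrightarrow> B s \<le> B t"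
  shows "ess_sup a \<beta> (\<lambda>x. B x * ess_sup (ereal x) \<beta> (\<lambda>t. A t * P x t powe c)) =
    (SUP x\<in>einterval a \<beta>. B x * (SUP t\<in>einterval (ereal x) \<beta>. A t * P x t powe c))"
proof -
  have sub: "einterval a \<beta> \<subseteq> S" using \<beta> by (intro einterval_mono) auto
  have "ess_sup a \<beta> (\<lambda>x. B x * ess_sup (ereal x) \<beta> (\<lambda>t. A t * P x t powe c)) =
    ess_sup a \<beta> (\<lambda>x. B x * (SUP t\<in>einterval (ereal x) \<beta>. A t * P x t powe c))"
  proof (rule ess_sup_cong)
    fix x assume "x \<in> einterval a \<beta>"
    then have "x \<in> S" using sub by blast
    then show "B x * ess_sup (ereal x) \<beta> (\<lambda>t. A t * P x t powe c) = B x * (SUP t\<in>einterval (ereal x) \<beta>. A t * P x t powe c)"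
      by (simp only: ess_sup_P_inner[OF _ \<beta> c A])
  qed
  also have "... = (SUP x\<in>einterval a \<beta>. B x * (SUP t\<in>einterval (ereal x) \<beta>. A t * P x t powe c))"
  proof (rule ess_sup_mono_antimono[OF B])
    fix x y assume xy: "x \<in> einterval a \<beta>" "y \<in> einterval a \<beta>" "x \<le> y"
    have "einterval (ereal y) \<beta> \<subseteq> einterval (ereal x) \<beta>" using xy by (intro einterval_mono) auto
    then show "(SUP t\<in>einterval (ereal y) \<beta>. A t * P y t powe c) \<le> (SUP t\<in>einterval (ereal x) \<beta>. A t * P x t powe c)"
      using xy c by (intro SUP_subset_mono mult_left_mono powe_mono P_mono) auto
  next
    fix x assume x: "x \<in> einterval a \<beta>"
    show "(SUP t\<in>einterval (ereal x) \<beta>. A t * P x t powe c) \<le>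
      (SUP y\<in>einterval a \<beta> \<inter> {x<..}. SUP t\<in>einterval (ereal y) \<beta>. A t * P y t powe c)" (is "_ \<le> ?R")
    proof (rule SUP_least)
      fix t assume t: "t \<in> einterval (ereal x) \<beta>"
      have tx: "x < t" "t \<in> einterval a \<beta>" using t x less_trans[of a "ereal x" "ereal t"] by (auto simp: einterval_iff)
      have "A t * P x t powe c \<le> A t * (SUP y\<in>S \<inter> {x<..<t}. P y t powe c)"
        using x tx sub c by (intro mult_left_mono P_right_powe) auto
      also have "... = (SUP y\<in>S \<inter> {x<..<t}. A t * P y t powe c)" by (rule SUP_mult_left_ennreal)
      also have "... \<le> ?R"
      proof (rule SUP_least)
        fix y assume y: "y \<in> S \<inter> {x<..<t}"
        have "y \<in> einterval a \<beta> \<inter> {x<..}" using y einterval_between[OF x tx(2), of y] by auto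
        moreover have "t \<in> einterval (ereal y) \<beta>" using t y by (auto simp: einterval_iff)
        ultimately show "A t * P y t powe c \<le> ?R" by (intro SUP_upper2[of y] SUP_upper2[of t]) auto
      qed
      finally show "A t * P x t powe c \<le> ?R" .
    qed
  qed
  finally show ?thesis .
qed

end

lemma powe_swap_le:
  assumes W: "W \<noteq> 0" "W < (top :: ennreal)" and c: "0 < c" shows "W powe (- c) * x \<le> y \<longleftrightarrow> x \<le> y * W powe c"
proof
  have cancel: "W powe (- c) * W powe c = 1" using W c by (intro powe_neg_mult) auto
  assume "W powe (- c) * x \<le> y"
  then have "(W powe (- c) * x) * W powe c \<le> y * W powe c" by (rule mult_right_mono) simp
  moreover have "(W powe (- c) * x) * W powe c = (W powe (- c) * W powe c) * x" by (simp only: mult_ac)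
  ultimately show "x \<le> y * W powe c" using cancel by simp
next
  have cancel: "W powe (- c) * W powe c = 1" using W c by (intro powe_neg_mult) auto
  assume "x \<le> y * W powe c"
  then have "W powe (- c) * x \<le> W powe (- c) * (y * W powe c)" by (rule mult_left_mono) simp
  moreover have "W powe (- c) * (y * W powe c) = (W powe (- c) * W powe c) * y" by (simp only: mult_ac)
  ultimately show "W powe (- c) * x \<le> y" using cancel by simp
qed

lemma (in line_measure) AQ_mono:
  assumes rq: "0 < r" "0 < q" and le: "\<And>x. x \<in> space M \<Longrightarrow> u x \<le> u' x" "\<And>x. x \<in> space M \<Longrightarrow> v x \<le> v' x"
  shows "AQ r q u v \<le> AQ r q u' v'"
proof -
  have V: "VR r (cut {..<t} v) \<le> VR r (cut {..<t} v')" for t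
    using le by (intro VR_mono mult_right_mono) auto
  show ?thesis
  proof (cases "q < 1")
    case True
    then show ?thesis unfolding AQ_def using rq le V
      by (auto intro!: powe_mono nn_integral_mono mult_mono tail_mono_fun)
  next
    case False
    then show ?thesis unfolding AQ_def using rq le V
      by (auto intro!: SUP_mono' mult_mono tail_mono_fun powe_mono)
  qed
qed

section \<open>The quantities \<open>C1\<close>, ..., \<open>C7\<close> in terms of
  \<open>tail\<close>, \<open>P\<close>, \<open>Q\<close> and \<open>AQ\<close>\<close>

context interval_weights
begin

abbreviation "D\<^sub>1 \<equiv> C1 a b p q r u v w"
abbreviation "D\<^sub>2 \<equiv> C2 a b p q r u v w"
abbreviation "D\<^sub>3 \<equiv> C3 a b p q r u v w"
abbreviation "D\<^sub>4 \<equiv> C4 a b p q r u v w"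
abbreviation "D\<^sub>5 \<equiv> C5 a b p q r u v w"
abbreviation "D\<^sub>6 \<equiv> C6 a b p q r u v w"
abbreviation "D\<^sub>7 \<equiv> C7 a b p q r u v w"

lemma W_props: "x \<in> S \<Longrightarrow> tail w x \<noteq> 0" "x \<in> S \<Longrightarrow> tail w x < top" using W_pos W_fin by (auto simp: less_le)

lemma above_nonempty: "x \<in> S \<Longrightarrow> einterval (ereal x) b \<noteq> {}"
  using einterval_nonempty[of "ereal x" b] by (auto simp: einterval_iff)

lemma below_nonempty: "x \<in> S \<Longrightarrow> einterval a (ereal x) \<noteq> {}"
  using einterval_nonempty[of a "ereal x"] by (auto simp: einterval_iff)

lemma above_sub: "x \<in> S \<Longrightarrow> einterval (ereal x) b \<subseteq> S" by (intro einterval_mono) (auto simp: einterval_iff)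

lemma below_sub: "x \<in> S \<Longrightarrow> einterval a (ereal x) \<subseteq> S" by (intro einterval_mono) (auto simp: einterval_iff)

lemma below_eq: "x \<in> S \<Longrightarrow> einterval a (ereal x) = {y \<in> S. y < x}"
  using less_trans[of _ "ereal x" b] by (auto simp: einterval_iff)

lemma P_powe: "0 < c \<Longrightarrow> (P x t powe (1 / r)) powe c = P x t powe (c / r)"
  using pos by (subst powe_powe) auto

lemma cut_cut: "(\<lambda>s. cut {x..} g s * ind {..<t} s) = cut {x..<t} g" by (auto simp: indicator_def)

lemma C1_eq:
  "D\<^sub>1 = (SUP x\<in>S. tail w x powe (- (1 / p)) *
     (SUP t\<in>einterval (ereal x) b. tail u t powe (1 / q) * P x t powe (1 / r)))"
proof -
  have inner: "ess_sup (ereal x) b (\<lambda>t. (integ (ereal t) b u) powe (1 / q) * V r v (ereal x) (ereal t)) =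
      ess_sup (ereal x) b (\<lambda>t. tail u t powe (1 / q) * P x t powe (1 / r))" if x: "x \<in> S" for x
    using above_sub[OF x] x by (intro ess_sup_cong) (auto simp: integ_tail V_eq)
  have "D\<^sub>1 = ess_sup a b (\<lambda>x. tail w x powe (- (1 / p)) *
      ess_sup (ereal x) b (\<lambda>t. tail u t powe (1 / q) * P x t powe (1 / r)))"
    unfolding C1_def by (intro ess_sup_cong) (simp add: inner integ_tail)
  also have "... = (SUP x\<in>S. tail w x powe (- (1 / p)) *
     (SUP t\<in>einterval (ereal x) b. tail u t powe (1 / q) * P x t powe (1 / r)))"
  proof (rule ess_sup_P_outer)
    show "tail u t powe (1 / q) \<le> tail u s powe (1 / q)" if "s \<le> t" for s t
      using that pos by (intro powe_mono tail_antimono) auto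
    show "tail w s powe (- (1 / p)) \<le> tail w t powe (- (1 / p))" if "s \<in> S" "t \<in> S" "s \<le> t" for s t
      using that pos W_pos by (intro powe_neg_antimono tail_antimono) auto
  qed (use pos in auto)
  finally show ?thesis .
qed

lemma C1_upper:
  assumes A: "D\<^sub>1 powe q \<le> A" and x: "x \<in> S" and t: "t \<in> S"
  shows "tail u t * P x t powe (q / r) \<le> A * tail w x powe (q / p)"
proof (cases "x < t")
  case False
  then show ?thesis using pos by (simp add: P_zero)
next
  case True
  then have tx: "t \<in> einterval (ereal x) b" using t by (auto simp: einterval_iff)
  have "tail w x powe (- (1 / p)) * (tail u t powe (1 / q) * P x t powe (1 / r)) \<le> D\<^sub>1" unfolding C1_eq
    by (intro SUP_upper2[OF x] mult_left_mono) (use tx in \<open>auto intro: SUP_upper\<close>)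
  then have "tail u t powe (1 / q) * P x t powe (1 / r) \<le> D\<^sub>1 * tail w x powe (1 / p)"
    using W_props[OF x] pos by (simp add: powe_swap_le)
  then have "(tail u t powe (1 / q) * P x t powe (1 / r)) powe q \<le> (D\<^sub>1 * tail w x powe (1 / p)) powe q"
    using pos by (intro powe_mono) auto
  then have "tail u t * P x t powe (q / r) \<le> D\<^sub>1 powe q * tail w x powe (q / p)"
    using pos by (simp add: powe_mult powe_powe)
  then show ?thesis using A by (meson mult_right_mono order_trans zero_le)
qed

lemma C1_lower:
  assumes D: "bounded_by D" shows "D\<^sub>1 \<le> D powe (1 / q)" unfolding C1_eq SUP_mult_left_ennreal
proof (intro SUP_least)
  fix x t assume x: "x \<in> S" and tx: "t \<in> einterval (ereal x) b"
  have t: "t \<in> S" using above_sub[OF x] tx by blast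
  have "(tail u t * P x t powe (q / r)) powe (1 / q) \<le> (D * tail w x powe (q / p)) powe (1 / q)"
    using pos tail_P_le[OF D, of t x] t by (intro powe_mono) auto
  then have "tail u t powe (1 / q) * P x t powe (1 / r) \<le> D powe (1 / q) * tail w x powe (1 / p)"
    using pos by (simp add: powe_mult powe_powe)
  then show "tail w x powe (- (1 / p)) * (tail u t powe (1 / q) * P x t powe (1 / r)) \<le> D powe (1 / q)"
    using W_props[OF x] pos by (simp add: powe_swap_le)
qed

abbreviation c_upper :: ennreal where "c_upper \<equiv> dyad (2 * (q / r) + q + 2)"

lemma C1_KQ:
  assumes q: "1 \<le> q" and A: "D\<^sub>1 powe q \<le> A" and x: "x \<in> S"
  shows "KQ\<^sub>c {x..} \<le> c_upper * A * tail w x powe (q / p)"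
proof -
  have "KQ\<^sub>c {x..} \<le> c_upper * AQ\<^sub>c {x..}" using pos by (intro KQ_le_AQ) auto
  also have "AQ\<^sub>c {x..} \<le> A * tail w x powe (q / p)"
  proof -
    have "tail (cut {x..} u) t * P x t powe (q / r) \<le> A * tail w x powe (q / p)" if "t \<in> S" for t
    proof -
      have "tail (cut {x..} u) t * P x t powe (q / r) \<le> tail u t * P x t powe (q / r)"
        by (intro mult_right_mono tail_mono_fun) (auto simp: indicator_def)
      also have "... \<le> A * tail w x powe (q / p)" by (rule C1_upper[OF A x that])
      finally show ?thesis .
    qed
    then show ?thesis unfolding AQ_def cut_cut P_def[symmetric] using q by (auto intro!: SUP_least)
  qed
  finally show ?thesis by (simp add: mult_left_mono mult.assoc)
qed

lemma AQ_tail: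
  assumes q: "q < 1" and x: "x \<in> S"
  shows "AQ\<^sub>c {x..} = (integ (ereal x) b (\<lambda>t. (integ (ereal t) b u) powe (q / (1 - q)) * u t *
          V r v (ereal x) (ereal t) powe (q / (1 - q)))) powe (1 - q)"
proof -
  have e: "0 < q / (1 - q)" using q pos by simp
  have "tail (cut {x..} u) t powe (q / (1 - q)) * P x t powe (q / r / (1 - q)) * cut {x..} u t =
      (integ (ereal t) b u) powe (q / (1 - q)) * u t * V r v (ereal x) (ereal t) powe (q / (1 - q)) * ind {x..} t"
    if t: "t \<in> S" for t
  proof (cases "x \<le> t")
    case True
    then have "tail (cut {x..} u) t = tail u t"
      unfolding tail_def by (intro nn_integral_cong) (auto simp: indicator_def)
    then show ?thesis
      unfolding integ_tail[OF t] V_eq[OF x t] P_powe[OF e] using True by (simp add: mult_ac)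
  qed simp
  then show ?thesis unfolding AQ_def cut_cut P_def[symmetric] integ_tail[OF x] tail_def[of _ x]
    using q by (auto intro!: arg_cong[where f = "\<lambda>z. z powe (1 - q)"] nn_integral_cong)
qed

lemma C2_eq:
  assumes q: "q < 1"
  shows "D\<^sub>2 = (SUP x\<in>S. tail w x powe (- (1 / p)) * AQ\<^sub>c {x..} powe (1 / q))" unfolding C2_def
proof (rule SUP_cong[OF refl])
  fix x assume x: "x \<in> S"
  have e: "0 < 1 - q" "0 < 1 / q" "(1 - q) * (1 / q) = (1 - q) / q" using q pos by simp_all
  show "(integ (ereal x) b w) powe (- (1 / p)) *
       (integ (ereal x) b (\<lambda>t. (integ (ereal t) b u) powe (q / (1 - q)) * u t *
          V r v (ereal x) (ereal t) powe (q / (1 - q)))) powe ((1 - q) / q) =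
     tail w x powe (- (1 / p)) * AQ\<^sub>c {x..} powe (1 / q)"
    unfolding AQ_tail[OF q x] powe_powe[OF e(1,2)] e(3) integ_tail[OF x, of w] by (rule refl)
qed

lemma C2_upper:
  assumes q: "q < 1" and A: "D\<^sub>2 powe q \<le> A" and x: "x \<in> S"
  shows "KQ\<^sub>c {x..} \<le> c_upper * A * tail w x powe (q / p)"
proof -
  let ?A = "AQ\<^sub>c {x..}"
  have "tail w x powe (- (1 / p)) * ?A powe (1 / q) \<le> D\<^sub>2" unfolding C2_eq[OF q] by (rule SUP_upper) fact
  then have "?A powe (1 / q) \<le> D\<^sub>2 * tail w x powe (1 / p)"
    using W_props[OF x] pos by (simp add: powe_swap_le)
  then have "(?A powe (1 / q)) powe q \<le> (D\<^sub>2 * tail w x powe (1 / p)) powe q"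
    using pos by (intro powe_mono) auto
  then have "?A \<le> D\<^sub>2 powe q * tail w x powe (q / p)" using pos by (simp add: powe_mult powe_powe)
  then have "?A \<le> A * tail w x powe (q / p)" using A by (meson mult_right_mono order_trans zero_le)
  then have "c_upper * ?A \<le> c_upper * (A * tail w x powe (q / p))" by (rule mult_left_mono) simp
  moreover have "KQ\<^sub>c {x..} \<le> c_upper * ?A" using pos by (intro KQ_le_AQ) auto
  ultimately show ?thesis by (simp add: mult.assoc)
qed

lemma C2_lower:
  assumes q: "q < 1" and D: "bounded_by D"
  shows "D\<^sub>2 \<le> c_local r q powe (1 / q) * D powe (1 / q)" unfolding C2_eq[OF q]
proof (rule SUP_least)
  fix x assume x: "x \<in> S"
  have "AQ\<^sub>c {x..} \<le> c_local r q * KQ\<^sub>c {x..}" using pos by (intro AQ_le_KQ) auto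
  also have "... \<le> c_local r q * (D * tail w x powe (q / p))"
    by (intro mult_left_mono KQ_tail_le[OF D]) simp
  finally have "AQ\<^sub>c {x..} powe (1 / q) \<le> (c_local r q * (D * tail w x powe (q / p))) powe (1 / q)"
    using pos by (intro powe_mono) auto
  also have "... = (c_local r q powe (1 / q) * D powe (1 / q)) * tail w x powe (1 / p)"
    using pos by (simp add: powe_mult powe_powe mult.assoc)
  finally show "tail w x powe (- (1 / p)) * AQ\<^sub>c {x..} powe (1 / q) \<le> c_local r q powe (1 / q) * D powe (1 / q)"
    unfolding powe_swap_le[OF W_props(1)[OF x] W_props(2)[OF x] divide_pos_pos[OF zero_less_one pos(1)]] .
qed

lemma Q_eq:
  assumes rp: "r < p" and x: "x \<in> S"
  shows "integ a (ereal x) (\<lambda>t. (integ (ereal t) b w) powe (- (p / (p - r))) * w t *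
          V r v (ereal t) (ereal x) powe (p * r / (p - r))) = Q x"
proof -
  have e: "0 < p * r / (p - r)" "p * r / (p - r) / r = p / (p - r)" using rp pos by simp_all
  show ?thesis unfolding integ_head[OF x] head_def Q_def
    by (intro nn_integral_cong) (simp only: space_einterval integ_tail V_eq[OF _ x] P_powe[OF e(1)] e(2))
qed

lemma C3_eq:
  assumes rp: "r < p"
  shows "D\<^sub>3 = (SUP x\<in>S. tail u x powe (1 / q) * Q x powe (1 / \<theta>))"
  unfolding C3_def by (rule SUP_cong[OF refl]) (simp add: integ_tail Q_eq[OF rp] \<theta>_def)

lemma C3_upper:
  assumes rp: "r < p" and A: "D\<^sub>3 powe q \<le> A" and x: "x \<in> S"
  shows "tail u x powe (\<theta> / q) * Q x \<le> A powe (\<theta> / q)"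
proof -
  have \<theta>: "0 < \<theta>" using rp pos by (simp add: \<theta>_def)
  have "tail u x powe (1 / q) * Q x powe (1 / \<theta>) \<le> D\<^sub>3" unfolding C3_eq[OF rp] by (rule SUP_upper) fact
  then have "(tail u x powe (1 / q) * Q x powe (1 / \<theta>)) powe \<theta> \<le> D\<^sub>3 powe \<theta>"
    using \<theta> by (intro powe_mono) auto
  moreover have "(D\<^sub>3 powe q) powe (\<theta> / q) \<le> A powe (\<theta> / q)" using \<theta> pos A by (intro powe_mono) auto
  ultimately show ?thesis using \<theta> pos by (simp add: powe_mult powe_powe)
qed

definition c_three :: ennreal where
  "c_three = (c_Q * (2 * c_hardy p 1 powe (r / p)) powe (p / (p - r))) powe (1 / \<theta>)"

lemma c_three_finite: "r < p \<Longrightarrow> c_three < top" using c_Q_finite c_hardy_finite[of p 1] pos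
  by (simp add: c_three_def ennreal_mult_less_top powe_less_top_iff \<theta>_def)

lemma C3_lower':
  assumes rp: "r < p" and k: "band ka" and D: "bounded_by D" "D < top"
  shows "D\<^sub>3 \<le> c_three * D powe (1 / q)" unfolding C3_eq[OF rp]
proof (rule SUP_least)
  fix x assume x: "x \<in> S"
  have \<theta>: "0 < \<theta>" "0 < 1 / \<theta>" "0 < 1 / q" "0 < \<theta> / q" using rp pos by (simp_all add: \<theta>_def)
  have "tail u x powe (\<theta> / q) * Q x \<le> c_Q * ((2 * c_hardy p 1 powe (r / p)) powe (p / (p - r)) * D powe (\<theta> / q))"
    unfolding c_Q_def using x by (intro C3_lower[OF k D rp]) simp
  then have "(tail u x powe (\<theta> / q) * Q x) powe (1 / \<theta>) \<le>
      (c_Q * (2 * c_hardy p 1 powe (r / p)) powe (p / (p - r)) * D powe (\<theta> / q)) powe (1 / \<theta>)"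
    using \<theta> by (intro powe_mono) (auto simp: mult.assoc)
  then show "tail u x powe (1 / q) * Q x powe (1 / \<theta>) \<le> c_three * D powe (1 / q)"
    unfolding c_three_def powe_mult[OF \<theta>(2), of _ "D powe (\<theta> / q)"] powe_mult[OF \<theta>(2), of "tail u x powe (\<theta> / q)"]
    using \<theta> pos by (simp add: powe_powe)
qed

lemma outer_upper:
  assumes qp: "q < p" and A: "(X powe ((p - q) / (p * q))) powe q \<le> A"
  shows "X \<le> A powe (p / (p - q))"
proof -
  have e: "0 < (p - q) / (p * q)" "0 < (p - q) / p" "(p - q) / (p * q) * q = (p - q) / p" "1 / ((p - q) / p) = p / (p - q)"
    using qp pos by simp_all
  show ?thesis using A unfolding powe_powe[OF e(1) pos(2)] e(3) powe_le_move[OF e(2)] e(4) .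
qed

lemma outer_lower:
  assumes qp: "q < p" and X: "X \<le> c * D powe (p / (p - q))"
  shows "X powe ((p - q) / (p * q)) \<le> c powe ((p - q) / (p * q)) * D powe (1 / q)"
proof -
  have e: "0 < (p - q) / (p * q)" "0 < p / (p - q)" "p / (p - q) * ((p - q) / (p * q)) = 1 / q" using qp pos by simp_all
  have "X powe ((p - q) / (p * q)) \<le> (c * D powe (p / (p - q))) powe ((p - q) / (p * q))"
    using X e by (intro powe_mono) auto
  then show ?thesis unfolding powe_mult[OF e(1)] powe_powe[OF e(2,1)] e(3) .
qed

lemma S4_eq:
  assumes qp: "q < p" and x: "x \<in> S"
  shows "ess_sup a (ereal x) (\<lambda>t. (integ (ereal t) b w) powe (- (q / (p - q))) * V r v (ereal t) (ereal x) powe (p * q / (p - q)))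
    = S4 x powe (1 / r * (p * q / (p - q)))"
proof -
  define s where "s = p * q / (p - q)"
  have s: "0 < s" "0 < s / r" "r / p * (s / r) = q / (p - q)" "1 / r * s = s / r" using qp pos by (simp_all add: s_def)
  have "ess_sup a (ereal x) (\<lambda>t. (integ (ereal t) b w) powe (- (q / (p - q))) * V r v (ereal t) (ereal x) powe s) =
      ess_sup a (ereal x) (\<lambda>t. tail w t powe (- (q / (p - q))) * P t x powe (s / r))"
    using below_sub[OF x] by (intro ess_sup_cong) (auto simp: integ_tail V_eq[OF _ x] P_powe[OF s(1)])
  also have "... = (SUP t\<in>einterval a (ereal x). tail w t powe (- (q / (p - q))) * P t x powe (s / r))"
  proof (rule ess_sup_mono_antimono)
    fix y t assume yt: "y \<in> einterval a (ereal x)" "t \<in> einterval a (ereal x)" "y \<le> t"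
    have "t \<in> S" using below_sub[OF x] yt by blast
    then show "tail w y powe (- (q / (p - q))) \<le> tail w t powe (- (q / (p - q)))"
      using yt(3) qp pos W_pos[of t] by (intro powe_neg_antimono tail_antimono) auto
    show "P t x powe (s / r) \<le> P y x powe (s / r)" using yt(3) s by (intro powe_mono P_mono) auto
  next
    fix y assume y: "y \<in> einterval a (ereal x)"
    then have y': "y \<in> S" "y < x" using below_sub[OF x] by (auto simp: einterval_iff)
    have "P y x powe (s / r) \<le> (SUP z\<in>S \<inter> {y<..<x}. P z x powe (s / r))"
      by (rule P_right_powe[OF y' x s(2)])
    also have "... \<le> (SUP z\<in>einterval a (ereal x) \<inter> {y<..}. P z x powe (s / r))"
      by (rule SUP_subset_mono) (auto simp: einterval_iff)
    finally show "P y x powe (s / r) \<le> (SUP z\<in>einterval a (ereal x) \<inter> {y<..}. P z x powe (s / r))" .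
  qed
  also have "... = (SUP t\<in>{y \<in> S. y < x}. (tail w t powe (- (r / p)) * P t x) powe (s / r))"
    unfolding below_eq[OF x] powe_mult[OF s(2)] powe_neg_powe[OF s(2)] s(3) by (rule refl)
  also have "... = S4 x powe (s / r)"
    unfolding S4_def using below_nonempty[OF x] s by (simp add: powe_SUP below_eq[OF x])
  finally show ?thesis unfolding s_def[symmetric] s(4) .
qed

lemma C4_eq:
  assumes qp: "q < p"
  shows "D\<^sub>4 = (\<I> t. tail u t powe (q / (p - q)) * S4 t powe (1 / r * (p * q / (p - q))) * u t) powe ((p - q) / (p * q))"
  unfolding C4_def
proof (intro arg_cong[where f = "\<lambda>z. z powe ((p - q) / (p * q))"] nn_integral_cong)
  fix x assume "x \<in> space L"
  then have x: "x \<in> S" by simp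
  show "(integ (ereal x) b u) powe (q / (p - q)) * u x *
       ess_sup a (ereal x) (\<lambda>t. (integ (ereal t) b w) powe (- (q / (p - q))) * V r v (ereal t) (ereal x) powe (p * q / (p - q)))
    = tail u x powe (q / (p - q)) * S4 x powe (1 / r * (p * q / (p - q))) * u x"
    unfolding S4_eq[OF qp x] integ_tail[OF x] by (simp only: mult_ac)
qed

definition c_four :: ennreal where
  "c_four = (c_lower p q (1 / r * (p * q / (p - q))) * (1 / dyad (- 1) powe (q / r)) powe (p / (p - q))) powe ((p - q) / (p * q))"

lemma c_four_finite: "q < p \<Longrightarrow> c_four < top"
proof -
  assume qp: "q < p"
  have "1 / dyad (- 1) powe (q / r) < top"
    by (metis dyad_powe dyad_pos(2) ennreal_divide_eq_top_iff ennreal_one_neq_top less_top)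
  then show "c_four < top" using qp pos c_lower_finite[OF pos(2) qp, of "1 / r * (p * q / (p - q))"]
    by (simp add: c_four_def ennreal_mult_less_top powe_less_top_iff)
qed

lemma C4_lower':
  assumes qp: "q < p" "p \<le> 1" and D: "bounded_by D" "D < top"
  shows "D\<^sub>4 \<le> c_four * D powe (1 / q)" unfolding C4_eq[OF qp(1)] c_four_def
proof (rule outer_lower[OF qp(1)])
  have e: "0 < p / (p - q)" using qp pos by simp
  have "D * 1 powe (q / p) / dyad (- 1) powe (q / r) = (1 / dyad (- 1) powe (q / r)) * D"
    by (simp add: ennreal_times_divide mult.commute)
  then show "(\<I> t. tail u t powe (q / (p - q)) * S4 t powe (1 / r * (p * q / (p - q))) * u t) \<le>
      c_lower p q (1 / r * (p * q / (p - q))) * (1 / dyad (- 1) powe (q / r)) powe (p / (p - q)) * D powe (p / (p - q))"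
    using C4_lower[OF D qp] by (simp only: powe_mult[OF e] mult.assoc)
qed

definition S5A :: "real \<Rightarrow> ennreal" where
  "S5A x = (SUP y\<in>{y\<in>S. y < x}. (tail w y powe (- 1) * AQ\<^sub>c {y..<x}) powe (p / (p - q)))"

text \<open>The common value of \<open>C5\<close> for q < 1 and \<open>C7\<close> for q >= 1,
  because \<open>AQ\<close> switches between its two forms at q = 1. The ranges (v) to (vii) thus
  share \<open>K5_upper\<close> and \<open>K5_lower\<close>.\<close>

definition K5 :: ennreal where "K5 = (\<I> x. w x * S5A x) powe ((p - q) / (p * q))"

lemma S5A_measurable: "q < p \<Longrightarrow> S5A \<in> borel_measurable L"
proof (intro mono_measurable monoI)
  fix x x' :: real assume qp: "q < p" and x: "x \<le> x'"
  have "AQ\<^sub>c {y..<x} \<le> AQ\<^sub>c {y..<x'}" for y using pos x by (intro AQ_mono) (auto simp: indicator_def)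
  then show "S5A x \<le> S5A x'"
    unfolding S5A_def using x qp pos by (intro SUP_mono) (auto intro!: bexI powe_mono mult_left_mono)
qed

lemma K5_upper:
  assumes qp: "q < p" and A: "K5 powe q \<le> A"
  shows "(\<I> x. w x * S5 x) \<le> (c_upper * A) powe (p / (p - q))"
proof -
  have b: "0 < p / (p - q)" using qp pos by simp
  note [measurable] = S5A_measurable[OF qp]
  have le: "S5 x \<le> c_upper powe (p / (p - q)) * S5A x" for x unfolding S5_def
  proof (rule SUP_least)
    fix y assume y: "y \<in> {y \<in> space L. y < x}"
    let ?A = "AQ\<^sub>c {y..<x}"
    have "K y x \<le> c_upper * ?A" unfolding K_def using pos by (intro KQ_le_AQ) auto
    then have "tail w y powe (- 1) * K y x \<le> tail w y powe (- 1) * (c_upper * ?A)" by (rule mult_left_mono) simp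
    then have "(tail w y powe (- 1) * K y x) powe (p / (p - q)) \<le> (c_upper * (tail w y powe (- 1) * ?A)) powe (p / (p - q))"
      using b by (intro powe_mono) (auto simp: mult.left_commute)
    also have "... = c_upper powe (p / (p - q)) * (tail w y powe (- 1) * ?A) powe (p / (p - q))"
      by (rule powe_mult[OF b])
    also have "... \<le> c_upper powe (p / (p - q)) * S5A x"
      unfolding S5A_def using y by (intro mult_left_mono SUP_upper) auto
    finally show "(tail w y powe (- 1) * K y x) powe (p / (p - q)) \<le> c_upper powe (p / (p - q)) * S5A x" .
  qed
  have "(\<I> x. w x * S5 x) \<le> (\<I> x. c_upper powe (p / (p - q)) * (w x * S5A x))"
    by (intro nn_integral_mono) (subst mult.left_commute, intro mult_left_mono le, simp)
  also have "... = c_upper powe (p / (p - q)) * (\<I> x. w x * S5A x)"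
    by (rule nn_integral_cmult) measurable
  also have "... \<le> c_upper powe (p / (p - q)) * A powe (p / (p - q))"
    by (rule mult_left_mono[OF outer_upper[OF qp A[unfolded K5_def]]]) simp
  finally show ?thesis unfolding powe_mult[OF b] .
qed

definition c_five :: ennreal where
  "c_five = (c_local r q powe (p / (p - q)) * c_window) powe ((p - q) / (p * q))"

lemma c_local_finite: "c_local r q < top" using c_lower_finite[of q 1 "q / r / (1 - q)"] pos
  by (auto simp: c_local_def ennreal_mult_less_top powe_less_top_iff)

lemma c_five_finite: "q < p \<Longrightarrow> c_five < top" using c_local_finite c_window_finite pos
  by (simp add: c_five_def ennreal_mult_less_top powe_less_top_iff)

lemma K5_lower:
  assumes qp: "q < p" and k: "band ka" and D: "bounded_by D" "D < top"
  shows "K5 \<le> c_five * D powe (1 / q)" unfolding K5_def c_five_def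
proof (rule outer_lower[OF qp])
  have b: "0 < p / (p - q)" using qp pos by simp
  note [measurable] = S5_measurable[OF qp]
  have le: "S5A x \<le> c_local r q powe (p / (p - q)) * S5 x" for x unfolding S5A_def
  proof (rule SUP_least)
    fix y assume y: "y \<in> {y \<in> S. y < x}"
    have "AQ\<^sub>c {y..<x} \<le> c_local r q * K y x" unfolding K_def using pos by (intro AQ_le_KQ) auto
    then have "tail w y powe (- 1) * AQ\<^sub>c {y..<x} \<le> tail w y powe (- 1) * (c_local r q * K y x)"
      by (rule mult_left_mono) simp
    then have "(tail w y powe (- 1) * AQ\<^sub>c {y..<x}) powe (p / (p - q)) \<le>
        (c_local r q * (tail w y powe (- 1) * K y x)) powe (p / (p - q))"
      using b by (intro powe_mono) (auto simp: mult.left_commute)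
    also have "... = c_local r q powe (p / (p - q)) * (tail w y powe (- 1) * K y x) powe (p / (p - q))"
      by (rule powe_mult[OF b])
    also have "... \<le> c_local r q powe (p / (p - q)) * S5 x"
      unfolding S5_def using y by (intro mult_left_mono SUP_upper) auto
    finally show "(tail w y powe (- 1) * AQ\<^sub>c {y..<x}) powe (p / (p - q)) \<le>
      c_local r q powe (p / (p - q)) * S5 x" .
  qed
  have "(\<I> x. w x * S5A x) \<le> (\<I> x. c_local r q powe (p / (p - q)) * (w x * S5 x))"
    by (intro nn_integral_mono) (subst mult.left_commute, intro mult_left_mono le, simp)
  also have "... = c_local r q powe (p / (p - q)) * (\<I> x. w x * S5 x)"
    by (rule nn_integral_cmult) measurable
  also have "... \<le> c_local r q powe (p / (p - q)) * (c_window * D powe (p / (p - q)))"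
    unfolding S5_def[abs_def] by (intro mult_left_mono window_lower[OF k D qp]) simp
  finally show "(\<I> x. w x * S5A x) \<le> c_local r q powe (p / (p - q)) * c_window * D powe (p / (p - q))"
    by (simp add: mult.assoc)
qed

lemma cut_window:
  assumes "y \<in> S" "x \<in> S" "t \<in> {y..<x}"
  shows "tail (cut {y..<x} u) t = mass {t..<x} u"
    "VR r (\<lambda>s. cut {y..<x} v s * ind {..<t} s) = P y t"
proof -
  show "tail (cut {y..<x} u) t = mass {t..<x} u"
    unfolding tail_def using assms by (intro nn_integral_cong) (auto simp: indicator_def)
  show "VR r (\<lambda>s. cut {y..<x} v s * ind {..<t} s) = P y t"
    unfolding P_def using assms by (intro VR_cong) (auto simp: indicator_def)
qed

lemma AQ_mid_less:
  assumes q: "q < 1" and y: "y \<in> S" and x: "x \<in> S"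
  shows "AQ\<^sub>c {y..<x} =
    (integ (ereal y) (ereal x) (\<lambda>t. (integ (ereal t) (ereal x) u) powe (q / (1 - q)) * u t *
             V r v (ereal y) (ereal t) powe (q / (1 - q)))) powe (1 - q)"
proof -
  have e: "0 < q / (1 - q)" "q / (1 - q) / r = q / r / (1 - q)" using q pos by simp_all
  have "tail (cut {y..<x} u) t powe (q / (1 - q)) * VR r (\<lambda>s. cut {y..<x} v s * ind {..<t} s) powe (q / r / (1 - q)) *
      cut {y..<x} u t =
    (integ (ereal t) (ereal x) u) powe (q / (1 - q)) * u t * V r v (ereal y) (ereal t) powe (q / (1 - q)) * ind {y..<x} t"
    if t: "t \<in> S" for t
  proof (cases "t \<in> {y..<x}")
    case True
    show ?thesis unfolding cut_window[OF y x True] integ_mid[OF t x] V_eq[OF y t] P_powe[OF e(1)] e(2)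
      using True by (simp add: mult_ac)
  qed simp
  then show ?thesis unfolding AQ_def integ_mid[OF y x]
    using q by (auto intro!: arg_cong[where f = "\<lambda>z. z powe (1 - q)"] nn_integral_cong)
qed

lemma C5_eq:
  assumes qp: "q < p" and q: "q < 1"
  shows "D\<^sub>5 = K5" unfolding C5_def K5_def
proof (intro arg_cong[where f = "\<lambda>z. z powe ((p - q) / (p * q))"] nn_integral_cong arg_cong2[where f = "(*)"] refl)
  fix x assume "x \<in> space L"
  then have x: "x \<in> S" by simp
  have b: "0 < p / (p - q)" "0 < 1 - q" "(1 - q) * (p / (p - q)) = p * (1 - q) / (p - q)" using qp q pos by simp_all
  show "(SUP y \<in> einterval a (ereal x). (integ (ereal y) b w) powe (- (p / (p - q))) *
          (integ (ereal y) (ereal x) (\<lambda>t. (integ (ereal t) (ereal x) u) powe (q / (1 - q)) * u t *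
             V r v (ereal y) (ereal t) powe (q / (1 - q)))) powe (p * (1 - q) / (p - q))) = S5A x"
    unfolding below_eq[OF x] S5A_def
  proof (rule SUP_cong[OF refl])
    fix y assume "y \<in> {y \<in> S. y < x}"
    then have y: "y \<in> S" by simp
    show "(integ (ereal y) b w) powe (- (p / (p - q))) *
          (integ (ereal y) (ereal x) (\<lambda>t. (integ (ereal t) (ereal x) u) powe (q / (1 - q)) * u t *
             V r v (ereal y) (ereal t) powe (q / (1 - q)))) powe (p * (1 - q) / (p - q)) =
       (tail w y powe (- 1) * AQ\<^sub>c {y..<x}) powe (p / (p - q))"
      unfolding powe_mult[OF b(1)] powe_neg_powe[OF b(1)] mult_1 integ_tail[OF y, of w]
        AQ_mid_less[OF q y x] powe_powe[OF b(2,1)] b(3) by (rule refl)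
  qed
qed

text \<open>The supremum in \<open>AQ\<close> runs over the whole interval; for t <= y the factor
  with V_r vanishes, and for t >= x the tail of u cut off at x does.\<close>

lemma AQ_mid_ge:
  assumes q: "1 \<le> q" and qp: "q < p" and y: "y \<in> S" and x: "x \<in> S" and yx: "y < x"
  shows "AQ\<^sub>c {y..<x} powe (p / (p - q)) =
    (SUP t\<in>einterval (ereal y) (ereal x). (mass {t..<x} u) powe (p / (p - q)) *
       P y t powe (p * q / (p - q) / r))"
proof -
  have b: "0 < p / (p - q)" "0 < q / r" "q / r * (p / (p - q)) = p * q / (p - q) / r"
    using qp pos by (simp_all add: mult_ac)
  have ne: "S \<noteq> {}" using x by blast
  let ?V = "\<lambda>t. VR r (\<lambda>s. cut {y..<x} v s * ind {..<t} s)"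
  have "AQ\<^sub>c {y..<x} powe (p / (p - q)) =
      (SUP t\<in>S. tail (cut {y..<x} u) t * ?V t powe (q / r)) powe (p / (p - q))"
    unfolding AQ_def using q by simp
  also have "... = (SUP t\<in>S. tail (cut {y..<x} u) t powe (p / (p - q)) * ?V t powe (p * q / (p - q) / r))"
    unfolding powe_SUP[OF b(1) ne] powe_mult[OF b(1)] powe_powe[OF b(2,1)] b(3) by (rule refl)
  also have "... = (SUP t\<in>einterval (ereal y) (ereal x). (mass {t..<x} u) powe (p / (p - q)) *
       P y t powe (p * q / (p - q) / r))" (is "?l = ?r")
  proof (rule antisym)
    show "?l \<le> ?r"
    proof (rule SUP_least)
      fix t assume t: "t \<in> S"
      consider "t \<le> y" | "x \<le> t" | "y < t" "t < x" by linarith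
      then show "tail (cut {y..<x} u) t powe (p / (p - q)) * ?V t powe (p * q / (p - q) / r) \<le> ?r"
      proof cases
        case 1
        then have "?V t = 0" using pos by (intro VR_zero_fun) (auto simp: indicator_def)
        then show ?thesis using b qp pos by simp
      next
        case 2
        then have "tail (cut {y..<x} u) t = (\<I> s. 0)"
          unfolding tail_def by (intro nn_integral_cong) (auto simp: indicator_def)
        then show ?thesis using b by simp
      next
        case 3
        then have "t \<in> {y..<x}" by simp
        then show ?thesis using 3 by (intro SUP_upper2[of t]) (auto simp: cut_window[OF y x])
      qed
    qed
    show "?r \<le> ?l"
    proof (rule SUP_least)
      fix t assume "t \<in> einterval (ereal y) (ereal x)"
      then have t: "t \<in> {y..<x}" by simp
      then have "t \<in> S" using einterval_between[OF y x, of t] by simp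
      then show "mass {t..<x} u powe (p / (p - q)) * P y t powe (p * q / (p - q) / r) \<le> ?l"
        by (intro SUP_upper2[of t]) (auto simp: cut_window[OF y x t])
    qed
  qed
  finally show ?thesis .
qed

lemma C7_eq:
  assumes qp: "q < p" and q: "1 \<le> q"
  shows "D\<^sub>7 = K5" unfolding C7_def K5_def
proof (intro arg_cong[where f = "\<lambda>z. z powe ((p - q) / (p * q))"] nn_integral_cong arg_cong2[where f = "(*)"] refl)
  fix x assume "x \<in> space L"
  then have x: "x \<in> S" by simp
  have b: "0 < p / (p - q)" "0 < p * q / (p - q)" "0 < p * q / (p - q) / r" using qp pos by simp_all
  let ?A = "\<lambda>t. (mass {t..<x} u) powe (p / (p - q))"
  let ?c = "p * q / (p - q) / r"
  show "ess_sup a (ereal x) (\<lambda>y. (integ (ereal y) b w) powe (- (p / (p - q))) *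
          ess_sup (ereal y) (ereal x) (\<lambda>t. (integ (ereal t) (ereal x) u) powe (p / (p - q)) *
             V r v (ereal y) (ereal t) powe (p * q / (p - q)))) = S5A x" (is "?l = _")
  proof -
  have "?l =
     ess_sup a (ereal x) (\<lambda>y. tail w y powe (- (p / (p - q))) * ess_sup (ereal y) (ereal x) (\<lambda>t. ?A t * P y t powe ?c))"
  proof (rule ess_sup_cong)
    fix y assume "y \<in> einterval a (ereal x)"
    then have y: "y \<in> S" using below_sub[OF x] by blast
    have "ess_sup (ereal y) (ereal x) (\<lambda>t. (integ (ereal t) (ereal x) u) powe (p / (p - q)) *
             V r v (ereal y) (ereal t) powe (p * q / (p - q))) = ess_sup (ereal y) (ereal x) (\<lambda>t. ?A t * P y t powe ?c)"
    proof (rule ess_sup_cong)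
      fix t assume "t \<in> einterval (ereal y) (ereal x)"
      then have t: "t \<in> S" using einterval_between[OF y x, of t] by simp
      show "(integ (ereal t) (ereal x) u) powe (p / (p - q)) * V r v (ereal y) (ereal t) powe (p * q / (p - q)) =
          ?A t * P y t powe ?c" unfolding integ_mid[OF t x] V_eq[OF y t] P_powe[OF b(2)] by (rule refl)
    qed
    then show "(integ (ereal y) b w) powe (- (p / (p - q))) *
          ess_sup (ereal y) (ereal x) (\<lambda>t. (integ (ereal t) (ereal x) u) powe (p / (p - q)) *
             V r v (ereal y) (ereal t) powe (p * q / (p - q))) =
        tail w y powe (- (p / (p - q))) * ess_sup (ereal y) (ereal x) (\<lambda>t. ?A t * P y t powe ?c)"
      by (simp only: integ_tail[OF y])
  qed
  also have "... = (SUP y\<in>einterval a (ereal x). tail w y powe (- (p / (p - q))) *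
      (SUP t\<in>einterval (ereal y) (ereal x). ?A t * P y t powe ?c))"
  proof (rule ess_sup_P_outer)
    show "ereal x \<le> b" using x by (simp add: einterval_iff less_imp_le)
    show "0 < ?c" by (rule b)
    show "?A t \<le> ?A s" if "s \<le> t" for s t
      using that b by (intro powe_mono nn_integral_mono) (auto simp: indicator_def)
    fix s t assume st: "s \<in> einterval a (ereal x)" "t \<in> einterval a (ereal x)" "s \<le> t"
    have "t \<in> S" using st below_sub[OF x] by blast
    then show "tail w s powe (- (p / (p - q))) \<le> tail w t powe (- (p / (p - q)))"
      using st(3) b W_pos[of t] by (intro powe_neg_antimono tail_antimono) auto
  qed
  also have "... = S5A x" unfolding below_eq[OF x] S5A_def
  proof (rule SUP_cong[OF refl])
    fix y assume "y \<in> {y \<in> S. y < x}"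
    then have y: "y \<in> S" "y < x" by auto
    show "tail w y powe (- (p / (p - q))) * (SUP t\<in>einterval (ereal y) (ereal x). ?A t * P y t powe ?c) =
       (tail w y powe (- 1) * AQ\<^sub>c {y..<x}) powe (p / (p - q))"
      unfolding powe_mult[OF b(1)] powe_neg_powe[OF b(1)] mult_1 AQ_mid_ge[OF q qp y(1) x y(2)] by (rule refl)
  qed
    finally show ?thesis .
  qed
qed

lemma C6_eq:
  assumes rp: "r < p" and qp: "q < p"
  shows "D\<^sub>6 = (\<I> x. w x * S6 x) powe ((p - q) / (p * q))" unfolding C6_def
proof (intro arg_cong[where f = "\<lambda>z. z powe ((p - q) / (p * q))"] nn_integral_cong arg_cong2[where f = "(*)"] refl)
  fix x assume "x \<in> space L"
  then have x: "x \<in> S" by simp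
  note ex = exponent_eqs[OF rp qp]
  let ?B = "\<lambda>y. tail w y powe (- 1) * Q y powe \<eta>"
  show "ess_sup a (ereal x) (\<lambda>y. (integ (ereal y) b w) powe (- 1) *
          integ (ereal y) (ereal x) (\<lambda>t. (integ (ereal t) b u) powe (q / (p - q)) * u t) *
          (integ a (ereal y) (\<lambda>t. (integ (ereal t) b w) powe (- (p / (p - r))) * w t *
             V r v (ereal t) (ereal y) powe (p * r / (p - r)))) powe ((p - r) * q / ((p - q) * r))) = S6 x" (is "?l = _")
  proof -
  have "?l
      = ess_sup a (ereal x) (\<lambda>y. ?B y * \<Psi> y x)"
  proof (rule ess_sup_cong)
    fix y assume "y \<in> einterval a (ereal x)"
    then have y: "y \<in> S" using below_sub[OF x] by blast
    have "integ (ereal y) (ereal x) (\<lambda>t. (integ (ereal t) b u) powe (q / (p - q)) * u t) = \<Psi> y x"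
      unfolding integ_mid[OF y x] \<Psi>_def by (intro nn_integral_cong) (simp add: integ_tail)
    then show "(integ (ereal y) b w) powe (- 1) *
          integ (ereal y) (ereal x) (\<lambda>t. (integ (ereal t) b u) powe (q / (p - q)) * u t) *
          (integ a (ereal y) (\<lambda>t. (integ (ereal t) b w) powe (- (p / (p - r))) * w t *
             V r v (ereal t) (ereal y) powe (p * r / (p - r)))) powe ((p - r) * q / ((p - q) * r)) = ?B y * \<Psi> y x"
      unfolding Q_eq[OF rp y] \<eta>_def integ_tail[OF y, of w] by (simp only: mult_ac)
  qed
  also have "... = (SUP y\<in>einterval a (ereal x). ?B y * \<Psi> y x)"
  proof (rule ess_sup_mono_antimono)
    fix y t assume yt: "y \<in> einterval a (ereal x)" "t \<in> einterval a (ereal x)" "y \<le> t"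
    have "t \<in> S" using yt below_sub[OF x] by blast
    then show "?B y \<le> ?B t"
      using yt(3) W_pos[of t] ex(2) by (intro mult_mono powe_neg_antimono tail_antimono powe_mono Q_mono[OF rp]) auto
    show "\<Psi> t x \<le> \<Psi> y x"
      unfolding \<Psi>_def using yt(3) by (intro nn_integral_mono mult_left_mono) (auto simp: indicator_def)
  next
    fix y assume y: "y \<in> einterval a (ereal x)"
    show "\<Psi> y x \<le> (SUP z\<in>einterval a (ereal x) \<inter> {y<..}. \<Psi> z x)" unfolding \<Psi>_def[of y]
    proof (rule integral_le_of_right)
      fix z assume z: "y < z" "z < x" "z \<in> space L"
      then have "z \<in> einterval a (ereal x) \<inter> {y<..}" by (auto simp: einterval_iff)
      then have "\<Psi> z x \<le> (SUP z\<in>einterval a (ereal x) \<inter> {y<..}. \<Psi> z x)" by (rule SUP_upper)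
      then show "mass {z..<x} (\<lambda>s. tail u s powe (q / (p - q)) * u s) \<le> (SUP z\<in>einterval a (ereal x) \<inter> {y<..}. \<Psi> z x)"
        by (simp only: \<Psi>_def)
    qed (use y below_sub[OF x] in \<open>auto simp: null_point intro: point_sets\<close>)
  qed
  also have "... = S6 x" unfolding below_eq[OF x] S6_def by (simp add: mult_ac)
    finally show ?thesis .
  qed
qed

section \<open>The best constant\<close>

lemma ineq_holds_iff:
  assumes C: "0 \<le> C"
  shows "ineq_holds a b p q r u v w C \<longleftrightarrow>
    (\<forall>f\<in>borel_measurable L. Lq f powe (1 / q) \<le> ennreal C * Rp f powe (1 / p))"
proof -
  have l: "integ a b (\<lambda>t. (integ a (ereal t) (pw f r v)) powe (q / r) * u t) = Lq f" for f
    unfolding Lq_def by (intro nn_integral_cong) (simp add: integ_head)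
  have "integ a b (\<lambda>t. (integ a (ereal t) f) powe p * w t) = Rp f" for f
    unfolding Rp_def by (intro nn_integral_cong) (simp add: integ_head)
  with l show ?thesis unfolding ineq_holds_def Mplus_def by simp
qed

lemma ineq_holds_bounded_by:
  assumes C: "0 \<le> C" shows "ineq_holds a b p q r u v w C \<longleftrightarrow> bounded_by (ennreal C powe q)"
proof -
  have "Lq f powe (1 / q) \<le> ennreal C * Rp f powe (1 / p) \<longleftrightarrow> Lq f \<le> ennreal C powe q * Rp f powe (q / p)" for f
    using pos powe_le_move[of "1 / q" "Lq f" "ennreal C * Rp f powe (1 / p)"]
    by (simp add: powe_mult powe_powe)
  then show ?thesis unfolding ineq_holds_iff[OF C] bounded_by_def by simp
qed

lemma u_v_pos: "AE x in L. 0 < u x" "AE x in L. 0 < v x" using weights by (auto simp: weight_def)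

lemma integral_pos:
  assumes [measurable]: "g \<in> borel_measurable L" and g: "AE x in L. 0 < g x"
    and cd: "c < d" "c \<in> S" "d \<in> S"
  shows "0 < mass {c..<d} g"
proof (rule ccontr)
  assume "\<not> 0 < mass {c..<d} g"
  then have "mass {c..<d} g = 0" by simp
  then have "AE x in L. g x * ind {c..<d} x = 0" by (subst (asm) nn_integral_0_iff_AE) auto
  with g have "AE x in L. x \<notin> {c..<d}" by eventually_elim (auto simp: indicator_def split: if_splits)
  then have "AE x in lebesgue. x \<in> S \<longrightarrow> x \<notin> {c..<d}" by (subst (asm) AE_restrict_space_iff) auto
  then have "AE x in lebesgue. x \<notin> {c..<d}"
  proof eventually_elim
    case (elim x)
    then show ?case using einterval_between[OF cd(2,3), of x] by auto
  qed
  then have "{c..<d} \<in> null_sets lebesgue" by (subst AE_iff_null_sets) auto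
  then show False using cd(1) by (simp add: null_sets_def)
qed

text \<open>It keeps all admissible constants away from 0, as \<open>best_const\<close> demands a
  positive one. The function lives on [c, d), and [d, e) provides mass of u where its head is
  already positive.\<close>

lemma test_function:
  obtains f where "f \<in> borel_measurable L" "0 < Lq f" "Rp f < top"
proof -
  obtain c where c: "c \<in> S" using einterval_nonempty[OF ab] by blast
  obtain e where e: "e \<in> einterval (ereal c) b" using above_nonempty[OF c] by blast
  have e': "c < e" "e \<in> S" using e above_sub[OF c] by (auto simp: einterval_iff)
  define d where "d = (c + e) / 2"
  have d: "c < d" "d < e" "d \<in> S" using e' einterval_between[OF c e'(2), of d] by (auto simp: d_def)
  let ?f = "ind {c..<d} :: real \<Rightarrow> ennreal"
  have f [measurable]: "?f \<in> borel_measurable L" by (rule indicator_borel) simp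
  have h: "0 < head (pw ?f r v) d"
  proof -
    have "head (pw ?f r v) d = mass {c..<d} v"
      unfolding head_def using pos by (intro nn_integral_cong) (auto simp: indicator_def)
    then show ?thesis using integral_pos[OF _ u_v_pos(2) d(1) c d(3)] uvw by simp
  qed
  have "0 < head (pw ?f r v) d powe (q / r) * mass {d..<e} u"
    using h integral_pos[OF _ u_v_pos(1) d(2,3) e'(2)] uvw pos
    by (simp add: ennreal_zero_less_mult_iff zero_less_iff_neq_zero powe_eq_0_iff)
  also have "... = (\<I> t. head (pw ?f r v) d powe (q / r) * (u t * ind {d..<e} t))"
    by (rule nn_integral_cmult[symmetric]) measurable
  also have "... \<le> Lq ?f" unfolding Lq_def using pos
    by (intro nn_integral_mono) (auto simp: indicator_def intro!: mult_right_mono powe_mono head_mono)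
  finally have L: "0 < Lq ?f" .
  have fin: "emeasure L {c..<d} < top"
  proof -
    have "emeasure L {c..<d} = emeasure lebesgue {c..<d}"
      using einterval_between[OF c d(3)] by (intro emeasure_restrict_space) auto
    then show ?thesis using d by simp
  qed
  have hf: "head ?f t \<le> emeasure L {c..<d} * ind {c..} t" for t
  proof (cases "c \<le> t")
    case True
    have sets: "{c..<d} \<in> sets L"
      using einterval_between[OF c d(3)] by (subst sets_restrict_space_iff) auto
    have "head ?f t \<le> (\<I> s. ind {c..<d} s)"
      unfolding head_def by (intro nn_integral_mono) (auto simp: indicator_def)
    also have "... = emeasure L {c..<d}" using sets by (rule nn_integral_indicator)
    finally show ?thesis using True by simp
  next
    case False
    then have "head ?f t = (\<I> s. 0)"
      unfolding head_def by (intro nn_integral_cong) (auto simp: indicator_def)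
    then show ?thesis by simp
  qed
  have "Rp ?f \<le> (\<I> t. emeasure L {c..<d} powe p * (w t * ind {c..} t))" unfolding Rp_def
  proof (rule nn_integral_mono)
    fix t
    have "head ?f t powe p \<le> (emeasure L {c..<d} * ind {c..} t) powe p"
      using hf pos by (intro powe_mono) auto
    then have "head ?f t powe p * w t \<le> (emeasure L {c..<d} * ind {c..} t) powe p * w t"
      by (rule mult_right_mono) simp
    also have "... = emeasure L {c..<d} powe p * (w t * ind {c..} t)"
      using pos by (simp add: indicator_def)
    finally show "head ?f t powe p * w t \<le> emeasure L {c..<d} powe p * (w t * ind {c..} t)" .
  qed
  also have "... = emeasure L {c..<d} powe p * tail w c"
    unfolding tail_def by (rule nn_integral_cmult) measurable
  also have "... < top"
    using fin W_props(2)[OF c] pos by (simp add: ennreal_mult_less_top powe_less_top_iff)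
  finally have R: "Rp ?f < top" .
  show thesis by (rule that[OF f L R])
qed

lemma ineq_bounded_below: "\<exists>\<epsilon>>0. \<forall>C\<ge>0. ineq_holds a b p q r u v w C \<longrightarrow> \<epsilon> \<le> C"
proof -
  obtain f where f: "f \<in> borel_measurable L" "0 < Lq f" "Rp f < top" by (rule test_function)
  obtain R where R: "Rp f powe (1 / p) = ennreal R" "0 \<le> R"
    using f(3) pos by (cases "Rp f powe (1 / p)") (auto simp: powe_eq_top_iff)
  have Lp: "0 < Lq f powe (1 / q)" using f(2) pos by (simp add: zero_less_iff_neq_zero powe_eq_0_iff)
  obtain l where l: "0 < l" "ennreal l \<le> Lq f powe (1 / q)"
  proof (cases "Lq f powe (1 / q)")
    case (real x)
    then show ?thesis using Lp that[of x] by auto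
  next
    case top
    then show ?thesis using that[of 1] by simp
  qed
  show ?thesis
  proof (intro exI conjI allI impI)
    show "0 < l / (R + 1)" using l R by simp
    fix C :: real assume C: "0 \<le> C" "ineq_holds a b p q r u v w C"
    have "ennreal l \<le> ennreal C * ennreal R"
      using l C f(1) R unfolding ineq_holds_iff[OF C(1)] by (metis order_trans)
    then have "l \<le> C * R" using C R by (simp add: ennreal_mult[symmetric])
    also have "... \<le> C * (R + 1)" using C by (intro mult_left_mono) auto
    finally show "l / (R + 1) \<le> C" using R by (simp add: divide_le_eq)
  qed
qed

text \<open>The infimum of the admissible constants is positive by
  \<open>ineq_bounded_below\<close>. It is admissible: for f with finite right side the inequality
  passes to the limit, and for an infinite one any positive constant will do.\<close>

lemma best_const_exists:
  assumes "0 < C" "ineq_holds a b p q r u v w C"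
  obtains C0 where "best_const a b p q r u v w C0"
proof -
  let ?T = "{C. 0 < C \<and> ineq_holds a b p q r u v w C}"
  obtain \<epsilon> where \<epsilon>: "0 < \<epsilon>" "\<And>C. 0 \<le> C \<Longrightarrow> ineq_holds a b p q r u v w C \<Longrightarrow> \<epsilon> \<le> C"
    using ineq_bounded_below by blast
  have ne: "?T \<noteq> {}" and bdd: "bdd_below ?T" using assms by (auto intro!: bdd_belowI[of _ 0])
  let ?C = "Inf ?T"
  have "\<epsilon> \<le> ?C" using ne \<epsilon> by (intro cInf_greatest) auto
  then have C0: "0 < ?C" using \<epsilon>(1) by simp
  have above: "ineq_holds a b p q r u v w D" if D: "?C < D" for D
  proof -
    obtain C where C: "C \<in> ?T" "C < D" using cInf_lessD[OF ne D] by blast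
    then have "ennreal C * x \<le> ennreal D * x" for x by (intro mult_right_mono ennreal_leI) auto
    then show ?thesis using C ineq_holds_iff[of C] ineq_holds_iff[of D] by (auto intro: order_trans)
  qed
  have "ineq_holds a b p q r u v w ?C" unfolding ineq_holds_iff[OF less_imp_le[OF C0]]
  proof
    fix f :: "real \<Rightarrow> ennreal" assume f: "f \<in> borel_measurable L"
    show "Lq f powe (1 / q) \<le> ennreal ?C * Rp f powe (1 / p)"
    proof (cases "Rp f powe (1 / p)")
      case top
      then show ?thesis using C0 by (simp add: ennreal_mult_top)
    next
      case (real x)
      have split: "ennreal (c + d) * ennreal x = ennreal c * ennreal x + ennreal (d * x)" if "0 \<le> c" "0 \<le> d" for c d
        using that real by (simp add: distrib_right ennreal_mult)
      show ?thesis
      proof (rule ennreal_le_epsilon)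
        fix e :: real assume e: "0 < e"
        let ?d = "e / (x + 1)"
        have d: "0 < ?d" "?d * x \<le> e" using e real by (simp_all add: divide_le_eq mult_left_mono)
        have D: "0 \<le> ?C + ?d" "?C < ?C + ?d" using C0 d by auto
        have "Lq f powe (1 / q) \<le> ennreal (?C + ?d) * ennreal x"
          using above[OF D(2)] f real unfolding ineq_holds_iff[OF D(1)] by metis
        also have "... = ennreal ?C * ennreal x + ennreal (?d * x)" using split[of ?C ?d] C0 d by simp
        also have "... \<le> ennreal ?C * ennreal x + ennreal e" using d by (intro add_left_mono ennreal_leI)
        finally show "Lq f powe (1 / q) \<le> ennreal ?C * Rp f powe (1 / p) + ennreal e" using real by simp
      qed
    qed
  qed
  moreover have "?C \<le> C'" if "0 < C'" "ineq_holds a b p q r u v w C'" for C'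
    using that bdd by (intro cInf_lower) auto
  ultimately have "best_const a b p q r u v w ?C" using C0 unfolding best_const_def by blast
  then show thesis by (rule that)
qed

text \<open>\<open>D\<close> is a constant for the inequality raised to the power \<open>q\<close>, so \<open>D powe (1 / q)\<close> is one for
  the inequality itself.\<close>

definition characterises :: "ennreal \<Rightarrow> ennreal \<Rightarrow> ennreal \<Rightarrow> bool" where
  "characterises s n Z \<longleftrightarrow> s < top \<and> s \<noteq> 0 \<and> n < top \<and>
     (\<forall>A. A \<noteq> 0 \<longrightarrow> A < top \<longrightarrow> Z powe q \<le> A \<longrightarrow> bounded_by (s * A)) \<and>
     (\<forall>D. D < top \<longrightarrow> bounded_by D \<longrightarrow> Z \<le> n * D powe (1 / q))"

text \<open>The exponent 1/q undoes the passage to q-th powers in \<open>bounded_by\<close>; adding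
  1 makes the equivalence factors positive reals at once.\<close>

lemma characterises_equiv:
  assumes ch: "characterises s n Z"
  shows "(\<exists>C>0. ineq_holds a b p q r u v w C) \<longleftrightarrow> Z < \<infinity>"
    and "Z < \<infinity> \<Longrightarrow> best_const_equiv a b p q r u v w (enn2real (s powe (1 / q)) + 1) (enn2real n + 1) Z"
proof -
  have s: "s < top" "s \<noteq> 0" "n < top" using ch by (auto simp: characterises_def)
  have suff: "bounded_by (s * A)" if "A \<noteq> 0" "A < top" "Z powe q \<le> A" for A
    using ch that by (auto simp: characterises_def)
  have nec: "Z \<le> n * ennreal C" if C: "0 < C" "ineq_holds a b p q r u v w C" for C
  proof -
    have "bounded_by (ennreal C powe q)" "ennreal C powe q < top"
      using C pos by (simp_all add: ineq_holds_bounded_by powe_less_top_iff)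
    then have "Z \<le> n * (ennreal C powe q) powe (1 / q)" using ch by (auto simp: characterises_def)
    then show ?thesis using pos by (simp add: powe_powe)
  qed
  have suff': "\<exists>C>0. ineq_holds a b p q r u v w C \<and> ennreal C = s powe (1 / q) * B" if B: "Z \<le> B" "B \<noteq> 0" "B < top" for B
  proof -
    let ?X = "s powe (1 / q) * B"
    have X: "?X \<noteq> 0" "?X < top" using s B pos by (simp_all add: powe_eq_0_iff ennreal_mult_less_top powe_less_top_iff)
    then obtain C where C: "?X = ennreal C" "0 < C" by (cases ?X) (auto simp: less_le)
    have "bounded_by (s * B powe q)"
      using B pos by (intro suff powe_mono) (auto simp: powe_eq_0_iff powe_less_top_iff)
    also have "s * B powe q = ennreal C powe q"
      unfolding C(1)[symmetric] using pos by (simp add: powe_mult powe_powe)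
    finally show ?thesis using C by (auto simp: ineq_holds_bounded_by)
  qed
  show iff: "(\<exists>C>0. ineq_holds a b p q r u v w C) \<longleftrightarrow> Z < \<infinity>"
  proof
    assume "\<exists>C>0. ineq_holds a b p q r u v w C"
    then obtain C where C: "0 < C" "ineq_holds a b p q r u v w C" by blast
    have "Z \<le> n * ennreal C" by (rule nec[OF C])
    also have "... < top" using s by (simp add: ennreal_mult_less_top)
    finally show "Z < \<infinity>" by simp
  next
    assume "Z < \<infinity>"
    \<comment> \<open>Z + 1 instead of Z, because the sufficiency part asks for a nonzero bound and
      Z = 0 is excluded only later.\<close>
    then have "\<exists>C>0. ineq_holds a b p q r u v w C \<and> ennreal C = s powe (1 / q) * (Z + 1)"
      by (intro suff') auto
    then show "\<exists>C>0. ineq_holds a b p q r u v w C" by blast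
  qed
  assume Kf: "Z < \<infinity>"
  then obtain C where C: "0 < C" "ineq_holds a b p q r u v w C" using iff by blast
  obtain C0 where C0: "best_const a b p q r u v w C0" by (rule best_const_exists[OF C])
  then have C0': "0 < C0" "ineq_holds a b p q r u v w C0"
    and min: "\<And>C'. 0 < C' \<Longrightarrow> ineq_holds a b p q r u v w C' \<Longrightarrow> C0 \<le> C'" by (auto simp: best_const_def)
  have up: "ennreal C0 \<le> s powe (1 / q) * B" if B: "Z \<le> B" "B \<noteq> 0" "B < top" for B
  proof -
    obtain C' where "0 < C'" "ineq_holds a b p q r u v w C'" "ennreal C' = s powe (1 / q) * B"
      using suff'[OF B] by blast
    then show ?thesis using min[of C'] by (metis ennreal_leI)
  qed
  have s1: "s powe (1 / q) < top" "s powe (1 / q) \<noteq> 0" using s pos by (simp_all add: powe_less_top_iff powe_eq_0_iff)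
  \<comment> \<open>For Z = 0 the sufficiency part would accept arbitrarily small bounds and produce
    constants below the best one, which is positive.\<close>
  have "Z \<noteq> 0"
  proof
    assume K0: "Z = 0"
    let ?B = "ennreal (C0 / 2) / s powe (1 / q)"
    have B: "?B \<noteq> 0" "?B < top"
      using s1 C0'(1) by (auto simp: ennreal_divide_eq_0_iff less_top[symmetric] ennreal_divide_eq_top_iff)
    have "ennreal C0 \<le> s powe (1 / q) * ?B" using up[OF _ B] K0 by simp
    also have "... \<le> ennreal (C0 / 2)" by (rule ennreal_times_divide_le)
    finally show False using C0'(1) by simp
  qed
  then have "ennreal C0 \<le> s powe (1 / q) * Z" using Kf by (intro up) auto
  also have "... \<le> ennreal (enn2real (s powe (1 / q)) + 1) * Z"
    using s1 by (intro mult_right_mono) (auto simp: ennreal_plus add_increasing2)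
  finally have 1: "ennreal C0 \<le> ennreal (enn2real (s powe (1 / q)) + 1) * Z" .
  have "Z \<le> n * ennreal C0" by (rule nec[OF C0'])
  also have "... \<le> ennreal (enn2real n + 1) * ennreal C0"
    using s by (intro mult_right_mono) (auto simp: ennreal_plus add_increasing2)
  finally show "best_const_equiv a b p q r u v w (enn2real (s powe (1 / q)) + 1) (enn2real n + 1) Z"
    unfolding best_const_equiv_def using C0 1 by blast
qed

lemma characterisesI:
  assumes "s < top" "s \<noteq> 0" "n < top"
    "\<And>A. A \<noteq> 0 \<Longrightarrow> A < top \<Longrightarrow> Z powe q \<le> A \<Longrightarrow> bounded_by (s * A)"
    "\<And>D. bounded_by D \<Longrightarrow> D < top \<Longrightarrow> Z \<le> n * D powe (1 / q)"
  shows "characterises s n Z" using assms unfolding characterises_def by blast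

lemma sum_powe_leD:
  assumes "(x + y) powe q \<le> A" shows "x powe q \<le> A" "y powe q \<le> A"
proof -
  have "x powe q \<le> (x + y) powe q" "y powe q \<le> (x + y) powe q"
    using pos by (auto intro!: powe_mono simp: add_increasing add_increasing2)
  then show "x powe q \<le> A" "y powe q \<le> A" using assms by (auto intro: order_trans)
qed

lemma sum_le:
  assumes "x \<le> m * z" "y \<le> n * (z :: ennreal)" shows "x + y \<le> (m + n) * z"
  using add_mono[OF assms] by (simp add: distrib_right)

lemma full_band_obtain: obtains ka where "full_band ka" "band ka"
proof -
  obtain ka where k: "full_band ka" by (rule full_band_exists[OF null_point])
  show thesis by (rule that[OF k full_bandD(1)[OF k]])
qed

section \<open>The seven ranges of exponents\<close>

lemma case_i:
  assumes "p \<le> r" "1 \<le> q"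
  shows "characterises (c_suff * c_upper) 1 (D\<^sub>1)"
proof (rule characterisesI)
  show "c_suff * c_upper < top" "c_suff * c_upper \<noteq> 0" using c_suff_props by (simp_all add: ennreal_mult_less_top)
  show "(1 :: ennreal) < top" by simp
next
  fix A :: ennreal assume A: "A \<noteq> 0" "A < top" "D\<^sub>1 powe q \<le> A"
  obtain ka where k: "full_band ka" by (rule full_band_obtain)
  have "bounded_by (c_suff * (c_upper * A))" using A assms pos C1_KQ[OF assms(2) A(3)]
    by (intro sufficient_i_ii[OF k]) (auto simp: ennreal_mult_less_top)
  then show "bounded_by (c_suff * c_upper * A)" by (simp add: mult.assoc)
next
  fix D assume "bounded_by D"
  then show "D\<^sub>1 \<le> 1 * D powe (1 / q)" using C1_lower by simp
qed

lemma case_ii: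
  assumes "p \<le> r" "p \<le> q" "q < 1"
  shows "characterises (c_suff * c_upper) (c_local r q powe (1 / q)) (D\<^sub>2)"
proof (rule characterisesI)
  show "c_suff * c_upper < top" "c_suff * c_upper \<noteq> 0" using c_suff_props by (simp_all add: ennreal_mult_less_top)
  show "c_local r q powe (1 / q) < top" using c_local_finite pos by (simp add: powe_less_top_iff)
next
  fix A :: ennreal assume A: "A \<noteq> 0" "A < top" "D\<^sub>2 powe q \<le> A"
  obtain ka where k: "full_band ka" by (rule full_band_obtain)
  have "bounded_by (c_suff * (c_upper * A))" using A assms pos C2_upper[OF assms(3) A(3)]
    by (intro sufficient_i_ii[OF k]) (auto simp: ennreal_mult_less_top)
  then show "bounded_by (c_suff * c_upper * A)" by (simp add: mult.assoc)
next
  fix D assume "bounded_by D"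
  then show "D\<^sub>2 \<le> c_local r q powe (1 / q) * D powe (1 / q)" by (rule C2_lower[OF assms(3)])
qed

definition c_iii :: ennreal where
  "c_iii = c_suff * (dyad (q / r) * (dyad (p / (p - r)) + 3) powe (q / \<theta>) * c_upper)"

lemma c_iii_props: "r < p \<Longrightarrow> c_iii < top" "r < p \<Longrightarrow> c_iii \<noteq> 0"
proof -
  assume rp: "r < p"
  have e: "0 < q / \<theta>" using rp pos by (simp add: \<theta>_def)
  have "(dyad (p / (p - r)) + 3) powe (q / \<theta>) < top" "(dyad (p / (p - r)) + 3) powe (q / \<theta>) \<noteq> 0"
    using e by (simp_all add: powe_less_top_iff powe_eq_0_iff)
  then show "c_iii < top" "c_iii \<noteq> 0"
    using c_suff_props by (simp_all add: c_iii_def ennreal_mult_less_top)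
qed

lemma le_c_upper: "A \<le> c_upper * A"
  using mult_right_mono[of 1 c_upper A] dyad_mono[of 0 "2 * (q / r) + q + 2"] pos by simp

text \<open>Z stands for \<open>C1\<close> when q >= 1 and for \<open>C2\<close> when q < 1; both
  enter through the bound for \<open>KQ\<^sub>c\<close> on half-lines.\<close>

lemma case_iii_iv:
  assumes rp: "r < p" and pq: "p \<le> q"
    and upper: "\<And>A x. Z powe q \<le> A \<Longrightarrow> x \<in> S \<Longrightarrow> KQ\<^sub>c {x..} \<le> c_upper * A * tail w x powe (q / p)"
    and lower: "\<And>D. bounded_by D \<Longrightarrow> Z \<le> n * D powe (1 / q)" and n: "n < top"
  shows "characterises c_iii (n + c_three) (Z + D\<^sub>3)"
proof (rule characterisesI)
  show "c_iii < top" "c_iii \<noteq> 0" by (rule c_iii_props[OF rp])+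
  show "n + c_three < top" using c_three_finite[OF rp] n by simp
next
  fix A :: ennreal assume A: "A \<noteq> 0" "A < top" "(Z + D\<^sub>3) powe q \<le> A"
  note AA = sum_powe_leD[OF A(3)]
  obtain ka where k: "full_band ka" by (rule full_band_obtain)
  have \<theta>: "0 < \<theta> / q" using rp pos by (simp add: \<theta>_def)
  have "A powe (\<theta> / q) \<le> (c_upper * A) powe (\<theta> / q)" using \<theta> by (intro powe_mono le_c_upper) auto
  then have H3: "tail u t powe (\<theta> / q) * Q t \<le> (c_upper * A) powe (\<theta> / q)" if "t \<in> space L" for t
    using C3_upper[OF rp AA(2), of t] that by (auto intro: order_trans)
  have "bounded_by (c_suff * (dyad (q / r) * (dyad (p / (p - r)) + 3) powe (q / \<theta>) * (c_upper * A)))"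
    using A upper[OF AA(1)] by (intro sufficient_iii_iv[OF k rp pq _ _ _ H3]) (auto simp: ennreal_mult_less_top)
  then show "bounded_by (c_iii * A)" by (simp add: c_iii_def mult.assoc)
next
  fix D assume D: "bounded_by D" "D < top"
  obtain ka where k: "band ka" by (rule full_band_obtain)
  show "Z + D\<^sub>3 \<le> (n + c_three) * D powe (1 / q)" by (intro sum_le lower D(1) C3_lower'[OF rp k D])
qed

lemma case_iii:
  assumes "r < p" "p \<le> q" "1 \<le> q"
  shows "characterises c_iii (1 + c_three) (D\<^sub>1 + D\<^sub>3)"
  using assms C1_lower C1_KQ[OF assms(3)] by (intro case_iii_iv) auto

lemma case_iv:
  assumes "r < p" "p \<le> q" "q < 1"
  shows "characterises c_iii (c_local r q powe (1 / q) + c_three) (D\<^sub>2 + D\<^sub>3)"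
  using assms C2_lower[OF assms(3)] C2_upper[OF assms(3)] c_local_finite pos
  by (intro case_iii_iv) (auto simp: powe_less_top_iff)

lemma case_v:
  assumes qp: "q < p" and pr: "p \<le> r"
  shows "characterises (c_suff * (dyad (2 * (p - q) / p) * c_upper)) (c_four + c_five) (D\<^sub>4 + D\<^sub>5)"
proof (rule characterisesI)
  show "c_suff * (dyad (2 * (p - q) / p) * c_upper) < top" "c_suff * (dyad (2 * (p - q) / p) * c_upper) \<noteq> 0"
    using c_suff_props by (simp_all add: ennreal_mult_less_top)
  show "c_four + c_five < top" using c_four_finite[OF qp] c_five_finite[OF qp] by simp
next
  have q1: "q < 1" using qp pr pos by simp
  fix A :: ennreal assume A: "A \<noteq> 0" "A < top" "(D\<^sub>4 + D\<^sub>5) powe q \<le> A"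
  note AA = sum_powe_leD[OF A(3)]
  obtain ka where k: "full_band ka" by (rule full_band_obtain)
  have "(\<I> t. tail u t powe (q / (p - q)) * S4 t powe (1 / r * (p * q / (p - q))) * u t) \<le> A powe (p / (p - q))"
    using AA(1) unfolding C4_eq[OF qp] by (rule outer_upper[OF qp])
  also have "... \<le> (c_upper * A) powe (p / (p - q))" using qp pos by (intro powe_mono le_c_upper) auto
  finally have "bounded_by (c_suff * (dyad (2 * (p - q) / p) * (c_upper * A)))"
    using A K5_upper[OF qp AA(2)[unfolded C5_eq[OF qp q1]]]
    by (intro sufficient_v[OF k pr qp]) (auto simp: ennreal_mult_less_top)
  then show "bounded_by (c_suff * (dyad (2 * (p - q) / p) * c_upper) * A)" by (simp add: mult.assoc)
next
  have q1: "q < 1" "p \<le> 1" using qp pr pos by auto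
  fix D assume D: "bounded_by D" "D < top"
  obtain ka where k: "band ka" by (rule full_band_obtain)
  show "D\<^sub>4 + D\<^sub>5 \<le> (c_four + c_five) * D powe (1 / q)"
    unfolding C5_eq[OF qp q1(1)] by (intro sum_le C4_lower'[OF qp q1(2) D] K5_lower[OF qp k D])
qed

definition c_vi_nec :: ennreal where "c_vi_nec = c_six powe ((p - q) / (p * q))"

definition c_vi_suff :: ennreal where "c_vi_suff = c_suff * (c_vi powe ((p - q) / p) * c_upper)"

lemma case_vi_vii:
  assumes rp: "r < p" and qp: "q < p"
  shows "characterises c_vi_suff (1 + c_five + c_vi_nec) (D\<^sub>1 + K5 + D\<^sub>6)"
proof (rule characterisesI)
  have e: "0 < (p - q) / (p * q)" "0 < (p - q) / p" using qp pos by simp_all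
  have "c_vi < top" "c_vi \<noteq> 0" by (simp_all add: c_vi_def ennreal_mult_less_top)
  then have "c_vi powe ((p - q) / p) < top" "c_vi powe ((p - q) / p) \<noteq> 0"
    using e by (simp_all add: powe_less_top_iff powe_eq_0_iff)
  then show "c_vi_suff < top" "c_vi_suff \<noteq> 0"
    using c_suff_props by (simp_all add: c_vi_suff_def ennreal_mult_less_top)
  show "1 + c_five + c_vi_nec < top"
    using c_five_finite[OF qp] c_six_finite[OF rp qp] e by (simp add: c_vi_nec_def powe_less_top_iff)
next
  fix A :: ennreal assume A: "A \<noteq> 0" "A < top" "(D\<^sub>1 + K5 + D\<^sub>6) powe q \<le> A"
  note AA = sum_powe_leD[OF A(3)] and A1 = sum_powe_leD[OF sum_powe_leD(1)[OF A(3)]]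
  obtain ka where k: "full_band ka" by (rule full_band_obtain)
  have "(\<I> x. w x * S6 x) \<le> A powe (p / (p - q))"
    using AA(2) unfolding C6_eq[OF rp qp] by (rule outer_upper[OF qp])
  also have "... \<le> (c_upper * A) powe (p / (p - q))" using qp pos by (intro powe_mono le_c_upper) auto
  finally have H6: "(\<I> x. w x * S6 x) \<le> (c_upper * A) powe (p / (p - q))" .
  have H1: "tail u t * P x t powe (q / r) \<le> c_upper * A * tail w x powe (q / p)" if "x \<in> space L" "t \<in> space L" for x t
  proof -
    have "tail u t * P x t powe (q / r) \<le> A * tail w x powe (q / p)"
      using that by (intro C1_upper[OF A1(1)]) auto
    also have "... \<le> c_upper * A * tail w x powe (q / p)" by (intro mult_right_mono le_c_upper) simp
    finally show ?thesis .
  qed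
  have "bounded_by (c_suff * (c_vi powe ((p - q) / p) * (c_upper * A)))"
    by (rule sufficient_vi_vii[OF k rp qp _ _ H1 K5_upper[OF qp A1(2)] H6])
       (use A in \<open>simp_all add: ennreal_mult_less_top\<close>)
  then show "bounded_by (c_vi_suff * A)" by (simp add: c_vi_suff_def mult.assoc)
next
  fix D assume D: "bounded_by D" "D < top"
  obtain ka where kf: "full_band ka" by (rule full_band_obtain)
  note k = full_bandD(1)[OF kf] and fine = full_bandD(2)[OF kf]
  have 6: "D\<^sub>6 \<le> c_vi_nec * D powe (1 / q)" unfolding C6_eq[OF rp qp] c_vi_nec_def S6_def[abs_def]
    by (rule outer_lower[OF qp C6_lower[OF k fine D rp qp]])
  have 1: "D\<^sub>1 \<le> 1 * D powe (1 / q)" using C1_lower[OF D(1)] by simp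
  show "D\<^sub>1 + K5 + D\<^sub>6 \<le> (1 + c_five + c_vi_nec) * D powe (1 / q)"
    by (intro sum_le 1 6 K5_lower[OF qp k D])
qed

lemma case_vi:
  assumes "r < p" "q < p" "q < 1"
  shows "characterises c_vi_suff (1 + c_five + c_vi_nec) (D\<^sub>1 + D\<^sub>5 + D\<^sub>6)"
  unfolding C5_eq[OF assms(2,3)] by (rule case_vi_vii[OF assms(1,2)])

lemma case_vii:
  assumes "r < p" "q < p" "1 \<le> q"
  shows "characterises c_vi_suff (1 + c_five + c_vi_nec) (D\<^sub>1 + D\<^sub>6 + D\<^sub>7)"
  unfolding C7_eq[OF assms(2,3)] using case_vi_vii[OF assms(1,2)] by (simp only: add_ac)

end

definition equivalent ::
  "real \<Rightarrow> real \<Rightarrow> real \<Rightarrow> (ereal \<Rightarrow> ereal \<Rightarrow> (real \<Rightarrow> ennreal) \<Rightarrow> (real \<Rightarrow> ennreal) \<Rightarrow> (real \<Rightarrow> ennreal) \<Rightarrow> ennreal) \<Rightarrow> bool" where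
  "equivalent p q r Z \<longleftrightarrow> (\<exists>lam>0. \<exists>lam'>0. \<forall>a b u v w. interval_weights a b u v w p q r \<longrightarrow>
     ((\<exists>C>0. ineq_holds a b p q r u v w C) \<longleftrightarrow> Z a b u v w < \<infinity>) \<and>
     (Z a b u v w < \<infinity> \<longrightarrow> best_const_equiv a b p q r u v w lam lam' (Z a b u v w)))"

text \<open>s and n are fixed before the weights: the constants defined inside the locales depend on
  p, q, r alone, and this uniformity is what equivalence means here.\<close>

lemma equivalentI:
  assumes "\<And>a b u v w. interval_weights a b u v w p q r \<Longrightarrow>
    interval_weights.characterises a b u v w p q r s n (Z a b u v w)"
  shows "equivalent p q r Z" unfolding equivalent_def
proof (intro exI conjI allI impI)
  show "0 < enn2real (s powe (1 / q)) + 1" "0 < enn2real n + 1" by (simp_all add: add_nonneg_pos)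
  fix a b u v w assume i: "interval_weights a b u v w p q r"
  note c = interval_weights.characterises_equiv[OF i assms[OF i]]
  show "(\<exists>C>0. ineq_holds a b p q r u v w C) = (Z a b u v w < \<infinity>)" by (rule c(1))
  assume "Z a b u v w < \<infinity>"
  then show "best_const_equiv a b p q r u v w (enn2real (s powe (1 / q)) + 1) (enn2real n + 1) (Z a b u v w)" by (rule c(2))
qed

theorem theorem2p5:
  fixes p q r :: real
  assumes "0 < r" and "r \<le> 1" and "0 < p" and "0 < q"
  shows "\<exists>lam > 0. \<exists>lam' > 0. \<forall>(a::ereal) (b::ereal) u v w.
     0 \<le> a \<longrightarrow> a < b \<longrightarrow> weight a b u \<longrightarrow> weight a b v \<longrightarrow> weight a b w \<longrightarrow>
     (\<forall>x \<in> einterval a b. 0 < integ (ereal x) b w \<and> integ (ereal x) b w < \<infinity>) \<longrightarrow>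
     ((\<exists>C > 0. ineq_holds a b p q r u v w C) \<longleftrightarrow>
         (p \<le> r \<and> r \<le> 1 \<and> 1 \<le> q \<and> C1 a b p q r u v w < \<infinity>)
       \<or> (p \<le> q \<and> q < 1 \<and> p \<le> r \<and> r \<le> 1 \<and> C2 a b p q r u v w < \<infinity>)
       \<or> (r < p \<and> p \<le> q \<and> r \<le> 1 \<and> 1 \<le> q \<and> max (C1 a b p q r u v w) (C3 a b p q r u v w) < \<infinity>)
       \<or> (r < p \<and> p \<le> q \<and> q < 1 \<and> max (C2 a b p q r u v w) (C3 a b p q r u v w) < \<infinity>)
       \<or> (q < p \<and> p \<le> r \<and> r \<le> 1 \<and> max (C4 a b p q r u v w) (C5 a b p q r u v w) < \<infinity>)
       \<or> (q < p \<and> q < 1 \<and> r < p \<and> r \<le> 1 \<and> max (C1 a b p q r u v w) (max (C5 a b p q r u v w) (C6 a b p q r u v w)) < \<infinity>)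
       \<or> (r \<le> 1 \<and> 1 \<le> q \<and> q < p \<and> max (C1 a b p q r u v w) (max (C6 a b p q r u v w) (C7 a b p q r u v w)) < \<infinity>))
     \<and> (p \<le> r \<and> r \<le> 1 \<and> 1 \<le> q \<and> C1 a b p q r u v w < \<infinity> \<longrightarrow>
          best_const_equiv a b p q r u v w lam lam'
            (C1 a b p q r u v w))
     \<and> (p \<le> q \<and> q < 1 \<and> p \<le> r \<and> r \<le> 1 \<and> C2 a b p q r u v w < \<infinity> \<longrightarrow>
          best_const_equiv a b p q r u v w lam lam'
            (C2 a b p q r u v w))
     \<and> (r < p \<and> p \<le> q \<and> r \<le> 1 \<and> 1 \<le> q \<and> max (C1 a b p q r u v w) (C3 a b p q r u v w) < \<infinity> \<longrightarrow>
          best_const_equiv a b p q r u v w lam lam'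
            (C1 a b p q r u v w + C3 a b p q r u v w))
     \<and> (r < p \<and> p \<le> q \<and> q < 1 \<and> max (C2 a b p q r u v w) (C3 a b p q r u v w) < \<infinity> \<longrightarrow>
          best_const_equiv a b p q r u v w lam lam'
            (C2 a b p q r u v w + C3 a b p q r u v w))
     \<and> (q < p \<and> p \<le> r \<and> r \<le> 1 \<and> max (C4 a b p q r u v w) (C5 a b p q r u v w) < \<infinity> \<longrightarrow>
          best_const_equiv a b p q r u v w lam lam'
            (C4 a b p q r u v w + C5 a b p q r u v w))
     \<and> (q < p \<and> q < 1 \<and> r < p \<and> r \<le> 1 \<and> max (C1 a b p q r u v w) (max (C5 a b p q r u v w) (C6 a b p q r u v w)) < \<infinity> \<longrightarrow>
          best_const_equiv a b p q r u v w lam lam'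
            (C1 a b p q r u v w + C5 a b p q r u v w + C6 a b p q r u v w))
     \<and> (r \<le> 1 \<and> 1 \<le> q \<and> q < p \<and> max (C1 a b p q r u v w) (max (C6 a b p q r u v w) (C7 a b p q r u v w)) < \<infinity> \<longrightarrow>
          best_const_equiv a b p q r u v w lam lam'
            (C1 a b p q r u v w + C6 a b p q r u v w + C7 a b p q r u v w))"
proof -
  \<comment> \<open>F is the shape of the goal as a function of the data; each range then only has
    to derive F from a single equivalence.\<close>
  have *: "\<exists>lam>0. \<exists>lam'>0. \<forall>a b u v w. 0 \<le> a \<longrightarrow> a < b \<longrightarrow> weight a b u \<longrightarrow> weight a b v \<longrightarrow> weight a b w \<longrightarrow>
     (\<forall>x \<in> einterval a b. 0 < integ (ereal x) b w \<and> integ (ereal x) b w < \<infinity>) \<longrightarrow> F a b u v w lam lam'"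
    if e: "equivalent p q r Z"
      and F: "\<And>a b u v w lam lam'. ((\<exists>C>0. ineq_holds a b p q r u v w C) \<longleftrightarrow> Z a b u v w < \<infinity>) \<Longrightarrow>
        (Z a b u v w < \<infinity> \<Longrightarrow> best_const_equiv a b p q r u v w lam lam' (Z a b u v w)) \<Longrightarrow> F a b u v w lam lam'" for F Z
  proof -
    obtain lam lam' where l: "0 < lam" "0 < lam'" and eq: "\<forall>a b u v w. interval_weights a b u v w p q r \<longrightarrow>
       ((\<exists>C>0. ineq_holds a b p q r u v w C) \<longleftrightarrow> Z a b u v w < \<infinity>) \<and>
       (Z a b u v w < \<infinity> \<longrightarrow> best_const_equiv a b p q r u v w lam lam' (Z a b u v w))"
      using e unfolding equivalent_def by blast
    show ?thesis
    proof (intro exI conjI allI impI)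
      fix a b :: ereal and u v w assume ab: "a < b" and weights: "weight a b u" "weight a b v" "weight a b w"
        and W: "\<forall>x \<in> einterval a b. 0 < integ (ereal x) b w \<and> integ (ereal x) b w < \<infinity>"
      have "interval_weights a b u v w p q r"
        using ab weights W assms unfolding interval_weights_def by blast
      with eq show "F a b u v w lam lam'" by (intro F) blast+
    qed (rule l)+
  qed
  \<comment> \<open>The statement uses the maximum in the condition and the sum in the equivalence;
    both are finite together.\<close>
  have max_less: "max x y < \<infinity> \<longleftrightarrow> x + y < \<infinity>" for x y :: ennreal by (auto simp: less_top)
  \<comment> \<open>These ranges are exhaustive and, as r <= 1, mutually exclusive, so in each of
    them one alternative of the disjunction survives.\<close>
  consider "p \<le> r" "1 \<le> q" | "p \<le> r" "p \<le> q" "q < 1" | "r < p" "p \<le> q" "1 \<le> q" | "r < p" "p \<le> q" "q < 1"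
    | "q < p" "p \<le> r" | "r < p" "q < p" "q < 1" | "r < p" "q < p" "1 \<le> q" by linarith
  then show ?thesis
  proof cases
    case 1
    have "equivalent p q r (\<lambda>a b u v w. C1 a b p q r u v w)"
      by (rule equivalentI, rule interval_weights.case_i) (use 1 in auto)
    then show ?thesis by (rule *) (use 1 assms in \<open>auto simp: max_less add.assoc\<close>)
  next
    case 2
    have "equivalent p q r (\<lambda>a b u v w. C2 a b p q r u v w)"
      by (rule equivalentI, rule interval_weights.case_ii) (use 2 in auto)
    then show ?thesis by (rule *) (use 2 assms in \<open>auto simp: max_less add.assoc\<close>)
  next
    case 3
    have "equivalent p q r (\<lambda>a b u v w. C1 a b p q r u v w + C3 a b p q r u v w)"
      by (rule equivalentI, rule interval_weights.case_iii) (use 3 in auto)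
    then show ?thesis by (rule *) (use 3 assms in \<open>auto simp: max_less add.assoc\<close>)
  next
    case 4
    have "equivalent p q r (\<lambda>a b u v w. C2 a b p q r u v w + C3 a b p q r u v w)"
      by (rule equivalentI, rule interval_weights.case_iv) (use 4 in auto)
    then show ?thesis by (rule *) (use 4 assms in \<open>auto simp: max_less add.assoc\<close>)
  next
    case 5
    have "equivalent p q r (\<lambda>a b u v w. C4 a b p q r u v w + C5 a b p q r u v w)"
      by (rule equivalentI, rule interval_weights.case_v) (use 5 in auto)
    then show ?thesis by (rule *) (use 5 assms in \<open>auto simp: max_less add.assoc\<close>)
  next
    case 6
    have "equivalent p q r (\<lambda>a b u v w. C1 a b p q r u v w + C5 a b p q r u v w + C6 a b p q r u v w)"
      by (rule equivalentI, rule interval_weights.case_vi) (use 6 in auto)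
    then show ?thesis by (rule *) (use 6 assms in \<open>auto simp: max_less add.assoc\<close>)
  next
    case 7
    have "equivalent p q r (\<lambda>a b u v w. C1 a b p q r u v w + C6 a b p q r u v w + C7 a b p q r u v w)"
      by (rule equivalentI, rule interval_weights.case_vii) (use 7 in auto)
    then show ?thesis by (rule *) (use 7 assms in \<open>auto simp: max_less add.assoc\<close>)
  qed
qed

end
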